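(* Let $B\subseteq A$ be a principal $H$-comodule algebra, let $\mathcal{C}(A,H)$ be its Ehresmann–Schauenburg bialgebroid, let $\mathcal{T}^*$ be the group of twists of $\mathcal{C}(A,H)$, and let $\mathrm{Alg}^{H}(A)$ be the group of unital right $H$-comodule algebra automorphisms of $A$ with product $F\cdot G:=G\circ F$. Then the formulas $$\phi_*^{F}(a\otimes\tilde a):=F(a)\tilde a,\qquad a\otimes\tilde a\in\mathcal{C}(A,H),\ F\in\mathrm{Alg}^H(A),$$ $$F_{\phi_*}(a):=\phi_*\big(a_{(0)}\otimes a_{(1)}{}^{\langle1\rangle}\big)\,a_{(1)}{}^{\langle2\rangle},\qquad a\in A,\ \phi_*\in\mathcal{T}^*,$$ provide a group isomorphism between $\mathrm{Alg}^H(A)$ and $\mathcal{T}^*$ (that is, $F\mapsto\phi_*^F$ and $\phi_*\mapsto F_{\phi_*}$ are mutually inverse group isomorphisms).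
   Context: $\mathbb{K}$ is a field, algebras are unital associative over $\mathbb{K}$, $\otimes=\otimes_{\mathbb{K}}$. Sweedler-type notations and expressions such as $a\otimes\tilde a$ denote sums. **Principal comodule algebras.** $H$ is a Hopf algebra with bijective antipode $S$; $A$ is a right $H$-comodule algebra, i.e. an algebra with a right coaction $\rho:A\to A\otimes H$, $\rho(a)=a_{(0)}\otimes a_{(1)}$, that is an algebra morphism; $B=A^{coH}=\{a\in A\mid\rho(a)=a\otimes1_H\}$. $B\subseteq A$ is an $H$-Hopf–Galois extension if the canonical map $\chi:A\otimes_BA\to A\otimes H$, $a\otimes_B\tilde a\mapsto a\tilde a_{(0)}\otimes\tilde a_{(1)}$, is bijective; it is a principal $H$-comodule algebra if moreover $A$ is faithfully flat as a left $B$-module. The translation map is $\tau:H\to A\otimes_BA$, $\tau(h)=\chi^{-1}(1_A\otimes h)=h^{\langle1\rangle}\otimes_Bh^{\langle2\rangle}$. A unital right $H$-comodule algebra automorphism of $A$ is a bijective unital algebra morphism $F$ with $\rho\circ F=(F\otimes\mathrm{id}_H)\circ\rho$. **Ehresmann–Schauenburg bialgebroid.** $$\mathcal{C}(A,H)=\{a\otimes\tilde a\in A\otimes A\mid a_{(0)}\otimes a_{(1)}{}^{\langle1\rangle}\otimes_Ba_{(1)}{}^{\langle2\rangle}\tilde a=a\otimes\tilde a\otimes_B1_A\},$$ which equals the coinvariants $(A\otimes A)^{coH}$ of the diagonal coaction $a\otimes\tilde a\mapsto a_{(0)}\otimes\tilde a_{(0)}\otimes a_{(1)}\tilde a_{(1)}$.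 It is a subalgebra of $A\otimes A^{op}$: $(a\otimes\tilde a)(c\otimes\tilde c)=ac\otimes\tilde c\tilde a$. It is a (left) $B$-bialgebroid with source $s(b)=b\otimes1_A$, target $t(b)=1_A\otimes b$, $B$-bimodule structure $b\,h\,b'=s(b)t(b')h$, coproduct $\underline{\Delta}(a\otimes\tilde a)=a_{(0)}\otimes a_{(1)}{}^{\langle1\rangle}\otimes_Ba_{(1)}{}^{\langle2\rangle}\otimes\tilde a\in\mathcal{C}(A,H)\otimes_B\mathcal{C}(A,H)$ and counit $\underline{\epsilon}(a\otimes\tilde a)=a\tilde a$. **Twists.** For $\mathcal{H}=\mathcal{C}(A,H)$ with $\underline{\Delta}(h)=h_{(1)}\otimes_Bh_{(2)}$, the convolution algebra $\mathcal{H}^*$ consists of the right $B$-linear maps $\phi_*:\mathcal{H}\to B$ (i.e. linear with $\phi_*(t(b)h)=\phi_*(h)b$), with product $(\phi_*\psi_* )(h)=\psi_*\big(s(\phi_*(h_{(1)}))h_{(2)}\big)$ and unit $\underline{\epsilon}$. It acts on $\mathcal{H}$ by $h\triangleleft\phi_*:=s(\phi_*(h_{(1)}))h_{(2)}$. A twist is an invertible element $\phi_*$ of $\mathcal{H}^*$ with $1_{\mathcal{H}}\triangleleft\phi_*=1_{\mathcal{H}}$ and $(h\triangleleft\phi_* )(h'\triangleleft\phi_* )=(hh')\triangleleft\phi_*$ for all $h,h'\in\mathcal{H}$. Twists form a group $\mathcal{T}^*$ under the convolution product. *)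

theory Defs
  imports "HOL-Algebra.Module" "HOL-Algebra.Free_Abelian_Groups"
begin

section \<open>Tensor products over a (possibly noncommutative) ring\<close>

text \<open>
  For a right \<open>R\<close>-module \<open>M\<close> (action \<open>m \<cdot> r = ract m r\<close>) and a left \<open>R\<close>-module \<open>N\<close>
  (action \<open>r \<cdot> n = lact r n\<close>), the tensor product over \<open>R\<close> is the free abelian group on
  \<open>M \<times> N\<close> modulo the subgroup generated by the usual relators; its elements are cosets.
  Only the carrier of \<open>R\<close> enters. Tensor products over the ground field are the instance
  in which both actions are scalar multiplication.
\<close>

type_synonym ('m, 'n) tensor = "('m \<times> 'n \<Rightarrow>\<^sub>0 int) set"

definition tensor_relators ::
  "'r set \<Rightarrow> ('m, 'x) ring_scheme \<Rightarrow> ('m \<Rightarrow> 'r \<Rightarrow> 'm) \<Rightarrow> ('n, 'y) ring_scheme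
    \<Rightarrow> ('r \<Rightarrow> 'n \<Rightarrow> 'n) \<Rightarrow> ('m \<times> 'n \<Rightarrow>\<^sub>0 int) set" where
  "tensor_relators R M ract N lact =
     {frag_of (m \<oplus>\<^bsub>M\<^esub> m', n) - frag_of (m, n) - frag_of (m', n) | m m' n.
        m \<in> carrier M \<and> m' \<in> carrier M \<and> n \<in> carrier N}
   \<union> {frag_of (m, n \<oplus>\<^bsub>N\<^esub> n') - frag_of (m, n) - frag_of (m, n') | m n n'.
        m \<in> carrier M \<and> n \<in> carrier N \<and> n' \<in> carrier N}
   \<union> {frag_of (ract m r, n) - frag_of (m, lact r n) | m r n.
        m \<in> carrier M \<and> r \<in> R \<and> n \<in> carrier N}"

definition tensor_null ::
  "'r set \<Rightarrow> ('m, 'x) ring_scheme \<Rightarrow> ('m \<Rightarrow> 'r \<Rightarrow> 'm) \<Rightarrow> ('n, 'y) ring_scheme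
    \<Rightarrow> ('r \<Rightarrow> 'n \<Rightarrow> 'n) \<Rightarrow> ('m, 'n) tensor" where
  "tensor_null R M ract N lact =
     generate (free_Abelian_group (carrier M \<times> carrier N)) (tensor_relators R M ract N lact)"

definition pure_tensor ::
  "'r set \<Rightarrow> ('m, 'x) ring_scheme \<Rightarrow> ('m \<Rightarrow> 'r \<Rightarrow> 'm) \<Rightarrow> ('n, 'y) ring_scheme
    \<Rightarrow> ('r \<Rightarrow> 'n \<Rightarrow> 'n) \<Rightarrow> 'm \<Rightarrow> 'n \<Rightarrow> ('m, 'n) tensor" where
  "pure_tensor R M ract N lact m n =
     tensor_null R M ract N lact #>\<^bsub>free_Abelian_group (carrier M \<times> carrier N)\<^esub> frag_of (m, n)"

text \<open>
  Only the additive structure of the following record is meaningful.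
\<close>

definition tensor_group ::
  "'r set \<Rightarrow> ('m, 'x) ring_scheme \<Rightarrow> ('m \<Rightarrow> 'r \<Rightarrow> 'm) \<Rightarrow> ('n, 'y) ring_scheme
    \<Rightarrow> ('r \<Rightarrow> 'n \<Rightarrow> 'n) \<Rightarrow> ('m, 'n) tensor ring" where
  "tensor_group R M ract N lact =
     (let Q = free_Abelian_group (carrier M \<times> carrier N) Mod tensor_null R M ract N lact
      in \<lparr>carrier = carrier Q, monoid.mult = undefined, one = undefined,
          ring.zero = one Q, add = monoid.mult Q\<rparr>)"

text \<open>
  The additive map \<open>M \<otimes>\<^bsub>R\<^esub> N \<rightarrow> P\<close> sending \<open>m \<otimes> n\<close> to \<open>f m n\<close>, evaluated on a chosen
  representative of the coset. It does not depend on this choice whenever \<open>f\<close> is biadditive and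
  \<open>R\<close>-balanced. Nested uses of this map spell out Sweedler-type expressions.
\<close>

definition tensor_lift ::
  "('p, 'z) ring_scheme \<Rightarrow> ('m \<Rightarrow> 'n \<Rightarrow> 'p) \<Rightarrow> ('m, 'n) tensor \<Rightarrow> 'p" where
  "tensor_lift P f X =
     (let c = (SOME c. c \<in> X) in
      \<Oplus>\<^bsub>P\<^esub>k \<in> Poly_Mapping.keys c. [Poly_Mapping.lookup c k] \<cdot>\<^bsub>P\<^esub> f (fst k) (snd k))"

text \<open>
  With the \<open>\<bbbK>\<close>-module structure coming from \<open>M\<close> (used when the actions are \<open>\<bbbK>\<close>-linear).
\<close>

definition tensor_module ::
  "'r set \<Rightarrow> ('k, 'm, 'x) module_scheme \<Rightarrow> ('m \<Rightarrow> 'r \<Rightarrow> 'm) \<Rightarrow> ('n, 'y) ring_scheme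
    \<Rightarrow> ('r \<Rightarrow> 'n \<Rightarrow> 'n) \<Rightarrow> ('k, ('m, 'n) tensor) module" where
  "tensor_module R M ract N lact =
     (let T = tensor_group R M ract N lact
      in \<lparr>carrier = carrier T, monoid.mult = undefined, one = undefined, ring.zero = ring.zero T, add = add T,
          smult = (\<lambda>k. tensor_lift T (\<lambda>m n. pure_tensor R M ract N lact (k \<odot>\<^bsub>M\<^esub> m) n))\<rparr>)"


section \<open>Faithful flatness\<close>

locale right_module = R?: ring R + M?: abelian_group M
  for R (structure) and M (structure) and act :: "'m \<Rightarrow> 'r \<Rightarrow> 'm" +
  assumes act_closed: "\<lbrakk>x \<in> carrier M; a \<in> carrier R\<rbrakk> \<Longrightarrow> act x a \<in> carrier M"
    and act_add_left: "\<lbrakk>x \<in> carrier M; y \<in> carrier M; a \<in> carrier R\<rbrakk>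
      \<Longrightarrow> act (x \<oplus>\<^bsub>M\<^esub> y) a = act x a \<oplus>\<^bsub>M\<^esub> act y a"
    and act_add_right: "\<lbrakk>x \<in> carrier M; a \<in> carrier R; b \<in> carrier R\<rbrakk>
      \<Longrightarrow> act x (a \<oplus>\<^bsub>R\<^esub> b) = act x a \<oplus>\<^bsub>M\<^esub> act x b"
    and act_mult: "\<lbrakk>x \<in> carrier M; a \<in> carrier R; b \<in> carrier R\<rbrakk>
      \<Longrightarrow> act x (a \<otimes>\<^bsub>R\<^esub> b) = act (act x a) b"
    and act_one: "x \<in> carrier M \<Longrightarrow> act x \<one>\<^bsub>R\<^esub> = x"

definition right_module_hom ::
  "('r, 'x) ring_scheme \<Rightarrow> ('m, 'y) ring_scheme \<Rightarrow> ('m \<Rightarrow> 'r \<Rightarrow> 'm)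
    \<Rightarrow> ('n, 'z) ring_scheme \<Rightarrow> ('n \<Rightarrow> 'r \<Rightarrow> 'n) \<Rightarrow> ('m \<Rightarrow> 'n) set" where
  "right_module_hom R M actM N actN =
     {f \<in> carrier M \<rightarrow> carrier N.
        (\<forall>x\<in>carrier M. \<forall>y\<in>carrier M. f (x \<oplus>\<^bsub>M\<^esub> y) = f x \<oplus>\<^bsub>N\<^esub> f y) \<and>
        (\<forall>x\<in>carrier M. \<forall>a\<in>carrier R. f (actM x a) = actN (f x) a)}"

definition exact_pair ::
  "('l, 'x) ring_scheme \<Rightarrow> ('l \<Rightarrow> 'm) \<Rightarrow> ('m, 'y) ring_scheme \<Rightarrow> ('m \<Rightarrow> 'p)
    \<Rightarrow> ('p, 'z) ring_scheme \<Rightarrow> bool" where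
  "exact_pair L f M g P \<longleftrightarrow> f ` carrier L = {x \<in> carrier M. g x = \<zero>\<^bsub>P\<^esub>}"

text \<open>
  A left \<open>R\<close>-module \<open>N\<close> is faithfully flat iff a pair \<open>L \<rightarrow> M \<rightarrow> P\<close> of maps of right \<open>R\<close>-modules
  is exact precisely when \<open>L \<otimes>\<^bsub>R\<^esub> N \<rightarrow> M \<otimes>\<^bsub>R\<^esub> N \<rightarrow> P \<otimes>\<^bsub>R\<^esub> N\<close> is. HOL cannot quantify over
  all types, so the test modules are those with elements in the type \<open>'u\<close>. Flatness may be tested
  on inclusions of finitely generated right ideals into \<open>R\<close> and faithfulness on cyclic modules, so
  the notion is independent of \<open>'u\<close> as soon as \<open>R\<close> injects into \<open>'u\<close>.
\<close>

definition faithfully_flat_left ::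
  "'u itself \<Rightarrow> ('r, 'x) ring_scheme \<Rightarrow> ('n, 'y) ring_scheme \<Rightarrow> ('r \<Rightarrow> 'n \<Rightarrow> 'n) \<Rightarrow> bool" where
  "faithfully_flat_left U R N lact \<longleftrightarrow>
     (\<forall>(L :: 'u ring) actL (M :: 'u ring) actM (P :: 'u ring) actP f g.
        right_module R L actL \<and> right_module R M actM \<and> right_module R P actP \<and>
        f \<in> right_module_hom R L actL M actM \<and> g \<in> right_module_hom R M actM P actP \<longrightarrow>
        (exact_pair L f M g P \<longleftrightarrow>
         exact_pair
           (tensor_group (carrier R) L actL N lact)
           (tensor_lift (tensor_group (carrier R) M actM N lact)
              (\<lambda>x n. pure_tensor (carrier R) M actM N lact (f x) n))
           (tensor_group (carrier R) M actM N lact)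
           (tensor_lift (tensor_group (carrier R) P actP N lact)
              (\<lambda>x n. pure_tensor (carrier R) P actP N lact (g x) n))
           (tensor_group (carrier R) P actP N lact)))"


section \<open>Algebras over a field and their tensor products\<close>

text \<open>
  The library locale \<open>algebra\<close> is restricted to commutative algebras. The zero algebra is
  not excluded here.
\<close>

definition unital_algebra :: "'k ring \<Rightarrow> ('k, 'a) module \<Rightarrow> bool" where
  "unital_algebra K A \<longleftrightarrow> field K \<and> module K A \<and> ring A \<and>
     (\<forall>k\<in>carrier K. \<forall>x\<in>carrier A. \<forall>y\<in>carrier A.
        (k \<odot>\<^bsub>A\<^esub> x) \<otimes>\<^bsub>A\<^esub> y = k \<odot>\<^bsub>A\<^esub> (x \<otimes>\<^bsub>A\<^esub> y) \<and>
        x \<otimes>\<^bsub>A\<^esub> (k \<odot>\<^bsub>A\<^esub> y) = k \<odot>\<^bsub>A\<^esub> (x \<otimes>\<^bsub>A\<^esub> y))"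

definition linear_maps :: "'k ring \<Rightarrow> ('k, 'm) module \<Rightarrow> ('k, 'n) module \<Rightarrow> ('m \<Rightarrow> 'n) set" where
  "linear_maps K M N =
     {f \<in> carrier M \<rightarrow> carrier N.
        (\<forall>x\<in>carrier M. \<forall>y\<in>carrier M. f (x \<oplus>\<^bsub>M\<^esub> y) = f x \<oplus>\<^bsub>N\<^esub> f y) \<and>
        (\<forall>k\<in>carrier K. \<forall>x\<in>carrier M. f (k \<odot>\<^bsub>M\<^esub> x) = k \<odot>\<^bsub>N\<^esub> f x)}"

definition algebra_homs :: "'k ring \<Rightarrow> ('k, 'a) module \<Rightarrow> ('k, 'b) module \<Rightarrow> ('a \<Rightarrow> 'b) set" where
  "algebra_homs K A B = ring_hom A B \<inter> linear_maps K A B"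

definition opposite :: "('k, 'a) module \<Rightarrow> ('k, 'a) module" where
  "opposite A = A\<lparr>monoid.mult := (\<lambda>x y. y \<otimes>\<^bsub>A\<^esub> x)\<rparr>"

text \<open>
  The tensor product over \<open>\<bbbK>\<close>, with \<open>(x \<otimes> y)(x' \<otimes> y') = xx' \<otimes> yy'\<close>. This multiplication and unit
  are meaningful only if both factors are algebras; for mere vector spaces they are ignored.
\<close>

definition ktensor_pure ::
  "'k ring \<Rightarrow> ('k, 'm) module \<Rightarrow> ('k, 'n) module \<Rightarrow> 'm \<Rightarrow> 'n \<Rightarrow> ('m, 'n) tensor" where
  "ktensor_pure K M N =
     pure_tensor (carrier K) M (\<lambda>x k. k \<odot>\<^bsub>M\<^esub> x) N (\<lambda>k y. k \<odot>\<^bsub>N\<^esub> y)"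

definition ktensor ::
  "'k ring \<Rightarrow> ('k, 'm) module \<Rightarrow> ('k, 'n) module \<Rightarrow> ('k, ('m, 'n) tensor) module" where
  "ktensor K M N =
     (let T = tensor_module (carrier K) M (\<lambda>x k. k \<odot>\<^bsub>M\<^esub> x) N (\<lambda>k y. k \<odot>\<^bsub>N\<^esub> y)
      in T\<lparr>monoid.mult := (\<lambda>X Y. tensor_lift T (\<lambda>x y.
                       tensor_lift T (\<lambda>x' y'.
                         ktensor_pure K M N (x \<otimes>\<^bsub>M\<^esub> x') (y \<otimes>\<^bsub>N\<^esub> y')) Y) X),
           one := ktensor_pure K M N \<one>\<^bsub>M\<^esub> \<one>\<^bsub>N\<^esub>\<rparr>)"


section \<open>Hopf algebras and comodule algebras\<close>

locale hopf_algebra =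
  fixes K :: "'k ring" and H :: "('k, 'h) module"
    and \<Delta> :: "'h \<Rightarrow> ('h, 'h) tensor" and \<epsilon> :: "'h \<Rightarrow> 'k" and S :: "'h \<Rightarrow> 'h"
  assumes unital_algebra_H: "unital_algebra K H"
    and comult_hom: "\<Delta> \<in> algebra_homs K H (ktensor K H H)"
    and counit_hom: "\<epsilon> \<in> ring_hom H K"
    and counit_smult: "\<lbrakk>k \<in> carrier K; h \<in> carrier H\<rbrakk> \<Longrightarrow> \<epsilon> (k \<odot>\<^bsub>H\<^esub> h) = k \<otimes>\<^bsub>K\<^esub> \<epsilon> h"
    and coassoc: "h \<in> carrier H \<Longrightarrow>
      tensor_lift (ktensor K H (ktensor K H H)) (\<lambda>x y.
        tensor_lift (ktensor K H (ktensor K H H)) (\<lambda>x' x''.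
          ktensor_pure K H (ktensor K H H) x' (ktensor_pure K H H x'' y)) (\<Delta> x)) (\<Delta> h)
      = tensor_lift (ktensor K H (ktensor K H H)) (\<lambda>x y.
          ktensor_pure K H (ktensor K H H) x (\<Delta> y)) (\<Delta> h)"
    and counit_left: "h \<in> carrier H \<Longrightarrow> tensor_lift H (\<lambda>x y. \<epsilon> x \<odot>\<^bsub>H\<^esub> y) (\<Delta> h) = h"
    and counit_right: "h \<in> carrier H \<Longrightarrow> tensor_lift H (\<lambda>x y. \<epsilon> y \<odot>\<^bsub>H\<^esub> x) (\<Delta> h) = h"
    and antipode_linear: "S \<in> linear_maps K H H"
    and antipode_left: "h \<in> carrier H \<Longrightarrow>
      tensor_lift H (\<lambda>x y. S x \<otimes>\<^bsub>H\<^esub> y) (\<Delta> h) = \<epsilon> h \<odot>\<^bsub>H\<^esub> \<one>\<^bsub>H\<^esub>"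
    and antipode_right: "h \<in> carrier H \<Longrightarrow>
      tensor_lift H (\<lambda>x y. x \<otimes>\<^bsub>H\<^esub> S y) (\<Delta> h) = \<epsilon> h \<odot>\<^bsub>H\<^esub> \<one>\<^bsub>H\<^esub>"

locale comodule_algebra = hopf_algebra K H \<Delta> \<epsilon> S
  for K :: "'k ring" and H :: "('k, 'h) module"
    and \<Delta> :: "'h \<Rightarrow> ('h, 'h) tensor" and \<epsilon> :: "'h \<Rightarrow> 'k" and S :: "'h \<Rightarrow> 'h" +
  fixes A :: "('k, 'a) module" and \<rho> :: "'a \<Rightarrow> ('a, 'h) tensor"
  assumes unital_algebra_A: "unital_algebra K A"
    and coaction_hom: "\<rho> \<in> algebra_homs K A (ktensor K A H)"
    and coaction_coassoc: "a \<in> carrier A \<Longrightarrow>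
      tensor_lift (ktensor K A (ktensor K H H)) (\<lambda>x h.
        tensor_lift (ktensor K A (ktensor K H H)) (\<lambda>x' h'.
          ktensor_pure K A (ktensor K H H) x' (ktensor_pure K H H h' h)) (\<rho> x)) (\<rho> a)
      = tensor_lift (ktensor K A (ktensor K H H)) (\<lambda>x h.
          ktensor_pure K A (ktensor K H H) x (\<Delta> h)) (\<rho> a)"
    and coaction_counit: "a \<in> carrier A \<Longrightarrow> tensor_lift A (\<lambda>x h. \<epsilon> h \<odot>\<^bsub>A\<^esub> x) (\<rho> a) = a"


section \<open>The canonical map, the bialgebroid and its twists\<close>

text \<open>
  The locale below carries no assumptions; it only fixes the data on which the constructions depend.
\<close>

locale coaction_data =
  fixes K :: "'k ring" and H :: "('k, 'h) module"
    and A :: "('k, 'a) module" and \<rho> :: "'a \<Rightarrow> ('a, 'h) tensor"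
begin

definition coinv :: "'a set" where
  "coinv = {a \<in> carrier A. \<rho> a = ktensor_pure K A H a \<one>\<^bsub>H\<^esub>}"

definition B :: "('k, 'a) module" where
  "B = A\<lparr>carrier := coinv\<rparr>"

definition AA :: "('k, ('a, 'a) tensor) module" where
  "AA = tensor_module coinv A (\<lambda>x b. x \<otimes>\<^bsub>A\<^esub> b) A (\<lambda>b y. b \<otimes>\<^bsub>A\<^esub> y)"

definition AA_pure :: "'a \<Rightarrow> 'a \<Rightarrow> ('a, 'a) tensor" where
  "AA_pure = pure_tensor coinv A (\<lambda>x b. x \<otimes>\<^bsub>A\<^esub> b) A (\<lambda>b y. b \<otimes>\<^bsub>A\<^esub> y)"

definition can :: "('a, 'a) tensor \<Rightarrow> ('a, 'h) tensor" where
  "can = tensor_lift (ktensor K A H) (\<lambda>a a'.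
           tensor_lift (ktensor K A H) (\<lambda>x h. ktensor_pure K A H (a \<otimes>\<^bsub>A\<^esub> x) h) (\<rho> a'))"

definition hopf_galois :: bool where
  "hopf_galois \<longleftrightarrow> bij_betw can (carrier AA) (carrier (ktensor K A H))"

definition translation :: "'h \<Rightarrow> ('a, 'a) tensor" where
  "translation h = inv_into (carrier AA) can (ktensor_pure K A H \<one>\<^bsub>A\<^esub> h)"

text \<open>The algebra \<open>A \<otimes> A\<^sup>o\<^sup>p\<close> containing the bialgebroid.\<close>

definition Ae :: "('k, ('a, 'a) tensor) module" where
  "Ae = ktensor K A (opposite A)"

definition Ae_pure :: "'a \<Rightarrow> 'a \<Rightarrow> ('a, 'a) tensor" where
  "Ae_pure = ktensor_pure K A (opposite A)"

text \<open>
  The condition is an equation \<open>a\<^bsub>(0)\<^esub> \<otimes> a\<^bsub>(1)\<^esub>\<^sup>\<langle>\<^sup>1\<^sup>\<rangle> \<otimes>\<^bsub>B\<^esub> a\<^bsub>(1)\<^esub>\<^sup>\<langle>\<^sup>2\<^sup>\<rangle>a' = a \<otimes> a' \<otimes>\<^bsub>B\<^esub> 1\<close> in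
  \<open>A \<otimes> (A \<otimes>\<^bsub>B\<^esub> A)\<close>. The product and unit are those of \<open>A \<otimes> A\<^sup>o\<^sup>p\<close>.
\<close>

definition ES :: "('k, ('a, 'a) tensor) module" where
  "ES = Ae\<lparr>carrier := {X \<in> carrier Ae.
     tensor_lift (ktensor K A AA) (\<lambda>a a'.
       tensor_lift (ktensor K A AA) (\<lambda>x h.
         ktensor_pure K A AA x
           (tensor_lift AA (\<lambda>p q. AA_pure p (q \<otimes>\<^bsub>A\<^esub> a')) (translation h))) (\<rho> a)) X
     = tensor_lift (ktensor K A AA) (\<lambda>a a'. ktensor_pure K A AA a (AA_pure a' \<one>\<^bsub>A\<^esub>)) X}\<rparr>"

definition source :: "'a \<Rightarrow> ('a, 'a) tensor" where
  "source b = Ae_pure b \<one>\<^bsub>A\<^esub>"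

definition target :: "'a \<Rightarrow> ('a, 'a) tensor" where
  "target b = Ae_pure \<one>\<^bsub>A\<^esub> b"

text \<open>
  The bimodule structure \<open>b X b' = s(b) t(b') X\<close> on \<open>A \<otimes> A\<^sup>o\<^sup>p\<close> and on its subalgebra \<open>ES\<close>;
  on pure tensors it is \<open>b (a \<otimes> a') b' = b a \<otimes> a' b'\<close>.
\<close>

definition bl :: "'a \<Rightarrow> ('a, 'a) tensor \<Rightarrow> ('a, 'a) tensor" where
  "bl b X = source b \<otimes>\<^bsub>Ae\<^esub> X"

definition br :: "('a, 'a) tensor \<Rightarrow> 'a \<Rightarrow> ('a, 'a) tensor" where
  "br X b = target b \<otimes>\<^bsub>Ae\<^esub> X"

text \<open>
  The coproduct formula \<open>a\<^bsub>(0)\<^esub> \<otimes> a\<^bsub>(1)\<^esub>\<^sup>\<langle>\<^sup>1\<^sup>\<rangle> \<otimes>\<^bsub>B\<^esub> a\<^bsub>(1)\<^esub>\<^sup>\<langle>\<^sup>2\<^sup>\<rangle> \<otimes> a'\<close> a priori defines an element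
  of \<open>(A \<otimes> A) \<otimes>\<^bsub>B\<^esub> (A \<otimes> A)\<close>; the coproduct is its unique preimage in \<open>ES \<otimes>\<^bsub>B\<^esub> ES\<close>
  (the inclusion-induced map is injective and the formula lies in its range by faithful flatness).
\<close>

definition ES_coproduct :: "('a, 'a) tensor \<Rightarrow> (('a, 'a) tensor, ('a, 'a) tensor) tensor" where
  "ES_coproduct X = (THE Y. Y \<in> carrier (tensor_group coinv ES br ES bl) \<and>
     tensor_lift (tensor_group coinv Ae br Ae bl) (\<lambda>U V. pure_tensor coinv Ae br Ae bl U V) Y
     = tensor_lift (tensor_group coinv Ae br Ae bl) (\<lambda>a a'.
         tensor_lift (tensor_group coinv Ae br Ae bl) (\<lambda>x h.
           tensor_lift (tensor_group coinv Ae br Ae bl) (\<lambda>p q.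
             pure_tensor coinv Ae br Ae bl (Ae_pure x p) (Ae_pure q a'))
           (translation h)) (\<rho> a)) X)"

definition ES_counit :: "('a, 'a) tensor \<Rightarrow> 'a" where
  "ES_counit = restrict (tensor_lift A (\<lambda>a a'. a \<otimes>\<^bsub>A\<^esub> a')) (carrier ES)"

text \<open>
  The element \<open>a\<^bsub>(0)\<^esub> \<otimes> a\<^bsub>(1)\<^esub>\<^sup>\<langle>\<^sup>1\<^sup>\<rangle> \<otimes>\<^bsub>B\<^esub> a\<^bsub>(1)\<^esub>\<^sup>\<langle>\<^sup>2\<^sup>\<rangle>\<close>, a priori in \<open>(A \<otimes> A) \<otimes>\<^bsub>B\<^esub> A\<close>,
  regarded as an element of \<open>ES \<otimes>\<^bsub>B\<^esub> A\<close>, again using flatness.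
\<close>

definition ES_coaction :: "'a \<Rightarrow> (('a, 'a) tensor, 'a) tensor" where
  "ES_coaction a = (THE Y. Y \<in> carrier (tensor_group coinv ES br A (\<lambda>b y. b \<otimes>\<^bsub>A\<^esub> y)) \<and>
     tensor_lift (tensor_group coinv Ae br A (\<lambda>b y. b \<otimes>\<^bsub>A\<^esub> y))
       (\<lambda>U y. pure_tensor coinv Ae br A (\<lambda>b y. b \<otimes>\<^bsub>A\<^esub> y) U y) Y
     = tensor_lift (tensor_group coinv Ae br A (\<lambda>b y. b \<otimes>\<^bsub>A\<^esub> y)) (\<lambda>x h.
         tensor_lift (tensor_group coinv Ae br A (\<lambda>b y. b \<otimes>\<^bsub>A\<^esub> y)) (\<lambda>p q.
           pure_tensor coinv Ae br A (\<lambda>b y. b \<otimes>\<^bsub>A\<^esub> y) (Ae_pure x p) q)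
         (translation h)) (\<rho> a))"

text \<open>
  Maps are made extensional on their domain, so that equality of functions is equality of maps.
  Only the monoid structure of the convolution algebra is recorded.
\<close>

definition convolution :: "(('a, 'a) tensor \<Rightarrow> 'a) monoid" where
  "convolution =
     \<lparr>carrier = {\<phi> \<in> extensional (carrier ES). \<phi> \<in> linear_maps K ES B \<and>
        (\<forall>b\<in>coinv. \<forall>X\<in>carrier ES. \<phi> (target b \<otimes>\<^bsub>ES\<^esub> X) = \<phi> X \<otimes>\<^bsub>A\<^esub> b)},
      monoid.mult = (\<lambda>\<phi> \<psi>. \<lambda>X\<in>carrier ES.
        tensor_lift B (\<lambda>U V. \<psi> (source (\<phi> U) \<otimes>\<^bsub>ES\<^esub> V)) (ES_coproduct X)),
      one = ES_counit\<rparr>"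

definition conv_act :: "('a, 'a) tensor \<Rightarrow> (('a, 'a) tensor \<Rightarrow> 'a) \<Rightarrow> ('a, 'a) tensor" where
  "conv_act X \<phi> = tensor_lift ES (\<lambda>U V. source (\<phi> U) \<otimes>\<^bsub>ES\<^esub> V) (ES_coproduct X)"

definition twists :: "(('a, 'a) tensor \<Rightarrow> 'a) monoid" where
  "twists = convolution\<lparr>carrier := {\<phi> \<in> Units convolution.
     conv_act \<one>\<^bsub>ES\<^esub> \<phi> = \<one>\<^bsub>ES\<^esub> \<and>
     (\<forall>X\<in>carrier ES. \<forall>Y\<in>carrier ES.
        conv_act X \<phi> \<otimes>\<^bsub>ES\<^esub> conv_act Y \<phi> = conv_act (X \<otimes>\<^bsub>ES\<^esub> Y) \<phi>)}\<rparr>"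

definition comodule_algebra_auts :: "('a \<Rightarrow> 'a) monoid" where
  "comodule_algebra_auts =
     \<lparr>carrier = {F \<in> extensional (carrier A). F \<in> algebra_homs K A A \<and>
        bij_betw F (carrier A) (carrier A) \<and>
        (\<forall>a\<in>carrier A. \<rho> (F a) =
           tensor_lift (ktensor K A H) (\<lambda>x h. ktensor_pure K A H (F x) h) (\<rho> a))},
      monoid.mult = (\<lambda>F G. compose (carrier A) G F),
      one = (\<lambda>a\<in>carrier A. a)\<rparr>"

definition twist_of_aut :: "('a \<Rightarrow> 'a) \<Rightarrow> ('a, 'a) tensor \<Rightarrow> 'a" where
  "twist_of_aut F = (\<lambda>X\<in>carrier ES. tensor_lift A (\<lambda>a a'. F a \<otimes>\<^bsub>A\<^esub> a') X)"

definition aut_of_twist :: "(('a, 'a) tensor \<Rightarrow> 'a) \<Rightarrow> 'a \<Rightarrow> 'a" where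
  "aut_of_twist \<phi> = (\<lambda>a\<in>carrier A. tensor_lift A (\<lambda>U y. \<phi> U \<otimes>\<^bsub>A\<^esub> y) (ES_coaction a))"

end

text \<open>
  The type \<open>(nat + 'a + 'h) list\<close> of test modules is large enough to contain, up to
  isomorphism, all modules built from \<open>A\<close> and \<open>H\<close> by iterated tensor products, submodules and
  quotients.
\<close>

locale principal_comodule_algebra = comodule_algebra K H \<Delta> \<epsilon> S A \<rho>
  for K :: "'k ring" and H :: "('k, 'h) module"
    and \<Delta> :: "'h \<Rightarrow> ('h, 'h) tensor" and \<epsilon> :: "'h \<Rightarrow> 'k" and S :: "'h \<Rightarrow> 'h"
    and A :: "('k, 'a) module" and \<rho> :: "'a \<Rightarrow> ('a, 'h) tensor" +
  assumes antipode_bij: "bij_betw S (carrier H) (carrier H)"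
    and hopf_galois: "coaction_data.hopf_galois K H A \<rho>"
    and faithfully_flat: "faithfully_flat_left TYPE((nat + 'a + 'h) list)
      (coaction_data.B K H A \<rho>) A (\<lambda>b y. b \<otimes>\<^bsub>A\<^esub> y)"

end

theory Submission
  imports Defs
begin

text \<open>
  Write \<open>ES\<close> for the bialgebroid, the equalizer in \<open>A \<otimes> A\<close> of \<open>a \<otimes> a' \<mapsto> a\<^bsub>(0)\<^esub> \<otimes> (1 \<otimes> a\<^bsub>(1)\<^esub>) \<rho>(a')\<close> and
  \<open>a \<otimes> a' \<mapsto> a \<otimes> a' \<otimes> 1\<close>. After tensoring with \<open>A\<close> over \<open>B\<close> this equalizer becomes split, by means of the
  translation map. Flatness then yields \<open>ES \<otimes>\<^bsub>B\<^esub> A \<cong> A \<otimes> A\<close>, \<open>X \<otimes>\<^bsub>B\<^esub> y \<mapsto> X y\<close>, so that additive maps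
  on \<open>A \<otimes> A\<close> are determined by their values on the elements \<open>X y\<close> with \<open>X \<in> ES\<close>. Since the splitting is left
  \<open>B\<close>-linear, faithful flatness shows that \<open>ES \<otimes>\<^bsub>B\<^esub> -\<close> preserves the equalizer too, which makes the
  coproduct well defined.

  For a right colinear \<open>\<bbbK>\<close>-linear endomorphism \<open>f\<close> of \<open>A\<close>, multiplicative or not, \<open>f(a) a'\<close> is coinvariant on \<open>ES\<close>.
  This identifies the whole convolution monoid with the monoid of such endomorphisms. Under this
  identification \<open>X \<triangleleft> \<phi>\<close> is \<open>(f \<otimes> id) X\<close>, invertible elements correspond to bijections, and the twist
  conditions say that \<open>f\<close> is unital and, because \<open>ES\<close> generates \<open>A \<otimes> A\<close>, multiplicative.
\<close>

section \<open>Tensor products\<close>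

text \<open>Every Sweedler expression is a \<open>tensor_lift\<close>, meaningful only for balanced
  maps, so the proof turns such expressions into ring products wherever it can. The condition on
  \<open>ES\<close> lives in \<open>A \<otimes> (A \<otimes>\<^sub>B A)\<close>; applying the
  canonical map to the last two factors moves it to \<open>A \<otimes> (A \<otimes> H)\<close>,
  where it involves only \<open>\<rho>\<close> and multiplications. The inverse of the canonical map
  gives back \<open>\<sigma>\<close>, with \<open>\<sigma> (D2 X) = X \<otimes>\<^sub>B 1\<close>.
  The one computation that is not formal is that \<open>\<sigma> (D1 X)\<close> is equalized again;
  it combines coassociativity with the coproduct rule for the translation map. The obstacle is the
  coproduct, defined by \<open>THE\<close> in \<open>ES \<otimes>\<^sub>B ES\<close> although its
  formula lies in \<open>(A \<otimes> A) \<otimes>\<^sub>B (A \<otimes> A)\<close>. Flatness of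
  \<open>A\<close> concerns \<open>- \<otimes>\<^sub>B A\<close> and says nothing directly about
  \<open>ES \<otimes>\<^sub>B -\<close>. So the inclusion is factored through
  \<open>ES \<otimes>\<^sub>B (A \<otimes> A)\<close>: one half is injective by descent, the other
  has an explicit retraction.\<close>

definition add_hom :: "('m, 'x) ring_scheme \<Rightarrow> ('p, 'z) ring_scheme \<Rightarrow> ('m \<Rightarrow> 'p) \<Rightarrow> bool" where
  "add_hom M P f \<longleftrightarrow> f \<in> carrier M \<rightarrow> carrier P \<and>
     (\<forall>x\<in>carrier M. \<forall>y\<in>carrier M. f (x \<oplus>\<^bsub>M\<^esub> y) = f x \<oplus>\<^bsub>P\<^esub> f y)"

text \<open>The condition under which \<open>tensor_lift P f\<close> does not depend on the chosen
  representative; each Sweedler formula below has to be shown balanced before it can be computed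
  with.\<close>

definition balanced ::
  "'r set \<Rightarrow> ('m, 'x) ring_scheme \<Rightarrow> ('m \<Rightarrow> 'r \<Rightarrow> 'm) \<Rightarrow> ('n, 'y) ring_scheme
    \<Rightarrow> ('r \<Rightarrow> 'n \<Rightarrow> 'n) \<Rightarrow> ('p, 'z) ring_scheme \<Rightarrow> ('m \<Rightarrow> 'n \<Rightarrow> 'p) \<Rightarrow> bool" where
  "balanced R M ract N lact P f \<longleftrightarrow>
     (\<forall>n\<in>carrier N. add_hom M P (\<lambda>m. f m n)) \<and> (\<forall>m\<in>carrier M. add_hom N P (f m)) \<and>
     (\<forall>m\<in>carrier M. \<forall>r\<in>R. \<forall>n\<in>carrier N. f (ract m r) n = f m (lact r n))"

text \<open>Abstracts from the multiplicative and scalar structure that \<open>ktensor\<close> and \<open>tensor_module\<close>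
  add to the same underlying group.\<close>

definition is_tensor ::
  "'r set \<Rightarrow> ('m, 'x) ring_scheme \<Rightarrow> ('m \<Rightarrow> 'r \<Rightarrow> 'm) \<Rightarrow> ('n, 'y) ring_scheme
    \<Rightarrow> ('r \<Rightarrow> 'n \<Rightarrow> 'n) \<Rightarrow> (('m, 'n) tensor, 'z) ring_scheme \<Rightarrow> ('m \<Rightarrow> 'n \<Rightarrow> ('m, 'n) tensor) \<Rightarrow> bool" where
  "is_tensor R M ract N lact T p \<longleftrightarrow>
     abelian_group M \<and> abelian_group N \<and>
     (\<forall>m\<in>carrier M. \<forall>r\<in>R. ract m r \<in> carrier M) \<and> (\<forall>r\<in>R. \<forall>n\<in>carrier N. lact r n \<in> carrier N) \<and>
     carrier T = carrier (tensor_group R M ract N lact) \<and>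
     add T = add (tensor_group R M ract N lact) \<and>
     ring.zero T = ring.zero (tensor_group R M ract N lact) \<and>
     p = pure_tensor R M ract N lact"

lemma add_homI:
  "\<lbrakk>\<And>x. x \<in> carrier M \<Longrightarrow> f x \<in> carrier P;
    \<And>x y. \<lbrakk>x \<in> carrier M; y \<in> carrier M\<rbrakk> \<Longrightarrow> f (x \<oplus>\<^bsub>M\<^esub> y) = f x \<oplus>\<^bsub>P\<^esub> f y\<rbrakk> \<Longrightarrow> add_hom M P f"
  by (auto simp: add_hom_def)

lemma add_hom_closed: "\<lbrakk>add_hom M P f; x \<in> carrier M\<rbrakk> \<Longrightarrow> f x \<in> carrier P"
  by (auto simp: add_hom_def)

lemma add_hom_add:
  "\<lbrakk>add_hom M P f; x \<in> carrier M; y \<in> carrier M\<rbrakk> \<Longrightarrow> f (x \<oplus>\<^bsub>M\<^esub> y) = f x \<oplus>\<^bsub>P\<^esub> f y"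
  by (auto simp: add_hom_def)

lemma add_hom_iff_hom: "add_hom M P f \<longleftrightarrow> f \<in> hom (add_monoid M) (add_monoid P)"
  by (auto simp: add_hom_def hom_def)

lemma add_hom_group_hom:
  "\<lbrakk>abelian_group M; abelian_group P; add_hom M P f\<rbrakk> \<Longrightarrow> group_hom (add_monoid M) (add_monoid P) f"
  by (simp add: add_hom_iff_hom group_hom_def group_hom_axioms_def abelian_group.a_group)

lemma add_hom_zero:
  "\<lbrakk>abelian_group M; abelian_group P; add_hom M P f\<rbrakk> \<Longrightarrow> f \<zero>\<^bsub>M\<^esub> = \<zero>\<^bsub>P\<^esub>"
  using group_hom.hom_one[OF add_hom_group_hom] by fastforce

lemma add_hom_neg:
  "\<lbrakk>abelian_group M; abelian_group P; add_hom M P f; x \<in> carrier M\<rbrakk>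
    \<Longrightarrow> f (\<ominus>\<^bsub>M\<^esub> x) = \<ominus>\<^bsub>P\<^esub> f x"
  using group_hom.hom_inv[OF add_hom_group_hom, of M P f x] by (simp add: a_inv_def)

lemma add_hom_minus:
  "\<lbrakk>abelian_group M; abelian_group P; add_hom M P f; x \<in> carrier M; y \<in> carrier M\<rbrakk>
    \<Longrightarrow> f (x \<ominus>\<^bsub>M\<^esub> y) = f x \<ominus>\<^bsub>P\<^esub> f y"
  by (simp add: a_minus_def add_hom_neg add_hom_add abelian_group.a_inv_closed)

lemma add_hom_id: "add_hom M M (\<lambda>x. x)"
  by (simp add: add_hom_def)

lemma add_hom_comp: "\<lbrakk>add_hom N P g; add_hom M N f\<rbrakk> \<Longrightarrow> add_hom M P (\<lambda>x. g (f x))"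
  by (auto simp: add_hom_def Pi_def)

lemma ag_closed: "\<lbrakk>abelian_group G; x \<in> carrier G; y \<in> carrier G\<rbrakk> \<Longrightarrow> x \<oplus>\<^bsub>G\<^esub> y \<in> carrier G"
  by (simp add: abelian_group.axioms(1) abelian_monoid.a_closed)

lemma ag_zero: "abelian_group G \<Longrightarrow> \<zero>\<^bsub>G\<^esub> \<in> carrier G"
  by (simp add: abelian_group.axioms(1) abelian_monoid.zero_closed)

lemma ag_minus: "\<lbrakk>abelian_group G; x \<in> carrier G; y \<in> carrier G\<rbrakk> \<Longrightarrow> x \<ominus>\<^bsub>G\<^esub> y \<in> carrier G"
  by (simp add: abelian_group.minus_closed)

lemma ag_exchange:
  assumes "abelian_group G" "a \<in> carrier G" "b \<in> carrier G" "c \<in> carrier G" "d \<in> carrier G"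
  shows "(a \<oplus>\<^bsub>G\<^esub> b) \<oplus>\<^bsub>G\<^esub> (c \<oplus>\<^bsub>G\<^esub> d) = (a \<oplus>\<^bsub>G\<^esub> c) \<oplus>\<^bsub>G\<^esub> (b \<oplus>\<^bsub>G\<^esub> d)"
proof -
  interpret abelian_group G by fact
  show ?thesis using assms by (simp add: a_ac)
qed

lemma add_hom_plus:
  assumes "abelian_group P" "add_hom M P f" "add_hom M P g"
  shows "add_hom M P (\<lambda>x. f x \<oplus>\<^bsub>P\<^esub> g x)"
  using assms by (intro add_homI) (auto simp: add_hom_closed add_hom_add ag_closed ag_exchange)

lemma add_hom_zero_map: "abelian_group P \<Longrightarrow> add_hom M P (\<lambda>_. \<zero>\<^bsub>P\<^esub>)"
  by (intro add_homI) (auto simp: ag_zero abelian_monoid.l_zero abelian_group.axioms(1))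

lemma add_hom_diff:
  assumes "abelian_group P" "add_hom M P f" "add_hom M P g"
  shows "add_hom M P (\<lambda>x. f x \<ominus>\<^bsub>P\<^esub> g x)"
proof (rule add_homI)
  interpret abelian_group P by fact
  show "f (x \<oplus>\<^bsub>M\<^esub> y) \<ominus>\<^bsub>P\<^esub> g (x \<oplus>\<^bsub>M\<^esub> y) = (f x \<ominus>\<^bsub>P\<^esub> g x) \<oplus>\<^bsub>P\<^esub> (f y \<ominus>\<^bsub>P\<^esub> g y)"
    if "x \<in> carrier M" "y \<in> carrier M" for x y
    using assms that
    by (simp add: add_hom_add a_minus_def minus_add add_hom_closed a_ac)
qed (use assms in \<open>auto simp: ag_minus add_hom_closed\<close>)

lemma balancedI:
  assumes "\<And>m n. \<lbrakk>m \<in> carrier M; n \<in> carrier N\<rbrakk> \<Longrightarrow> f m n \<in> carrier P"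
    and "\<And>m m' n. \<lbrakk>m \<in> carrier M; m' \<in> carrier M; n \<in> carrier N\<rbrakk>
      \<Longrightarrow> f (m \<oplus>\<^bsub>M\<^esub> m') n = f m n \<oplus>\<^bsub>P\<^esub> f m' n"
    and "\<And>m n n'. \<lbrakk>m \<in> carrier M; n \<in> carrier N; n' \<in> carrier N\<rbrakk>
      \<Longrightarrow> f m (n \<oplus>\<^bsub>N\<^esub> n') = f m n \<oplus>\<^bsub>P\<^esub> f m n'"
    and "\<And>m r n. \<lbrakk>m \<in> carrier M; r \<in> R; n \<in> carrier N\<rbrakk> \<Longrightarrow> f (ract m r) n = f m (lact r n)"
  shows "balanced R M ract N lact P f"
  using assms by (auto simp: balanced_def add_hom_def)

lemma balanced_closed:
  "\<lbrakk>balanced R M ract N lact P f; m \<in> carrier M; n \<in> carrier N\<rbrakk> \<Longrightarrow> f m n \<in> carrier P"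
  by (auto simp: balanced_def add_hom_def)

lemma balanced_add_left:
  "\<lbrakk>balanced R M ract N lact P f; m \<in> carrier M; m' \<in> carrier M; n \<in> carrier N\<rbrakk>
    \<Longrightarrow> f (m \<oplus>\<^bsub>M\<^esub> m') n = f m n \<oplus>\<^bsub>P\<^esub> f m' n"
  by (auto simp: balanced_def add_hom_def)

lemma balanced_add_right:
  "\<lbrakk>balanced R M ract N lact P f; m \<in> carrier M; n \<in> carrier N; n' \<in> carrier N\<rbrakk>
    \<Longrightarrow> f m (n \<oplus>\<^bsub>N\<^esub> n') = f m n \<oplus>\<^bsub>P\<^esub> f m n'"
  by (auto simp: balanced_def add_hom_def)

lemma balanced_act:
  "\<lbrakk>balanced R M ract N lact P f; m \<in> carrier M; r \<in> R; n \<in> carrier N\<rbrakk>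
    \<Longrightarrow> f (ract m r) n = f m (lact r n)"
  by (auto simp: balanced_def)

lemma balanced_comp:
  "\<lbrakk>balanced R M ract N lact P f; add_hom P Q g\<rbrakk> \<Longrightarrow> balanced R M ract N lact Q (\<lambda>m n. g (f m n))"
  by (rule balancedI)
    (simp_all add: balanced_add_left balanced_add_right balanced_act add_hom_add
      balanced_closed add_hom_closed)

subsection \<open>The universal property\<close>

context
  fixes R :: "'r set" and M :: "('m, 'x) ring_scheme" and ract :: "'m \<Rightarrow> 'r \<Rightarrow> 'm"
    and N :: "('n, 'y) ring_scheme" and lact :: "'r \<Rightarrow> 'n \<Rightarrow> 'n"
  assumes gM: "abelian_group M" and gN: "abelian_group N"
    and ract_closed: "\<And>m r. \<lbrakk>m \<in> carrier M; r \<in> R\<rbrakk> \<Longrightarrow> ract m r \<in> carrier M"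
    and lact_closed: "\<And>r n. \<lbrakk>r \<in> R; n \<in> carrier N\<rbrakk> \<Longrightarrow> lact r n \<in> carrier N"
begin

private abbreviation "FA \<equiv> free_Abelian_group (carrier M \<times> carrier N)"
private abbreviation "T0 \<equiv> tensor_null R M ract N lact"
private abbreviation "TG \<equiv> tensor_group R M ract N lact"
private abbreviation "pt \<equiv> pure_tensor R M ract N lact"

lemma tensor_relators_closed: "tensor_relators R M ract N lact \<subseteq> carrier FA"
proof
  fix c assume "c \<in> tensor_relators R M ract N lact"
  moreover have "frag_of (m, n) - frag_of (m', n') - frag_of (m'', n'') \<in> carrier FA"
      "frag_of (m, n) - frag_of (m', n') \<in> carrier FA"
    if "m \<in> carrier M" "m' \<in> carrier M" "m'' \<in> carrier M" "n \<in> carrier N" "n' \<in> carrier N" "n'' \<in> carrier N"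
    for m m' m'' n n' n''
    using that by (auto simp: keys_frag_of dest!: subsetD[OF keys_diff])
  ultimately show "c \<in> carrier FA"
    unfolding tensor_relators_def
    by (auto simp del: carrier_free_Abelian_group_iff simp: ag_closed gM gN ract_closed lact_closed)
qed

lemma tensor_null_normal: "T0 \<lhd> FA"
  unfolding tensor_null_def
  by (intro comm_group.subgroup_imp_normal[OF abelian_free_Abelian_group]
      group.generate_is_subgroup[OF group_free_Abelian_group] tensor_relators_closed)

lemma tensor_null_subgroup: "subgroup T0 FA"
  using tensor_null_normal normal_imp_subgroup by blast

lemma tensor_group_abelian: "abelian_group TG"
proof -
  have "comm_group (FA Mod T0)"
    using comm_group.abelian_FactGroup[OF abelian_free_Abelian_group tensor_null_subgroup] .
  moreover have "add_monoid TG = FA Mod T0"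
    by (simp add: tensor_group_def Let_def)
  ultimately show ?thesis by (intro comm_group_abelian_groupI) simp
qed

lemma tensor_group_carrier: "carrier TG = (\<lambda>c. T0 #>\<^bsub>FA\<^esub> c) ` carrier FA"
  by (auto simp: tensor_group_def Let_def FactGroup_def RCOSETS_def)

lemma tensor_group_add:
  "\<lbrakk>c \<in> carrier FA; d \<in> carrier FA\<rbrakk>
    \<Longrightarrow> (T0 #>\<^bsub>FA\<^esub> c) \<oplus>\<^bsub>TG\<^esub> (T0 #>\<^bsub>FA\<^esub> d) = T0 #>\<^bsub>FA\<^esub> (c + d)"
  using normal.rcos_sum[OF tensor_null_normal, of c d]
  by (simp add: tensor_group_def Let_def FactGroup_def)

lemma tensor_coset_eq_iff:
  assumes "c \<in> carrier FA" "d \<in> carrier FA"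
  shows "T0 #>\<^bsub>FA\<^esub> c = T0 #>\<^bsub>FA\<^esub> d \<longleftrightarrow> c - d \<in> T0"
proof -
  have d: "Poly_Mapping.keys d \<subseteq> carrier M \<times> carrier N" using assms by simp
  have "T0 #>\<^bsub>FA\<^esub> c = T0 #>\<^bsub>FA\<^esub> d \<longleftrightarrow> c \<in> T0 #>\<^bsub>FA\<^esub> d"
    using group.repr_independence[OF group_free_Abelian_group _ _ tensor_null_subgroup]
      group.rcos_self[OF group_free_Abelian_group _ tensor_null_subgroup] assms by metis
  also have "\<dots> \<longleftrightarrow> c - d \<in> T0"
    unfolding r_coset_def by (auto simp: ) (metis diff_add_cancel)
  finally show ?thesis .
qed

lemma tensor_coset_self: "c \<in> carrier FA \<Longrightarrow> c \<in> T0 #>\<^bsub>FA\<^esub> c"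
  using group.rcos_self[OF group_free_Abelian_group _ tensor_null_subgroup] .

lemma relators_null: "c \<in> tensor_relators R M ract N lact \<Longrightarrow> c \<in> T0"
  unfolding tensor_null_def by (rule generate.incl)

lemma pure_tensor_closed: "\<lbrakk>m \<in> carrier M; n \<in> carrier N\<rbrakk> \<Longrightarrow> pt m n \<in> carrier TG"
  unfolding pure_tensor_def tensor_group_carrier by (auto simp: keys_frag_of)

lemma pure_tensor_balanced: "balanced R M ract N lact TG pt"
proof (rule balancedI)
  fix m m' n assume h: "m \<in> carrier M" "m' \<in> carrier M" "n \<in> carrier N"
  then have "frag_of (m \<oplus>\<^bsub>M\<^esub> m', n) - frag_of (m, n) - frag_of (m', n) \<in> T0"
    by (intro relators_null) (auto simp: tensor_relators_def)
  then show "pt (m \<oplus>\<^bsub>M\<^esub> m') n = pt m n \<oplus>\<^bsub>TG\<^esub> pt m' n"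
    using h unfolding pure_tensor_def
    by (subst tensor_group_add) (simp_all add: ag_closed gM keys_frag_of,
      subst tensor_coset_eq_iff, auto simp: keys_frag_of ag_closed gM diff_diff_eq dest!: subsetD[OF keys_add])
next
  fix m n n' assume h: "m \<in> carrier M" "n \<in> carrier N" "n' \<in> carrier N"
  then have "frag_of (m, n \<oplus>\<^bsub>N\<^esub> n') - frag_of (m, n) - frag_of (m, n') \<in> T0"
    by (intro relators_null) (auto simp: tensor_relators_def)
  then show "pt m (n \<oplus>\<^bsub>N\<^esub> n') = pt m n \<oplus>\<^bsub>TG\<^esub> pt m n'"
    using h unfolding pure_tensor_def
    by (subst tensor_group_add) (simp_all add: ag_closed gN keys_frag_of,
      subst tensor_coset_eq_iff, auto simp: keys_frag_of ag_closed gN diff_diff_eq dest!: subsetD[OF keys_add])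
next
  fix m r n assume h: "m \<in> carrier M" "r \<in> R" "n \<in> carrier N"
  then have "frag_of (ract m r, n) - frag_of (m, lact r n) \<in> T0"
    by (intro relators_null) (auto simp: tensor_relators_def)
  then show "pt (ract m r) n = pt m (lact r n)"
    using h unfolding pure_tensor_def
    by (subst tensor_coset_eq_iff) (auto simp: keys_frag_of ract_closed lact_closed)
qed (rule pure_tensor_closed)

text \<open>Equality on pure tensors spreads to all cosets by induction over the free abelian group.
  Iterated, one variable at a time, this is how nearly every identity between tensor expressions is
  proved below.\<close>

lemma tensor_group_ext:
  assumes "abelian_group P" "add_hom TG P f" "add_hom TG P g"
    and eq: "\<And>m n. \<lbrakk>m \<in> carrier M; n \<in> carrier N\<rbrakk> \<Longrightarrow> f (pt m n) = g (pt m n)"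
    and X: "X \<in> carrier TG"
  shows "f X = g X"
proof -
  obtain c where c: "c \<in> carrier FA" "X = T0 #>\<^bsub>FA\<^esub> c" using X by (auto simp: tensor_group_carrier)
  let ?Q = "\<lambda>c. Poly_Mapping.keys c \<subseteq> carrier M \<times> carrier N \<and> f (T0 #>\<^bsub>FA\<^esub> c) = g (T0 #>\<^bsub>FA\<^esub> c)"
  have cc: "T0 #>\<^bsub>FA\<^esub> d \<in> carrier TG" if "Poly_Mapping.keys d \<subseteq> carrier M \<times> carrier N" for d
    using that by (auto simp: tensor_group_carrier)
  have "?Q c"
  proof (rule free_Abelian_group_induct[where S = "carrier M \<times> carrier N"])
    have "T0 #>\<^bsub>FA\<^esub> 0 = \<zero>\<^bsub>TG\<^esub>"
      using group.coset_join2[OF group_free_Abelian_group _ tensor_null_subgroup, of 0]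
        subgroup.one_closed[OF tensor_null_subgroup]
      by (simp add: tensor_group_def Let_def FactGroup_def)
    then show "?Q 0"
      using add_hom_zero[OF tensor_group_abelian assms(1,2)] add_hom_zero[OF tensor_group_abelian assms(1,3)] by simp
  next
    fix x y assume k: "Poly_Mapping.keys x \<subseteq> carrier M \<times> carrier N"
      "Poly_Mapping.keys y \<subseteq> carrier M \<times> carrier N" and q: "?Q x" "?Q y"
    have k': "Poly_Mapping.keys (x - y) \<subseteq> carrier M \<times> carrier N"
      using k by (rule_tac order_trans[OF keys_diff]) simp
    \<comment> \<open>The induction step is for differences while \<open>f\<close> and
      \<open>g\<close> are only known to be additive, so \<open>x\<close> is written as
      \<open>(x - y) + y\<close> and the common value at \<open>y\<close> is cancelled in
      \<open>P\<close>.\<close>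
    have e: "(T0 #>\<^bsub>FA\<^esub> (x - y)) \<oplus>\<^bsub>TG\<^esub> (T0 #>\<^bsub>FA\<^esub> y) = T0 #>\<^bsub>FA\<^esub> x"
    proof -
      have "x - y \<in> carrier FA" "y \<in> carrier FA"
        using k k' by (simp_all only: carrier_free_Abelian_group_iff)
      from tensor_group_add[OF this] show ?thesis by (simp only: diff_add_cancel)
    qed
    interpret P: abelian_group P by fact
    have "h (T0 #>\<^bsub>FA\<^esub> (x - y)) \<oplus>\<^bsub>P\<^esub> h (T0 #>\<^bsub>FA\<^esub> y) = h (T0 #>\<^bsub>FA\<^esub> x)" if "add_hom TG P h" for h
      using add_hom_add[OF that cc[OF k'] cc[OF k(2)]] e by simp
    from this[OF assms(2)] this[OF assms(3)]
    have "f (T0 #>\<^bsub>FA\<^esub> (x - y)) \<oplus>\<^bsub>P\<^esub> g (T0 #>\<^bsub>FA\<^esub> y) = g (T0 #>\<^bsub>FA\<^esub> (x - y)) \<oplus>\<^bsub>P\<^esub> g (T0 #>\<^bsub>FA\<^esub> y)"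
      using q by simp
    then have "f (T0 #>\<^bsub>FA\<^esub> (x - y)) = g (T0 #>\<^bsub>FA\<^esub> (x - y))"
      using add_hom_closed[OF assms(2) cc[OF k']] add_hom_closed[OF assms(3) cc[OF k']]
        add_hom_closed[OF assms(3) cc[OF k(2)]] by (simp add: P.add.right_cancel)
    then show "?Q (x - y)" using k' by simp
  next
    fix a assume "a \<in> carrier M \<times> carrier N"
    then show "?Q (frag_of a)" using eq by (auto simp: keys_frag_of pure_tensor_def)
  qed (use c in simp)
  then show ?thesis using c by simp
qed

text \<open>The universal property of the free abelian group supplies a homomorphism
  \<open>h'\<close> extending \<open>f\<close>. The sum in \<open>tensor_lift\<close> is a concrete
  formula for \<open>h'\<close>, and \<open>h'\<close> kills the relators, so the representative
  picked by \<open>SOME\<close> does not matter.\<close>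

lemma tensor_group_lift:
  assumes P: "abelian_group P" and f: "balanced R M ract N lact P f"
  shows "add_hom TG P (tensor_lift P f)"
    and "\<lbrakk>m \<in> carrier M; n \<in> carrier N\<rbrakk> \<Longrightarrow> tensor_lift P f (pt m n) = f m n"
proof -
  interpret P: abelian_group P by fact
  define ff where "ff = (\<lambda>k. f (fst k) (snd k))"
  define h :: "('m \<times> 'n \<Rightarrow>\<^sub>0 int) \<Rightarrow> _" where "h = (\<lambda>c. finsum P (\<lambda>k. [Poly_Mapping.lookup c k] \<cdot>\<^bsub>P\<^esub> ff k) (Poly_Mapping.keys c))"
  have ffc: "ff k \<in> carrier P" if "k \<in> carrier M \<times> carrier N" for k
    using that balanced_closed[OF f] by (auto simp: ff_def)
  obtain h' where h'hom: "h' \<in> hom FA (add_monoid P)"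
    and h'of: "\<And>x. x \<in> carrier M \<times> carrier N \<Longrightarrow> h' (frag_of x) = ff x"
  proof (rule comm_group.free_Abelian_group_universal[OF P.a_comm_group])
    show "ff ` (carrier M \<times> carrier N) \<subseteq> carrier (add_monoid P)" using ffc by auto
  qed (use that in auto)
  have h'add: "h' (x + y) = h' x \<oplus>\<^bsub>P\<^esub> h' y" if "x \<in> carrier FA" "y \<in> carrier FA" for x y
    using hom_mult[OF h'hom that] by simp
  interpret h': group_hom FA "add_monoid P" h'
    by (simp add: group_hom_def group_hom_axioms_def h'hom P.a_group)
  have h'cl: "h' c \<in> carrier P" if "c \<in> carrier FA" for c using h'.hom_closed that by simp
  \<comment> \<open>Expanding \<open>c\<close> into multiples of generators turns \<open>h'\<close>
    into the explicit sum; the induction runs over finite sets of generators, with the coefficients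
    of \<open>c\<close> held fixed.\<close>
  have hh': "h c = h' c" if c: "c \<in> carrier FA" for c
  proof -
    have "h' c = finsum P (\<lambda>k. [Poly_Mapping.lookup c k] \<cdot>\<^bsub>P\<^esub> ff k) (Poly_Mapping.keys c)"
    proof -
      have "\<And>I. finite I \<Longrightarrow> I \<subseteq> carrier M \<times> carrier N \<Longrightarrow>
         h' (sum (\<lambda>i. frag_cmul (Poly_Mapping.lookup c i) (frag_of i)) I)
          = finsum P (\<lambda>k. [Poly_Mapping.lookup c k] \<cdot>\<^bsub>P\<^esub> ff k) I"
      proof -
        fix I assume "finite I" "I \<subseteq> carrier M \<times> carrier N"
        then show "h' (sum (\<lambda>i. frag_cmul (Poly_Mapping.lookup c i) (frag_of i)) I)
          = finsum P (\<lambda>k. [Poly_Mapping.lookup c k] \<cdot>\<^bsub>P\<^esub> ff k) I"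
        proof (induction I rule: finite_induct)
          case empty
          then show ?case using h'.hom_one by simp
        next
          case (insert k I)
          have k: "frag_of k \<in> carrier FA" using insert.prems by (simp add: keys_frag_of)
          have "h' (frag_of k [^]\<^bsub>FA\<^esub> Poly_Mapping.lookup c k) = [Poly_Mapping.lookup c k] \<cdot>\<^bsub>P\<^esub> h' (frag_of k)"
            using h'.hom_int_pow[OF k] by (simp add: add_pow_def)
          then have e: "h' (frag_cmul (Poly_Mapping.lookup c k) (frag_of k)) = [Poly_Mapping.lookup c k] \<cdot>\<^bsub>P\<^esub> ff k"
            using k h'of insert.prems by (subst (asm) int_pow_free_Abelian_group) auto
          have c1: "frag_cmul (Poly_Mapping.lookup c k) (frag_of k) \<in> carrier FA"
            using k keys_cmul by (metis carrier_free_Abelian_group_iff order_trans)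
          have c2: "sum (\<lambda>i. frag_cmul (Poly_Mapping.lookup c i) (frag_of i)) I \<in> carrier FA"
            using insert.prems keys_cmul
            by (intro sum_closed_free_Abelian_group) (fastforce simp: keys_frag_of)
          have "finsum P (\<lambda>k. [Poly_Mapping.lookup c k] \<cdot>\<^bsub>P\<^esub> ff k) (insert k I)
            = [Poly_Mapping.lookup c k] \<cdot>\<^bsub>P\<^esub> ff k \<oplus>\<^bsub>P\<^esub> finsum P (\<lambda>k. [Poly_Mapping.lookup c k] \<cdot>\<^bsub>P\<^esub> ff k) I"
            using insert ffc by (intro P.finsum_insert) (auto intro!: P.add.int_pow_closed)
          then show ?case using insert e h'add[OF c1 c2] by simp
        qed
      qed
      from this[of "Poly_Mapping.keys c"] show ?thesis
        using c frag_expansion[of c] by (simp add: frag_extend_def)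
    qed
    then show ?thesis by (simp add: h_def)
  qed
  have ker: "h' c = \<zero>\<^bsub>P\<^esub>" if "c \<in> T0" for c
  proof -
    have "tensor_relators R M ract N lact \<subseteq> kernel FA (add_monoid P) h'"
    proof
      fix c assume c: "c \<in> tensor_relators R M ract N lact"
      have cF: "c \<in> carrier FA" using c tensor_relators_closed by blast
      have z: "x = \<zero>\<^bsub>P\<^esub>" if "x \<oplus>\<^bsub>P\<^esub> y = y" "x \<in> carrier P" "y \<in> carrier P" for x y
        using that by (metis P.add.l_cancel_one' P.a_comm)
      have frc: "frag_of (m, n) \<in> carrier FA" if "m \<in> carrier M" "n \<in> carrier N" for m n
        using that by (simp add: keys_frag_of)
      \<comment> \<open>Each relator is rewritten without subtraction, so that additivity of
        \<open>h'\<close> reduces its vanishing to a cancellation against the balanced identity for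
        \<open>f\<close>.\<close>
      consider m m' n where "c + (frag_of (m, n) + frag_of (m', n)) = frag_of (m \<oplus>\<^bsub>M\<^esub> m', n)"
          "m \<in> carrier M" "m' \<in> carrier M" "n \<in> carrier N"
        | m n n' where "c + (frag_of (m, n) + frag_of (m, n')) = frag_of (m, n \<oplus>\<^bsub>N\<^esub> n')"
          "m \<in> carrier M" "n \<in> carrier N" "n' \<in> carrier N"
        | m r n where "c + frag_of (m, lact r n) = frag_of (ract m r, n)" "m \<in> carrier M" "r \<in> R" "n \<in> carrier N"
        using c unfolding tensor_relators_def by (auto simp: algebra_simps) 
      then have "h' c = \<zero>\<^bsub>P\<^esub>"
      proof cases
        case 1
        have s: "frag_of (m, n) + frag_of (m', n) \<in> carrier FA"
          using 1 frc by (metis group.is_monoid group_free_Abelian_group monoid.m_closed mult_free_Abelian_group)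
        have "h' c \<oplus>\<^bsub>P\<^esub> (ff (m, n) \<oplus>\<^bsub>P\<^esub> ff (m', n)) = ff (m \<oplus>\<^bsub>M\<^esub> m', n)"
          using 1 h'add[OF cF s] h'add[OF frc frc] h'of by (simp add: ag_closed gM)
        then show ?thesis using 1 h'cl[OF cF] balanced_closed[OF f]
          by (intro z[of _ "ff (m \<oplus>\<^bsub>M\<^esub> m', n)"]) (auto simp: ff_def ag_closed gM balanced_add_left[OF f])
      next
        case 2
        have s: "frag_of (m, n) + frag_of (m, n') \<in> carrier FA"
          using 2 frc by (metis group.is_monoid group_free_Abelian_group monoid.m_closed mult_free_Abelian_group)
        have "h' c \<oplus>\<^bsub>P\<^esub> (ff (m, n) \<oplus>\<^bsub>P\<^esub> ff (m, n')) = ff (m, n \<oplus>\<^bsub>N\<^esub> n')"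
          using 2 h'add[OF cF s] h'add[OF frc frc] h'of by (simp add: ag_closed gN)
        then show ?thesis using 2 h'cl[OF cF] balanced_closed[OF f]
          by (intro z[of _ "ff (m, n \<oplus>\<^bsub>N\<^esub> n')"]) (auto simp: ff_def ag_closed gN balanced_add_right[OF f])
      next
        case 3
        have "h' c \<oplus>\<^bsub>P\<^esub> ff (m, lact r n) = ff (ract m r, n)"
          using 3 h'add[OF cF frc[of m "lact r n"]] h'of by (simp add: ract_closed lact_closed)
        then show ?thesis using 3 h'cl[OF cF] balanced_closed[OF f]
          by (intro z[of _ "ff (ract m r, n)"]) (auto simp: ff_def ract_closed lact_closed balanced_act[OF f])
      qed
      then show "c \<in> kernel FA (add_monoid P) h'" using cF by (simp add: kernel_def)
    qed
    then have "T0 \<subseteq> kernel FA (add_monoid P) h'"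
      unfolding tensor_null_def
      by (intro group.generate_subgroup_incl[OF group_free_Abelian_group] h'.subgroup_kernel)
    then show ?thesis using that by (auto simp: kernel_def)
  qed
  have lift: "tensor_lift P f (T0 #>\<^bsub>FA\<^esub> c) = h' c" if c: "c \<in> carrier FA" for c
  proof -
    define d where "d = (SOME d. d \<in> T0 #>\<^bsub>FA\<^esub> c)"
    have "d \<in> T0 #>\<^bsub>FA\<^esub> c" using tensor_coset_self[OF c] unfolding d_def by (rule someI)
    then obtain t where t: "t \<in> T0" "d = t + c" by (auto simp: r_coset_def)
    have tF: "t \<in> carrier FA" using t subgroup.subset[OF tensor_null_subgroup] by blast
    have dF: "d \<in> carrier FA"
      using t c tF by (metis group.is_monoid group_free_Abelian_group monoid.m_closed mult_free_Abelian_group)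
    have "tensor_lift P f (T0 #>\<^bsub>FA\<^esub> c) = h d"
      unfolding tensor_lift_def d_def h_def ff_def Let_def by simp
    also have "\<dots> = h' t \<oplus>\<^bsub>P\<^esub> h' c" using hh'[OF dF] t h'add[OF tF c] by simp
    also have "\<dots> = h' c" using ker[OF t(1)] h'cl[OF c] by simp
    finally show ?thesis .
  qed
  show "add_hom TG P (tensor_lift P f)"
  proof (rule add_homI)
    fix X Y assume "X \<in> carrier TG" "Y \<in> carrier TG"
    then obtain c d where c: "c \<in> carrier FA" "X = T0 #>\<^bsub>FA\<^esub> c" and d: "d \<in> carrier FA" "Y = T0 #>\<^bsub>FA\<^esub> d"
      by (auto simp: tensor_group_carrier)
    have "c + d \<in> carrier FA"
      using c d by (metis group.is_monoid group_free_Abelian_group monoid.m_closed mult_free_Abelian_group)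
    then show "tensor_lift P f (X \<oplus>\<^bsub>TG\<^esub> Y) = tensor_lift P f X \<oplus>\<^bsub>P\<^esub> tensor_lift P f Y"
      using c d lift tensor_group_add h'add by simp
  qed (auto simp: tensor_group_carrier lift h'cl simp del: carrier_free_Abelian_group_iff)
  show "tensor_lift P f (pt m n) = f m n" if "m \<in> carrier M" "n \<in> carrier N"
    using that lift[of "frag_of (m, n)"] h'of[of "(m, n)"]
    by (simp add: pure_tensor_def ff_def keys_frag_of)
qed

end

subsection \<open>Derived rules\<close>

lemma abelian_group_transfer:
  assumes "abelian_group G" "carrier T = carrier G" "add T = add G" "ring.zero T = ring.zero G"
  shows "abelian_group T"
proof -
  interpret G: abelian_group G by fact
  show ?thesis
    by (rule abelian_groupI) (auto simp: assms(2-4) G.a_ac intro: G.l_neg bexI[of _ "\<ominus>\<^bsub>G\<^esub> x" for x])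
qed

lemma is_tensor_tensor_group:
  assumes "abelian_group M" "abelian_group N"
    and "\<And>m r. \<lbrakk>m \<in> carrier M; r \<in> R\<rbrakk> \<Longrightarrow> ract m r \<in> carrier M"
    and "\<And>r n. \<lbrakk>r \<in> R; n \<in> carrier N\<rbrakk> \<Longrightarrow> lact r n \<in> carrier N"
  shows "is_tensor R M ract N lact (tensor_group R M ract N lact) (pure_tensor R M ract N lact)"
  using assms by (simp add: is_tensor_def)

context
  fixes R :: "'r set" and M :: "('m, 'x) ring_scheme" and ract :: "'m \<Rightarrow> 'r \<Rightarrow> 'm"
    and N :: "('n, 'y) ring_scheme" and lact :: "'r \<Rightarrow> 'n \<Rightarrow> 'n"
    and T :: "(('m, 'n) tensor, 'z) ring_scheme" and p
  assumes T: "is_tensor R M ract N lact T p"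
begin

lemma is_tensor_left_group: "abelian_group M" and is_tensor_right_group: "abelian_group N"
  using T by (auto simp: is_tensor_def)

lemma is_tensor_act_closed:
  "\<lbrakk>m \<in> carrier M; r \<in> R\<rbrakk> \<Longrightarrow> ract m r \<in> carrier M"
  "\<lbrakk>r \<in> R; n \<in> carrier N\<rbrakk> \<Longrightarrow> lact r n \<in> carrier N"
  using T by (auto simp: is_tensor_def)

lemma is_tensor_group: "abelian_group T"
  using T by (intro abelian_group_transfer[OF tensor_group_abelian[of M N R ract lact]])
    (auto simp: is_tensor_def)

lemma is_tensor_balanced: "balanced R M ract N lact T p"
  using pure_tensor_balanced[of M N R ract lact] T
  by (simp add: is_tensor_def balanced_def add_hom_def)

lemma pure_closed: "\<lbrakk>m \<in> carrier M; n \<in> carrier N\<rbrakk> \<Longrightarrow> p m n \<in> carrier T"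
  by (rule balanced_closed[OF is_tensor_balanced])

lemma pure_add_left:
  "\<lbrakk>m \<in> carrier M; m' \<in> carrier M; n \<in> carrier N\<rbrakk> \<Longrightarrow> p (m \<oplus>\<^bsub>M\<^esub> m') n = p m n \<oplus>\<^bsub>T\<^esub> p m' n"
  by (rule balanced_add_left[OF is_tensor_balanced])

lemma pure_add_right:
  "\<lbrakk>m \<in> carrier M; n \<in> carrier N; n' \<in> carrier N\<rbrakk> \<Longrightarrow> p m (n \<oplus>\<^bsub>N\<^esub> n') = p m n \<oplus>\<^bsub>T\<^esub> p m n'"
  by (rule balanced_add_right[OF is_tensor_balanced])

lemma pure_act:
  "\<lbrakk>m \<in> carrier M; r \<in> R; n \<in> carrier N\<rbrakk> \<Longrightarrow> p (ract m r) n = p m (lact r n)"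
  by (rule balanced_act[OF is_tensor_balanced])

lemma tensor_ext:
  assumes "abelian_group P" "add_hom T P f" "add_hom T P g"
    and "\<And>m n. \<lbrakk>m \<in> carrier M; n \<in> carrier N\<rbrakk> \<Longrightarrow> f (p m n) = g (p m n)"
    and "X \<in> carrier T"
  shows "f X = g X"
  using tensor_group_ext[of M N R ract lact P f g X] assms T
  by (simp add: is_tensor_def add_hom_def)

context
  fixes P :: "('p, 'w) ring_scheme" and f
  assumes P: "abelian_group P" and f: "balanced R M ract N lact P f"
begin

lemma tensor_lift_hom: "add_hom T P (tensor_lift P f)"
  using tensor_group_lift(1)[of M N R ract lact P f] P f T
  by (simp add: is_tensor_def add_hom_def)

lemma tensor_lift_closed: "X \<in> carrier T \<Longrightarrow> tensor_lift P f X \<in> carrier P"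
  by (rule add_hom_closed[OF tensor_lift_hom])

lemma tensor_lift_add:
  "\<lbrakk>X \<in> carrier T; Y \<in> carrier T\<rbrakk>
    \<Longrightarrow> tensor_lift P f (X \<oplus>\<^bsub>T\<^esub> Y) = tensor_lift P f X \<oplus>\<^bsub>P\<^esub> tensor_lift P f Y"
  by (rule add_hom_add[OF tensor_lift_hom])

lemma tensor_lift_pure: "\<lbrakk>m \<in> carrier M; n \<in> carrier N\<rbrakk> \<Longrightarrow> tensor_lift P f (p m n) = f m n"
  using tensor_group_lift(2)[of M N R ract lact P f] P f T
  by (simp add: is_tensor_def)

lemma tensor_lift_unique:
  assumes "add_hom T P g" "\<And>m n. \<lbrakk>m \<in> carrier M; n \<in> carrier N\<rbrakk> \<Longrightarrow> g (p m n) = f m n"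
    and "X \<in> carrier T"
  shows "tensor_lift P f X = g X"
  by (rule tensor_ext[OF P tensor_lift_hom]) (simp_all add: assms tensor_lift_pure)

end

lemma balanced_cong:
  assumes "balanced R M ract N lact P f"
    and "\<And>m n. \<lbrakk>m \<in> carrier M; n \<in> carrier N\<rbrakk> \<Longrightarrow> f m n = g m n"
  shows "balanced R M ract N lact P g"
proof (rule balancedI)
  note [simp] = assms(2)[symmetric] is_tensor_act_closed ag_closed is_tensor_left_group is_tensor_right_group
  show "g m n \<in> carrier P" if "m \<in> carrier M" "n \<in> carrier N" for m n
    using that balanced_closed[OF assms(1)] by simp
  show "g (m \<oplus>\<^bsub>M\<^esub> m') n = g m n \<oplus>\<^bsub>P\<^esub> g m' n"
    if "m \<in> carrier M" "m' \<in> carrier M" "n \<in> carrier N" for m m' n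
    using that by (simp add: balanced_add_left[OF assms(1)])
  show "g m (n \<oplus>\<^bsub>N\<^esub> n') = g m n \<oplus>\<^bsub>P\<^esub> g m n'"
    if "m \<in> carrier M" "n \<in> carrier N" "n' \<in> carrier N" for m n n'
    using that by (simp add: balanced_add_right[OF assms(1)])
  show "g (ract m r) n = g m (lact r n)" if "m \<in> carrier M" "r \<in> R" "n \<in> carrier N" for m r n
    using that by (simp add: balanced_act[OF assms(1)])
qed

lemma tensor_lift_cong:
  assumes "abelian_group P" "balanced R M ract N lact P f"
    and "\<And>m n. \<lbrakk>m \<in> carrier M; n \<in> carrier N\<rbrakk> \<Longrightarrow> f m n = g m n"
    and "X \<in> carrier T"
  shows "tensor_lift P f X = tensor_lift P g X"
  by (rule tensor_lift_unique[OF assms(1,2) tensor_lift_hom[OF assms(1)]])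
    (simp_all add: assms balanced_cong[OF assms(2,3)] tensor_lift_pure[OF assms(1) balanced_cong[OF assms(2,3)]])

lemma tensor_lift_comp:
  assumes "abelian_group P" "abelian_group Q" "balanced R M ract N lact P f" "add_hom P Q h"
    and "X \<in> carrier T"
  shows "h (tensor_lift P f X) = tensor_lift Q (\<lambda>m n. h (f m n)) X"
  by (rule tensor_lift_unique[OF assms(2) balanced_comp[OF assms(3,4)]
        add_hom_comp[OF assms(4) tensor_lift_hom[OF assms(1,3)]], symmetric])
    (simp_all add: assms tensor_lift_pure)

text \<open>By uniqueness of lifts: the sum of the lifts for \<open>x\<close> and \<open>y\<close>
  has the values on pure tensors that the lift for their sum must have. Needed for nested lifts,
  where one argument sits inside the integrand for the other.\<close>

lemma tensor_lift_param:
  assumes "abelian_group P"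
    and f: "\<And>x. x \<in> carrier L \<Longrightarrow> balanced R M ract N lact P (f x)"
    and add: "\<And>m n. \<lbrakk>m \<in> carrier M; n \<in> carrier N\<rbrakk> \<Longrightarrow> add_hom L P (\<lambda>x. f x m n)"
    and L: "abelian_group L" and X: "X \<in> carrier T"
  shows "add_hom L P (\<lambda>x. tensor_lift P (f x) X)"
proof (rule add_homI)
  fix x y assume xy: "x \<in> carrier L" "y \<in> carrier L"
  then have "x \<oplus>\<^bsub>L\<^esub> y \<in> carrier L" by (rule ag_closed[OF L])
  then show "tensor_lift P (f (x \<oplus>\<^bsub>L\<^esub> y)) X = tensor_lift P (f x) X \<oplus>\<^bsub>P\<^esub> tensor_lift P (f y) X"
    using xy
    by (intro tensor_lift_unique[OF assms(1) f] add_hom_plus[OF assms(1)] tensor_lift_hom[OF assms(1) f] X)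
      (simp_all add: tensor_lift_pure[OF assms(1) f] add_hom_add[OF add])
qed (use assms in \<open>auto intro: tensor_lift_closed\<close>)

end

section \<open>Modules and algebras\<close>

lemma is_tensor_ktensor:
  assumes "module K M" "module K N"
  shows "is_tensor (carrier K) M (\<lambda>x k. k \<odot>\<^bsub>M\<^esub> x) N (\<lambda>k y. k \<odot>\<^bsub>N\<^esub> y) (ktensor K M N) (ktensor_pure K M N)"
  using assms
  by (simp add: is_tensor_def ktensor_def tensor_module_def Let_def ktensor_pure_def
      module.smult_closed module.axioms(2))

lemma is_tensor_module:
  assumes "is_tensor R M ract N lact (tensor_group R M ract N lact) (pure_tensor R M ract N lact)"
  shows "is_tensor R M ract N lact (tensor_module R M ract N lact) (pure_tensor R M ract N lact)"
  using assms by (simp add: is_tensor_def tensor_module_def Let_def)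

text \<open>Covers both \<open>tensor_module\<close> and \<open>ktensor\<close>.\<close>

lemma tensor_smult:
  assumes T: "is_tensor R M ract N lact T p" and M: "module K M"
    and comm: "\<And>k m r. \<lbrakk>k \<in> carrier K; m \<in> carrier M; r \<in> R\<rbrakk> \<Longrightarrow> k \<odot>\<^bsub>M\<^esub> ract m r = ract (k \<odot>\<^bsub>M\<^esub> m) r"
    and sm: "smult T = (\<lambda>k. tensor_lift (tensor_group R M ract N lact) (\<lambda>m n. pure_tensor R M ract N lact (k \<odot>\<^bsub>M\<^esub> m) n))"
  shows "module K T"
    and "\<lbrakk>k \<in> carrier K; m \<in> carrier M; n \<in> carrier N\<rbrakk> \<Longrightarrow> k \<odot>\<^bsub>T\<^esub> p m n = p (k \<odot>\<^bsub>M\<^esub> m) n"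
proof -
  interpret M: module K M by fact
  interpret T: abelian_group T by (rule is_tensor_group[OF T])
  let ?G = "tensor_group R M ract N lact"
  have G: "is_tensor R M ract N lact ?G p"
    and c: "carrier T = carrier ?G" "add T = add ?G" and p: "p = pure_tensor R M ract N lact"
    using T by (auto simp: is_tensor_def)
  note gG = is_tensor_group[OF G] and gT = is_tensor_group[OF T]
  have bal: "balanced R M ract N lact ?G (\<lambda>m n. p (k \<odot>\<^bsub>M\<^esub> m) n)" if "k \<in> carrier K" for k
    using that is_tensor_act_closed[OF T]
    by (intro balancedI)
      (auto simp: pure_closed[OF G] pure_add_left[OF G] pure_add_right[OF G] M.smult_r_distr
        comm pure_act[OF T])
  note homG = tensor_lift_hom[OF G gG bal, unfolded p, folded fun_cong[OF sm]]
  have hom: "add_hom T T (smult T k)" if "k \<in> carrier K" for k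
    using homG[OF that] by (simp add: add_hom_def c)
  have pure: "k \<odot>\<^bsub>T\<^esub> p m n = p (k \<odot>\<^bsub>M\<^esub> m) n" if "k \<in> carrier K" "m \<in> carrier M" "n \<in> carrier N" for k m n
    using tensor_lift_pure[OF G gG bal[OF that(1)] that(2,3)] by (simp add: sm p)
  show "k \<odot>\<^bsub>T\<^esub> p m n = p (k \<odot>\<^bsub>M\<^esub> m) n" if "k \<in> carrier K" "m \<in> carrier M" "n \<in> carrier N"
    using pure that by blast
  show "module K T"
  proof (rule moduleI)
    fix a b x assume a: "a \<in> carrier K" and b: "b \<in> carrier K" and x: "x \<in> carrier T"
    show "(a \<oplus>\<^bsub>K\<^esub> b) \<odot>\<^bsub>T\<^esub> x = a \<odot>\<^bsub>T\<^esub> x \<oplus>\<^bsub>T\<^esub> b \<odot>\<^bsub>T\<^esub> x"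
      using a b
      by (intro tensor_ext[OF T gT hom[OF M.R.a_closed[OF a b]] add_hom_plus[OF gT hom[OF a] hom[OF b]] _ x])
        (simp add: pure M.smult_l_distr pure_add_left[OF T])
    show "(a \<otimes>\<^bsub>K\<^esub> b) \<odot>\<^bsub>T\<^esub> x = a \<odot>\<^bsub>T\<^esub> (b \<odot>\<^bsub>T\<^esub> x)"
      using a b
      by (intro tensor_ext[OF T gT hom[OF M.R.m_closed[OF a b]] add_hom_comp[OF hom[OF a] hom[OF b]] _ x])
        (simp add: pure M.smult_assoc1)
  next
    fix x assume x: "x \<in> carrier T"
    show "\<one>\<^bsub>K\<^esub> \<odot>\<^bsub>T\<^esub> x = x"
      by (rule tensor_ext[OF T gT hom[OF M.R.one_closed] add_hom_id _ x]) (simp add: pure)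
  qed (auto simp: M.R.is_cring T.abelian_group_axioms add_hom_closed[OF hom] add_hom_add[OF hom])
qed

lemma ktensor_module:
  assumes "module K M" "module K N"
  shows "module K (ktensor K M N)"
    and "\<lbrakk>k \<in> carrier K; m \<in> carrier M; n \<in> carrier N\<rbrakk>
      \<Longrightarrow> k \<odot>\<^bsub>ktensor K M N\<^esub> ktensor_pure K M N m n = ktensor_pure K M N (k \<odot>\<^bsub>M\<^esub> m) n"
proof -
  interpret M: module K M by fact
  have c: "k \<odot>\<^bsub>M\<^esub> (r \<odot>\<^bsub>M\<^esub> m) = r \<odot>\<^bsub>M\<^esub> (k \<odot>\<^bsub>M\<^esub> m)"
    if "k \<in> carrier K" "m \<in> carrier M" "r \<in> carrier K" for k m r
    using that by (metis M.smult_assoc1 M.R.m_comm)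
  have s: "smult (ktensor K M N) = (\<lambda>k. tensor_lift (tensor_group (carrier K) M (\<lambda>x k. k \<odot>\<^bsub>M\<^esub> x) N (\<lambda>k y. k \<odot>\<^bsub>N\<^esub> y))
     (\<lambda>m n. pure_tensor (carrier K) M (\<lambda>x k. k \<odot>\<^bsub>M\<^esub> x) N (\<lambda>k y. k \<odot>\<^bsub>N\<^esub> y) (k \<odot>\<^bsub>M\<^esub> m) n))"
    by (simp add: ktensor_def tensor_module_def Let_def)
  show "module K (ktensor K M N)"
    and "\<lbrakk>k \<in> carrier K; m \<in> carrier M; n \<in> carrier N\<rbrakk>
      \<Longrightarrow> k \<odot>\<^bsub>ktensor K M N\<^esub> ktensor_pure K M N m n = ktensor_pure K M N (k \<odot>\<^bsub>M\<^esub> m) n"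
    using tensor_smult[OF is_tensor_ktensor[OF assms] assms(1) c s] by auto
qed

lemma unital_algebraD:
  assumes "unital_algebra K A"
  shows "module K A" "ring A" "abelian_group A" "field K"
    and "\<lbrakk>k \<in> carrier K; x \<in> carrier A; y \<in> carrier A\<rbrakk> \<Longrightarrow> (k \<odot>\<^bsub>A\<^esub> x) \<otimes>\<^bsub>A\<^esub> y = k \<odot>\<^bsub>A\<^esub> (x \<otimes>\<^bsub>A\<^esub> y)"
    and "\<lbrakk>k \<in> carrier K; x \<in> carrier A; y \<in> carrier A\<rbrakk> \<Longrightarrow> x \<otimes>\<^bsub>A\<^esub> (k \<odot>\<^bsub>A\<^esub> y) = k \<odot>\<^bsub>A\<^esub> (x \<otimes>\<^bsub>A\<^esub> y)"
  using assms by (auto simp: unital_algebra_def ring.is_abelian_group)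

lemma unital_algebra_opposite:
  assumes "unital_algebra K A"
  shows "unital_algebra K (opposite A)"
proof -
  interpret A: ring A using assms by (simp add: unital_algebra_def)
  interpret M: module K A using assms by (simp add: unital_algebra_def)
  have "ring (opposite A)"
  proof (rule ringI)
    show "abelian_group (opposite A)"
      by (rule abelian_group_transfer[OF A.is_abelian_group]) (simp_all add: opposite_def)
    show "monoid (opposite A)"
      by (rule monoidI) (simp_all add: opposite_def A.m_assoc)
  qed (simp_all add: opposite_def A.l_distr A.r_distr)
  moreover have "module K (opposite A)"
  proof (rule moduleI)
    show "abelian_group (opposite A)"
      by (rule abelian_group_transfer[OF A.is_abelian_group]) (simp_all add: opposite_def)
  qed (simp_all add: opposite_def M.R.is_cring M.smult_l_distr M.smult_r_distr M.smult_assoc1)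
  ultimately show ?thesis
    using assms by (simp add: unital_algebra_def) (simp add: opposite_def)
qed

text \<open>The product is a nested lift; once it is additive in each argument, all ring laws are
  checked on pure tensors, associativity by three nested reductions.\<close>

lemma ktensor_algebra:
  fixes A :: "('k, 'a) module" and C :: "('k, 'c) module"
  assumes A: "unital_algebra K A" and C: "unital_algebra K C"
  shows ktensor_mult_pure: "\<lbrakk>a \<in> carrier A; c \<in> carrier C; a' \<in> carrier A; c' \<in> carrier C\<rbrakk> \<Longrightarrow>
      ktensor_pure K A C a c \<otimes>\<^bsub>ktensor K A C\<^esub> ktensor_pure K A C a' c'
       = ktensor_pure K A C (a \<otimes>\<^bsub>A\<^esub> a') (c \<otimes>\<^bsub>C\<^esub> c')"
    and ktensor_one: "\<one>\<^bsub>ktensor K A C\<^esub> = ktensor_pure K A C \<one>\<^bsub>A\<^esub> \<one>\<^bsub>C\<^esub>"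
    and ktensor_unital_algebra: "unital_algebra K (ktensor K A C)"
proof -
  let ?T = "ktensor K A C" and ?p = "ktensor_pure K A C"
  note [simp] = unital_algebraD(5,6)[OF A] unital_algebraD(5,6)[OF C]
  interpret A: ring A by (rule unital_algebraD[OF A])
  interpret C: ring C by (rule unital_algebraD[OF C])
  interpret AM: module K A by (rule unital_algebraD[OF A])
  interpret CM: module K C by (rule unital_algebraD[OF C])
  note T = is_tensor_ktensor[OF AM.module_axioms CM.module_axioms]
  note gT = is_tensor_group[OF T]
  interpret TM: module K ?T by (rule ktensor_module[OF AM.module_axioms CM.module_axioms])
  note sp = ktensor_module(2)[OF AM.module_axioms CM.module_axioms]
  note pr = pure_closed[OF T] pure_add_left[OF T] pure_add_right[OF T]
  note pact = pure_act[OF T]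
  have b1: "balanced (carrier K) A (\<lambda>x k. k \<odot>\<^bsub>A\<^esub> x) C (\<lambda>k y. k \<odot>\<^bsub>C\<^esub> y) ?T
      (\<lambda>x' y'. ?p (x \<otimes>\<^bsub>A\<^esub> x') (y \<otimes>\<^bsub>C\<^esub> y'))" if "x \<in> carrier A" "y \<in> carrier C" for x y
    using that by (intro balancedI) (auto simp: pr A.r_distr C.r_distr pact)
  have b2: "add_hom A ?T (\<lambda>x. ?p (x \<otimes>\<^bsub>A\<^esub> x') (y \<otimes>\<^bsub>C\<^esub> y'))"
    if "x' \<in> carrier A" "y' \<in> carrier C" "y \<in> carrier C" for x' y' y
    using that by (intro add_homI) (auto simp: pr A.l_distr)
  have b3: "add_hom C ?T (\<lambda>y. ?p (x \<otimes>\<^bsub>A\<^esub> x') (y \<otimes>\<^bsub>C\<^esub> y'))"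
    if "x' \<in> carrier A" "y' \<in> carrier C" "x \<in> carrier A" for x' y' x
    using that by (intro add_homI) (auto simp: pr C.l_distr)
  define r where "r x y = tensor_lift ?T (\<lambda>x' y'. ?p (x \<otimes>\<^bsub>A\<^esub> x') (y \<otimes>\<^bsub>C\<^esub> y'))" for x y
  have mult: "X \<otimes>\<^bsub>?T\<^esub> Y = tensor_lift ?T (\<lambda>x y. r x y Y) X" for X Y
    unfolding r_def by (simp add: ktensor_def Let_def tensor_lift_def finsum_def add_pow_def)
  note r_hom = tensor_lift_hom[OF T gT b1, folded r_def]
  note r_pure = tensor_lift_pure[OF T gT b1, folded r_def]
  have rbal: "balanced (carrier K) A (\<lambda>x k. k \<odot>\<^bsub>A\<^esub> x) C (\<lambda>k y. k \<odot>\<^bsub>C\<^esub> y) ?T (\<lambda>x y. r x y Y)"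
    if Y: "Y \<in> carrier ?T" for Y
  proof (rule balancedI)
    show "r x y Y \<in> carrier ?T" if "x \<in> carrier A" "y \<in> carrier C" for x y
      using add_hom_closed[OF r_hom Y] that by simp
    show "r (x \<oplus>\<^bsub>A\<^esub> x') y Y = r x y Y \<oplus>\<^bsub>?T\<^esub> r x' y Y"
      if "x \<in> carrier A" "x' \<in> carrier A" "y \<in> carrier C" for x x' y
      using that Y
      by (intro tensor_ext[OF T gT r_hom add_hom_plus[OF gT r_hom r_hom] _ Y])
        (auto simp: r_pure A.l_distr pr)
    show "r x (y \<oplus>\<^bsub>C\<^esub> y') Y = r x y Y \<oplus>\<^bsub>?T\<^esub> r x y' Y"
      if "x \<in> carrier A" "y \<in> carrier C" "y' \<in> carrier C" for x y y'
      using that Y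
      by (intro tensor_ext[OF T gT r_hom add_hom_plus[OF gT r_hom r_hom] _ Y])
        (auto simp: r_pure C.l_distr pr)
    show "r (k \<odot>\<^bsub>A\<^esub> x) y Y = r x (k \<odot>\<^bsub>C\<^esub> y) Y"
      if "x \<in> carrier A" "k \<in> carrier K" "y \<in> carrier C" for x k y
      using that Y by (intro tensor_ext[OF T gT r_hom r_hom _ Y]) (auto simp: r_pure pact)
  qed
  note mult_hom_left = tensor_lift_hom[OF T gT rbal, folded mult]
  have mult_left: "(?p a c) \<otimes>\<^bsub>?T\<^esub> Y = r a c Y" if "a \<in> carrier A" "c \<in> carrier C" "Y \<in> carrier ?T" for a c Y
    using that unfolding mult by (simp add: tensor_lift_pure[OF T gT rbal])
  have mult_hom_right: "add_hom ?T ?T (\<lambda>Y. X \<otimes>\<^bsub>?T\<^esub> Y)" if "X \<in> carrier ?T" for X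
    unfolding mult using that
    by (intro tensor_lift_param[OF T gT]) (auto simp: rbal gT intro: r_hom)
  show mp: "?p a c \<otimes>\<^bsub>?T\<^esub> ?p a' c' = ?p (a \<otimes>\<^bsub>A\<^esub> a') (c \<otimes>\<^bsub>C\<^esub> c')"
    if "a \<in> carrier A" "c \<in> carrier C" "a' \<in> carrier A" "c' \<in> carrier C" for a c a' c'
    using that by (simp add: mult_left r_pure pr)
  show one: "\<one>\<^bsub>?T\<^esub> = ?p \<one>\<^bsub>A\<^esub> \<one>\<^bsub>C\<^esub>" by (simp add: ktensor_def Let_def)
  have mult_hom_left': "add_hom ?T ?T (\<lambda>X. X \<otimes>\<^bsub>?T\<^esub> Y)" if "Y \<in> carrier ?T" for Y
    unfolding mult by (rule tensor_lift_hom[OF T gT rbal[OF that]])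
  note mc = add_hom_closed[OF mult_hom_left']
  have assoc: "(X \<otimes>\<^bsub>?T\<^esub> Y) \<otimes>\<^bsub>?T\<^esub> Z = X \<otimes>\<^bsub>?T\<^esub> (Y \<otimes>\<^bsub>?T\<^esub> Z)"
    if X: "X \<in> carrier ?T" and Y: "Y \<in> carrier ?T" and Z: "Z \<in> carrier ?T" for X Y Z
  proof (rule tensor_ext[OF T gT _ _ _ X])
    fix a c assume ac: "a \<in> carrier A" "c \<in> carrier C"
    show "(?p a c \<otimes>\<^bsub>?T\<^esub> Y) \<otimes>\<^bsub>?T\<^esub> Z = ?p a c \<otimes>\<^bsub>?T\<^esub> (Y \<otimes>\<^bsub>?T\<^esub> Z)"
    proof (rule tensor_ext[OF T gT _ _ _ Y])
      fix a' c' assume ac': "a' \<in> carrier A" "c' \<in> carrier C"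
      show "(?p a c \<otimes>\<^bsub>?T\<^esub> ?p a' c') \<otimes>\<^bsub>?T\<^esub> Z = ?p a c \<otimes>\<^bsub>?T\<^esub> (?p a' c' \<otimes>\<^bsub>?T\<^esub> Z)"
      proof (rule tensor_ext[OF T gT _ _ _ Z])
        fix a'' c'' assume ac'': "a'' \<in> carrier A" "c'' \<in> carrier C"
        show "(?p a c \<otimes>\<^bsub>?T\<^esub> ?p a' c') \<otimes>\<^bsub>?T\<^esub> ?p a'' c'' = ?p a c \<otimes>\<^bsub>?T\<^esub> (?p a' c' \<otimes>\<^bsub>?T\<^esub> ?p a'' c'')"
          using ac ac' ac'' by (simp add: mp A.m_assoc C.m_assoc)
      qed (use ac ac' in \<open>auto simp: pr mc intro!: mult_hom_right add_hom_comp[of ?T ?T "\<lambda>Y. ?p a c \<otimes>\<^bsub>?T\<^esub> Y"]\<close>)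
    qed (use ac Z in \<open>auto simp: pr mc intro!: add_hom_comp[of ?T ?T "\<lambda>Y. Y \<otimes>\<^bsub>?T\<^esub> Z"] add_hom_comp[of ?T ?T "\<lambda>Y. ?p a c \<otimes>\<^bsub>?T\<^esub> Y" ?T] mult_hom_left' mult_hom_right\<close>)
  qed (use Y Z in \<open>auto simp: pr mc intro!: add_hom_comp[of ?T ?T "\<lambda>Y. Y \<otimes>\<^bsub>?T\<^esub> Z"] mult_hom_left' mult_hom_right\<close>)
  have "ring ?T"
  proof (rule ringI)
    show "monoid ?T"
    proof (rule monoidI)
      fix X assume X: "X \<in> carrier ?T"
      show "\<one>\<^bsub>?T\<^esub> \<otimes>\<^bsub>?T\<^esub> X = X"
        by (rule tensor_ext[OF T gT _ add_hom_id _ X]) (auto simp: one mp pr intro!: mult_hom_right)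
      show "X \<otimes>\<^bsub>?T\<^esub> \<one>\<^bsub>?T\<^esub> = X"
        by (rule tensor_ext[OF T gT _ add_hom_id _ X]) (auto simp: one mp pr intro!: mult_hom_left')
    qed (auto simp: mc assoc one pr)
  qed (auto simp: gT add_hom_add[OF mult_hom_left'] add_hom_add[OF mult_hom_right])
  moreover have "(k \<odot>\<^bsub>?T\<^esub> X) \<otimes>\<^bsub>?T\<^esub> Y = k \<odot>\<^bsub>?T\<^esub> (X \<otimes>\<^bsub>?T\<^esub> Y)" (is ?l)
    and "X \<otimes>\<^bsub>?T\<^esub> (k \<odot>\<^bsub>?T\<^esub> Y) = k \<odot>\<^bsub>?T\<^esub> (X \<otimes>\<^bsub>?T\<^esub> Y)" (is ?r)
    if k: "k \<in> carrier K" and X: "X \<in> carrier ?T" and Y: "Y \<in> carrier ?T" for k X Y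
  proof -
    have sh: "add_hom ?T ?T (\<lambda>X. k \<odot>\<^bsub>?T\<^esub> X)"
      using k by (intro add_homI) (auto simp: TM.smult_r_distr)
    note h1 = add_hom_comp[OF sh mult_hom_left'] and h2 = add_hom_comp[OF sh mult_hom_right]
      and h3 = add_hom_comp[OF mult_hom_left' sh] and h4 = add_hom_comp[OF mult_hom_right sh]
    show ?l
    proof (rule tensor_ext[OF T gT h3 h1 _ X])
      fix a c assume "a \<in> carrier A" "c \<in> carrier C"
      then show "(k \<odot>\<^bsub>?T\<^esub> ?p a c) \<otimes>\<^bsub>?T\<^esub> Y = k \<odot>\<^bsub>?T\<^esub> (?p a c \<otimes>\<^bsub>?T\<^esub> Y)"
        using k by (intro tensor_ext[OF T gT _ h2 _ Y] mult_hom_right) (auto simp: sp mp pr)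
    qed (use Y in auto)
    show ?r
    proof (rule tensor_ext[OF T gT _ h1 _ X])
      fix a c assume "a \<in> carrier A" "c \<in> carrier C"
      then show "?p a c \<otimes>\<^bsub>?T\<^esub> (k \<odot>\<^bsub>?T\<^esub> Y) = k \<odot>\<^bsub>?T\<^esub> (?p a c \<otimes>\<^bsub>?T\<^esub> Y)"
        using k by (intro tensor_ext[OF T gT h4 h2 _ Y]) (auto simp: sp mp pr pact)
    qed (use k Y in \<open>auto intro!: mult_hom_left'\<close>)
  qed
  ultimately show "unital_algebra K ?T"
    using A TM.module_axioms by (auto simp: unital_algebra_def)
qed

section \<open>Test modules of arbitrary type\<close>

lemma infinite_times_lepoll:
  assumes "infinite (UNIV :: 'u set)" "A \<lesssim> (UNIV :: 'u set)" "B \<lesssim> (UNIV :: 'u set)"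
  shows "A \<times> B \<lesssim> (UNIV :: 'u set)"
proof -
  have "A \<times> B \<lesssim> (UNIV :: 'u set) \<times> (UNIV :: 'u set)"
    by (rule times_lepoll_mono[OF assms(2,3)])
  also have "\<dots> \<approx> (UNIV :: 'u set)"
    unfolding eqpoll_iff_card_of_ordIso using assms(1) by (simp add: card_of_Times_same_infinite del: UNIV_Times_UNIV)
  finally show ?thesis .
qed

text \<open>A tensor product is a quotient of the finitely supported integer functions on
  \<open>M \<times> N\<close>, and such a function is determined by a finite subset of
  \<open>(M \<times> N) \<times> int\<close>. Passing to finite subsets does not increase an
  infinite cardinality, so iterated tensor products still fit into the test type.\<close>

lemma tensor_lepoll:
  assumes inf: "infinite (UNIV :: 'u set)" and "carrier M \<lesssim> (UNIV :: 'u set)" "carrier N \<lesssim> (UNIV :: 'u set)"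
    and T: "is_tensor R M ract N lact T p"
  shows "carrier T \<lesssim> (UNIV :: 'u set)"
proof -
  let ?S = "carrier M \<times> carrier N"
  have "carrier T = carrier (tensor_group R M ract N lact)" using T by (simp add: is_tensor_def)
  also have "\<dots> \<lesssim> carrier (free_Abelian_group ?S)"
    using tensor_group_carrier[of M N R ract lact] is_tensor_left_group[OF T] is_tensor_right_group[OF T]
      is_tensor_act_closed[OF T]
    by (simp add: image_lepoll)
  also have "\<dots> \<lesssim> {f. f ` ?S \<subseteq> (UNIV :: int set) \<and> {x. f x \<noteq> 0} \<subseteq> ?S \<and> finite {x. f x \<noteq> 0}}"
    unfolding lepoll_def
    by (rule exI[of _ Poly_Mapping.lookup])
      (auto simp: poly_mapping_eqI lookup_not_eq_zero_eq_in_keys inj_onI)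
  also have "\<dots> \<lesssim> Fpow (?S \<times> (UNIV :: int set))" by (rule lepoll_restricted_funspace)
  also have "\<dots> \<lesssim> Fpow (UNIV :: 'u set)"
  proof -
    have "(UNIV :: int set) \<lesssim> (UNIV :: 'u set)"
      using inf by (metis infinite_iff_card_of_countable infinite_UNIV_int card_of_ordLeq countableI_type lepoll_def)
    then have "?S \<times> (UNIV :: int set) \<lesssim> (UNIV :: 'u set)"
      using assms by (intro infinite_times_lepoll)
    then obtain f :: "_ \<Rightarrow> 'u" where f: "inj_on f (?S \<times> (UNIV :: int set))" by (auto simp: lepoll_def)
    have "inj_on (image f) (Fpow (?S \<times> UNIV))"
      using f inj_on_image_eq_iff[OF f] by (intro inj_onI) (auto simp: Fpow_def)
    moreover have "image f ` Fpow (?S \<times> UNIV) \<subseteq> Fpow UNIV" by (auto simp: Fpow_def)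
    ultimately show ?thesis unfolding lepoll_def by blast
  qed
  also have "\<dots> \<approx> (UNIV :: 'u set)" by (rule eqpoll_Fpow[OF inf])
  finally show ?thesis .
qed

text \<open>On the right an injection preserving zero suffices, because \<open>P\<close> enters
  exactness only through the kernel of \<open>g\<close>.\<close>

lemma exact_pair_iso:
  assumes a: "bij_betw a (carrier L) (carrier L')" and b: "bij_betw b (carrier M) (carrier M')"
    and c: "inj_on c (carrier P)" "c \<zero>\<^bsub>P\<^esub> = \<zero>\<^bsub>P'\<^esub>" "\<zero>\<^bsub>P\<^esub> \<in> carrier P"
    and f: "f \<in> carrier L \<rightarrow> carrier M" and g: "g \<in> carrier M \<rightarrow> carrier P"
    and bf: "\<And>x. x \<in> carrier L \<Longrightarrow> b (f x) = f' (a x)"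
    and cg: "\<And>x. x \<in> carrier M \<Longrightarrow> c (g x) = g' (b x)"
  shows "exact_pair L f M g P \<longleftrightarrow> exact_pair L' f' M' g' P'"
proof -
  have 1: "f' ` carrier L' = b ` f ` carrier L"
    by (simp add: bij_betw_imp_surj_on[OF a, symmetric] image_image bf)
  have "c (g x) = \<zero>\<^bsub>P'\<^esub> \<longleftrightarrow> g x = \<zero>\<^bsub>P\<^esub>" if "x \<in> carrier M" for x
    using c g that by (metis PiE inj_on_eq_iff)
  then have 2: "{x \<in> carrier M'. g' x = \<zero>\<^bsub>P'\<^esub>} = b ` {x \<in> carrier M. g x = \<zero>\<^bsub>P\<^esub>}"
    by (auto simp: bij_betw_imp_surj_on[OF b, symmetric] cg[symmetric] c(2))
  show ?thesis
    unfolding exact_pair_def 1 2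
    by (rule inj_on_image_eq_iff[OF bij_betw_imp_inj_on[OF b], symmetric]) (use f in auto)
qed

text \<open>A copy of \<open>M\<close> inside the type \<open>'u\<close> along an injection
  \<open>e\<close>, because faithful flatness quantifies over test modules of that type only. Just
  the additive group carries meaning.\<close>

definition transport :: "('m \<Rightarrow> 'u) \<Rightarrow> ('m, 'x) ring_scheme \<Rightarrow> 'u ring" where
  "transport e M = \<lparr>carrier = e ` carrier M, monoid.mult = undefined, one = undefined,
     ring.zero = e \<zero>\<^bsub>M\<^esub>,
     add = (\<lambda>x y. e (inv_into (carrier M) e x \<oplus>\<^bsub>M\<^esub> inv_into (carrier M) e y))\<rparr>"

definition transport_act :: "('m \<Rightarrow> 'u) \<Rightarrow> ('m, 'x) ring_scheme \<Rightarrow> ('m \<Rightarrow> 'r \<Rightarrow> 'm) \<Rightarrow> 'u \<Rightarrow> 'r \<Rightarrow> 'u" where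
  "transport_act e M act x r = e (act (inv_into (carrier M) e x) r)"

lemma transport_module:
  assumes "right_module R M act" and e: "inj_on e (carrier M)"
  shows "right_module R (transport e M) (transport_act e M act)"
    and "x \<in> carrier M \<Longrightarrow> r \<in> carrier R \<Longrightarrow> transport_act e M act (e x) r = e (act x r)"
    and "add_hom M (transport e M) e"
    and "add_hom (transport e M) M (inv_into (carrier M) e)"
    and "abelian_group (transport e M)"
proof -
  interpret M: right_module R M act by fact
  show ab: "abelian_group (transport e M)"
    by (rule abelian_groupI)
      (auto simp: transport_def e M.M.a_ac intro!: bexI[of _ "\<ominus>\<^bsub>M\<^esub> x" for x] arg_cong[of _ _ e] M.M.l_neg)
  show "add_hom M (transport e M) e" "add_hom (transport e M) M (inv_into (carrier M) e)"
    by (auto simp: add_hom_def transport_def e)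
  show "x \<in> carrier M \<Longrightarrow> r \<in> carrier R \<Longrightarrow> transport_act e M act (e x) r = e (act x r)"
    by (simp add: transport_act_def e)
  show "right_module R (transport e M) (transport_act e M act)"
    by (intro right_module.intro right_module_axioms.intro ab M.R.ring_axioms)
      (auto simp: transport_def transport_act_def e M.act_closed M.act_add_left M.act_add_right M.act_mult M.act_one)
qed

lemma balanced_tensor_map:
  assumes T: "is_tensor R M ract N lact T p" and T': "is_tensor R M' ract' N lact T' p'"
    and f: "add_hom M M' f" and lin: "\<And>m r. \<lbrakk>m \<in> carrier M; r \<in> R\<rbrakk> \<Longrightarrow> f (ract m r) = ract' (f m) r"
  shows "balanced R M ract N lact T' (\<lambda>m n. p' (f m) n)"
  using add_hom_closed[OF f] is_tensor_act_closed[OF T]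
  by (intro balancedI)
    (auto simp: pure_closed[OF T'] add_hom_add[OF f] pure_add_left[OF T'] pure_add_right[OF T'] lin pure_act[OF T'])

lemma tensor_iso:
  assumes T: "is_tensor R M ract N lact T p" and T': "is_tensor R M' ract' N lact T' p'"
    and f: "add_hom M M' f" and g: "add_hom M' M g"
    and linf: "\<And>m r. \<lbrakk>m \<in> carrier M; r \<in> R\<rbrakk> \<Longrightarrow> f (ract m r) = ract' (f m) r"
    and ling: "\<And>m r. \<lbrakk>m \<in> carrier M'; r \<in> R\<rbrakk> \<Longrightarrow> g (ract' m r) = ract (g m) r"
    and gf: "\<And>m. m \<in> carrier M \<Longrightarrow> g (f m) = m" and fg: "\<And>m. m \<in> carrier M' \<Longrightarrow> f (g m) = m"
  shows "bij_betw (tensor_lift T' (\<lambda>m n. p' (f m) n)) (carrier T) (carrier T')"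
proof -
  note gT = is_tensor_group[OF T] and gT' = is_tensor_group[OF T']
  have b: "balanced R M ract N lact T' (\<lambda>m n. p' (f m) n)"
    by (rule balanced_tensor_map[OF T T' f]) (rule linf)
  have b': "balanced R M' ract' N lact T (\<lambda>m n. p (g m) n)"
    by (rule balanced_tensor_map[OF T' T g]) (rule ling)
  note h = tensor_lift_hom[OF T gT' b] and h' = tensor_lift_hom[OF T' gT b']
  show ?thesis
  proof (rule bij_betwI[of _ _ _ "tensor_lift T (\<lambda>m n. p (g m) n)"])
    show "tensor_lift T (\<lambda>m n. p (g m) n) (tensor_lift T' (\<lambda>m n. p' (f m) n) x) = x" if "x \<in> carrier T" for x
      by (rule tensor_ext[OF T gT add_hom_comp[OF h' h] add_hom_id _ that])
        (simp add: tensor_lift_pure[OF T gT' b] tensor_lift_pure[OF T' gT b'] add_hom_closed[OF f] gf)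
    show "tensor_lift T' (\<lambda>m n. p' (f m) n) (tensor_lift T (\<lambda>m n. p (g m) n) x) = x" if "x \<in> carrier T'" for x
      by (rule tensor_ext[OF T' gT' add_hom_comp[OF h h'] add_hom_id _ that])
        (simp add: tensor_lift_pure[OF T gT' b] tensor_lift_pure[OF T' gT b'] add_hom_closed[OF g] fg)
  qed (use add_hom_closed[OF h] add_hom_closed[OF h'] in auto)
qed

text \<open>Both the sequence and its tensored version are moved to copies inside \<open>'u\<close>,
  so the notion applies to modules of any type whose carriers embed there. Letting \<open>F\<close>
  and \<open>G\<close> be any additive maps with the right values on pure tensors frees later uses
  from the literal \<open>tensor_lift\<close> of the definition.\<close>

lemma faithfully_flat_exact:
  fixes R :: "('r, 'w) ring_scheme"
  assumes ff: "faithfully_flat_left TYPE('u) R N lact"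
    and L: "right_module R L actL" "carrier L \<lesssim> (UNIV :: 'u set)" "is_tensor (carrier R) L actL N lact TL pL"
    and M: "right_module R M actM" "carrier M \<lesssim> (UNIV :: 'u set)" "is_tensor (carrier R) M actM N lact TM pM"
    and P: "right_module R P actP" "carrier P \<lesssim> (UNIV :: 'u set)" "is_tensor (carrier R) P actP N lact TP pP"
    and f: "f \<in> right_module_hom R L actL M actM" and g: "g \<in> right_module_hom R M actM P actP"
    and F: "add_hom TL TM F" "\<And>x n. \<lbrakk>x \<in> carrier L; n \<in> carrier N\<rbrakk> \<Longrightarrow> F (pL x n) = pM (f x) n"
    and G: "add_hom TM TP G" "\<And>x n. \<lbrakk>x \<in> carrier M; n \<in> carrier N\<rbrakk> \<Longrightarrow> G (pM x n) = pP (g x) n"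
  shows "exact_pair L f M g P \<longleftrightarrow> exact_pair TL F TM G TP"
proof -
  obtain a :: "_ \<Rightarrow> 'u" and b :: "_ \<Rightarrow> 'u" and c :: "_ \<Rightarrow> 'u"
    where a: "inj_on a (carrier L)" and b: "inj_on b (carrier M)" and c: "inj_on c (carrier P)"
    using L(2) M(2) P(2) by (auto simp: lepoll_def)
  interpret L: right_module R L actL by fact
  interpret M: right_module R M actM by fact
  interpret P: right_module R P actP by fact
  let ?L = "transport a L" and ?M = "transport b M" and ?P = "transport c P"
  let ?aL = "transport_act a L actL" and ?aM = "transport_act b M actM" and ?aP = "transport_act c P actP"
  let ?TL = "tensor_group (carrier R) ?L ?aL N lact" and ?pL = "pure_tensor (carrier R) ?L ?aL N lact"
  let ?TM = "tensor_group (carrier R) ?M ?aM N lact" and ?pM = "pure_tensor (carrier R) ?M ?aM N lact"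
  let ?TP = "tensor_group (carrier R) ?P ?aP N lact" and ?pP = "pure_tensor (carrier R) ?P ?aP N lact"
  define f' where "f' = (\<lambda>x. b (f (inv_into (carrier L) a x)))"
  define g' where "g' = (\<lambda>x. c (g (inv_into (carrier M) b x)))"
  note tL = transport_module[OF L(1) a] and tM = transport_module[OF M(1) b] and tP = transport_module[OF P(1) c]
  have bij: "bij_betw a (carrier L) (carrier ?L)" "bij_betw b (carrier M) (carrier ?M)" "bij_betw c (carrier P) (carrier ?P)"
    using a b c by (auto simp: transport_def bij_betw_def)
  have fc: "\<And>x. x \<in> carrier L \<Longrightarrow> f x \<in> carrier M" and gc: "\<And>x. x \<in> carrier M \<Longrightarrow> g x \<in> carrier P"
    using f g by (auto simp: right_module_hom_def)
  have f'a: "f' (a x) = b (f x)" if "x \<in> carrier L" for x using that a by (simp add: f'_def)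
  have g'b: "g' (b x) = c (g x)" if "x \<in> carrier M" for x using that b by (simp add: g'_def)
  have ex1: "exact_pair L f M g P \<longleftrightarrow> exact_pair ?L f' ?M g' ?P"
    by (rule exact_pair_iso[OF bij(1,2) c]) (use fc gc f'a g'b in \<open>auto simp: transport_def\<close>)
  have f'hom: "f' \<in> right_module_hom R ?L ?aL ?M ?aM" and g'hom: "g' \<in> right_module_hom R ?M ?aM ?P ?aP"
    using f g a b c fc gc unfolding right_module_hom_def f'_def g'_def
    by (auto simp: transport_def transport_act_def L.act_closed M.act_closed)
  note gN = is_tensor_right_group[OF L(3)] and lact = is_tensor_act_closed(2)[OF L(3)]
  have T: "is_tensor (carrier R) ?L ?aL N lact ?TL ?pL"
    "is_tensor (carrier R) ?M ?aM N lact ?TM ?pM"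
    "is_tensor (carrier R) ?P ?aP N lact ?TP ?pP"
    using right_module.act_closed[OF tL(1)] right_module.act_closed[OF tM(1)] right_module.act_closed[OF tP(1)]
    by (auto intro!: is_tensor_tensor_group tL(5) tM(5) tP(5) gN lact)
  note gT = is_tensor_group[OF T(1)] is_tensor_group[OF T(2)] is_tensor_group[OF T(3)]
  have inva: "\<And>x. x \<in> carrier L \<Longrightarrow> inv_into (carrier L) a (a x) = x"
    "\<And>x. x \<in> carrier M \<Longrightarrow> inv_into (carrier M) b (b x) = x"
    "\<And>x. x \<in> carrier P \<Longrightarrow> inv_into (carrier P) c (c x) = x" using a b c by auto
  have isoL: "bij_betw (tensor_lift ?TL (\<lambda>m n. ?pL (a m) n)) (carrier TL) (carrier ?TL)"
    by (rule tensor_iso[OF L(3) T(1) tL(3,4)]) (auto simp: tL(2) inva L.act_closed transport_def transport_act_def)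
  have isoM: "bij_betw (tensor_lift ?TM (\<lambda>m n. ?pM (b m) n)) (carrier TM) (carrier ?TM)"
    by (rule tensor_iso[OF M(3) T(2) tM(3,4)]) (auto simp: tM(2) inva M.act_closed transport_def transport_act_def)
  have isoP: "bij_betw (tensor_lift ?TP (\<lambda>m n. ?pP (c m) n)) (carrier TP) (carrier ?TP)"
    by (rule tensor_iso[OF P(3) T(3) tP(3,4)]) (auto simp: tP(2) inva P.act_closed transport_def transport_act_def)
  have bL: "balanced (carrier R) L actL N lact ?TL (\<lambda>m n. ?pL (a m) n)"
    by (rule balanced_tensor_map[OF L(3) T(1) tL(3)]) (simp add: tL(2))
  have bM: "balanced (carrier R) M actM N lact ?TM (\<lambda>m n. ?pM (b m) n)"
    by (rule balanced_tensor_map[OF M(3) T(2) tM(3)]) (simp add: tM(2))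
  have bP: "balanced (carrier R) P actP N lact ?TP (\<lambda>m n. ?pP (c m) n)"
    by (rule balanced_tensor_map[OF P(3) T(3) tP(3)]) (simp add: tP(2))
  have bf: "balanced (carrier R) ?L ?aL N lact ?TM (\<lambda>m n. ?pM (f' m) n)"
    by (rule balanced_tensor_map[OF T(1,2)]) (use f'hom in \<open>auto simp: add_hom_def right_module_hom_def\<close>)
  have bg: "balanced (carrier R) ?M ?aM N lact ?TP (\<lambda>m n. ?pP (g' m) n)"
    by (rule balanced_tensor_map[OF T(2,3)]) (use g'hom in \<open>auto simp: add_hom_def right_module_hom_def\<close>)
  note hL = tensor_lift_hom[OF L(3) gT(1) bL] and hM = tensor_lift_hom[OF M(3) gT(2) bM]
    and hP = tensor_lift_hom[OF P(3) gT(3) bP] and hf = tensor_lift_hom[OF T(1) gT(2) bf]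
    and hg = tensor_lift_hom[OF T(2) gT(3) bg]
  have ac: "\<And>x. x \<in> carrier L \<Longrightarrow> a x \<in> carrier ?L" "\<And>x. x \<in> carrier M \<Longrightarrow> b x \<in> carrier ?M"
    by (auto simp: transport_def)
  have ex2: "exact_pair TL F TM G TP \<longleftrightarrow> exact_pair
      ?TL
      (tensor_lift ?TM (\<lambda>x n. ?pM (f' x) n))
      ?TM
      (tensor_lift ?TP (\<lambda>x n. ?pP (g' x) n))
      ?TP"
  proof (rule exact_pair_iso[OF isoL isoM bij_betw_imp_inj_on[OF isoP]])
    show "F \<in> carrier TL \<rightarrow> carrier TM" "G \<in> carrier TM \<rightarrow> carrier TP" using F G by (auto simp: add_hom_def)
    show "\<zero>\<^bsub>TP\<^esub> \<in> carrier TP" by (rule ag_zero[OF is_tensor_group[OF P(3)]])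
    show "tensor_lift ?TP (\<lambda>m. ?pP (c m)) \<zero>\<^bsub>TP\<^esub>
      = \<zero>\<^bsub>?TP\<^esub>"
      using add_hom_zero[OF is_tensor_group[OF P(3)] gT(3) hP] .
    fix x assume x: "x \<in> carrier TL"
    show "tensor_lift ?TM (\<lambda>m. ?pM (b m)) (F x)
      = tensor_lift ?TM (\<lambda>x. ?pM (f' x))
         (tensor_lift ?TL (\<lambda>m. ?pL (a m)) x)"
      by (rule tensor_ext[OF L(3) gT(2) add_hom_comp[OF hM F(1)] add_hom_comp[OF hf hL] _ x])
        (simp add: F(2) tensor_lift_pure[OF M(3) gT(2) bM] tensor_lift_pure[OF L(3) gT(1) bL]
          tensor_lift_pure[OF T(1) gT(2) bf] fc ac f'a)
  next
    fix x assume x: "x \<in> carrier TM"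
    show "tensor_lift ?TP (\<lambda>m. ?pP (c m)) (G x)
      = tensor_lift ?TP (\<lambda>x. ?pP (g' x))
         (tensor_lift ?TM (\<lambda>m. ?pM (b m)) x)"
      by (rule tensor_ext[OF M(3) gT(3) add_hom_comp[OF hP G(1)] add_hom_comp[OF hg hM] _ x])
        (simp add: G(2) tensor_lift_pure[OF P(3) gT(3) bP] tensor_lift_pure[OF M(3) gT(2) bM]
          tensor_lift_pure[OF T(2) gT(3) bg] gc ac g'b)
  qed
  show ?thesis
    unfolding ex1 ex2
    using ff tL(1) tM(1) tP(1) f'hom g'hom unfolding faithfully_flat_left_def by blast
qed

text \<open>Injectivity is exactness of \<open>M \<rightarrow> M \<rightarrow> P\<close> with first
  map zero; \<open>M\<close> itself stands in for the zero module on the left.\<close>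

lemma faithfully_flat_inj:
  fixes R :: "('r, 'w) ring_scheme"
  assumes ff: "faithfully_flat_left TYPE('u) R N lact"
    and M: "right_module R M actM" "carrier M \<lesssim> (UNIV :: 'u set)" "is_tensor (carrier R) M actM N lact TM pM"
    and P: "right_module R P actP" "carrier P \<lesssim> (UNIV :: 'u set)" "is_tensor (carrier R) P actP N lact TP pP"
    and g: "g \<in> right_module_hom R M actM P actP"
    and G: "add_hom TM TP G" "\<And>x n. \<lbrakk>x \<in> carrier M; n \<in> carrier N\<rbrakk> \<Longrightarrow> G (pM x n) = pP (g x) n"
  shows "inj_on g (carrier M) \<longleftrightarrow> inj_on G (carrier TM)"
proof -
  interpret M: right_module R M actM by fact
  interpret P: right_module R P actP by fact
  note gM = M.M.abelian_group_axioms and gP = P.M.abelian_group_axioms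
  note gTM = is_tensor_group[OF M(3)] and gTP = is_tensor_group[OF P(3)]
  have inj_iff: "inj_on h (carrier X) \<longleftrightarrow> exact_pair X (\<lambda>_. \<zero>\<^bsub>X\<^esub>) X h Y"
    if X: "abelian_group X" and Y: "abelian_group Y" and h: "add_hom X Y h"
    for X :: "('x, 'v) ring_scheme" and Y :: "('y, 'z) ring_scheme" and h
  proof -
    interpret group_hom "add_monoid X" "add_monoid Y" h by (rule add_hom_group_hom[OF X Y h])
    have "(\<lambda>_. \<zero>\<^bsub>X\<^esub>) ` carrier X = {\<zero>\<^bsub>X\<^esub>}" using ag_zero[OF X] by auto
    then show ?thesis
      using inj_iff_trivial_ker unfolding exact_pair_def kernel_def by auto
  qed
  have z: "pM \<zero>\<^bsub>M\<^esub> n = \<zero>\<^bsub>TM\<^esub>" if "n \<in> carrier N" for n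
    using add_hom_zero[OF gM gTM, of "\<lambda>m. pM m n"] is_tensor_balanced[OF M(3)] that
    by (simp add: balanced_def)
  have az: "actM \<zero>\<^bsub>M\<^esub> r = \<zero>\<^bsub>M\<^esub>" if "r \<in> carrier R" for r
    using add_hom_zero[OF gM gM, of "\<lambda>m. actM m r"] M.act_closed M.act_add_left that
    by (simp add: add_hom_def)
  have "exact_pair M (\<lambda>_. \<zero>\<^bsub>M\<^esub>) M g P \<longleftrightarrow> exact_pair TM (\<lambda>_. \<zero>\<^bsub>TM\<^esub>) TM G TP"
    by (rule faithfully_flat_exact[OF ff M M P _ g add_hom_zero_map[OF gTM] _ G])
      (auto simp: right_module_hom_def az z)
  then show ?thesis
    using inj_iff[OF gM gP] inj_iff[OF gTM gTP G(1)] g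
    by (auto simp: right_module_hom_def add_hom_def)
qed

text \<open>The right action on \<open>N\<close> passes to the tensor product because it commutes
  with the left action that is divided out.\<close>

lemma right_module_tensor:
  assumes T: "is_tensor R M ract N lact T p" and N: "right_module S N act"
    and comm: "\<And>r n s. \<lbrakk>r \<in> R; n \<in> carrier N; s \<in> carrier S\<rbrakk> \<Longrightarrow> act (lact r n) s = lact r (act n s)"
  shows "s \<in> carrier S \<Longrightarrow> balanced R M ract N lact T (\<lambda>m n. p m (act n s))"
    and "right_module S T (\<lambda>X s. tensor_lift T (\<lambda>m n. p m (act n s)) X)"
proof -
  interpret N: right_module S N act by fact
  note gT = is_tensor_group[OF T]
  have bal: "balanced R M ract N lact T (\<lambda>m n. p m (act n s))" if "s \<in> carrier S" for s
    using that
    by (intro balancedI)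
      (auto simp: pure_closed[OF T] pure_add_left[OF T] pure_add_right[OF T] N.act_closed
        N.act_add_left comm pure_act[OF T])
  then show "s \<in> carrier S \<Longrightarrow> balanced R M ract N lact T (\<lambda>m n. p m (act n s))" .
  note h = tensor_lift_hom[OF T gT bal] and pr = tensor_lift_pure[OF T gT bal]
  let ?a = "\<lambda>X s. tensor_lift T (\<lambda>m n. p m (act n s)) X"
  show "right_module S T ?a"
  proof (intro right_module.intro right_module_axioms.intro N.R.ring_axioms gT)
    fix X a b assume X: "X \<in> carrier T" and a: "a \<in> carrier S" and b: "b \<in> carrier S"
    have ab: "a \<oplus>\<^bsub>S\<^esub> b \<in> carrier S" "a \<otimes>\<^bsub>S\<^esub> b \<in> carrier S" using a b by auto
    show "?a X a \<in> carrier T" by (rule add_hom_closed[OF h[OF a] X])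
    show "?a X (a \<oplus>\<^bsub>S\<^esub> b) = ?a X a \<oplus>\<^bsub>T\<^esub> ?a X b"
      by (rule tensor_ext[OF T gT h[OF ab(1)] add_hom_plus[OF gT h[OF a] h[OF b]] _ X])
        (simp add: pr a b ab N.act_add_right pure_add_right[OF T] N.act_closed)
    show "?a X (a \<otimes>\<^bsub>S\<^esub> b) = ?a (?a X a) b"
      by (rule tensor_ext[OF T gT h[OF ab(2)] add_hom_comp[OF h[OF b] h[OF a]] _ X])
        (simp add: pr a b ab N.act_mult N.act_closed)
  next
    fix X Y a assume "X \<in> carrier T" "Y \<in> carrier T" "a \<in> carrier S"
    then show "?a (X \<oplus>\<^bsub>T\<^esub> Y) a = ?a X a \<oplus>\<^bsub>T\<^esub> ?a Y a" by (intro add_hom_add[OF h])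
  next
    fix X assume X: "X \<in> carrier T"
    show "?a X \<one>\<^bsub>S\<^esub> = X"
      by (rule tensor_ext[OF T gT h[OF N.R.one_closed] add_hom_id _ X])
        (simp add: pr N.act_one)
  qed
qed

section \<open>Faithfully flat descent of split exact sequences\<close>

text \<open>The left action enters only as a family of additive maps commuting with the right
  action.\<close>

definition bimodule :: "('r, 'w) ring_scheme \<Rightarrow> ('x, 'v) ring_scheme \<Rightarrow> ('x \<Rightarrow> 'r \<Rightarrow> 'x) \<Rightarrow> ('r \<Rightarrow> 'x \<Rightarrow> 'x) \<Rightarrow> bool" where
  "bimodule R X ract lact \<longleftrightarrow> right_module R X ract \<and> (\<forall>r\<in>carrier R. add_hom X X (lact r)) \<and>
     (\<forall>r\<in>carrier R. \<forall>x\<in>carrier X. \<forall>s\<in>carrier R. ract (lact r x) s = lact r (ract x s))"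

lemma bimoduleD:
  assumes "bimodule R X ract lact"
  shows "right_module R X ract" "\<lbrakk>r \<in> carrier R; x \<in> carrier X\<rbrakk> \<Longrightarrow> lact r x \<in> carrier X"
    "r \<in> carrier R \<Longrightarrow> add_hom X X (lact r)"
    "\<lbrakk>r \<in> carrier R; x \<in> carrier X; s \<in> carrier R\<rbrakk> \<Longrightarrow> ract (lact r x) s = lact r (ract x s)"
    "abelian_group X" "\<lbrakk>r \<in> carrier R; x \<in> carrier X\<rbrakk> \<Longrightarrow> ract x r \<in> carrier X" "ring R"
  using assms right_module.act_closed[of R X ract]
  by (auto simp: bimodule_def add_hom_def right_module_def)

lemma bimodule_tensor:
  assumes T: "is_tensor (carrier R) W actW X lX WX wX" and X: "bimodule R X rX lX"
  shows "s \<in> carrier R \<Longrightarrow> balanced (carrier R) W actW X lX WX (\<lambda>m n. wX m (rX n s))"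
    and "right_module R WX (\<lambda>V s. tensor_lift WX (\<lambda>m n. wX m (rX n s)) V)"
  by (rule right_module_tensor[OF T bimoduleD(1)[OF X]]; simp add: bimoduleD(4)[OF X])+

text \<open>A map \<open>X \<otimes> C \<rightarrow> Y \<otimes> C\<close> of left \<open>R\<close>-modules induces \<open>(W \<otimes> X) \<otimes> C \<rightarrow> (W \<otimes> Y) \<otimes> C\<close> by
  associativity of the tensor product.\<close>

lemma left_linear_tensor_map:
  fixes R :: "('r, 'w) ring_scheme"
  assumes W: "right_module R W actW" and X: "bimodule R X rX lX" and Y: "bimodule R Y rY lY"
    and TX: "is_tensor (carrier R) X rX C lC TX tX" and TY: "is_tensor (carrier R) Y rY C lC TY tY"
    and WX: "is_tensor (carrier R) W actW X lX WX wX" and WY: "is_tensor (carrier R) W actW Y lY WY wY"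
    and WXC: "is_tensor (carrier R) WX aX C lC WXC cX" and WYC: "is_tensor (carrier R) WY aY C lC WYC cY"
    and aX: "\<And>r. r \<in> carrier R \<Longrightarrow> add_hom WX WX (\<lambda>Z. aX Z r)"
      "\<And>w x r. \<lbrakk>w \<in> carrier W; x \<in> carrier X; r \<in> carrier R\<rbrakk> \<Longrightarrow> aX (wX w x) r = wX w (rX x r)"
    and aY: "\<And>w y r. \<lbrakk>w \<in> carrier W; y \<in> carrier Y; r \<in> carrier R\<rbrakk> \<Longrightarrow> aY (wY w y) r = wY w (rY y r)"
    and \<sigma>: "add_hom TX TY \<sigma>"
      "\<And>r x c. \<lbrakk>r \<in> carrier R; x \<in> carrier X; c \<in> carrier C\<rbrakk>
        \<Longrightarrow> \<sigma> (tX (lX r x) c) = tensor_lift TY (\<lambda>y c. tY (lY r y) c) (\<sigma> (tX x c))"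
  shows "\<exists>\<Sigma>. add_hom WXC WYC \<Sigma> \<and>
    (\<forall>w\<in>carrier W. \<forall>x\<in>carrier X. \<forall>c\<in>carrier C.
      \<Sigma> (cX (wX w x) c) = tensor_lift WYC (\<lambda>y c. cY (wY w y) c) (\<sigma> (tX x c)))"
proof -
  interpret W: right_module R W actW by fact
  note gg = is_tensor_group[OF TX] is_tensor_group[OF TY] is_tensor_group[OF WX] is_tensor_group[OF WY]
    is_tensor_group[OF WXC] is_tensor_group[OF WYC] is_tensor_right_group[OF TX]
  note pc = pure_closed[OF TX] pure_closed[OF TY] pure_closed[OF WX] pure_closed[OF WY]
    pure_closed[OF WXC] pure_closed[OF WYC]
  note pl = pure_add_left[OF TX] pure_add_left[OF TY] pure_add_left[OF WX] pure_add_left[OF WY]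
    pure_add_left[OF WXC] pure_add_left[OF WYC]
  note pr = pure_add_right[OF TX] pure_add_right[OF TY] pure_add_right[OF WX] pure_add_right[OF WY]
    pure_add_right[OF WXC] pure_add_right[OF WYC]
  note lCc = is_tensor_act_closed(2)[OF TX]
  define \<kappa> where "\<kappa> w = tensor_lift WYC (\<lambda>y c. cY (wY w y) c)" for w
  have \<kappa>b: "balanced (carrier R) Y rY C lC WYC (\<lambda>y c. cY (wY w y) c)" if "w \<in> carrier W" for w
    using that
    by (intro balancedI) (auto simp: pc pl pr pure_act[OF WYC] aY[symmetric])
  note \<kappa>h = tensor_lift_hom[OF TY gg(6) \<kappa>b, folded \<kappa>_def]
  note \<kappa>p = tensor_lift_pure[OF TY gg(6) \<kappa>b, folded \<kappa>_def]
  have \<kappa>add: "\<kappa> (w \<oplus>\<^bsub>W\<^esub> w') t = \<kappa> w t \<oplus>\<^bsub>WYC\<^esub> \<kappa> w' t"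
    if "w \<in> carrier W" "w' \<in> carrier W" "t \<in> carrier TY" for w w' t
    by (rule tensor_ext[OF TY gg(6) \<kappa>h[OF W.M.a_closed[OF that(1,2)]]
          add_hom_plus[OF gg(6) \<kappa>h[OF that(1)] \<kappa>h[OF that(2)]] _ that(3)])
      (simp add: \<kappa>p pc pl that)
  have lb: "balanced (carrier R) Y rY C lC TY (\<lambda>y c. tY (lY r y) c)" if "r \<in> carrier R" for r
    using that by (intro balancedI)
      (auto simp: pc pl pr pure_act[OF TY] bimoduleD(2,6)[OF Y] add_hom_add[OF bimoduleD(3)[OF Y]] bimoduleD(4)[OF Y, symmetric])
  have \<kappa>act: "\<kappa> (actW w r) t = \<kappa> w (tensor_lift TY (\<lambda>y c. tY (lY r y) c) t)"
    if "w \<in> carrier W" "r \<in> carrier R" "t \<in> carrier TY" for w r t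
    by (rule tensor_ext[OF TY gg(6) \<kappa>h[OF W.act_closed[OF that(1,2)]]
          add_hom_comp[OF \<kappa>h[OF that(1)] tensor_lift_hom[OF TY gg(2) lb[OF that(2)]]] _ that(3)])
      (simp add: \<kappa>p pc W.act_closed tensor_lift_pure[OF TY gg(2) lb] bimoduleD(2)[OF Y] pure_act[OF WY] that)
  note \<sigma>c = add_hom_closed[OF \<sigma>(1)]
  define u where "u c = tensor_lift WYC (\<lambda>w x. \<kappa> w (\<sigma> (tX x c)))" for c
  have ub: "balanced (carrier R) W actW X lX WYC (\<lambda>w x. \<kappa> w (\<sigma> (tX x c)))" if c: "c \<in> carrier C" for c
  proof (rule balancedI)
    show "\<kappa> (actW w r) (\<sigma> (tX x c)) = \<kappa> w (\<sigma> (tX (lX r x) c))"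
      if "w \<in> carrier W" "r \<in> carrier R" "x \<in> carrier X" for w r x
      using that c by (simp add: \<kappa>act \<sigma>c pc \<sigma>(2))
  qed (use c in \<open>auto simp: \<sigma>c pc pl \<kappa>add add_hom_closed[OF \<kappa>h] add_hom_add[OF \<kappa>h] add_hom_add[OF \<sigma>(1)]\<close>)
  note uh = tensor_lift_hom[OF WX gg(6) ub, folded u_def]
  note up = tensor_lift_pure[OF WX gg(6) ub, folded u_def]
  have vb: "balanced (carrier R) WX aX C lC WYC (\<lambda>Z c. u c Z)"
  proof (rule balancedI)
    show "u (c \<oplus>\<^bsub>C\<^esub> c') Z = u c Z \<oplus>\<^bsub>WYC\<^esub> u c' Z"
      if Z: "Z \<in> carrier WX" and c: "c \<in> carrier C" and c': "c' \<in> carrier C" for Z c c'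
      by (rule tensor_ext[OF WX gg(6) uh[OF ag_closed[OF gg(7) c c']] add_hom_plus[OF gg(6) uh[OF c] uh[OF c']] _ Z])
        (simp add: up c c' ag_closed[OF gg(7)] pr pc add_hom_add[OF \<sigma>(1)] add_hom_add[OF \<kappa>h] \<sigma>c)
    show "u c (aX Z r) = u (lC r c) Z"
      if Z: "Z \<in> carrier WX" and c: "c \<in> carrier C" and r: "r \<in> carrier R" for Z c r
      by (rule tensor_ext[OF WX gg(6) add_hom_comp[OF uh[OF c] aX(1)[OF r]] uh[OF lCc[OF r c]] _ Z])
        (simp add: up c r aX(2) lCc bimoduleD(6)[OF X] pure_act[OF TX])
  qed (auto simp: add_hom_closed[OF uh] add_hom_add[OF uh])
  show ?thesis
  proof (intro exI conjI ballI)
    show "add_hom WXC WYC (tensor_lift WYC (\<lambda>Z c. u c Z))" by (rule tensor_lift_hom[OF WXC gg(6) vb])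
    show "tensor_lift WYC (\<lambda>Z c. u c Z) (cX (wX w x) c) = tensor_lift WYC (\<lambda>y. cY (wY w y)) (\<sigma> (tX x c))"
      if "w \<in> carrier W" "x \<in> carrier X" "c \<in> carrier C" for w x c
      using that tensor_lift_pure[OF WXC gg(6) vb, of "wX w x" c] up[of c w x] by (simp add: pc \<kappa>_def)
  qed
qed

text \<open>After tensoring with \<open>C\<close> the sequence
  \<open>X \<rightarrow> Y \<rightarrow> Z\<close> splits: \<open>\<sigma>\<close> retracts
  \<open>f \<otimes> C\<close>, and the identity is
  \<open>(f \<otimes> C) \<sigma> + \<tau> (g \<otimes> C)\<close>. Left linearity lets
  \<open>W \<otimes> -\<close> act on \<open>\<sigma>\<close> and \<open>\<tau>\<close>, so the
  sequence tensored with \<open>W\<close> also splits over \<open>C\<close>; faithful flatness of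
  \<open>C\<close> then removes \<open>C\<close>.\<close>

lemma faithfully_flat_descent:
  fixes R :: "('r, 'w) ring_scheme"
  assumes ff: "faithfully_flat_left TYPE('u) R C lC" and inf: "infinite (UNIV :: 'u set)"
    and W: "right_module R W actW" "carrier W \<lesssim> (UNIV :: 'u set)"
    and X: "bimodule R X rX lX" "carrier X \<lesssim> (UNIV :: 'u set)" "is_tensor (carrier R) X rX C lC TX tX"
    and Y: "bimodule R Y rY lY" "carrier Y \<lesssim> (UNIV :: 'u set)" "is_tensor (carrier R) Y rY C lC TY tY"
    and Z: "bimodule R Z rZ lZ" "carrier Z \<lesssim> (UNIV :: 'u set)" "is_tensor (carrier R) Z rZ C lC TZ tZ"
    and f: "f \<in> right_module_hom R X rX Y rY" "\<And>r x. \<lbrakk>r \<in> carrier R; x \<in> carrier X\<rbrakk> \<Longrightarrow> f (lX r x) = lY r (f x)"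
    and g: "g \<in> right_module_hom R Y rY Z rZ" "\<And>r x. \<lbrakk>r \<in> carrier R; x \<in> carrier Y\<rbrakk> \<Longrightarrow> g (lY r x) = lZ r (g x)"
    and gf: "\<And>x. x \<in> carrier X \<Longrightarrow> g (f x) = \<zero>\<^bsub>Z\<^esub>"
    and \<sigma>: "add_hom TY TX \<sigma>" "\<And>r x c. \<lbrakk>r \<in> carrier R; x \<in> carrier Y; c \<in> carrier C\<rbrakk>
        \<Longrightarrow> \<sigma> (tY (lY r x) c) = tensor_lift TX (\<lambda>y c. tX (lX r y) c) (\<sigma> (tY x c))"
    and \<tau>: "add_hom TZ TY \<tau>" "\<And>r x c. \<lbrakk>r \<in> carrier R; x \<in> carrier Z; c \<in> carrier C\<rbrakk>
        \<Longrightarrow> \<tau> (tZ (lZ r x) c) = tensor_lift TY (\<lambda>y c. tY (lY r y) c) (\<tau> (tZ x c))"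
    and \<sigma>f: "\<And>x c. \<lbrakk>x \<in> carrier X; c \<in> carrier C\<rbrakk> \<Longrightarrow> \<sigma> (tY (f x) c) = tX x c"
    and split: "\<And>y c. \<lbrakk>y \<in> carrier Y; c \<in> carrier C\<rbrakk>
        \<Longrightarrow> tensor_lift TY (\<lambda>x c. tY (f x) c) (\<sigma> (tY y c)) \<oplus>\<^bsub>TY\<^esub> \<tau> (tZ (g y) c) = tY y c"
    and WX: "is_tensor (carrier R) W actW X lX WX wX" and WY: "is_tensor (carrier R) W actW Y lY WY wY"
    and WZ: "is_tensor (carrier R) W actW Z lZ WZ wZ"
    and F: "add_hom WX WY F" "\<And>w x. \<lbrakk>w \<in> carrier W; x \<in> carrier X\<rbrakk> \<Longrightarrow> F (wX w x) = wY w (f x)"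
    and G: "add_hom WY WZ G" "\<And>w x. \<lbrakk>w \<in> carrier W; x \<in> carrier Y\<rbrakk> \<Longrightarrow> G (wY w x) = wZ w (g x)"
  shows "inj_on F (carrier WX)" and "exact_pair WX F WY G WZ"
proof -
  interpret W: right_module R W actW by fact
  note gW = is_tensor_group[OF WX] is_tensor_group[OF WY] is_tensor_group[OF WZ]
  have homs: "add_hom X Y f" "add_hom Y Z g"
    and lin: "\<And>x r. \<lbrakk>x \<in> carrier X; r \<in> carrier R\<rbrakk> \<Longrightarrow> f (rX x r) = rY (f x) r"
      "\<And>x r. \<lbrakk>x \<in> carrier Y; r \<in> carrier R\<rbrakk> \<Longrightarrow> g (rY x r) = rZ (g x) r"
    using f(1) g(1) by (auto simp: right_module_hom_def add_hom_def)
  note fgc = add_hom_closed[OF homs(1)] add_hom_closed[OF homs(2)]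
  define aX where "aX V r = tensor_lift WX (\<lambda>w x. wX w (rX x r)) V" for V r
  define aY where "aY V r = tensor_lift WY (\<lambda>w x. wY w (rY x r)) V" for V r
  define aZ where "aZ V r = tensor_lift WZ (\<lambda>w x. wZ w (rZ x r)) V" for V r
  note mX = bimodule_tensor[OF WX X(1)]
  note mY = bimodule_tensor[OF WY Y(1)]
  note mZ = bimodule_tensor[OF WZ Z(1)]
  have M: "right_module R WX aX" "right_module R WY aY" "right_module R WZ aZ"
    using mX(2) mY(2) mZ(2) by (simp_all add: aX_def[abs_def] aY_def[abs_def] aZ_def[abs_def])
  have ah: "add_hom WX WX (\<lambda>V. aX V r)" "add_hom WY WY (\<lambda>V. aY V r)" "add_hom WZ WZ (\<lambda>V. aZ V r)"
    if "r \<in> carrier R" for r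
    using tensor_lift_hom[OF WX gW(1) mX(1)[OF that]] tensor_lift_hom[OF WY gW(2) mY(1)[OF that]]
      tensor_lift_hom[OF WZ gW(3) mZ(1)[OF that]]
    by (simp_all add: aX_def aY_def aZ_def)
  have ap: "x \<in> carrier X \<Longrightarrow> aX (wX w x) r = wX w (rX x r)"
    "y \<in> carrier Y \<Longrightarrow> aY (wY w y) r = wY w (rY y r)"
    "z \<in> carrier Z \<Longrightarrow> aZ (wZ w z) r = wZ w (rZ z r)"
    if "w \<in> carrier W" "r \<in> carrier R" for w x y z r
    using that by (simp_all add: aX_def aY_def aZ_def tensor_lift_pure[OF WX gW(1) mX(1)]
        tensor_lift_pure[OF WY gW(2) mY(1)] tensor_lift_pure[OF WZ gW(3) mZ(1)])
  note gC = is_tensor_right_group[OF X(3)] and lC = is_tensor_act_closed(2)[OF X(3)]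
  let ?WXC = "tensor_group (carrier R) WX aX C lC" and ?WYC = "tensor_group (carrier R) WY aY C lC"
    and ?WZC = "tensor_group (carrier R) WZ aZ C lC"
  let ?cX = "pure_tensor (carrier R) WX aX C lC" and ?cY = "pure_tensor (carrier R) WY aY C lC"
    and ?cZ = "pure_tensor (carrier R) WZ aZ C lC"
  have TX: "is_tensor (carrier R) WX aX C lC ?WXC ?cX"
    by (rule is_tensor_tensor_group[OF gW(1) gC right_module.act_closed[OF M(1)] lC])
  have TY: "is_tensor (carrier R) WY aY C lC ?WYC ?cY"
    by (rule is_tensor_tensor_group[OF gW(2) gC right_module.act_closed[OF M(2)] lC])
  have TZ: "is_tensor (carrier R) WZ aZ C lC ?WZC ?cZ"
    by (rule is_tensor_tensor_group[OF gW(3) gC right_module.act_closed[OF M(3)] lC])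
  note gT = is_tensor_group[OF TX] is_tensor_group[OF TY] is_tensor_group[OF TZ]
  have le: "carrier WX \<lesssim> (UNIV :: 'u set)" "carrier WY \<lesssim> (UNIV :: 'u set)" "carrier WZ \<lesssim> (UNIV :: 'u set)"
    using tensor_lepoll[OF inf W(2) X(2) WX] tensor_lepoll[OF inf W(2) Y(2) WY] tensor_lepoll[OF inf W(2) Z(2) WZ] .
  have Flin: "F (aX V r) = aY (F V) r" if V: "V \<in> carrier WX" and r: "r \<in> carrier R" for V r
    by (rule tensor_ext[OF WX gW(2) add_hom_comp[OF F(1) ah(1)[OF r]] add_hom_comp[OF ah(2)[OF r] F(1)] _ V])
      (simp add: ap F(2) r fgc lin bimoduleD(6)[OF X(1)])
  have Glin: "G (aY V r) = aZ (G V) r" if V: "V \<in> carrier WY" and r: "r \<in> carrier R" for V r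
    by (rule tensor_ext[OF WY gW(3) add_hom_comp[OF G(1) ah(2)[OF r]] add_hom_comp[OF ah(3)[OF r] G(1)] _ V])
      (simp add: ap G(2) r fgc lin bimoduleD(6)[OF Y(1)])
  have Fr: "F \<in> right_module_hom R WX aX WY aY" and Gr: "G \<in> right_module_hom R WY aY WZ aZ"
    using F(1) G(1) Flin Glin by (auto simp: right_module_hom_def add_hom_def)
  have bF: "balanced (carrier R) WX aX C lC ?WYC (\<lambda>V c. ?cY (F V) c)"
    by (rule balanced_tensor_map[OF TX TY F(1)]) (rule Flin)
  have bG: "balanced (carrier R) WY aY C lC ?WZC (\<lambda>V c. ?cZ (G V) c)"
    by (rule balanced_tensor_map[OF TY TZ G(1)]) (rule Glin)
  define F' where "F' = tensor_lift ?WYC (\<lambda>V c. ?cY (F V) c)"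
  define G' where "G' = tensor_lift ?WZC (\<lambda>V c. ?cZ (G V) c)"
  note F'h = tensor_lift_hom[OF TX gT(2) bF, folded F'_def] and F'p = tensor_lift_pure[OF TX gT(2) bF, folded F'_def]
  note G'h = tensor_lift_hom[OF TY gT(3) bG, folded G'_def] and G'p = tensor_lift_pure[OF TY gT(3) bG, folded G'_def]
  \<comment> \<open>\<open>\<Sigma>\<close> and, below, \<open>\<Upsilon>\<close> are
    \<open>W \<otimes> \<sigma>\<close> and \<open>W \<otimes> \<tau>\<close>, carried through the
    associativity of the tensor product.\<close>
  obtain \<Sigma> where \<Sigma>: "add_hom ?WYC ?WXC \<Sigma>"
    "\<And>w x c. \<lbrakk>w \<in> carrier W; x \<in> carrier Y; c \<in> carrier C\<rbrakk>
      \<Longrightarrow> \<Sigma> (?cY (wY w x) c) = tensor_lift ?WXC (\<lambda>y c. ?cX (wX w y) c) (\<sigma> (tY x c))"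
    using left_linear_tensor_map[where \<sigma> = \<sigma>, OF W(1) Y(1) X(1) Y(3) X(3) WY WX TY TX] ah(2) ap(1,2) \<sigma>
    by auto
  obtain \<Upsilon> where \<Upsilon>: "add_hom ?WZC ?WYC \<Upsilon>"
    "\<And>w x c. \<lbrakk>w \<in> carrier W; x \<in> carrier Z; c \<in> carrier C\<rbrakk>
      \<Longrightarrow> \<Upsilon> (?cZ (wZ w x) c) = tensor_lift ?WYC (\<lambda>y c. ?cY (wY w y) c) (\<tau> (tZ x c))"
    using left_linear_tensor_map[where \<sigma> = \<tau>, OF W(1) Z(1) Y(1) Z(3) Y(3) WZ WY TZ TY] ah(3) ap(2,3) \<tau>
    by auto
  have bX: "balanced (carrier R) X rX C lC ?WXC (\<lambda>y c. ?cX (wX w y) c)" if "w \<in> carrier W" for w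
    using that by (intro balancedI)
      (auto simp: pure_closed[OF TX] pure_closed[OF WX] pure_add_left[OF TX] pure_add_right[OF WX]
        pure_add_right[OF TX] pure_act[OF TX] ap(1)[symmetric])
  have bY: "balanced (carrier R) Y rY C lC ?WYC (\<lambda>y c. ?cY (wY w y) c)" if "w \<in> carrier W" for w
    using that by (intro balancedI)
      (auto simp: pure_closed[OF TY] pure_closed[OF WY] pure_add_left[OF TY] pure_add_right[OF WY]
        pure_add_right[OF TY] pure_act[OF TY] ap(2)[symmetric])
  have bf: "balanced (carrier R) X rX C lC TY (\<lambda>x c. tY (f x) c)"
    by (rule balanced_tensor_map[OF X(3) Y(3) homs(1)]) (rule lin(1))
  note gTT = is_tensor_group[OF X(3)] is_tensor_group[OF Y(3)] is_tensor_group[OF Z(3)]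
  have \<Sigma>F: "\<Sigma> (F' V) = V" if "V \<in> carrier ?WXC" for V
  proof (rule tensor_ext[OF TX gT(1) add_hom_comp[OF \<Sigma>(1) F'h] add_hom_id _ that])
    fix U c assume U: "U \<in> carrier WX" and c: "c \<in> carrier C"
    have h: "add_hom WX ?WXC (\<lambda>U. ?cX U c)" "add_hom WY ?WYC (\<lambda>U. ?cY U c)"
      using is_tensor_balanced[OF TX] is_tensor_balanced[OF TY] c by (auto simp: balanced_def)
    have "\<Sigma> (?cY (F U) c) = ?cX U c"
      by (rule tensor_ext[OF WX gT(1) add_hom_comp[OF \<Sigma>(1) add_hom_comp[OF h(2) F(1)]] h(1) _ U])
        (simp add: F(2) \<Sigma>(2) fgc c \<sigma>f tensor_lift_pure[OF X(3) gT(1) bX])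
    then show "\<Sigma> (F' (?cX U c)) = ?cX U c" using U c by (simp add: F'p)
  qed
  \<comment> \<open>The splitting identity tensored with \<open>W\<close>. On elements
    \<open>(w \<otimes> y) \<otimes> c\<close> it reduces to \<open>split\<close>, since
    \<open>F\<kappa>\<close> moves \<open>F'\<close> past the factor \<open>w\<close>.\<close>
  have split': "F' (\<Sigma> V) \<oplus>\<^bsub>?WYC\<^esub> \<Upsilon> (G' V) = V" if "V \<in> carrier ?WYC" for V
  proof (rule tensor_ext[OF TY gT(2) add_hom_plus[OF gT(2) add_hom_comp[OF F'h \<Sigma>(1)] add_hom_comp[OF \<Upsilon>(1) G'h]] add_hom_id _ that])
    fix U c assume U: "U \<in> carrier WY" and c: "c \<in> carrier C"
    have h: "add_hom WY ?WYC (\<lambda>U. ?cY U c)" "add_hom WZ ?WZC (\<lambda>U. ?cZ U c)"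
      using is_tensor_balanced[OF TY] is_tensor_balanced[OF TZ] c by (auto simp: balanced_def)
    have "F' (\<Sigma> (?cY U c)) \<oplus>\<^bsub>?WYC\<^esub> \<Upsilon> (?cZ (G U) c) = ?cY U c"
    proof (rule tensor_ext[OF WY gT(2) add_hom_plus[OF gT(2) add_hom_comp[OF F'h add_hom_comp[OF \<Sigma>(1) h(1)]]
            add_hom_comp[OF \<Upsilon>(1) add_hom_comp[OF h(2) G(1)]]] h(1) _ U])
      fix w y assume w: "w \<in> carrier W" and y: "y \<in> carrier Y"
      have F\<kappa>: "F' (tensor_lift ?WXC (\<lambda>y c. ?cX (wX w y) c) t)
         = tensor_lift ?WYC (\<lambda>y c. ?cY (wY w y) c) (tensor_lift TY (\<lambda>x c. tY (f x) c) t)" if t: "t \<in> carrier TX" for t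
        by (rule tensor_ext[OF X(3) gT(2) add_hom_comp[OF F'h tensor_lift_hom[OF X(3) gT(1) bX[OF w]]]
              add_hom_comp[OF tensor_lift_hom[OF Y(3) gT(2) bY[OF w]] tensor_lift_hom[OF X(3) gTT(2) bf]] _ t])
          (simp add: tensor_lift_pure[OF X(3) gT(1) bX[OF w]] tensor_lift_pure[OF X(3) gTT(2) bf] fgc
            tensor_lift_pure[OF Y(3) gT(2) bY[OF w]] F'p pure_closed[OF WX] w F(2))
      have ts: "\<sigma> (tY y c) \<in> carrier TX" "\<tau> (tZ (g y) c) \<in> carrier TY"
        using y c by (auto intro!: add_hom_closed[OF \<sigma>(1)] add_hom_closed[OF \<tau>(1)] pure_closed[OF Y(3)] pure_closed[OF Z(3)] fgc)
      show "F' (\<Sigma> (?cY (wY w y) c)) \<oplus>\<^bsub>?WYC\<^esub> \<Upsilon> (?cZ (G (wY w y)) c) = ?cY (wY w y) c"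
      proof -
        have "F' (\<Sigma> (?cY (wY w y) c)) \<oplus>\<^bsub>?WYC\<^esub> \<Upsilon> (?cZ (G (wY w y)) c)
          = tensor_lift ?WYC (\<lambda>y c. ?cY (wY w y) c) (tensor_lift TY (\<lambda>x c. tY (f x) c) (\<sigma> (tY y c)))
            \<oplus>\<^bsub>?WYC\<^esub> tensor_lift ?WYC (\<lambda>y c. ?cY (wY w y) c) (\<tau> (tZ (g y) c))"
          using w y c ts by (simp add: \<Sigma>(2) \<Upsilon>(2) G(2) fgc F\<kappa>)
        also have "\<dots> = tensor_lift ?WYC (\<lambda>y c. ?cY (wY w y) c)
            (tensor_lift TY (\<lambda>x c. tY (f x) c) (\<sigma> (tY y c)) \<oplus>\<^bsub>TY\<^esub> \<tau> (tZ (g y) c))"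
          by (rule add_hom_add[OF tensor_lift_hom[OF Y(3) gT(2) bY[OF w]]
                add_hom_closed[OF tensor_lift_hom[OF X(3) gTT(2) bf] ts(1)] ts(2), symmetric])
        also have "\<dots> = ?cY (wY w y) c"
          unfolding split[OF y c] by (rule tensor_lift_pure[OF Y(3) gT(2) bY[OF w] y c])
        finally show ?thesis .
      qed
    qed
    then show "F' (\<Sigma> (?cY U c)) \<oplus>\<^bsub>?WYC\<^esub> \<Upsilon> (G' (?cY U c)) = ?cY U c" using U c by (simp add: G'p)
  qed
  have GF: "G' (F' V) = \<zero>\<^bsub>?WZC\<^esub>" if "V \<in> carrier ?WXC" for V
  proof (rule tensor_ext[OF TX gT(3) add_hom_comp[OF G'h F'h] add_hom_zero_map[OF gT(3)] _ that])
    fix U c assume U: "U \<in> carrier WX" and c: "c \<in> carrier C"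
    have "wZ w \<zero>\<^bsub>Z\<^esub> = \<zero>\<^bsub>WZ\<^esub>" if "w \<in> carrier W" for w
      using add_hom_zero[OF bimoduleD(5)[OF Z(1)] gW(3), of "wZ w"] is_tensor_balanced[OF WZ] that by (auto simp: balanced_def)
    then have "G (F U) = \<zero>\<^bsub>WZ\<^esub>"
      by (intro tensor_ext[OF WX gW(3) add_hom_comp[OF G(1) F(1)] add_hom_zero_map[OF gW(3)] _ U])
        (simp add: F(2) G(2) fgc gf)
    moreover have "?cZ \<zero>\<^bsub>WZ\<^esub> c = \<zero>\<^bsub>?WZC\<^esub>"
      using add_hom_zero[OF gW(3) gT(3), of "\<lambda>x. ?cZ x c"] is_tensor_balanced[OF TZ] c by (auto simp: balanced_def)
    ultimately show "G' (F' (?cX U c)) = \<zero>\<^bsub>?WZC\<^esub>"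
      using U c by (simp add: F'p G'p add_hom_closed[OF F(1)])
  qed
  have "inj_on F' (carrier ?WXC)" using \<Sigma>F by (metis inj_on_inverseI)
  then show "inj_on F (carrier WX)"
    using faithfully_flat_inj[OF ff M(1) le(1) TX M(2) le(2) TY Fr F'h F'p] by simp
  \<comment> \<open>If \<open>G' V\<close> vanishes, the splitting identity reads
    \<open>F' (\<Sigma> V) = V\<close> and exhibits a preimage.\<close>
  have "exact_pair ?WXC F' ?WYC G' ?WZC"
    unfolding exact_pair_def
  proof (intro equalityI subsetI)
    fix V assume "V \<in> F' ` carrier ?WXC"
    then show "V \<in> {x \<in> carrier ?WYC. G' x = \<zero>\<^bsub>?WZC\<^esub>}" using GF add_hom_closed[OF F'h] by auto
  next
    fix V assume "V \<in> {x \<in> carrier ?WYC. G' x = \<zero>\<^bsub>?WZC\<^esub>}"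
    then have V: "V \<in> carrier ?WYC" "G' V = \<zero>\<^bsub>?WZC\<^esub>" by auto
    have "F' (\<Sigma> V) = V"
      using split'[OF V(1)] V(2) add_hom_zero[OF gT(3,2) \<Upsilon>(1)] add_hom_closed[OF F'h add_hom_closed[OF \<Sigma>(1) V(1)]]
        gT(2) by (simp add: abelian_monoid.r_zero abelian_group.axioms(1))
    then show "V \<in> F' ` carrier ?WXC" using add_hom_closed[OF \<Sigma>(1) V(1)] by (metis imageI)
  qed
  then show "exact_pair WX F WY G WZ"
    using faithfully_flat_exact[OF ff M(1) le(1) TX M(2) le(2) TY M(3) le(3) TZ Fr Gr F'h F'p G'h G'p] by simp
qed

section \<open>The canonical map of a comodule algebra\<close>

lemma tensor_lift_smult:
  assumes T: "is_tensor R M ract N lact T p" and P: "module K P" and f: "balanced R M ract N lact P f"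
    and TM: "module K T" and TS: "\<And>m n. \<lbrakk>m \<in> carrier M; n \<in> carrier N\<rbrakk> \<Longrightarrow> k \<odot>\<^bsub>T\<^esub> p m n = p (k \<odot>\<^bsub>M\<^esub> m) n"
    and M: "module K M"
    and fs: "\<And>m n. \<lbrakk>m \<in> carrier M; n \<in> carrier N\<rbrakk> \<Longrightarrow> f (k \<odot>\<^bsub>M\<^esub> m) n = k \<odot>\<^bsub>P\<^esub> f m n"
    and k: "k \<in> carrier K" and X: "X \<in> carrier T"
  shows "tensor_lift P f (k \<odot>\<^bsub>T\<^esub> X) = k \<odot>\<^bsub>P\<^esub> tensor_lift P f X"
proof -
  interpret P: module K P by fact
  interpret TM: module K T by fact
  interpret M: module K M by fact
  note gP = P.M.abelian_group_axioms
  have h: "add_hom T T (\<lambda>X. k \<odot>\<^bsub>T\<^esub> X)" "add_hom P P (\<lambda>X. k \<odot>\<^bsub>P\<^esub> X)"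
    using k by (auto intro!: add_homI simp: TM.smult_r_distr P.smult_r_distr)
  note l = tensor_lift_hom[OF T gP f] and lp = tensor_lift_pure[OF T gP f]
  show ?thesis
    by (rule tensor_ext[OF T gP add_hom_comp[OF l h(1)] add_hom_comp[OF h(2) l] _ X])
      (simp add: TS lp fs k)
qed

sublocale comodule_algebra \<subseteq> coaction_data K H A \<rho> .

sublocale comodule_algebra \<subseteq> A: ring A by (rule unital_algebraD(2)[OF unital_algebra_A])
sublocale comodule_algebra \<subseteq> H: ring H by (rule unital_algebraD(2)[OF unital_algebra_H])
sublocale comodule_algebra \<subseteq> AK: module K A by (rule unital_algebraD(1)[OF unital_algebra_A])
sublocale comodule_algebra \<subseteq> HK: module K H by (rule unital_algebraD(1)[OF unital_algebra_H])
sublocale comodule_algebra \<subseteq> R: ring "ktensor K A H"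
  by (rule unital_algebraD(2)[OF ktensor_unital_algebra[OF unital_algebra_A unital_algebra_H]])
sublocale comodule_algebra \<subseteq> RK: module K "ktensor K A H"
  by (rule unital_algebraD(1)[OF ktensor_unital_algebra[OF unital_algebra_A unital_algebra_H]])

context comodule_algebra
begin

abbreviation "R \<equiv> ktensor K A H"
abbreviation mult_A (infixl "\<cdot>" 70) where "x \<cdot> y \<equiv> x \<otimes>\<^bsub>A\<^esub> y"
abbreviation mult_R (infixl "\<star>" 70) where "X \<star> Y \<equiv> X \<otimes>\<^bsub>R\<^esub> Y"
abbreviation "kbal M N \<equiv> balanced (carrier K) M (\<lambda>x k. k \<odot>\<^bsub>M\<^esub> x) N (\<lambda>k y. k \<odot>\<^bsub>N\<^esub> y)"
abbreviation "bbal \<equiv> balanced coinv A (\<lambda>x b. x \<cdot> b) A (\<lambda>b y. b \<cdot> y)"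
abbreviation "pR \<equiv> ktensor_pure K A H"
abbreviation "AR \<equiv> ktensor K A R"
abbreviation "pAR \<equiv> ktensor_pure K A R"

lemmas A_smult = unital_algebraD(5,6)[OF unital_algebra_A]
lemmas R_algebra = ktensor_unital_algebra[OF unital_algebra_A unital_algebra_H]
lemmas R_smult = unital_algebraD(5,6)[OF R_algebra]
lemmas A_group = A.is_abelian_group
lemmas R_group = R.is_abelian_group

lemmas tR = is_tensor_ktensor[OF AK.module_axioms HK.module_axioms]
lemmas pR_closed = pure_closed[OF tR] and pR_add = pure_add_left[OF tR] pure_add_right[OF tR]
  and pR_act = pure_act[OF tR]
  and pR_smult = ktensor_module(2)[OF AK.module_axioms HK.module_axioms]
  and pR_mult = ktensor_mult_pure[OF unital_algebra_A unital_algebra_H]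
  and R_one = ktensor_one[OF unital_algebra_A unital_algebra_H]

subsection \<open>The algebra \<open>A \<otimes> H\<close>\<close>

text \<open>The commuting algebra embeddings of \<open>A\<close> and \<open>H\<close> into
  \<open>A \<otimes> H\<close>. Writing \<open>a \<otimes> h\<close> as
  \<open>\<iota> a \<star> \<eta> h\<close> turns Sweedler calculations into calculations in a
  ring.\<close>

definition "\<iota> a = pR a \<one>\<^bsub>H\<^esub>"
definition "\<eta> h = pR \<one>\<^bsub>A\<^esub> h"

lemma \<iota>_closed [simp]: "a \<in> carrier A \<Longrightarrow> \<iota> a \<in> carrier R"
  and \<eta>_closed [simp]: "h \<in> carrier H \<Longrightarrow> \<eta> h \<in> carrier R"
  by (simp_all add: \<iota>_def \<eta>_def pR_closed)

lemma \<iota>_add: "\<lbrakk>a \<in> carrier A; a' \<in> carrier A\<rbrakk> \<Longrightarrow> \<iota> (a \<oplus>\<^bsub>A\<^esub> a') = \<iota> a \<oplus>\<^bsub>R\<^esub> \<iota> a'"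
  and \<eta>_add: "\<lbrakk>h \<in> carrier H; h' \<in> carrier H\<rbrakk> \<Longrightarrow> \<eta> (h \<oplus>\<^bsub>H\<^esub> h') = \<eta> h \<oplus>\<^bsub>R\<^esub> \<eta> h'"
  and \<iota>_mult: "\<lbrakk>a \<in> carrier A; a' \<in> carrier A\<rbrakk> \<Longrightarrow> \<iota> (a \<cdot> a') = \<iota> a \<star> \<iota> a'"
  and \<eta>_mult: "\<lbrakk>h \<in> carrier H; h' \<in> carrier H\<rbrakk> \<Longrightarrow> \<eta> (h \<otimes>\<^bsub>H\<^esub> h') = \<eta> h \<star> \<eta> h'"
  and \<iota>_\<eta>: "\<lbrakk>a \<in> carrier A; h \<in> carrier H\<rbrakk> \<Longrightarrow> \<iota> a \<star> \<eta> h = pR a h"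
  and \<eta>_\<iota>: "\<lbrakk>a \<in> carrier A; h \<in> carrier H\<rbrakk> \<Longrightarrow> \<eta> h \<star> \<iota> a = pR a h"
  and \<iota>_one: "\<iota> \<one>\<^bsub>A\<^esub> = \<one>\<^bsub>R\<^esub>" and \<eta>_one: "\<eta> \<one>\<^bsub>H\<^esub> = \<one>\<^bsub>R\<^esub>"
  and \<iota>_smult: "\<lbrakk>k \<in> carrier K; a \<in> carrier A\<rbrakk> \<Longrightarrow> \<iota> (k \<odot>\<^bsub>A\<^esub> a) = k \<odot>\<^bsub>R\<^esub> \<iota> a"
  and \<eta>_smult: "\<lbrakk>k \<in> carrier K; h \<in> carrier H\<rbrakk> \<Longrightarrow> \<eta> (k \<odot>\<^bsub>H\<^esub> h) = k \<odot>\<^bsub>R\<^esub> \<eta> h"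
  by (simp_all add: \<iota>_def \<eta>_def pR_add pR_mult R_one pR_smult) (simp add: pR_act)

lemma \<iota>_\<eta>_commute: "\<lbrakk>a \<in> carrier A; h \<in> carrier H\<rbrakk> \<Longrightarrow> \<eta> h \<star> \<iota> a = \<iota> a \<star> \<eta> h"
  by (simp add: \<iota>_\<eta> \<eta>_\<iota>)

lemma \<rho>_closed [simp]: "a \<in> carrier A \<Longrightarrow> \<rho> a \<in> carrier R"
  and \<rho>_add: "\<lbrakk>a \<in> carrier A; a' \<in> carrier A\<rbrakk> \<Longrightarrow> \<rho> (a \<oplus>\<^bsub>A\<^esub> a') = \<rho> a \<oplus>\<^bsub>R\<^esub> \<rho> a'"
  and \<rho>_mult: "\<lbrakk>a \<in> carrier A; a' \<in> carrier A\<rbrakk> \<Longrightarrow> \<rho> (a \<cdot> a') = \<rho> a \<star> \<rho> a'"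
  and \<rho>_one: "\<rho> \<one>\<^bsub>A\<^esub> = \<one>\<^bsub>R\<^esub>"
  and \<rho>_smult: "\<lbrakk>k \<in> carrier K; a \<in> carrier A\<rbrakk> \<Longrightarrow> \<rho> (k \<odot>\<^bsub>A\<^esub> a) = k \<odot>\<^bsub>R\<^esub> \<rho> a"
  using coaction_hom by (auto simp: algebra_homs_def ring_hom_def linear_maps_def)

lemma R_ext:
  assumes "abelian_group P" "add_hom R P f" "add_hom R P g"
    and "\<And>a h. \<lbrakk>a \<in> carrier A; h \<in> carrier H\<rbrakk> \<Longrightarrow> f (\<iota> a \<star> \<eta> h) = g (\<iota> a \<star> \<eta> h)" "Z \<in> carrier R"
  shows "f Z = g Z"
  using assms(4) by (intro tensor_ext[OF tR assms(1-3) _ assms(5)]) (simp add: \<iota>_\<eta>)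

lemma \<iota>_hom: "add_hom A R \<iota>" and \<rho>_hom: "add_hom A R \<rho>"
  by (simp_all add: add_homI \<iota>_add \<rho>_add)

lemma R_mult_hom: "Z \<in> carrier R \<Longrightarrow> add_hom R R (\<lambda>Y. Y \<star> Z)" "Z \<in> carrier R \<Longrightarrow> add_hom R R (\<lambda>Y. Z \<star> Y)"
  by (auto intro!: add_homI simp: R.l_distr R.r_distr)

subsection \<open>Coinvariants\<close>

text \<open>Scalars as coinvariant elements, so that scalar actions become special cases of the
  actions of \<open>B\<close>.\<close>

definition "scal k = k \<odot>\<^bsub>A\<^esub> \<one>\<^bsub>A\<^esub>"

lemma coinv_iff: "b \<in> coinv \<longleftrightarrow> b \<in> carrier A \<and> \<rho> b = \<iota> b"
  by (simp add: coinv_def \<iota>_def)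

lemma coinv_closed [simp]: "b \<in> coinv \<Longrightarrow> b \<in> carrier A" and coinv_\<rho>: "b \<in> coinv \<Longrightarrow> \<rho> b = \<iota> b"
  by (simp_all add: coinv_iff)

lemma coinv_mult: "\<lbrakk>b \<in> coinv; b' \<in> coinv\<rbrakk> \<Longrightarrow> b \<cdot> b' \<in> coinv"
  and coinv_add: "\<lbrakk>b \<in> coinv; b' \<in> coinv\<rbrakk> \<Longrightarrow> b \<oplus>\<^bsub>A\<^esub> b' \<in> coinv"
  and coinv_one: "\<one>\<^bsub>A\<^esub> \<in> coinv"
  and coinv_smult: "\<lbrakk>k \<in> carrier K; b \<in> coinv\<rbrakk> \<Longrightarrow> k \<odot>\<^bsub>A\<^esub> b \<in> coinv"
  by (simp_all add: coinv_iff \<rho>_mult \<iota>_mult \<rho>_add \<iota>_add \<rho>_one \<iota>_one \<rho>_smult \<iota>_smult)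

lemma coinv_zero: "\<zero>\<^bsub>A\<^esub> \<in> coinv"
  using add_hom_zero[OF A_group R_group \<rho>_hom] add_hom_zero[OF A_group R_group \<iota>_hom]
  by (simp add: coinv_iff)

lemma coinv_neg: "b \<in> coinv \<Longrightarrow> \<ominus>\<^bsub>A\<^esub> b \<in> coinv"
  using add_hom_neg[OF A_group R_group \<rho>_hom] add_hom_neg[OF A_group R_group \<iota>_hom]
  by (simp add: coinv_iff)

lemma scal_coinv: "k \<in> carrier K \<Longrightarrow> scal k \<in> coinv"
  unfolding scal_def by (rule coinv_smult[OF _ coinv_one])

lemma scal_left: "\<lbrakk>k \<in> carrier K; a \<in> carrier A\<rbrakk> \<Longrightarrow> k \<odot>\<^bsub>A\<^esub> a = scal k \<cdot> a"
  and scal_right: "\<lbrakk>k \<in> carrier K; a \<in> carrier A\<rbrakk> \<Longrightarrow> k \<odot>\<^bsub>A\<^esub> a = a \<cdot> scal k"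
  by (simp_all add: scal_def A_smult)

lemma B_simps [simp]: "carrier B = coinv" "mult B = mult A" "one B = one A" "ring.zero B = ring.zero A"
  "add B = add A" "smult B = smult A"
  by (simp_all add: B_def)

lemma B_ring: "ring B"
proof (rule ringI)
  show "abelian_group B"
    by (rule abelian_groupI)
      (auto simp: coinv_add coinv_zero A.a_ac coinv_neg intro!: bexI[of _ "\<ominus>\<^bsub>A\<^esub> x" for x] A.r_neg)
  show "monoid B"
    by (rule monoidI) (auto simp: coinv_mult coinv_one A.m_assoc)
qed (auto simp: A.l_distr A.r_distr)

subsection \<open>The canonical map\<close>

lemma tAA: "is_tensor coinv A (\<lambda>x b. x \<cdot> b) A (\<lambda>b y. b \<cdot> y) AA AA_pure"
  unfolding AA_def AA_pure_def
  by (intro is_tensor_module is_tensor_tensor_group) (auto simp: A_group)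

lemmas AA_group = is_tensor_group[OF tAA]
lemmas AA_closed = pure_closed[OF tAA] and AA_add = pure_add_left[OF tAA] pure_add_right[OF tAA]
  and AA_act = pure_act[OF tAA]

lemma AA_module: "module K AA"
  and AA_smult: "\<lbrakk>k \<in> carrier K; m \<in> carrier A; n \<in> carrier A\<rbrakk> \<Longrightarrow> k \<odot>\<^bsub>AA\<^esub> AA_pure m n = AA_pure (k \<odot>\<^bsub>A\<^esub> m) n"
proof -
  have s: "smult AA = (\<lambda>k. tensor_lift (tensor_group coinv A (\<lambda>x b. x \<cdot> b) A (\<lambda>b y. b \<cdot> y))
     (\<lambda>m n. pure_tensor coinv A (\<lambda>x b. x \<cdot> b) A (\<lambda>b y. b \<cdot> y) (k \<odot>\<^bsub>A\<^esub> m) n))"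
    by (simp add: AA_def tensor_module_def Let_def)
  have c: "k \<odot>\<^bsub>A\<^esub> (m \<cdot> r) = (k \<odot>\<^bsub>A\<^esub> m) \<cdot> r"
    if "k \<in> carrier K" "m \<in> carrier A" "r \<in> coinv" for k m r
    using that by (simp add: A_smult)
  show "module K AA"
    and "\<lbrakk>k \<in> carrier K; m \<in> carrier A; n \<in> carrier A\<rbrakk> \<Longrightarrow> k \<odot>\<^bsub>AA\<^esub> AA_pure m n = AA_pure (k \<odot>\<^bsub>A\<^esub> m) n"
    using tensor_smult[OF tAA AK.module_axioms c s] by auto
qed

definition "lA x = tensor_lift AA (\<lambda>p q. AA_pure (x \<cdot> p) q)"
definition "rA y = tensor_lift AA (\<lambda>p q. AA_pure p (q \<cdot> y))"

lemma lA_bal: "x \<in> carrier A \<Longrightarrow>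
    bbal AA (\<lambda>p q. AA_pure (x \<cdot> p) q)"
  and rA_bal: "x \<in> carrier A \<Longrightarrow>
    bbal AA (\<lambda>p q. AA_pure p (q \<cdot> x))"
  by (rule balancedI;
      simp add: AA_closed AA_add A.r_distr A.l_distr A.m_assoc[symmetric] AA_act)+

lemmas lA_hom = tensor_lift_hom[OF tAA AA_group lA_bal, folded lA_def]
  and lA_pure = tensor_lift_pure[OF tAA AA_group lA_bal, folded lA_def]
  and rA_hom = tensor_lift_hom[OF tAA AA_group rA_bal, folded rA_def]
  and rA_pure = tensor_lift_pure[OF tAA AA_group rA_bal, folded rA_def]

text \<open>With the inner lift recognized as a left multiplication, \<open>can\<close> becomes
  \<open>p \<otimes> q \<mapsto> \<iota> p \<star> \<rho> q\<close>, and its balancedness is just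
  \<open>\<rho> b = \<iota> b\<close> on coinvariants.\<close>

lemma can_inner:
  assumes a: "a \<in> carrier A" and Z: "Z \<in> carrier R"
  shows "tensor_lift R (\<lambda>x h. pR (a \<cdot> x) h) Z = \<iota> a \<star> Z"
proof (rule tensor_lift_unique[OF tR R_group _ R_mult_hom(2) _ Z])
  show "kbal A H R (\<lambda>x h. pR (a \<cdot> x) h)"
    using a by (intro balancedI) (simp_all add: pR_closed pR_add A.r_distr A_smult pR_act)
qed (use a in \<open>simp_all add: \<iota>_def pR_mult pR_closed\<close>)

lemma can_bal: "bbal R
    (\<lambda>a a'. tensor_lift R (\<lambda>x h. pR (a \<cdot> x) h) (\<rho> a'))"
  by (rule balancedI)
    (simp_all add: can_inner \<iota>_add \<rho>_add R.l_distr R.r_distr \<iota>_mult \<rho>_mult R.m_assoc coinv_\<rho>)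

lemmas can_hom = tensor_lift_hom[OF tAA R_group can_bal, folded can_def]

lemma can_pure: "\<lbrakk>p \<in> carrier A; q \<in> carrier A\<rbrakk> \<Longrightarrow> can (AA_pure p q) = \<iota> p \<star> \<rho> q"
  using tensor_lift_pure[OF tAA R_group can_bal, folded can_def] by (simp add: can_inner)

text \<open>Together with \<open>can_rA\<close>: the canonical map is a bimodule map once
  \<open>A\<close> acts on \<open>A \<otimes> H\<close> from the left through \<open>\<iota>\<close>
  and from the right through \<open>\<rho>\<close>.\<close>

lemma can_lA: "\<lbrakk>x \<in> carrier A; z \<in> carrier AA\<rbrakk> \<Longrightarrow> can (lA x z) = \<iota> x \<star> can z"
  by (rule tensor_ext[OF tAA R_group add_hom_comp[OF can_hom lA_hom] add_hom_comp[OF R_mult_hom(2) can_hom]])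
    (simp_all add: lA_pure can_pure \<iota>_mult R.m_assoc)

lemma can_rA: "\<lbrakk>x \<in> carrier A; z \<in> carrier AA\<rbrakk> \<Longrightarrow> can (rA x z) = can z \<star> \<rho> x"
  by (rule tensor_ext[OF tAA R_group add_hom_comp[OF can_hom rA_hom] add_hom_comp[OF R_mult_hom(1) can_hom]])
    (simp_all add: rA_pure can_pure \<rho>_mult R.m_assoc)

text \<open>The algebra map \<open>id \<otimes> \<epsilon>\<close> from \<open>A \<otimes> H\<close>
  to \<open>A\<close>.\<close>

definition "\<epsilon>R = tensor_lift A (\<lambda>x h. \<epsilon> h \<odot>\<^bsub>A\<^esub> x)"

lemma \<epsilon>_closed [simp]: "h \<in> carrier H \<Longrightarrow> \<epsilon> h \<in> carrier K"
  and \<epsilon>_add: "\<lbrakk>h \<in> carrier H; h' \<in> carrier H\<rbrakk> \<Longrightarrow> \<epsilon> (h \<oplus>\<^bsub>H\<^esub> h') = \<epsilon> h \<oplus>\<^bsub>K\<^esub> \<epsilon> h'"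
  and \<epsilon>_mult: "\<lbrakk>h \<in> carrier H; h' \<in> carrier H\<rbrakk> \<Longrightarrow> \<epsilon> (h \<otimes>\<^bsub>H\<^esub> h') = \<epsilon> h \<otimes>\<^bsub>K\<^esub> \<epsilon> h'"
  and \<epsilon>_one: "\<epsilon> \<one>\<^bsub>H\<^esub> = \<one>\<^bsub>K\<^esub>"
  using counit_hom by (auto simp: ring_hom_def)

lemma \<epsilon>R_bal: "kbal A H A (\<lambda>x h. \<epsilon> h \<odot>\<^bsub>A\<^esub> x)"
  by (rule balancedI)
    (simp_all add: AK.smult_r_distr AK.smult_l_distr \<epsilon>_add counit_smult AK.smult_assoc1 AK.R.m_comm
      flip: AK.smult_assoc1)

lemmas \<epsilon>R_hom = tensor_lift_hom[OF tR A_group \<epsilon>R_bal, folded \<epsilon>R_def]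

lemma \<epsilon>R_pure: "\<lbrakk>a \<in> carrier A; h \<in> carrier H\<rbrakk> \<Longrightarrow> \<epsilon>R (\<iota> a \<star> \<eta> h) = \<epsilon> h \<odot>\<^bsub>A\<^esub> a"
  using tensor_lift_pure[OF tR A_group \<epsilon>R_bal, folded \<epsilon>R_def] by (simp add: \<iota>_\<eta>)

lemma \<epsilon>R_\<rho>: "a \<in> carrier A \<Longrightarrow> \<epsilon>R (\<rho> a) = a"
  unfolding \<epsilon>R_def by (rule coaction_counit)

lemma \<epsilon>R_mult:
  assumes Y: "Y \<in> carrier R" and Z: "Z \<in> carrier R"
  shows "\<epsilon>R (Y \<star> Z) = \<epsilon>R Y \<cdot> \<epsilon>R Z"
proof -
  have hA: "add_hom A A (\<lambda>x. x \<cdot> a)" "add_hom A A (\<lambda>x. a \<cdot> x)" if "a \<in> carrier A" for a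
    using that by (auto intro!: add_homI simp: A.l_distr A.r_distr)
  note ec = add_hom_closed[OF \<epsilon>R_hom]
  show ?thesis
  proof (rule R_ext[OF A_group add_hom_comp[OF \<epsilon>R_hom R_mult_hom(1)[OF Z]] add_hom_comp[OF hA(1)[OF ec[OF Z]] \<epsilon>R_hom] _ Y])
    fix a h assume a: "a \<in> carrier A" and h: "h \<in> carrier H"
    then have ah: "\<iota> a \<star> \<eta> h \<in> carrier R" by simp
    show "\<epsilon>R (\<iota> a \<star> \<eta> h \<star> Z) = \<epsilon>R (\<iota> a \<star> \<eta> h) \<cdot> \<epsilon>R Z"
    proof (rule R_ext[OF A_group add_hom_comp[OF \<epsilon>R_hom R_mult_hom(2)[OF ah]] add_hom_comp[OF hA(2)[OF ec[OF ah]] \<epsilon>R_hom] _ Z])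
      fix a' h' assume a': "a' \<in> carrier A" and h': "h' \<in> carrier H"
      have "\<iota> a \<star> \<eta> h \<star> (\<iota> a' \<star> \<eta> h') = \<iota> (a \<cdot> a') \<star> \<eta> (h \<otimes>\<^bsub>H\<^esub> h')"
        using a h a' h' by (simp add: \<iota>_\<eta> pR_mult)
      then show "\<epsilon>R (\<iota> a \<star> \<eta> h \<star> (\<iota> a' \<star> \<eta> h')) = \<epsilon>R (\<iota> a \<star> \<eta> h) \<cdot> \<epsilon>R (\<iota> a' \<star> \<eta> h')"
        using a h a' h' by (simp add: \<epsilon>R_pure \<epsilon>_mult A_smult AK.smult_assoc1[symmetric] AK.R.m_comm)
    qed
  qed
qed

definition "mA = tensor_lift A (\<lambda>p q. p \<cdot> q)"

lemma mA_bal: "bbal A (\<lambda>p q. p \<cdot> q)"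
  by (rule balancedI) (simp_all add: A.l_distr A.r_distr A.m_assoc)

lemmas mA_hom = tensor_lift_hom[OF tAA A_group mA_bal, folded mA_def]
  and mA_pure = tensor_lift_pure[OF tAA A_group mA_bal, folded mA_def]

lemma \<epsilon>R_\<iota>: "a \<in> carrier A \<Longrightarrow> \<epsilon>R (\<iota> a) = a"
  using \<epsilon>R_pure[of a "\<one>\<^bsub>H\<^esub>"] by (simp add: \<eta>_one \<epsilon>_one)

lemma \<epsilon>R_\<eta>: "h \<in> carrier H \<Longrightarrow> \<epsilon>R (\<eta> h) = scal (\<epsilon> h)"
  using \<epsilon>R_pure[of "\<one>\<^bsub>A\<^esub>" h] by (simp add: \<iota>_one scal_def)

text \<open>Multiplicativity of \<open>\<epsilon>R\<close> and the counit law reduce both sides to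
  \<open>p \<cdot> q\<close>. For the translation map this is the rule
  \<open>h<1> h<2> = \<epsilon>(h) 1\<close>.\<close>

lemma mA_\<epsilon>R: "z \<in> carrier AA \<Longrightarrow> \<epsilon>R (can z) = mA z"
  by (rule tensor_ext[OF tAA A_group add_hom_comp[OF \<epsilon>R_hom can_hom] mA_hom])
    (simp_all add: can_pure mA_pure \<epsilon>R_mult \<epsilon>R_\<iota> \<epsilon>R_\<rho>)

subsection \<open>The tensor product \<open>A \<otimes> (A \<otimes> H)\<close>\<close>

lemma tAR: "is_tensor (carrier K) A (\<lambda>x k. k \<odot>\<^bsub>A\<^esub> x) R (\<lambda>k y. k \<odot>\<^bsub>R\<^esub> y) AR pAR"
  by (rule is_tensor_ktensor[OF AK.module_axioms RK.module_axioms])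

lemmas AR_group = is_tensor_group[OF tAR]
lemmas AR_closed = pure_closed[OF tAR] and AR_add = pure_add_left[OF tAR] pure_add_right[OF tAR]
  and AR_act = pure_act[OF tAR] and AR_module = ktensor_module(1)[OF AK.module_axioms RK.module_axioms]
  and AR_smult = ktensor_module(2)[OF AK.module_axioms RK.module_axioms]

definition "rAR Z = tensor_lift AR (\<lambda>x Y. pAR x (Y \<star> Z))"

lemma rAR_bal: "Z \<in> carrier R \<Longrightarrow>
    kbal A R AR (\<lambda>x Y. pAR x (Y \<star> Z))"
  by (rule balancedI) (simp_all add: AR_closed AR_add R.l_distr R_smult AR_act)

lemmas rAR_hom = tensor_lift_hom[OF tAR AR_group rAR_bal, folded rAR_def]
  and rAR_pure = tensor_lift_pure[OF tAR AR_group rAR_bal, folded rAR_def]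

lemma rAR_closed [simp]: "\<lbrakk>Z \<in> carrier R; W \<in> carrier AR\<rbrakk> \<Longrightarrow> rAR Z W \<in> carrier AR"
  by (rule add_hom_closed[OF rAR_hom])

lemma rAR_add: "\<lbrakk>Z \<in> carrier R; Z' \<in> carrier R; W \<in> carrier AR\<rbrakk> \<Longrightarrow> rAR (Z \<oplus>\<^bsub>R\<^esub> Z') W = rAR Z W \<oplus>\<^bsub>AR\<^esub> rAR Z' W"
  by (rule tensor_ext[OF tAR AR_group rAR_hom add_hom_plus[OF AR_group rAR_hom rAR_hom]])
    (simp_all add: rAR_pure R.r_distr AR_add)

lemma rAR_mult: "\<lbrakk>Z \<in> carrier R; Z' \<in> carrier R; W \<in> carrier AR\<rbrakk> \<Longrightarrow> rAR Z' (rAR Z W) = rAR (Z \<star> Z') W"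
  by (rule tensor_ext[OF tAR AR_group add_hom_comp[OF rAR_hom rAR_hom] rAR_hom])
    (simp_all add: rAR_pure R.m_assoc)

lemma rAR_one: "W \<in> carrier AR \<Longrightarrow> rAR \<one>\<^bsub>R\<^esub> W = W"
  by (rule tensor_ext[OF tAR AR_group rAR_hom add_hom_id]) (simp_all add: rAR_pure)

lemma rAR_smult: "\<lbrakk>k \<in> carrier K; Z \<in> carrier R; W \<in> carrier AR\<rbrakk> \<Longrightarrow> rAR (k \<odot>\<^bsub>R\<^esub> Z) W = rAR Z (k \<odot>\<^bsub>AR\<^esub> W)"
proof -
  interpret AR: module K AR by (rule AR_module)
  assume k: "k \<in> carrier K" and Z: "Z \<in> carrier R" and W: "W \<in> carrier AR"
  have h: "add_hom AR AR (\<lambda>W. k \<odot>\<^bsub>AR\<^esub> W)" using k by (intro add_homI) (auto simp: AR.smult_r_distr)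
  show ?thesis
    using k Z by (intro tensor_ext[OF tAR AR_group rAR_hom add_hom_comp[OF rAR_hom h] _ W])
      (simp_all add: rAR_pure AR_smult AR_act R_smult)
qed

definition "\<Theta> = tensor_lift AR (\<lambda>x h. pAR x (\<eta> h))"

lemma \<Theta>_bal: "kbal A H AR (\<lambda>x h. pAR x (\<eta> h))"
  by (rule balancedI) (simp_all add: AR_closed AR_add \<eta>_add \<eta>_smult AR_act)

lemmas \<Theta>_hom = tensor_lift_hom[OF tR AR_group \<Theta>_bal, folded \<Theta>_def]
lemma \<Theta>_pure: "\<lbrakk>a \<in> carrier A; h \<in> carrier H\<rbrakk> \<Longrightarrow> \<Theta> (\<iota> a \<star> \<eta> h) = pAR a (\<eta> h)"
  using tensor_lift_pure[OF tR AR_group \<Theta>_bal, folded \<Theta>_def] by (simp add: \<iota>_\<eta>)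
lemmas \<Theta>_closed [simp] = add_hom_closed[OF \<Theta>_hom]

lemma \<Theta>_smult: "\<lbrakk>k \<in> carrier K; Z \<in> carrier R\<rbrakk> \<Longrightarrow> \<Theta> (k \<odot>\<^bsub>R\<^esub> Z) = k \<odot>\<^bsub>AR\<^esub> \<Theta> Z"
  unfolding \<Theta>_def
  by (rule tensor_lift_smult[OF tR AR_module \<Theta>_bal RK.module_axioms _ AK.module_axioms])
    (simp_all add: pR_smult AR_smult)

subsection \<open>The enveloping algebra\<close>

lemma Ae_algebra: "unital_algebra K Ae"
  unfolding Ae_def by (rule ktensor_unital_algebra[OF unital_algebra_A unital_algebra_opposite[OF unital_algebra_A]])

lemma opposite_simps [simp]: "carrier (opposite A) = carrier A" "add (opposite A) = add A"
  "smult (opposite A) = smult A" "one (opposite A) = one A" "ring.zero (opposite A) = ring.zero A"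
  "x \<otimes>\<^bsub>opposite A\<^esub> y = y \<cdot> x"
  by (simp_all add: opposite_def)

text \<open>The opposite algebra has the same additive group and scalars, so \<open>Ae\<close> can
  be treated as a tensor square of \<open>A\<close>.\<close>

lemma tAe: "is_tensor (carrier K) A (\<lambda>x k. k \<odot>\<^bsub>A\<^esub> x) A (\<lambda>k y. k \<odot>\<^bsub>A\<^esub> y) Ae Ae_pure"
proof -
  have "is_tensor (carrier K) A (\<lambda>x k. k \<odot>\<^bsub>A\<^esub> x) (opposite A) (\<lambda>k y. k \<odot>\<^bsub>opposite A\<^esub> y) Ae Ae_pure"
    unfolding Ae_def Ae_pure_def
    by (rule is_tensor_ktensor[OF AK.module_axioms unital_algebraD(1)[OF unital_algebra_opposite[OF unital_algebra_A]]])
  then show ?thesis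
    by (simp add: is_tensor_def tensor_group_def tensor_null_def tensor_relators_def pure_tensor_def[abs_def] A_group)
qed

lemma Ae_mult_pure: "\<lbrakk>a \<in> carrier A; b \<in> carrier A; c \<in> carrier A; d \<in> carrier A\<rbrakk>
    \<Longrightarrow> Ae_pure a b \<otimes>\<^bsub>Ae\<^esub> Ae_pure c d = Ae_pure (a \<cdot> c) (d \<cdot> b)"
  and Ae_one: "\<one>\<^bsub>Ae\<^esub> = Ae_pure \<one>\<^bsub>A\<^esub> \<one>\<^bsub>A\<^esub>"
  and Ae_module: "module K Ae"
  and Ae_smult: "\<lbrakk>k \<in> carrier K; m \<in> carrier A; n \<in> carrier A\<rbrakk> \<Longrightarrow> k \<odot>\<^bsub>Ae\<^esub> Ae_pure m n = Ae_pure (k \<odot>\<^bsub>A\<^esub> m) n"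
  using ktensor_algebra[OF unital_algebra_A unital_algebra_opposite[OF unital_algebra_A]]
    ktensor_module[OF AK.module_axioms unital_algebraD(1)[OF unital_algebra_opposite[OF unital_algebra_A]]]
  by (simp_all add: Ae_def Ae_pure_def)

lemmas Ae_group = is_tensor_group[OF tAe]
lemmas Ae_closed = pure_closed[OF tAe] and Ae_add = pure_add_left[OF tAe] pure_add_right[OF tAe]
  and Ae_act = pure_act[OF tAe]

definition "rAe y = tensor_lift Ae (\<lambda>a a'. Ae_pure a (a' \<cdot> y))"
definition "lAe y = tensor_lift Ae (\<lambda>a a'. Ae_pure (y \<cdot> a) a')"

lemma rAe_bal: "y \<in> carrier A \<Longrightarrow>
    kbal A A Ae (\<lambda>a a'. Ae_pure a (a' \<cdot> y))"
  and lAe_bal: "y \<in> carrier A \<Longrightarrow>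
    kbal A A Ae (\<lambda>a a'. Ae_pure (y \<cdot> a) a')"
  by (rule balancedI; simp add: Ae_closed Ae_add A.r_distr A.l_distr A_smult Ae_act)+

lemmas rAe_hom = tensor_lift_hom[OF tAe Ae_group rAe_bal, folded rAe_def]
  and rAe_pure = tensor_lift_pure[OF tAe Ae_group rAe_bal, folded rAe_def]
  and lAe_hom = tensor_lift_hom[OF tAe Ae_group lAe_bal, folded lAe_def]
  and lAe_pure = tensor_lift_pure[OF tAe Ae_group lAe_bal, folded lAe_def]
lemmas rAe_closed = add_hom_closed[OF rAe_hom] and lAe_closed = add_hom_closed[OF lAe_hom]

lemma Ae_ring: "ring Ae" by (rule unital_algebraD(2)[OF Ae_algebra])

lemma Ae_mult_hom: "X \<in> carrier Ae \<Longrightarrow> add_hom Ae Ae (\<lambda>Y. Y \<otimes>\<^bsub>Ae\<^esub> X)" "X \<in> carrier Ae \<Longrightarrow> add_hom Ae Ae (\<lambda>Y. X \<otimes>\<^bsub>Ae\<^esub> Y)"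
proof -
  interpret Ae: ring Ae by (rule Ae_ring)
  show "X \<in> carrier Ae \<Longrightarrow> add_hom Ae Ae (\<lambda>Y. Y \<otimes>\<^bsub>Ae\<^esub> X)" "X \<in> carrier Ae \<Longrightarrow> add_hom Ae Ae (\<lambda>Y. X \<otimes>\<^bsub>Ae\<^esub> Y)"
    by (auto intro!: add_homI simp: Ae.l_distr Ae.r_distr)
qed

text \<open>The product is reversed in the second factor: left multiplication by
  \<open>1 \<otimes> b\<close> in \<open>Ae\<close> is right multiplication by \<open>b\<close> in
  \<open>A\<close>.\<close>

lemma source_mult: "\<lbrakk>b \<in> carrier A; X \<in> carrier Ae\<rbrakk> \<Longrightarrow> source b \<otimes>\<^bsub>Ae\<^esub> X = lAe b X"
  and target_mult: "\<lbrakk>b \<in> carrier A; X \<in> carrier Ae\<rbrakk> \<Longrightarrow> target b \<otimes>\<^bsub>Ae\<^esub> X = rAe b X"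
  unfolding source_def target_def
  by (rule tensor_ext[OF tAe Ae_group Ae_mult_hom(2) lAe_hom];
      simp add: Ae_closed Ae_mult_pure lAe_pure)
    (rule tensor_ext[OF tAe Ae_group Ae_mult_hom(2) rAe_hom];
      simp add: Ae_closed Ae_mult_pure rAe_pure)

lemma rAe_mult: "\<lbrakk>y \<in> carrier A; y' \<in> carrier A; X \<in> carrier Ae\<rbrakk> \<Longrightarrow> rAe y' (rAe y X) = rAe (y \<cdot> y') X"
  by (rule tensor_ext[OF tAe Ae_group add_hom_comp[OF rAe_hom rAe_hom] rAe_hom])
    (simp_all add: rAe_pure A.m_assoc)

lemma rAe_one: "X \<in> carrier Ae \<Longrightarrow> rAe \<one>\<^bsub>A\<^esub> X = X"
  by (rule tensor_ext[OF tAe Ae_group rAe_hom add_hom_id]) (simp_all add: rAe_pure)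

lemma rAe_add: "\<lbrakk>y \<in> carrier A; y' \<in> carrier A; X \<in> carrier Ae\<rbrakk> \<Longrightarrow> rAe (y \<oplus>\<^bsub>A\<^esub> y') X = rAe y X \<oplus>\<^bsub>Ae\<^esub> rAe y' X"
  by (rule tensor_ext[OF tAe Ae_group rAe_hom add_hom_plus[OF Ae_group rAe_hom rAe_hom]])
    (simp_all add: rAe_pure A.r_distr Ae_add)

lemma rAe_lAe: "\<lbrakk>y \<in> carrier A; y' \<in> carrier A; X \<in> carrier Ae\<rbrakk> \<Longrightarrow> rAe y (lAe y' X) = lAe y' (rAe y X)"
  by (rule tensor_ext[OF tAe Ae_group add_hom_comp[OF rAe_hom lAe_hom] add_hom_comp[OF lAe_hom rAe_hom]])
    (simp_all add: rAe_pure lAe_pure)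

text \<open>The bialgebroid will be the equalizer of these two maps; \<open>D1 (a \<otimes> a') = a\<^bsub>(0)\<^esub> \<otimes> (1 \<otimes> a\<^bsub>(1)\<^esub>) \<rho>(a')\<close>.\<close>

definition "D1 = tensor_lift AR (\<lambda>a a'. rAR (\<rho> a') (\<Theta> (\<rho> a)))"
definition "D2 = tensor_lift AR (\<lambda>a a'. pAR a (\<iota> a'))"

lemma D1_bal: "kbal A A AR (\<lambda>a a'. rAR (\<rho> a') (\<Theta> (\<rho> a)))"
  by (rule balancedI)
    (simp_all add: \<rho>_add \<rho>_smult rAR_add rAR_smult \<Theta>_smult add_hom_add[OF rAR_hom] add_hom_add[OF \<Theta>_hom])

lemma D2_bal: "kbal A A AR (\<lambda>a a'. pAR a (\<iota> a'))"
  by (rule balancedI) (simp_all add: AR_closed AR_add \<iota>_add \<iota>_smult AR_act)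

lemmas D1_hom = tensor_lift_hom[OF tAe AR_group D1_bal, folded D1_def]
  and D1_pure = tensor_lift_pure[OF tAe AR_group D1_bal, folded D1_def]
  and D2_hom = tensor_lift_hom[OF tAe AR_group D2_bal, folded D2_def]
  and D2_pure = tensor_lift_pure[OF tAe AR_group D2_bal, folded D2_def]
lemmas D1_closed [simp] = add_hom_closed[OF D1_hom] and D2_closed [simp] = add_hom_closed[OF D2_hom]

text \<open>\<open>D1\<close> converts right multiplication by \<open>y\<close> into
  \<open>\<rho> y\<close>, \<open>D2\<close> converts it into \<open>\<iota> y\<close>. These
  coincide for coinvariant \<open>y\<close>, which is why the equalizer is a right
  \<open>B\<close>-module.\<close>

lemma D1_rAe: "\<lbrakk>y \<in> carrier A; X \<in> carrier Ae\<rbrakk> \<Longrightarrow> D1 (rAe y X) = rAR (\<rho> y) (D1 X)"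
  by (rule tensor_ext[OF tAe AR_group add_hom_comp[OF D1_hom rAe_hom] add_hom_comp[OF rAR_hom D1_hom]])
    (simp_all add: rAe_pure D1_pure rAR_mult \<rho>_mult)

lemma D2_rAe: "\<lbrakk>y \<in> carrier A; X \<in> carrier Ae\<rbrakk> \<Longrightarrow> D2 (rAe y X) = rAR (\<iota> y) (D2 X)"
  by (rule tensor_ext[OF tAe AR_group add_hom_comp[OF D2_hom rAe_hom] add_hom_comp[OF rAR_hom D2_hom]])
    (simp_all add: rAe_pure D2_pure rAR_pure \<iota>_mult)

lemma \<Delta>_closed [simp]: "h \<in> carrier H \<Longrightarrow> \<Delta> h \<in> carrier (ktensor K H H)"
  and \<Delta>_add: "\<lbrakk>h \<in> carrier H; h' \<in> carrier H\<rbrakk> \<Longrightarrow> \<Delta> (h \<oplus>\<^bsub>H\<^esub> h') = \<Delta> h \<oplus>\<^bsub>ktensor K H H\<^esub> \<Delta> h'"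
  and \<Delta>_smult: "\<lbrakk>k \<in> carrier K; h \<in> carrier H\<rbrakk> \<Longrightarrow> \<Delta> (k \<odot>\<^bsub>H\<^esub> h) = k \<odot>\<^bsub>ktensor K H H\<^esub> \<Delta> h"
  using comult_hom by (auto simp: algebra_homs_def ring_hom_def linear_maps_def)

text \<open>Coassociativity \<open>a\<^bsub>(0)(0)\<^esub> \<otimes> a\<^bsub>(0)(1)\<^esub> \<otimes> a\<^bsub>(1)\<^esub> = a\<^bsub>(0)\<^esub> \<otimes> a\<^bsub>(1)(1)\<^esub> \<otimes> a\<^bsub>(1)(2)\<^esub>\<close>, evaluated on a
  trilinear map.\<close>

lemma coassoc_trilinear:
  assumes P: "abelian_group P"
    and f1: "\<And>h h'. \<lbrakk>h \<in> carrier H; h' \<in> carrier H\<rbrakk> \<Longrightarrow> add_hom A P (\<lambda>x. f x h h')"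
    and f2: "\<And>x h'. \<lbrakk>x \<in> carrier A; h' \<in> carrier H\<rbrakk> \<Longrightarrow> add_hom H P (\<lambda>h. f x h h')"
    and f3: "\<And>x h. \<lbrakk>x \<in> carrier A; h \<in> carrier H\<rbrakk> \<Longrightarrow> add_hom H P (\<lambda>h'. f x h h')"
    and k1: "\<And>k x h h'. \<lbrakk>k \<in> carrier K; x \<in> carrier A; h \<in> carrier H; h' \<in> carrier H\<rbrakk>
      \<Longrightarrow> f (k \<odot>\<^bsub>A\<^esub> x) h h' = f x (k \<odot>\<^bsub>H\<^esub> h) h'"
    and k2: "\<And>k x h h'. \<lbrakk>k \<in> carrier K; x \<in> carrier A; h \<in> carrier H; h' \<in> carrier H\<rbrakk>
      \<Longrightarrow> f x (k \<odot>\<^bsub>H\<^esub> h) h' = f x h (k \<odot>\<^bsub>H\<^esub> h')"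
    and a: "a \<in> carrier A"
  shows "tensor_lift P (\<lambda>x h. tensor_lift P (\<lambda>x' h'. f x' h' h) (\<rho> x)) (\<rho> a)
    = tensor_lift P (\<lambda>x h. tensor_lift P (\<lambda>h1 h2. f x h1 h2) (\<Delta> h)) (\<rho> a)"
proof -
  let ?HH = "ktensor K H H" and ?pHH = "ktensor_pure K H H"
  let ?A3 = "ktensor K A ?HH" and ?p3 = "ktensor_pure K A ?HH"
  note tHH = is_tensor_ktensor[OF HK.module_axioms HK.module_axioms]
  note HHm = ktensor_module[OF HK.module_axioms HK.module_axioms]
  note t3 = is_tensor_ktensor[OF AK.module_axioms HHm(1)]
  note gHH = is_tensor_group[OF tHH] and g3 = is_tensor_group[OF t3]
  note f = add_hom_closed[OF f1] add_hom_add[OF f1] add_hom_add[OF f2] add_hom_add[OF f3]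
  define G where "G x = tensor_lift P (\<lambda>h h'. f x h h')" for x
  have Gb: "kbal H H P (\<lambda>h h'. f x h h')" if "x \<in> carrier A" for x
    using that by (intro balancedI) (simp_all add: f k2)
  note Gh = tensor_lift_hom[OF tHH P Gb, folded G_def] and Gp = tensor_lift_pure[OF tHH P Gb, folded G_def]
  have Fb: "balanced (carrier K) A (\<lambda>x k. k \<odot>\<^bsub>A\<^esub> x) ?HH (\<lambda>k y. k \<odot>\<^bsub>?HH\<^esub> y) P G"
  proof (rule balancedI)
    show "G (x \<oplus>\<^bsub>A\<^esub> x') Z = G x Z \<oplus>\<^bsub>P\<^esub> G x' Z"
      if x: "x \<in> carrier A" "x' \<in> carrier A" and Z: "Z \<in> carrier ?HH" for x x' Z
      by (rule tensor_ext[OF tHH P Gh[OF A.a_closed[OF x]] add_hom_plus[OF P Gh[OF x(1)] Gh[OF x(2)]] _ Z])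
        (simp add: Gp x f)
    interpret HHK: module K ?HH by (rule HHm)
    show "G (k \<odot>\<^bsub>A\<^esub> x) Z = G x (k \<odot>\<^bsub>?HH\<^esub> Z)"
      if x: "x \<in> carrier A" and k: "k \<in> carrier K" and Z: "Z \<in> carrier ?HH" for x k Z
    proof -
      have kh: "add_hom ?HH ?HH (\<lambda>Z. k \<odot>\<^bsub>?HH\<^esub> Z)" using k by (intro add_homI) (auto simp: HHK.smult_r_distr)
      show ?thesis
        by (rule tensor_ext[OF tHH P Gh[OF AK.smult_closed[OF k x]] add_hom_comp[OF Gh[OF x] kh] _ Z])
          (simp add: Gp x k HHm(2) k1)
    qed
  qed (simp_all add: add_hom_closed[OF Gh] add_hom_add[OF Gh])
  \<comment> \<open>\<open>F\<close> is the additive map on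
    \<open>A \<otimes> (H \<otimes> H)\<close> induced by \<open>f\<close>; the claim is
    \<open>coaction_coassoc\<close> pushed through \<open>F\<close>.\<close>
  define F where "F = tensor_lift P G"
  note Fh = tensor_lift_hom[OF t3 P Fb, folded F_def] and Fp = tensor_lift_pure[OF t3 P Fb, folded F_def]
  have b1: "kbal A H ?A3 (\<lambda>x' h'. ?p3 x' (?pHH h' h))"
    if "h \<in> carrier H" for h
    using that by (intro balancedI)
      (simp_all add: pure_closed[OF t3] pure_closed[OF tHH] pure_add_left[OF t3] pure_add_right[OF t3] pure_add_left[OF tHH]
        pure_act[OF t3] HHm(2))
  have b2: "kbal A H ?A3 (\<lambda>x h. ?p3 x (\<Delta> h))"
    by (rule balancedI)
      (simp_all add: pure_closed[OF t3] pure_add_left[OF t3] pure_add_right[OF t3] \<Delta>_add \<Delta>_smult pure_act[OF t3])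
  define I where "I h = tensor_lift ?A3 (\<lambda>x' h'. ?p3 x' (?pHH h' h))" for h
  note Ih = tensor_lift_hom[OF tR g3 b1, folded I_def] and Ip = tensor_lift_pure[OF tR g3 b1, folded I_def]
  have I_add: "I (h \<oplus>\<^bsub>H\<^esub> h') Z = I h Z \<oplus>\<^bsub>?A3\<^esub> I h' Z"
    if h: "h \<in> carrier H" "h' \<in> carrier H" and Z: "Z \<in> carrier R" for h h' Z
    by (rule tensor_ext[OF tR g3 Ih[OF H.a_closed[OF h]] add_hom_plus[OF g3 Ih[OF h(1)] Ih[OF h(2)]] _ Z])
      (simp add: Ip h pure_add_right[OF t3] pure_add_right[OF tHH] pure_closed[OF tHH])
  have I_smult: "I h (k \<odot>\<^bsub>R\<^esub> Z) = I (k \<odot>\<^bsub>H\<^esub> h) Z"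
    if h: "h \<in> carrier H" and k: "k \<in> carrier K" and Z: "Z \<in> carrier R" for h k Z
  proof -
    have kh: "add_hom R R (\<lambda>Z. k \<odot>\<^bsub>R\<^esub> Z)" using k by (intro add_homI) (auto simp: RK.smult_r_distr)
    show ?thesis
      by (rule tensor_ext[OF tR g3 add_hom_comp[OF Ih[OF h] kh] Ih[OF HK.smult_closed[OF k h]] _ Z])
        (simp add: Ip pR_smult h k pure_act[OF t3] pure_closed[OF tHH] HHm(2) pure_act[OF tHH])
  qed
  have b3: "kbal A H ?A3 (\<lambda>x h. I h (\<rho> x))"
    by (rule balancedI)
      (simp_all add: \<rho>_add \<rho>_smult I_add I_smult add_hom_closed[OF Ih] add_hom_add[OF Ih])
  have FI: "F (I h Z) = tensor_lift P (\<lambda>x' h'. f x' h' h) Z" if h: "h \<in> carrier H" and Z: "Z \<in> carrier R" for h Z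
  proof -
    have "F (I h Z) = tensor_lift P (\<lambda>x' h'. F (?p3 x' (?pHH h' h))) Z"
      unfolding I_def by (rule tensor_lift_comp[OF tR g3 P b1[OF h] Fh Z])
    also have "\<dots> = tensor_lift P (\<lambda>x' h'. f x' h' h) Z"
      by (rule tensor_lift_cong[OF tR P balanced_comp[OF b1[OF h] Fh] _ Z])
        (simp add: Fp Gp pure_closed[OF tHH] h)
    finally show ?thesis .
  qed
  have "tensor_lift P (\<lambda>x h. tensor_lift P (\<lambda>x' h'. f x' h' h) (\<rho> x)) (\<rho> a) = tensor_lift P (\<lambda>x h. F (I h (\<rho> x))) (\<rho> a)"
    by (rule tensor_lift_cong[OF tR P balanced_comp[OF b3 Fh], symmetric]) (simp_all add: FI a)
  also have "\<dots> = F (tensor_lift ?A3 (\<lambda>x h. I h (\<rho> x)) (\<rho> a))"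
    by (rule tensor_lift_comp[OF tR g3 P b3 Fh, symmetric]) (simp add: a)
  also have "\<dots> = F (tensor_lift ?A3 (\<lambda>x h. ?p3 x (\<Delta> h)) (\<rho> a))"
    using coaction_coassoc[OF a] by (simp add: I_def)
  also have "\<dots> = tensor_lift P (\<lambda>x h. F (?p3 x (\<Delta> h))) (\<rho> a)"
    by (rule tensor_lift_comp[OF tR g3 P b2 Fh]) (simp add: a)
  also have "\<dots> = tensor_lift P (\<lambda>x h. tensor_lift P (\<lambda>h1 h2. f x h1 h2) (\<Delta> h)) (\<rho> a)"
    by (rule tensor_lift_cong[OF tR P balanced_comp[OF b2 Fh]]) (simp_all add: Fp G_def a)
  finally show ?thesis .
qed

end

section \<open>The translation map and the Ehresmann--Schauenburg bialgebroid\<close>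

context principal_comodule_algebra
begin

text \<open>Defined on all of \<open>A \<otimes> H\<close>, this is the left \<open>A\<close>-linear
  extension of the translation map: \<open>translation h = \<gamma> (\<eta> h)\<close>. Its
  properties are proved by applying \<open>can\<close>.\<close>

definition "\<gamma> = inv_into (carrier AA) can"

lemma can_bij: "bij_betw can (carrier AA) (carrier R)"
  using hopf_galois by (simp add: hopf_galois_def)

lemma \<gamma>_closed [simp]: "Z \<in> carrier R \<Longrightarrow> \<gamma> Z \<in> carrier AA"
  unfolding \<gamma>_def by (metis bij_betw_imp_surj_on[OF can_bij] inv_into_into)

lemma can_\<gamma>: "Z \<in> carrier R \<Longrightarrow> can (\<gamma> Z) = Z"
  unfolding \<gamma>_def by (metis bij_betw_imp_surj_on[OF can_bij] f_inv_into_f)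

lemma \<gamma>_can: "z \<in> carrier AA \<Longrightarrow> \<gamma> (can z) = z"
  unfolding \<gamma>_def by (simp add: bij_betw_imp_inj_on[OF can_bij])

lemma can_closed [simp]: "z \<in> carrier AA \<Longrightarrow> can z \<in> carrier R"
  by (rule add_hom_closed[OF can_hom])

lemma \<gamma>_eqI: "\<lbrakk>z \<in> carrier AA; can z = Z\<rbrakk> \<Longrightarrow> \<gamma> Z = z"
  using \<gamma>_can by blast

lemma \<gamma>_hom: "add_hom R AA \<gamma>"
  by (rule add_homI) (auto intro!: \<gamma>_eqI ag_closed AA_group simp: add_hom_add[OF can_hom] can_\<gamma>)

lemma lA_closed [simp]: "\<lbrakk>x \<in> carrier A; z \<in> carrier AA\<rbrakk> \<Longrightarrow> lA x z \<in> carrier AA"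
  and rA_closed [simp]: "\<lbrakk>x \<in> carrier A; z \<in> carrier AA\<rbrakk> \<Longrightarrow> rA x z \<in> carrier AA"
  by (simp_all add: add_hom_closed[OF lA_hom] add_hom_closed[OF rA_hom])

lemma \<gamma>_\<iota>_mult: "\<lbrakk>x \<in> carrier A; Z \<in> carrier R\<rbrakk> \<Longrightarrow> \<gamma> (\<iota> x \<star> Z) = lA x (\<gamma> Z)"
  by (rule \<gamma>_eqI) (simp_all add: can_lA can_\<gamma>)

lemma \<gamma>_mult_\<rho>: "\<lbrakk>x \<in> carrier A; Z \<in> carrier R\<rbrakk> \<Longrightarrow> \<gamma> (Z \<star> \<rho> x) = rA x (\<gamma> Z)"
  by (rule \<gamma>_eqI) (simp_all add: can_rA can_\<gamma>)

lemma \<gamma>_\<rho>: "q \<in> carrier A \<Longrightarrow> \<gamma> (\<rho> q) = AA_pure \<one>\<^bsub>A\<^esub> q"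
  by (rule \<gamma>_eqI) (simp_all add: can_pure AA_closed \<iota>_one)

lemma \<gamma>_\<iota>: "q \<in> carrier A \<Longrightarrow> \<gamma> (\<iota> q) = AA_pure q \<one>\<^bsub>A\<^esub>"
  by (rule \<gamma>_eqI) (simp_all add: can_pure AA_closed \<rho>_one)

lemma \<gamma>_\<eta>: "translation h = \<gamma> (\<eta> h)"
  by (simp add: translation_def \<gamma>_def \<eta>_def)

lemma mA_\<gamma>: "Z \<in> carrier R \<Longrightarrow> mA (\<gamma> Z) = \<epsilon>R Z"
  using mA_\<epsilon>R[of "\<gamma> Z"] by (simp add: can_\<gamma>)

lemma can_smult: "\<lbrakk>k \<in> carrier K; z \<in> carrier AA\<rbrakk> \<Longrightarrow> can (k \<odot>\<^bsub>AA\<^esub> z) = k \<odot>\<^bsub>R\<^esub> can z"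
  unfolding can_def
  by (rule tensor_lift_smult[OF tAA RK.module_axioms can_bal AA_module _ AK.module_axioms])
    (simp_all add: AA_smult can_inner \<iota>_smult R_smult)

lemma \<gamma>_smult: "\<lbrakk>k \<in> carrier K; Z \<in> carrier R\<rbrakk> \<Longrightarrow> \<gamma> (k \<odot>\<^bsub>R\<^esub> Z) = k \<odot>\<^bsub>AA\<^esub> \<gamma> Z"
  by (rule \<gamma>_eqI) (simp_all add: can_smult can_\<gamma> module.smult_closed[OF AA_module])

subsection \<open>The bialgebroid as an equalizer\<close>

text \<open>Applying \<open>\<gamma>\<close> to the second factor sends \<open>D1 X\<close> and
  \<open>D2 X\<close> to the two sides of the defining equation, and applying \<open>can\<close>
  there undoes this. So the equation may be tested in
  \<open>A \<otimes> (A \<otimes> H)\<close>.\<close>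

lemma ES_iff: "X \<in> carrier ES \<longleftrightarrow> X \<in> carrier Ae \<and> D1 X = D2 X"
proof -
  let ?T = "ktensor K A AA" and ?p = "ktensor_pure K A AA"
  note t = is_tensor_ktensor[OF AK.module_axioms AA_module]
  note gt = is_tensor_group[OF t]
  interpret AAK: module K AA by (rule AA_module)
  have gb: "kbal A R ?T (\<lambda>x Z. ?p x (\<gamma> Z))"
    by (rule balancedI)
      (simp_all add: pure_closed[OF t] pure_add_left[OF t] pure_add_right[OF t] add_hom_add[OF \<gamma>_hom] \<gamma>_smult pure_act[OF t])
  define G where "G = tensor_lift ?T (\<lambda>x Z. ?p x (\<gamma> Z))"
  note Gh = tensor_lift_hom[OF tAR gt gb, folded G_def] and Gp = tensor_lift_pure[OF tAR gt gb, folded G_def]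
  have cb: "balanced (carrier K) A (\<lambda>x k. k \<odot>\<^bsub>A\<^esub> x) AA (\<lambda>k y. k \<odot>\<^bsub>AA\<^esub> y) AR (\<lambda>x z. pAR x (can z))"
    by (rule balancedI)
      (simp_all add: AR_closed AR_add add_hom_add[OF can_hom] can_smult AR_act)
  define C where "C = tensor_lift AR (\<lambda>x z. pAR x (can z))"
  note Ch = tensor_lift_hom[OF t AR_group cb, folded C_def] and Cp = tensor_lift_pure[OF t AR_group cb, folded C_def]
  have CG: "C (G W) = W" if "W \<in> carrier AR" for W
    by (rule tensor_ext[OF tAR AR_group add_hom_comp[OF Ch Gh] add_hom_id _ that]) (simp add: Gp Cp can_\<gamma>)
  \<comment> \<open>Uses \<open>h<1> \<otimes> h<2> a' = \<gamma> (\<eta> h \<star> \<rho>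
    a')\<close>, the right linearity of \<open>\<gamma>\<close> along \<open>\<rho>\<close>.\<close>
  have inner: "tensor_lift ?T (\<lambda>x h. ?p x (rA a' (translation h))) Z = G (rAR (\<rho> a') (\<Theta> Z))"
    if a': "a' \<in> carrier A" and Z: "Z \<in> carrier R" for a' Z
  proof (rule tensor_lift_unique[OF tR gt _ add_hom_comp[OF Gh add_hom_comp[OF rAR_hom \<Theta>_hom]] _ Z])
    have e: "G (rAR (\<rho> a') (pAR x (\<eta> h))) = ?p x (rA a' (translation h))"
      if "x \<in> carrier A" "h \<in> carrier H" for x h
      using that a' by (simp add: rAR_pure Gp \<gamma>_mult_\<rho> \<gamma>_\<eta>)
    show "kbal A H ?T (\<lambda>x h. ?p x (rA a' (translation h)))"
      by (rule balanced_cong[OF tR balanced_comp[OF \<Theta>_bal add_hom_comp[OF Gh rAR_hom]] e]) (simp_all add: a')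
    show "G (rAR (\<rho> a') (\<Theta> (pR x h))) = ?p x (rA a' (translation h))" if "x \<in> carrier A" "h \<in> carrier H" for x h
      using that e \<Theta>_pure[of x h] by (simp add: \<iota>_\<eta>)
  qed (simp add: a')
  have \<alpha>: "tensor_lift ?T (\<lambda>a a'. tensor_lift ?T (\<lambda>x h. ?p x (tensor_lift AA (\<lambda>p q. AA_pure p (q \<cdot> a')) (translation h))) (\<rho> a)) X
      = G (D1 X)" if X: "X \<in> carrier Ae" for X
  proof -
    have "G (D1 X) = tensor_lift ?T (\<lambda>a a'. G (rAR (\<rho> a') (\<Theta> (\<rho> a)))) X"
      unfolding D1_def by (rule tensor_lift_comp[OF tAe AR_group gt D1_bal Gh X])
    also have "\<dots> = tensor_lift ?T (\<lambda>a a'. tensor_lift ?T (\<lambda>x h. ?p x (rA a' (translation h))) (\<rho> a)) X"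
      by (rule tensor_lift_cong[OF tAe gt balanced_comp[OF D1_bal Gh] _ X]) (simp add: inner)
    finally show ?thesis by (simp add: rA_def)
  qed
  have \<beta>: "tensor_lift ?T (\<lambda>a a'. ?p a (AA_pure a' \<one>\<^bsub>A\<^esub>)) X = G (D2 X)" if X: "X \<in> carrier Ae" for X
  proof -
    have "G (D2 X) = tensor_lift ?T (\<lambda>a a'. G (pAR a (\<iota> a'))) X"
      unfolding D2_def by (rule tensor_lift_comp[OF tAe AR_group gt D2_bal Gh X])
    also have "\<dots> = tensor_lift ?T (\<lambda>a a'. ?p a (AA_pure a' \<one>\<^bsub>A\<^esub>)) X"
      by (rule tensor_lift_cong[OF tAe gt balanced_comp[OF D2_bal Gh] _ X]) (simp add: Gp \<gamma>_\<iota>)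
    finally show ?thesis by simp
  qed
  have "X \<in> carrier ES \<longleftrightarrow> X \<in> carrier Ae \<and> G (D1 X) = G (D2 X)"
    using \<alpha>[of X] \<beta>[of X] by (auto simp: ES_def)
  also have "\<dots> \<longleftrightarrow> X \<in> carrier Ae \<and> D1 X = D2 X"
    using CG D1_closed D2_closed by metis
  finally show ?thesis .
qed

lemma ES_simps [simp]: "mult ES = mult Ae" "one ES = one Ae" "ring.zero ES = ring.zero Ae"
  "add ES = add Ae" "smult ES = smult Ae"
  by (simp_all add: ES_def)

lemma ES_Ae: "X \<in> carrier ES \<Longrightarrow> X \<in> carrier Ae"
  and ES_D: "X \<in> carrier ES \<Longrightarrow> D1 X = D2 X"
  by (simp_all add: ES_iff)

lemma ES_add: "\<lbrakk>X \<in> carrier ES; Y \<in> carrier ES\<rbrakk> \<Longrightarrow> X \<oplus>\<^bsub>Ae\<^esub> Y \<in> carrier ES"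
  by (simp add: ES_iff ag_closed Ae_group add_hom_add[OF D1_hom] add_hom_add[OF D2_hom])

lemma ES_group: "abelian_group ES"
proof -
  interpret Ae: abelian_group Ae by (rule Ae_group)
  have z: "\<zero>\<^bsub>Ae\<^esub> \<in> carrier ES"
    by (simp add: ES_iff add_hom_zero[OF Ae_group AR_group D1_hom] add_hom_zero[OF Ae_group AR_group D2_hom])
  have n: "\<ominus>\<^bsub>Ae\<^esub> X \<in> carrier ES" if "X \<in> carrier ES" for X
    using that by (simp add: ES_iff add_hom_neg[OF Ae_group AR_group D1_hom] add_hom_neg[OF Ae_group AR_group D2_hom])
  show ?thesis
  proof (rule abelian_groupI)
    fix X assume X: "X \<in> carrier ES"
    show "\<exists>Y\<in>carrier ES. Y \<oplus>\<^bsub>ES\<^esub> X = \<zero>\<^bsub>ES\<^esub>"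
      using X by (intro bexI[OF _ n]) (simp_all add: Ae.l_neg ES_Ae)
  qed (auto simp: ES_add z Ae.a_ac ES_Ae)
qed

lemma ES_one: "\<one>\<^bsub>Ae\<^esub> \<in> carrier ES"
  using \<Theta>_pure[of "\<one>\<^bsub>A\<^esub>" "\<one>\<^bsub>H\<^esub>"]
  by (simp add: ES_iff Ae_one Ae_closed D1_pure D2_pure \<rho>_one rAR_one \<iota>_one \<eta>_one AR_closed)

section \<open>Closure of the bialgebroid under the \<open>B\<close>-actions and the product\<close>

definition "lAR y = tensor_lift AR (\<lambda>a Z. pAR (y \<cdot> a) Z)"

lemma lAR_bal: "y \<in> carrier A \<Longrightarrow>
    kbal A R AR (\<lambda>a Z. pAR (y \<cdot> a) Z)"
  by (rule balancedI) (simp_all add: AR_closed AR_add A.r_distr A_smult AR_act)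

lemmas lAR_hom = tensor_lift_hom[OF tAR AR_group lAR_bal, folded lAR_def]
  and lAR_pure = tensor_lift_pure[OF tAR AR_group lAR_bal, folded lAR_def]

lemma lAR_rAR: "\<lbrakk>y \<in> carrier A; Z \<in> carrier R; W \<in> carrier AR\<rbrakk> \<Longrightarrow> rAR Z (lAR y W) = lAR y (rAR Z W)"
  by (rule tensor_ext[OF tAR AR_group add_hom_comp[OF rAR_hom lAR_hom] add_hom_comp[OF lAR_hom rAR_hom]])
    (simp_all add: rAR_pure lAR_pure)

lemma \<Theta>_\<iota>_mult: "\<lbrakk>y \<in> carrier A; Z \<in> carrier R\<rbrakk> \<Longrightarrow> \<Theta> (\<iota> y \<star> Z) = lAR y (\<Theta> Z)"
  by (rule R_ext[OF AR_group add_hom_comp[OF \<Theta>_hom R_mult_hom(2)] add_hom_comp[OF lAR_hom \<Theta>_hom]])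
    (simp_all add: \<Theta>_pure lAR_pure R.m_assoc[symmetric] flip: \<iota>_mult)

lemma D1_lAe: "\<lbrakk>b \<in> coinv; X \<in> carrier Ae\<rbrakk> \<Longrightarrow> D1 (lAe b X) = lAR b (D1 X)"
  by (rule tensor_ext[OF tAe AR_group add_hom_comp[OF D1_hom lAe_hom] add_hom_comp[OF lAR_hom D1_hom]])
    (simp_all add: lAe_pure D1_pure lAR_rAR \<rho>_mult coinv_\<rho> \<Theta>_\<iota>_mult)

lemma D2_lAe: "\<lbrakk>b \<in> carrier A; X \<in> carrier Ae\<rbrakk> \<Longrightarrow> D2 (lAe b X) = lAR b (D2 X)"
  by (rule tensor_ext[OF tAe AR_group add_hom_comp[OF D2_hom lAe_hom] add_hom_comp[OF lAR_hom D2_hom]])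
    (simp_all add: lAe_pure D2_pure lAR_pure)

lemma ES_lAe: "\<lbrakk>b \<in> coinv; X \<in> carrier ES\<rbrakk> \<Longrightarrow> lAe b X \<in> carrier ES"
  and ES_rAe: "\<lbrakk>b \<in> coinv; X \<in> carrier ES\<rbrakk> \<Longrightarrow> rAe b X \<in> carrier ES"
  by (simp_all add: ES_iff lAe_closed rAe_closed D1_lAe D2_lAe D1_rAe D2_rAe coinv_\<rho>)

lemma scal_lAe: "\<lbrakk>k \<in> carrier K; X \<in> carrier Ae\<rbrakk> \<Longrightarrow> k \<odot>\<^bsub>Ae\<^esub> X = lAe (scal k) X"
proof -
  interpret AeK: module K Ae by (rule Ae_module)
  show "\<lbrakk>k \<in> carrier K; X \<in> carrier Ae\<rbrakk> \<Longrightarrow> k \<odot>\<^bsub>Ae\<^esub> X = lAe (scal k) X"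
    by (rule tensor_ext[OF tAe Ae_group _ lAe_hom])
      (auto intro!: add_homI simp: AeK.smult_r_distr Ae_smult lAe_pure scal_coinv scal_left)
qed

lemma ES_smult: "\<lbrakk>k \<in> carrier K; X \<in> carrier ES\<rbrakk> \<Longrightarrow> k \<odot>\<^bsub>Ae\<^esub> X \<in> carrier ES"
  by (simp add: scal_lAe ES_Ae ES_lAe scal_coinv)

text \<open>Left multiplication by \<open>x \<otimes> h\<close> in the outer factors, \<open>w \<otimes> Y \<mapsto> x w \<otimes> (1 \<otimes> h) Y\<close>.\<close>

definition "lm W = tensor_lift AR (\<lambda>x h. lAR x (tensor_lift AR (\<lambda>w Y. pAR w (\<eta> h \<star> Y)) W))"

lemma lm_inner_bal: "h \<in> carrier H \<Longrightarrow>
    kbal A R AR (\<lambda>w Y. pAR w (\<eta> h \<star> Y))"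
  by (rule balancedI) (simp_all add: AR_closed AR_add R.r_distr R_smult AR_act)

lemma lm_props:
  assumes W: "W \<in> carrier AR"
  shows "add_hom R AR (lm W)"
    and "\<lbrakk>x \<in> carrier A; h \<in> carrier H\<rbrakk> \<Longrightarrow> lm W (\<iota> x \<star> \<eta> h) = lAR x (tensor_lift AR (\<lambda>w Y. pAR w (\<eta> h \<star> Y)) W)"
    and "\<lbrakk>k \<in> carrier K; Z \<in> carrier R\<rbrakk> \<Longrightarrow> lm W (k \<odot>\<^bsub>R\<^esub> Z) = k \<odot>\<^bsub>AR\<^esub> lm W Z"
proof -
  define n where "n h = tensor_lift AR (\<lambda>w Y. pAR w (\<eta> h \<star> Y))" for h
  note nh = tensor_lift_hom[OF tAR AR_group lm_inner_bal, folded n_def]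
    and np = tensor_lift_pure[OF tAR AR_group lm_inner_bal, folded n_def]
  have n_add: "n (h \<oplus>\<^bsub>H\<^esub> h') W = n h W \<oplus>\<^bsub>AR\<^esub> n h' W" if "h \<in> carrier H" "h' \<in> carrier H" for h h'
    by (rule tensor_ext[OF tAR AR_group nh add_hom_plus[OF AR_group nh nh] _ W])
      (simp_all add: that np \<eta>_add R.l_distr AR_add)
  have l_add: "lAR (x \<oplus>\<^bsub>A\<^esub> x') W = lAR x W \<oplus>\<^bsub>AR\<^esub> lAR x' W" if "x \<in> carrier A" "x' \<in> carrier A" "W \<in> carrier AR" for x x' W
    by (rule tensor_ext[OF tAR AR_group lAR_hom add_hom_plus[OF AR_group lAR_hom lAR_hom] _ that(3)])
      (simp_all add: that lAR_pure A.l_distr AR_add)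
  have act: "lAR (k \<odot>\<^bsub>A\<^esub> x) (n h W) = lAR x (n (k \<odot>\<^bsub>H\<^esub> h) W)"
    if "x \<in> carrier A" "h \<in> carrier H" "k \<in> carrier K" for k x h
    by (rule tensor_ext[OF tAR AR_group add_hom_comp[OF lAR_hom nh] add_hom_comp[OF lAR_hom nh] _ W])
      (simp_all add: that lAR_pure np \<eta>_smult R_smult A_smult AR_act)
  have b: "kbal A H AR (\<lambda>x h. lAR x (n h W))"
    by (rule balancedI)
      (simp_all add: n_add l_add act W add_hom_closed[OF nh] add_hom_closed[OF lAR_hom] add_hom_add[OF lAR_hom])
  show "add_hom R AR (lm W)"
    using tensor_lift_hom[OF tR AR_group b] by (simp add: lm_def n_def)
  show "\<lbrakk>x \<in> carrier A; h \<in> carrier H\<rbrakk> \<Longrightarrow> lm W (\<iota> x \<star> \<eta> h) = lAR x (tensor_lift AR (\<lambda>w Y. pAR w (\<eta> h \<star> Y)) W)"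
    using tensor_lift_pure[OF tR AR_group b] by (simp add: lm_def n_def \<iota>_\<eta>)
  interpret ARK: module K AR by (rule AR_module)
  have ls: "lAR (k \<odot>\<^bsub>A\<^esub> x) V = k \<odot>\<^bsub>AR\<^esub> lAR x V" if "k \<in> carrier K" "x \<in> carrier A" "V \<in> carrier AR" for k x V
  proof -
    have "add_hom AR AR (\<lambda>V. k \<odot>\<^bsub>AR\<^esub> V)" using that by (intro add_homI) (auto simp: ARK.smult_r_distr)
    from tensor_ext[OF tAR AR_group lAR_hom add_hom_comp[OF this lAR_hom] _ that(3)] show ?thesis
      using that by (simp add: lAR_pure AR_smult A_smult)
  qed
  show "lm W (k \<odot>\<^bsub>R\<^esub> Z) = k \<odot>\<^bsub>AR\<^esub> lm W Z" if "k \<in> carrier K" "Z \<in> carrier R"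
    using tensor_lift_smult[OF tR AR_module b RK.module_axioms pR_smult AK.module_axioms _ that(1) that(2)] that
    by (simp add: lm_def n_def[symmetric] ls add_hom_closed[OF nh] W)
qed

lemma lm_pure:
  assumes "x \<in> carrier A" "h \<in> carrier H" "w \<in> carrier A" "Y \<in> carrier R"
  shows "lm (pAR w Y) (\<iota> x \<star> \<eta> h) = pAR (x \<cdot> w) (\<eta> h \<star> Y)"
  using assms by (simp add: lm_props(2) AR_closed tensor_lift_pure[OF tAR AR_group lm_inner_bal] lAR_pure)

lemma lm_closed: "\<lbrakk>W \<in> carrier AR; Z \<in> carrier R\<rbrakk> \<Longrightarrow> lm W Z \<in> carrier AR"
  by (rule add_hom_closed[OF lm_props(1)])

lemma lm_hom:
  assumes Z: "Z \<in> carrier R"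
  shows "add_hom AR AR (\<lambda>W. lm W Z)"
proof (rule add_homI)
  fix V W assume V: "V \<in> carrier AR" and W: "W \<in> carrier AR"
  have VW: "V \<oplus>\<^bsub>AR\<^esub> W \<in> carrier AR" by (rule ag_closed[OF AR_group V W])
  note i = tensor_lift_hom[OF tAR AR_group lm_inner_bal]
  show "lm (V \<oplus>\<^bsub>AR\<^esub> W) Z = lm V Z \<oplus>\<^bsub>AR\<^esub> lm W Z"
    by (rule R_ext[OF AR_group lm_props(1)[OF VW] add_hom_plus[OF AR_group lm_props(1)[OF V] lm_props(1)[OF W]] _ Z])
      (simp add: lm_props(2) V W VW add_hom_add[OF i] add_hom_closed[OF i] add_hom_add[OF lAR_hom])
qed (rule lm_closed[OF _ Z])

lemma lm_rAR:
  assumes Z: "Z \<in> carrier R" and Z': "Z' \<in> carrier R" and W: "W \<in> carrier AR"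
  shows "lm (rAR Z' W) Z = rAR Z' (lm W Z)"
proof (rule R_ext[OF AR_group lm_props(1)[OF rAR_closed[OF Z' W]] add_hom_comp[OF rAR_hom[OF Z'] lm_props(1)[OF W]] _ Z])
  fix x h assume x: "x \<in> carrier A" and h: "h \<in> carrier H"
  have xh: "\<iota> x \<star> \<eta> h \<in> carrier R" using x h by simp
  show "lm (rAR Z' W) (\<iota> x \<star> \<eta> h) = rAR Z' (lm W (\<iota> x \<star> \<eta> h))"
    by (rule tensor_ext[OF tAR AR_group add_hom_comp[OF lm_hom[OF xh] rAR_hom[OF Z']] add_hom_comp[OF rAR_hom[OF Z'] lm_hom[OF xh]] _ W])
      (simp add: rAR_pure lm_pure x h Z' R.m_assoc)
qed

lemma lm_\<Theta>:
  assumes Z: "Z \<in> carrier R" and Z': "Z' \<in> carrier R"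
  shows "lm (\<Theta> Z') Z = \<Theta> (Z \<star> Z')"
proof (rule R_ext[OF AR_group lm_props(1)[OF \<Theta>_closed[OF Z']] add_hom_comp[OF \<Theta>_hom R_mult_hom(1)[OF Z']] _ Z])
  fix x h assume x: "x \<in> carrier A" and h: "h \<in> carrier H"
  have xh: "\<iota> x \<star> \<eta> h \<in> carrier R" using x h by simp
  have m: "(\<iota> x \<star> \<eta> h) \<star> (\<iota> y \<star> \<eta> h') = \<iota> (x \<cdot> y) \<star> \<eta> (h \<otimes>\<^bsub>H\<^esub> h')"
    if "y \<in> carrier A" "h' \<in> carrier H" for y h'
    using that x h by (simp add: \<iota>_\<eta> pR_mult)
  show "lm (\<Theta> Z') (\<iota> x \<star> \<eta> h) = \<Theta> (\<iota> x \<star> \<eta> h \<star> Z')"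
    by (rule R_ext[OF AR_group add_hom_comp[OF lm_hom[OF xh] \<Theta>_hom] add_hom_comp[OF \<Theta>_hom R_mult_hom(2)[OF xh]] _ Z'])
      (simp add: m \<Theta>_pure lm_pure x h \<eta>_mult[symmetric])
qed

text \<open>\<open>D1\<close> of a product nests \<open>D1 Y\<close> between the legs of
  \<open>D1 X\<close>. Since \<open>Y\<close> is in \<open>ES\<close>, the inner \<open>D1 Y\<close>
  becomes \<open>D2 Y\<close>; the resulting expression depends on \<open>X\<close> only through
  \<open>D1 X\<close>, which becomes \<open>D2 X\<close>.\<close>

lemma ES_mult:
  assumes X: "X \<in> carrier ES" and Y: "Y \<in> carrier ES"
  shows "X \<otimes>\<^bsub>Ae\<^esub> Y \<in> carrier ES"
proof -
  interpret Ae: ring Ae by (rule Ae_ring)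
  note X' = ES_Ae[OF X] and Y' = ES_Ae[OF Y]
  have 1: "D1 (Ae_pure a a' \<otimes>\<^bsub>Ae\<^esub> V) = rAR (\<rho> a') (lm (D1 V) (\<rho> a))"
    if a: "a \<in> carrier A" and a': "a' \<in> carrier A" and V: "V \<in> carrier Ae" for a a' V
    by (rule tensor_ext[OF tAe AR_group add_hom_comp[OF D1_hom Ae_mult_hom(2)]
          add_hom_comp[OF rAR_hom add_hom_comp[OF lm_hom D1_hom]] _ V])
      (simp_all add: a a' Ae_closed Ae_mult_pure D1_pure lm_rAR lm_\<Theta> rAR_mult \<rho>_mult)
  \<comment> \<open>This is \<open>D1 (X V)\<close> with the inner \<open>D1 V\<close> replaced by
    \<open>D2 V\<close>. It makes sense and is additive for every \<open>V\<close> in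
    \<open>Ae\<close>, so it can be compared on pure tensors, which need not lie in
    \<open>ES\<close>.\<close>
  define N where "N V = tensor_lift AR (\<lambda>a a'. rAR (\<rho> a') (lm (D2 V) (\<rho> a))) X" for V
  have Nb: "kbal A A AR (\<lambda>a a'. rAR (\<rho> a') (lm (D2 V) (\<rho> a)))"
    if "V \<in> carrier Ae" for V
    by (rule balancedI)
      (simp_all add: that \<rho>_add \<rho>_smult rAR_add rAR_smult lm_props(3) lm_closed add_hom_add[OF rAR_hom] add_hom_add[OF lm_props(1)])
  have Nh: "add_hom Ae AR N"
    unfolding N_def
    by (rule tensor_lift_param[OF tAe AR_group Nb _ Ae_group X'])
      (simp_all add: add_hom_comp[OF rAR_hom add_hom_comp[OF lm_hom D2_hom]])
  have "D1 (X \<otimes>\<^bsub>Ae\<^esub> Y) = N Y"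
    unfolding N_def
    by (rule tensor_lift_unique[OF tAe AR_group Nb[OF Y'] add_hom_comp[OF D1_hom Ae_mult_hom(1)[OF Y']] _ X', symmetric])
      (simp add: 1 Y' ES_D[OF Y])
  also have "N Y = D2 (X \<otimes>\<^bsub>Ae\<^esub> Y)"
  proof (rule tensor_ext[OF tAe AR_group Nh add_hom_comp[OF D2_hom Ae_mult_hom(2)[OF X']] _ Y'])
    fix c c' assume c: "c \<in> carrier A" and c': "c' \<in> carrier A"
    have gb: "kbal A R AR (\<lambda>w Y. pAR (w \<cdot> c) (\<iota> c' \<star> Y))"
      by (rule balancedI) (simp_all add: c c' AR_closed AR_add A.l_distr R.r_distr A_smult R_smult AR_act)
    \<comment> \<open>The effect of nesting \<open>D2 (c \<otimes> c')\<close> between the legs of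
      \<open>D1 X\<close>: \<open>\<iota> c'\<close> may be moved to the far left because it
      commutes with \<open>\<eta> h\<close>.\<close>
    define G where "G = tensor_lift AR (\<lambda>w Y. pAR (w \<cdot> c) (\<iota> c' \<star> Y))"
    note Gh = tensor_lift_hom[OF tAR AR_group gb, folded G_def] and Gp = tensor_lift_pure[OF tAR AR_group gb, folded G_def]
    have Gr: "G (rAR Z W) = rAR Z (G W)" if Z: "Z \<in> carrier R" and W: "W \<in> carrier AR" for Z W
      by (rule tensor_ext[OF tAR AR_group add_hom_comp[OF Gh rAR_hom[OF Z]] add_hom_comp[OF rAR_hom[OF Z] Gh] _ W])
        (simp add: Z rAR_pure Gp c c' R.m_assoc)
    have G\<Theta>: "lm (pAR c (\<iota> c')) Z = G (\<Theta> Z)" if Z: "Z \<in> carrier R" for Z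
      by (rule R_ext[OF AR_group lm_props(1) add_hom_comp[OF Gh \<Theta>_hom] _ Z])
        (simp_all add: c c' AR_closed \<Theta>_pure Gp lm_pure \<iota>_\<eta>_commute)
    have "N (Ae_pure c c') = G (D1 X)"
      unfolding N_def
      by (rule tensor_lift_unique[OF tAe AR_group Nb add_hom_comp[OF Gh D1_hom] _ X'])
        (simp_all add: c c' Ae_closed D1_pure D2_pure Gr G\<Theta>)
    also have "\<dots> = G (D2 X)" by (simp add: ES_D[OF X])
    also have "\<dots> = D2 (X \<otimes>\<^bsub>Ae\<^esub> Ae_pure c c')"
      by (rule tensor_ext[OF tAe AR_group add_hom_comp[OF Gh D2_hom] add_hom_comp[OF D2_hom Ae_mult_hom(1)] _ X'])
        (simp_all add: c c' Ae_closed D2_pure Gp Ae_mult_pure \<iota>_mult)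
    finally show "N (Ae_pure c c') = D2 (X \<otimes>\<^bsub>Ae\<^esub> Ae_pure c c')" .
  qed
  finally show ?thesis using X' Y' by (simp add: ES_iff)
qed

section \<open>The bialgebroid generates \<open>A \<otimes> A\<close> as a right \<open>A\<close>-module\<close>

lemma br_eq [simp]: "\<lbrakk>b \<in> carrier A; X \<in> carrier Ae\<rbrakk> \<Longrightarrow> br X b = rAe b X"
  by (simp add: br_def target_mult)

lemma bl_eq [simp]: "\<lbrakk>b \<in> carrier A; X \<in> carrier Ae\<rbrakk> \<Longrightarrow> bl b X = lAe b X"
  by (simp add: bl_def source_mult)

lemma Ae_right_module: "right_module B Ae br"
  by (intro right_module.intro right_module_axioms.intro B_ring Ae_group)
    (simp_all add: rAe_closed rAe_mult rAe_one rAe_add add_hom_add[OF rAe_hom] ag_closed[OF Ae_group])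

lemma ES_right_module: "right_module B ES br"
  by (intro right_module.intro right_module_axioms.intro B_ring ES_group)
    (simp_all add: ES_rAe ES_Ae rAe_mult rAe_one rAe_add add_hom_add[OF rAe_hom] ag_closed[OF Ae_group])

lemma AR_right_module: "right_module B AR (\<lambda>W b. rAR (\<iota> b) W)"
  by (intro right_module.intro right_module_axioms.intro B_ring AR_group)
    (simp_all add: rAR_mult rAR_one rAR_add add_hom_add[OF rAR_hom] \<iota>_add \<iota>_mult \<iota>_one)

section \<open>The defining sequence of the bialgebroid tensored with \<open>A\<close> over
  \<open>B\<close>, and its splitting\<close>

abbreviation "lmult \<equiv> \<lambda>b y. b \<cdot> y"
abbreviation "E1 \<equiv> tensor_group coinv ES br A lmult"
abbreviation "p1 \<equiv> pure_tensor coinv ES br A lmult"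
abbreviation "E2 \<equiv> tensor_group coinv Ae br A lmult"
abbreviation "p2 \<equiv> pure_tensor coinv Ae br A lmult"
abbreviation "E3 \<equiv> tensor_group coinv AR (\<lambda>W b. rAR (\<iota> b) W) A lmult"
abbreviation "p3 \<equiv> pure_tensor coinv AR (\<lambda>W b. rAR (\<iota> b) W) A lmult"

lemma tE1: "is_tensor coinv ES br A lmult E1 p1"
  by (rule is_tensor_tensor_group) (simp_all add: ES_group A_group ES_Ae ES_rAe)
lemma tE2: "is_tensor coinv Ae br A lmult E2 p2"
  by (rule is_tensor_tensor_group) (simp_all add: Ae_group A_group rAe_closed)
lemma tE3: "is_tensor coinv AR (\<lambda>W b. rAR (\<iota> b) W) A lmult E3 p3"
  by (rule is_tensor_tensor_group) (simp_all add: AR_group A_group)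

lemmas E1_group = is_tensor_group[OF tE1] and E2_group = is_tensor_group[OF tE2] and E3_group = is_tensor_group[OF tE3]
lemmas E1_closed = pure_closed[OF tE1] and E2_closed = pure_closed[OF tE2] and E3_closed = pure_closed[OF tE3]
lemmas E1_add = pure_add_left[OF tE1, simplified] pure_add_right[OF tE1]
  and E2_add = pure_add_left[OF tE2] pure_add_right[OF tE2]
  and E3_add = pure_add_left[OF tE3] pure_add_right[OF tE3]

lemma E1_act: "\<lbrakk>X \<in> carrier ES; b \<in> coinv; y \<in> carrier A\<rbrakk> \<Longrightarrow> p1 (rAe b X) y = p1 X (b \<cdot> y)"
  using pure_act[OF tE1, of X b y] by (simp add: ES_Ae)
lemma E2_act: "\<lbrakk>X \<in> carrier Ae; b \<in> coinv; y \<in> carrier A\<rbrakk> \<Longrightarrow> p2 (rAe b X) y = p2 X (b \<cdot> y)"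
  using pure_act[OF tE2, of X b y] by simp
lemma E3_act: "\<lbrakk>W \<in> carrier AR; b \<in> coinv; y \<in> carrier A\<rbrakk> \<Longrightarrow> p3 (rAR (\<iota> b) W) y = p3 W (b \<cdot> y)"
  using pure_act[OF tE3, of W b y] by simp

lemma balanced_E1I:
  assumes "\<And>X y. \<lbrakk>X \<in> carrier ES; y \<in> carrier A\<rbrakk> \<Longrightarrow> f X y \<in> carrier P"
    and "\<And>X X' y. \<lbrakk>X \<in> carrier ES; X' \<in> carrier ES; y \<in> carrier A\<rbrakk> \<Longrightarrow> f (X \<oplus>\<^bsub>Ae\<^esub> X') y = f X y \<oplus>\<^bsub>P\<^esub> f X' y"
    and "\<And>X y y'. \<lbrakk>X \<in> carrier ES; y \<in> carrier A; y' \<in> carrier A\<rbrakk> \<Longrightarrow> f X (y \<oplus>\<^bsub>A\<^esub> y') = f X y \<oplus>\<^bsub>P\<^esub> f X y'"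
    and "\<And>X b y. \<lbrakk>X \<in> carrier ES; b \<in> coinv; y \<in> carrier A\<rbrakk> \<Longrightarrow> f (rAe b X) y = f X (b \<cdot> y)"
  shows "balanced coinv ES br A lmult P f"
  by (rule balancedI) (simp_all add: assms ES_Ae)

lemma balanced_E2I:
  assumes "\<And>X y. \<lbrakk>X \<in> carrier Ae; y \<in> carrier A\<rbrakk> \<Longrightarrow> f X y \<in> carrier P"
    and "\<And>X X' y. \<lbrakk>X \<in> carrier Ae; X' \<in> carrier Ae; y \<in> carrier A\<rbrakk> \<Longrightarrow> f (X \<oplus>\<^bsub>Ae\<^esub> X') y = f X y \<oplus>\<^bsub>P\<^esub> f X' y"
    and "\<And>X y y'. \<lbrakk>X \<in> carrier Ae; y \<in> carrier A; y' \<in> carrier A\<rbrakk> \<Longrightarrow> f X (y \<oplus>\<^bsub>A\<^esub> y') = f X y \<oplus>\<^bsub>P\<^esub> f X y'"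
    and "\<And>X b y. \<lbrakk>X \<in> carrier Ae; b \<in> coinv; y \<in> carrier A\<rbrakk> \<Longrightarrow> f (rAe b X) y = f X (b \<cdot> y)"
  shows "balanced coinv Ae br A lmult P f"
  by (rule balancedI) (simp_all add: assms)

definition "r1 y = tensor_lift E1 (\<lambda>X q. p1 X (q \<cdot> y))"
definition "r2 y = tensor_lift E2 (\<lambda>X q. p2 X (q \<cdot> y))"
definition "r3 y = tensor_lift E3 (\<lambda>X q. p3 X (q \<cdot> y))"

lemma r1_bal: "y \<in> carrier A \<Longrightarrow> balanced coinv ES br A lmult E1 (\<lambda>X q. p1 X (q \<cdot> y))"
  by (rule balanced_E1I) (simp_all add: E1_closed E1_add A.l_distr E1_act A.m_assoc)
lemma r2_bal: "y \<in> carrier A \<Longrightarrow> balanced coinv Ae br A lmult E2 (\<lambda>X q. p2 X (q \<cdot> y))"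
  by (rule balanced_E2I) (simp_all add: E2_closed E2_add A.l_distr E2_act A.m_assoc)
lemma r3_bal: "y \<in> carrier A \<Longrightarrow> balanced coinv AR (\<lambda>W b. rAR (\<iota> b) W) A lmult E3 (\<lambda>X q. p3 X (q \<cdot> y))"
  by (rule balancedI) (simp_all add: E3_closed E3_add A.l_distr E3_act A.m_assoc)

lemmas r1_hom = tensor_lift_hom[OF tE1 E1_group r1_bal, folded r1_def]
  and r1_pure = tensor_lift_pure[OF tE1 E1_group r1_bal, folded r1_def]
  and r2_hom = tensor_lift_hom[OF tE2 E2_group r2_bal, folded r2_def]
  and r2_pure = tensor_lift_pure[OF tE2 E2_group r2_bal, folded r2_def]
  and r3_hom = tensor_lift_hom[OF tE3 E3_group r3_bal, folded r3_def]
  and r3_pure = tensor_lift_pure[OF tE3 E3_group r3_bal, folded r3_def]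
lemmas r2_closed = add_hom_closed[OF r2_hom]

definition "l1 b = tensor_lift E1 (\<lambda>X q. p1 (bl b X) q)"
definition "l2 b = tensor_lift E2 (\<lambda>X q. p2 (bl b X) q)"

lemma l1_bal: "b \<in> coinv \<Longrightarrow> balanced coinv ES br A lmult E1 (\<lambda>X q. p1 (bl b X) q)"
  by (rule balanced_E1I)
    (simp_all add: E1_closed E1_add ES_Ae ES_lAe ES_add rAe_closed rAe_lAe[symmetric] E1_act add_hom_add[OF lAe_hom] ag_closed[OF Ae_group])
lemma l2_bal: "b \<in> coinv \<Longrightarrow> balanced coinv Ae br A lmult E2 (\<lambda>X q. p2 (bl b X) q)"
  by (rule balanced_E2I)
    (simp_all add: E2_closed E2_add lAe_closed rAe_closed rAe_lAe[symmetric] E2_act add_hom_add[OF lAe_hom] ag_closed[OF Ae_group])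

lemmas l1_hom = tensor_lift_hom[OF tE1 E1_group l1_bal, folded l1_def]
  and l1_pure = tensor_lift_pure[OF tE1 E1_group l1_bal, folded l1_def]
  and l2_hom = tensor_lift_hom[OF tE2 E2_group l2_bal, folded l2_def]
  and l2_pure = tensor_lift_pure[OF tE2 E2_group l2_bal, folded l2_def]

definition "incl = tensor_lift E2 (\<lambda>X y. p2 X y)"

lemma incl_bal: "balanced coinv ES br A lmult E2 (\<lambda>X y. p2 X y)"
  by (rule balanced_E1I) (simp_all add: ES_Ae E2_closed E2_add E2_act)
lemmas incl_hom = tensor_lift_hom[OF tE1 E2_group incl_bal, folded incl_def]
  and incl_pure = tensor_lift_pure[OF tE1 E2_group incl_bal, folded incl_def]
lemmas incl_closed = add_hom_closed[OF incl_hom]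

definition "\<mu> = tensor_lift Ae (\<lambda>X y. rAe y X)"

lemma \<mu>_bal: "balanced coinv Ae br A lmult Ae (\<lambda>X y. rAe y X)"
  by (rule balanced_E2I) (simp_all add: rAe_closed add_hom_add[OF rAe_hom] rAe_add rAe_mult)
lemmas \<mu>_hom = tensor_lift_hom[OF tE2 Ae_group \<mu>_bal, folded \<mu>_def]
  and \<mu>_pure = tensor_lift_pure[OF tE2 Ae_group \<mu>_bal, folded \<mu>_def]
lemmas \<mu>_closed = add_hom_closed[OF \<mu>_hom]

text \<open>Associativity of the tensor product \<open>A \<otimes> (A \<otimes>\<^sub>B A)\<close>,
  with the first factor held fixed.\<close>

definition "v x = tensor_lift E2 (\<lambda>p q. p2 (Ae_pure x p) q)"

lemma v_bal: "x \<in> carrier A \<Longrightarrow>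
    bbal E2 (\<lambda>p q. p2 (Ae_pure x p) q)"
  by (rule balancedI) (simp_all add: E2_closed E2_add Ae_closed Ae_add E2_act flip: rAe_pure)
lemmas v_hom = tensor_lift_hom[OF tAA E2_group v_bal, folded v_def]
  and v_pure = tensor_lift_pure[OF tAA E2_group v_bal, folded v_def]
lemmas v_closed = add_hom_closed[OF v_hom]

lemma v_add: "\<lbrakk>x \<in> carrier A; x' \<in> carrier A; z \<in> carrier AA\<rbrakk> \<Longrightarrow> v (x \<oplus>\<^bsub>A\<^esub> x') z = v x z \<oplus>\<^bsub>E2\<^esub> v x' z"
  by (rule tensor_ext[OF tAA E2_group v_hom add_hom_plus[OF E2_group v_hom v_hom]])
    (simp_all add: v_pure Ae_add Ae_closed E2_add)

lemma AA_smult_hom: "k \<in> carrier K \<Longrightarrow> add_hom AA AA (\<lambda>z. k \<odot>\<^bsub>AA\<^esub> z)"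
proof -
  interpret AAK: module K AA by (rule AA_module)
  show "k \<in> carrier K \<Longrightarrow> add_hom AA AA (\<lambda>z. k \<odot>\<^bsub>AA\<^esub> z)" by (intro add_homI) (auto simp: AAK.smult_r_distr)
qed

lemma v_smult: "\<lbrakk>x \<in> carrier A; k \<in> carrier K; z \<in> carrier AA\<rbrakk> \<Longrightarrow> v (k \<odot>\<^bsub>A\<^esub> x) z = v x (k \<odot>\<^bsub>AA\<^esub> z)"
  by (rule tensor_ext[OF tAA E2_group v_hom add_hom_comp[OF v_hom AA_smult_hom]])
    (simp_all add: v_pure AA_smult Ae_act)

lemma v_rA: "\<lbrakk>x \<in> carrier A; y \<in> carrier A; z \<in> carrier AA\<rbrakk> \<Longrightarrow> v x (rA y z) = r2 y (v x z)"
  by (rule tensor_ext[OF tAA E2_group add_hom_comp[OF v_hom rA_hom] add_hom_comp[OF r2_hom v_hom]])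
    (simp_all add: v_pure rA_pure r2_pure Ae_closed)

text \<open>Inverts the canonical map inside \<open>A \<otimes> (A \<otimes> H)\<close> and
  regroups, landing in \<open>(A \<otimes> A) \<otimes>\<^sub>B A\<close>. Both splitting maps used
  later come from it.\<close>

definition "\<sigma> = tensor_lift E2 (\<lambda>x Z. v x (\<gamma> Z))"

lemma \<sigma>_bal: "kbal A R E2 (\<lambda>x Z. v x (\<gamma> Z))"
  by (rule balancedI) (simp_all add: v_closed v_add add_hom_add[OF v_hom] add_hom_add[OF \<gamma>_hom] v_smult \<gamma>_smult)
lemmas \<sigma>_hom = tensor_lift_hom[OF tAR E2_group \<sigma>_bal, folded \<sigma>_def]
  and \<sigma>_pure = tensor_lift_pure[OF tAR E2_group \<sigma>_bal, folded \<sigma>_def]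
lemmas \<sigma>_closed = add_hom_closed[OF \<sigma>_hom]

lemma \<sigma>_rAR: "\<lbrakk>y \<in> carrier A; W \<in> carrier AR\<rbrakk> \<Longrightarrow> \<sigma> (rAR (\<rho> y) W) = r2 y (\<sigma> W)"
  by (rule tensor_ext[OF tAR E2_group add_hom_comp[OF \<sigma>_hom rAR_hom] add_hom_comp[OF r2_hom \<sigma>_hom]])
    (simp_all add: rAR_pure \<sigma>_pure \<gamma>_mult_\<rho> v_rA)

lemma p_hom: "y \<in> carrier A \<Longrightarrow> add_hom ES E1 (\<lambda>X. p1 X y)" "y \<in> carrier A \<Longrightarrow> add_hom Ae E2 (\<lambda>X. p2 X y)"
  "y \<in> carrier A \<Longrightarrow> add_hom AR E3 (\<lambda>X. p3 X y)"
  by (rule add_homI; simp add: E1_closed E1_add E2_closed E2_add E3_closed E3_add)+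

text \<open>Because \<open>\<gamma> (\<iota> y) = y \<otimes>\<^sub>B 1\<close>. On
  \<open>ES\<close>, where \<open>D1\<close> and \<open>D2\<close> agree, it follows that
  \<open>\<sigma> (D1 X)\<close> is \<open>X \<otimes>\<^sub>B 1\<close>.\<close>

lemma s_D2: "X \<in> carrier Ae \<Longrightarrow> \<sigma> (D2 X) = p2 X \<one>\<^bsub>A\<^esub>"
  by (rule tensor_ext[OF tAe E2_group add_hom_comp[OF \<sigma>_hom D2_hom] p_hom(2)])
    (simp_all add: D2_pure \<sigma>_pure \<gamma>_\<iota> v_pure)

definition "DD1 = tensor_lift E3 (\<lambda>X y. p3 (D1 X) y)"
definition "DD2 = tensor_lift E3 (\<lambda>X y. p3 (D2 X) y)"

lemma DD1_bal: "balanced coinv Ae br A lmult E3 (\<lambda>X y. p3 (D1 X) y)"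
  by (rule balanced_E2I) (simp_all add: E3_closed E3_add add_hom_add[OF D1_hom] D1_rAe coinv_\<rho> E3_act)
lemma DD2_bal: "balanced coinv Ae br A lmult E3 (\<lambda>X y. p3 (D2 X) y)"
  by (rule balanced_E2I) (simp_all add: E3_closed E3_add add_hom_add[OF D2_hom] D2_rAe E3_act)
lemmas DD1_hom = tensor_lift_hom[OF tE2 E3_group DD1_bal, folded DD1_def]
  and DD1_pure = tensor_lift_pure[OF tE2 E3_group DD1_bal, folded DD1_def]
  and DD2_hom = tensor_lift_hom[OF tE2 E3_group DD2_bal, folded DD2_def]
  and DD2_pure = tensor_lift_pure[OF tE2 E3_group DD2_bal, folded DD2_def]

lemma DD1_r2: "\<lbrakk>y \<in> carrier A; t \<in> carrier E2\<rbrakk> \<Longrightarrow> DD1 (r2 y t) = r3 y (DD1 t)"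
  by (rule tensor_ext[OF tE2 E3_group add_hom_comp[OF DD1_hom r2_hom] add_hom_comp[OF r3_hom DD1_hom]])
    (simp_all add: r2_pure DD1_pure r3_pure)
lemma DD2_r2: "\<lbrakk>y \<in> carrier A; t \<in> carrier E2\<rbrakk> \<Longrightarrow> DD2 (r2 y t) = r3 y (DD2 t)"
  by (rule tensor_ext[OF tE2 E3_group add_hom_comp[OF DD2_hom r2_hom] add_hom_comp[OF r3_hom DD2_hom]])
    (simp_all add: r2_pure DD2_pure r3_pure)

text \<open>The form that \<open>DD1\<close> takes on regrouped tensors, with \<open>W\<close> in
  the place of \<open>\<Theta> (\<rho> x)\<close>; keeping \<open>W\<close> free lets its legs vary
  independently of the argument from \<open>A \<otimes>\<^sub>B A\<close>.\<close>

definition "u W = tensor_lift E3 (\<lambda>p q. p3 (rAR (\<rho> p) W) q)"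

lemma u_bal: "W \<in> carrier AR \<Longrightarrow>
    bbal E3 (\<lambda>p q. p3 (rAR (\<rho> p) W) q)"
  by (rule balancedI)
    (simp_all add: E3_closed E3_add \<rho>_add rAR_add \<rho>_mult rAR_mult[symmetric] coinv_\<rho> E3_act)
lemmas u_hom = tensor_lift_hom[OF tAA E3_group u_bal, folded u_def]
  and u_pure = tensor_lift_pure[OF tAA E3_group u_bal, folded u_def]
lemmas u_closed = add_hom_closed[OF u_hom]

lemma u_add: "\<lbrakk>W \<in> carrier AR; W' \<in> carrier AR; z \<in> carrier AA\<rbrakk> \<Longrightarrow> u (W \<oplus>\<^bsub>AR\<^esub> W') z = u W z \<oplus>\<^bsub>E3\<^esub> u W' z"
  by (rule tensor_ext[OF tAA E3_group u_hom add_hom_plus[OF E3_group u_hom u_hom]])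
    (simp_all add: ag_closed[OF AR_group] u_pure add_hom_add[OF rAR_hom] E3_add)

lemma u_hom_left: "z \<in> carrier AA \<Longrightarrow> add_hom AR E3 (\<lambda>W. u W z)"
  by (rule add_homI) (simp_all add: u_closed u_add)

lemma u_smult: "\<lbrakk>W \<in> carrier AR; k \<in> carrier K; z \<in> carrier AA\<rbrakk> \<Longrightarrow> u (k \<odot>\<^bsub>AR\<^esub> W) z = u W (k \<odot>\<^bsub>AA\<^esub> z)"
proof -
  interpret ARK: module K AR by (rule AR_module)
  show "\<lbrakk>W \<in> carrier AR; k \<in> carrier K; z \<in> carrier AA\<rbrakk> \<Longrightarrow> u (k \<odot>\<^bsub>AR\<^esub> W) z = u W (k \<odot>\<^bsub>AA\<^esub> z)"
    by (rule tensor_ext[OF tAA E3_group u_hom add_hom_comp[OF u_hom AA_smult_hom]])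
      (simp_all add: u_pure AA_smult \<rho>_smult rAR_smult)
qed

lemma u_lA: "\<lbrakk>d \<in> carrier A; W \<in> carrier AR; z \<in> carrier AA\<rbrakk> \<Longrightarrow> u W (lA d z) = u (rAR (\<rho> d) W) z"
  by (rule tensor_ext[OF tAA E3_group add_hom_comp[OF u_hom lA_hom] u_hom])
    (simp_all add: lA_pure u_pure rAR_mult \<rho>_mult)

lemma DD1_v: "\<lbrakk>x \<in> carrier A; z \<in> carrier AA\<rbrakk> \<Longrightarrow> DD1 (v x z) = u (\<Theta> (\<rho> x)) z"
  by (rule tensor_ext[OF tAA E3_group add_hom_comp[OF DD1_hom v_hom] u_hom])
    (simp_all add: v_pure DD1_pure Ae_closed u_pure D1_pure)

lemma tHH: "is_tensor (carrier K) H (\<lambda>x k. k \<odot>\<^bsub>H\<^esub> x) H (\<lambda>k y. k \<odot>\<^bsub>H\<^esub> y) (ktensor K H H) (ktensor_pure K H H)"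
  by (rule is_tensor_ktensor[OF HK.module_axioms HK.module_axioms])

text \<open>In \<open>A \<otimes> H \<otimes>\<^bsub>B\<^esub> A\<close> this reads \<open>(1 \<otimes> h\<^bsub>(1)\<^esub>) \<rho>(h\<^bsub>(2)\<^esub>\<^sup>\<langle>\<^sup>1\<^sup>\<rangle>) \<otimes>\<^bsub>B\<^esub> h\<^bsub>(2)\<^esub>\<^sup>\<langle>\<^sup>2\<^sup>\<rangle> = (h\<^sup>\<langle>\<^sup>1\<^sup>\<rangle> \<otimes> 1) \<otimes>\<^bsub>B\<^esub> h\<^sup>\<langle>\<^sup>2\<^sup>\<rangle>\<close>.
  Both sides extend to left \<open>A\<close>-linear maps on \<open>A \<otimes> H\<close>, which can be compared on the elements
  \<open>(c \<otimes> 1) \<rho>(q)\<close> because the canonical map is onto.\<close>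

lemma translation_comult:
  assumes x: "x \<in> carrier A" and h: "h \<in> carrier H"
  shows "tensor_lift E3 (\<lambda>h1 h2. u (pAR x (\<eta> h1)) (\<gamma> (\<eta> h2))) (\<Delta> h) = DD2 (v x (\<gamma> (\<eta> h)))"
proof -
  \<comment> \<open>At \<open>c = d = 1\<close> this is the integrand on the left of the claim. The
    slot \<open>d\<close> takes the \<open>A\<close>-leg of a coaction, and \<open>c\<close> records
    a left factor so that left \<open>A\<close>-linearity can be used.\<close>
  define f where "f c d h1 h2 = u (pAR x (\<iota> c \<star> (\<iota> d \<star> \<eta> h1))) (\<gamma> (\<eta> h2))" for c d h1 h2
  have \<gamma>\<eta>: "\<gamma> (\<eta> (h1 \<oplus>\<^bsub>H\<^esub> h2)) = \<gamma> (\<eta> h1) \<oplus>\<^bsub>AA\<^esub> \<gamma> (\<eta> h2)"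
    if "h1 \<in> carrier H" "h2 \<in> carrier H" for h1 h2
    using that by (simp add: \<eta>_add add_hom_add[OF \<gamma>_hom])
  note fs = x AR_closed u_closed u_add \<iota>_add \<eta>_add \<iota>_smult \<eta>_smult R.r_distr R.l_distr AR_add
    add_hom_add[OF u_hom] add_hom_add[OF \<gamma>_hom] \<gamma>_smult R_smult AR_act u_smult[symmetric] AR_smult
  have fb: "kbal H H E3 (\<lambda>h1 h2. f c d h1 h2)"
    if "c \<in> carrier A" "d \<in> carrier A" for c d
    using that unfolding f_def by (intro balancedI) (simp_all add: fs)
  note fc = add_hom_closed[OF tensor_lift_hom[OF tHH E3_group fb]]
  have Lb: "kbal A H E3 (\<lambda>d h. tensor_lift E3 (f c d) (\<Delta> h))"
    if c: "c \<in> carrier A" for c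
  proof (rule balancedI)
    fix d d' h assume d: "d \<in> carrier A" "d' \<in> carrier A" and h: "h \<in> carrier H"
    have d2: "d \<oplus>\<^bsub>A\<^esub> d' \<in> carrier A" using d by simp
    show "tensor_lift E3 (f c (d \<oplus>\<^bsub>A\<^esub> d')) (\<Delta> h) = tensor_lift E3 (f c d) (\<Delta> h) \<oplus>\<^bsub>E3\<^esub> tensor_lift E3 (f c d') (\<Delta> h)"
      by (rule tensor_lift_unique[OF tHH E3_group fb[OF c d2]
            add_hom_plus[OF E3_group tensor_lift_hom[OF tHH E3_group fb[OF c d(1)]] tensor_lift_hom[OF tHH E3_group fb[OF c d(2)]]] _ \<Delta>_closed[OF h]])
        (simp add: tensor_lift_pure[OF tHH E3_group fb] c d, simp add: f_def c d fs)
  next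
    fix d k h assume d: "d \<in> carrier A" and k: "k \<in> carrier K" and h: "h \<in> carrier H"
    have d2: "k \<odot>\<^bsub>A\<^esub> d \<in> carrier A" using d k by simp
    interpret HHK: module K "ktensor K H H" by (rule ktensor_module[OF HK.module_axioms HK.module_axioms])
    have kh: "add_hom (ktensor K H H) (ktensor K H H) (\<lambda>Z. k \<odot>\<^bsub>ktensor K H H\<^esub> Z)"
      using k by (intro add_homI) (auto simp: HHK.smult_r_distr)
    have "tensor_lift E3 (f c (k \<odot>\<^bsub>A\<^esub> d)) (\<Delta> h) = tensor_lift E3 (f c d) (k \<odot>\<^bsub>ktensor K H H\<^esub> \<Delta> h)"
      by (rule tensor_lift_unique[OF tHH E3_group fb[OF c d2] add_hom_comp[OF tensor_lift_hom[OF tHH E3_group fb[OF c d]] kh] _ \<Delta>_closed[OF h]])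
        (simp add: tensor_lift_pure[OF tHH E3_group fb] ktensor_module(2)[OF HK.module_axioms HK.module_axioms] c d k,
          simp add: f_def c d k fs)
    then show "tensor_lift E3 (f c (k \<odot>\<^bsub>A\<^esub> d)) (\<Delta> h) = tensor_lift E3 (f c d) (\<Delta> (k \<odot>\<^bsub>H\<^esub> h))"
      by (simp add: \<Delta>_smult k h)
  qed (simp_all add: fc c \<Delta>_add tensor_lift_add[OF tHH E3_group fb])
  \<comment> \<open>\<open>L 1\<close> extends the left side of the claim from
    \<open>\<eta> h\<close> to all of \<open>A \<otimes> H\<close>. Since
    \<open>L 1 (\<iota> c \<star> Z) = L c Z\<close>, its value on
    \<open>can (c \<otimes> q) = \<iota> c \<star> \<rho> q\<close> is
    \<open>L c (\<rho> q)\<close>.\<close>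
  define L where "L c = tensor_lift E3 (\<lambda>d h. tensor_lift E3 (f c d) (\<Delta> h))" for c
  note Lh = tensor_lift_hom[OF tR E3_group Lb, folded L_def]
  have Lp: "L c (\<iota> d \<star> \<eta> h) = tensor_lift E3 (f c d) (\<Delta> h)"
    if "c \<in> carrier A" "d \<in> carrier A" "h \<in> carrier H" for c d h
    using tensor_lift_pure[OF tR E3_group Lb, folded L_def] that by (simp add: \<iota>_\<eta>)
  have L\<iota>: "L \<one>\<^bsub>A\<^esub> (\<iota> c \<star> Z) = L c Z" if c: "c \<in> carrier A" and Z: "Z \<in> carrier R" for c Z
  proof (rule R_ext[OF E3_group add_hom_comp[OF Lh[OF A.one_closed] R_mult_hom(2)] Lh[OF c] _ Z])
    fix d h assume d: "d \<in> carrier A" and h: "h \<in> carrier H"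
    have "f \<one>\<^bsub>A\<^esub> (c \<cdot> d) h1 h2 = f c d h1 h2" if "h1 \<in> carrier H" "h2 \<in> carrier H" for h1 h2
      using that c d by (simp add: f_def \<iota>_one \<iota>_mult R.m_assoc)
    then have "tensor_lift E3 (f \<one>\<^bsub>A\<^esub> (c \<cdot> d)) (\<Delta> h) = tensor_lift E3 (f c d) (\<Delta> h)"
      using c d h by (intro tensor_lift_cong[OF tHH E3_group fb]) simp_all
    then show "L \<one>\<^bsub>A\<^esub> (\<iota> c \<star> (\<iota> d \<star> \<eta> h)) = L c (\<iota> d \<star> \<eta> h)"
      using c d h by (simp add: R.m_assoc[symmetric] \<iota>_mult[symmetric] Lp)
  qed (use c in simp)
  have L\<rho>: "L c (\<rho> q) = p3 (pAR x (\<iota> c)) q" if c: "c \<in> carrier A" and q: "q \<in> carrier A" for c q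
  proof -
    \<comment> \<open>Coassociativity replaces the coproduct of the \<open>H\<close>-leg by a second
      coaction on the \<open>A\<close>-leg. The inner sum is then \<open>\<rho> d\<close>, which
      \<open>u\<close> absorbs as a factor \<open>d\<close> on the first leg of
      \<open>\<gamma> (\<eta> h)\<close>.\<close>
    have "L c (\<rho> q) = tensor_lift E3 (\<lambda>d h. tensor_lift E3 (\<lambda>d' h'. f c d' h' h) (\<rho> d)) (\<rho> q)"
      unfolding L_def
      by (rule coassoc_trilinear[OF E3_group _ _ _ _ _ q, symmetric])
        (auto intro!: add_homI simp: f_def fs c)
    also have "\<dots> = tensor_lift E3 (\<lambda>d h. u (pAR x (\<iota> c \<star> \<rho> d)) (\<gamma> (\<eta> h))) (\<rho> q)"
    proof (rule tensor_lift_cong[OF tR E3_group _ _ \<rho>_closed[OF q], symmetric])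
      show "kbal A H E3 (\<lambda>d h. u (pAR x (\<iota> c \<star> \<rho> d)) (\<gamma> (\<eta> h)))"
        by (rule balancedI) (simp_all add: fs c \<rho>_add \<rho>_smult)
      fix d h assume d: "d \<in> carrier A" and h: "h \<in> carrier H"
      have b: "kbal A H E3 (\<lambda>d' h'. f c d' h' h)"
        by (rule balancedI) (simp_all add: f_def fs c h)
      have g: "add_hom R E3 (\<lambda>Z. u (pAR x (\<iota> c \<star> Z)) (\<gamma> (\<eta> h)))"
        by (rule add_homI) (simp_all add: fs c h)
      show "u (pAR x (\<iota> c \<star> \<rho> d)) (\<gamma> (\<eta> h)) = tensor_lift E3 (\<lambda>d' h'. f c d' h' h) (\<rho> d)"
        by (rule tensor_lift_unique[OF tR E3_group b g _ \<rho>_closed[OF d], symmetric]) (simp add: f_def \<iota>_\<eta>)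
    qed
    also have "\<dots> = u (pAR x (\<iota> c)) (\<gamma> (\<rho> q))"
    proof (rule tensor_lift_unique[OF tR E3_group _ add_hom_comp[OF u_hom \<gamma>_hom] _ \<rho>_closed[OF q]])
      show "kbal A H E3 (\<lambda>d h. u (pAR x (\<iota> c \<star> \<rho> d)) (\<gamma> (\<eta> h)))"
        by (rule balancedI) (simp_all add: fs c \<rho>_add \<rho>_smult)
      show "u (pAR x (\<iota> c)) (\<gamma> (pR d h)) = u (pAR x (\<iota> c \<star> \<rho> d)) (\<gamma> (\<eta> h))"
        if "d \<in> carrier A" "h \<in> carrier H" for d h
        using that c x by (simp add: \<iota>_\<eta>[symmetric] \<gamma>_\<iota>_mult u_lA AR_closed rAR_pure)
    qed (use x c in \<open>simp add: AR_closed\<close>)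
    also have "\<dots> = p3 (pAR x (\<iota> c)) q"
      using x c q by (simp add: \<gamma>_\<rho> u_pure AR_closed \<rho>_one rAR_one)
    finally show ?thesis .
  qed
  have "L \<one>\<^bsub>A\<^esub> (can z) = DD2 (v x z)" if "z \<in> carrier AA" for z
    by (rule tensor_ext[OF tAA E3_group add_hom_comp[OF Lh can_hom] add_hom_comp[OF DD2_hom v_hom] _ that])
      (simp_all add: x can_pure L\<iota> L\<rho> v_pure DD2_pure Ae_closed D2_pure)
  from this[of "\<gamma> (\<eta> h)"] have "L \<one>\<^bsub>A\<^esub> (\<eta> h) = DD2 (v x (\<gamma> (\<eta> h)))" using h by (simp add: can_\<gamma>)
  moreover have "L \<one>\<^bsub>A\<^esub> (\<eta> h) = tensor_lift E3 (f \<one>\<^bsub>A\<^esub> \<one>\<^bsub>A\<^esub>) (\<Delta> h)"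
    using Lp[of "\<one>\<^bsub>A\<^esub>" "\<one>\<^bsub>A\<^esub>" h] h by (simp add: \<iota>_one)
  moreover have "tensor_lift E3 (f \<one>\<^bsub>A\<^esub> \<one>\<^bsub>A\<^esub>) (\<Delta> h) = tensor_lift E3 (\<lambda>h1 h2. u (pAR x (\<eta> h1)) (\<gamma> (\<eta> h2))) (\<Delta> h)"
    using h by (intro tensor_lift_cong[OF tHH E3_group fb]) (simp_all add: f_def \<iota>_one)
  ultimately show ?thesis by simp
qed

text \<open>Right \<open>A\<close>-linearity reduces the claim to \<open>a \<otimes> 1\<close>.
  There \<open>DD1\<close> produces two successive coactions on \<open>a\<close>; coassociativity
  turns them into a coproduct of the \<open>H\<close>-leg, and \<open>translation_comult\<close>
  identifies the outcome with \<open>DD2\<close>.\<close>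

lemma DD_s_D1:
  assumes X: "X \<in> carrier Ae"
  shows "DD1 (\<sigma> (D1 X)) = DD2 (\<sigma> (D1 X))"
proof (rule tensor_ext[OF tAe E3_group add_hom_comp[OF DD1_hom add_hom_comp[OF \<sigma>_hom D1_hom]]
      add_hom_comp[OF DD2_hom add_hom_comp[OF \<sigma>_hom D1_hom]] _ X])
  fix a y assume a: "a \<in> carrier A" and y: "y \<in> carrier A"
  have sb: "kbal A H E2 (\<lambda>x h. v x (\<gamma> (\<eta> h)))"
    by (rule balancedI) (simp_all add: v_closed v_add v_smult \<eta>_add \<eta>_smult \<gamma>_smult add_hom_add[OF \<gamma>_hom] add_hom_add[OF v_hom])
  have s\<Theta>: "\<sigma> (\<Theta> (\<rho> a)) = tensor_lift E2 (\<lambda>x h. v x (\<gamma> (\<eta> h))) (\<rho> a)"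
    by (rule tensor_lift_unique[OF tR E2_group sb add_hom_comp[OF \<sigma>_hom \<Theta>_hom] _ \<rho>_closed[OF a], symmetric])
      (simp add: \<iota>_\<eta>[symmetric] \<Theta>_pure \<sigma>_pure)
  have "DD1 (\<sigma> (\<Theta> (\<rho> a))) = tensor_lift E3 (\<lambda>x h. DD1 (v x (\<gamma> (\<eta> h)))) (\<rho> a)"
    unfolding s\<Theta> by (rule tensor_lift_comp[OF tR E2_group E3_group sb DD1_hom \<rho>_closed[OF a]])
  also have "\<dots> = tensor_lift E3 (\<lambda>x h. tensor_lift E3 (\<lambda>x' h'. u (pAR x' (\<eta> h')) (\<gamma> (\<eta> h))) (\<rho> x)) (\<rho> a)"
  proof (rule tensor_lift_cong[OF tR E3_group balanced_comp[OF sb DD1_hom] _ \<rho>_closed[OF a]])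
    fix x h assume x: "x \<in> carrier A" and h: "h \<in> carrier H"
    have "tensor_lift E3 (\<lambda>x' h'. u (pAR x' (\<eta> h')) (\<gamma> (\<eta> h))) (\<rho> x) = u (\<Theta> (\<rho> x)) (\<gamma> (\<eta> h))"
      unfolding \<Theta>_def
      by (rule tensor_lift_comp[OF tR AR_group E3_group \<Theta>_bal u_hom_left \<rho>_closed[OF x], symmetric]) (simp add: h)
    then show "DD1 (v x (\<gamma> (\<eta> h))) = tensor_lift E3 (\<lambda>x' h'. u (pAR x' (\<eta> h')) (\<gamma> (\<eta> h))) (\<rho> x)"
      by (simp add: x h DD1_v)
  qed
  also have "\<dots> = tensor_lift E3 (\<lambda>x h. tensor_lift E3 (\<lambda>h1 h2. u (pAR x (\<eta> h1)) (\<gamma> (\<eta> h2))) (\<Delta> h)) (\<rho> a)"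
    by (rule coassoc_trilinear[OF E3_group _ _ _ _ _ a])
      (auto intro!: add_homI simp: AR_closed u_closed u_add AR_add \<eta>_add \<eta>_smult AR_act \<gamma>_smult
        add_hom_add[OF u_hom] add_hom_add[OF \<gamma>_hom] u_smult[symmetric] AR_smult)
  also have "\<dots> = tensor_lift E3 (\<lambda>x h. DD2 (v x (\<gamma> (\<eta> h)))) (\<rho> a)"
    by (rule tensor_lift_cong[OF tR E3_group balanced_comp[OF sb DD2_hom] _ \<rho>_closed[OF a], symmetric])
      (simp add: translation_comult)
  also have "\<dots> = DD2 (\<sigma> (\<Theta> (\<rho> a)))"
    unfolding s\<Theta> by (rule tensor_lift_comp[OF tR E2_group E3_group sb DD2_hom \<rho>_closed[OF a], symmetric])
  finally show "DD1 (\<sigma> (D1 (Ae_pure a y))) = DD2 (\<sigma> (D1 (Ae_pure a y)))"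
    using a y by (simp add: D1_pure \<sigma>_rAR \<sigma>_closed DD1_r2 DD2_r2)
qed

end

lemma ag_minus_eq_zero_iff:
  assumes "abelian_group G" "x \<in> carrier G" "y \<in> carrier G"
  shows "x \<ominus>\<^bsub>G\<^esub> y = \<zero>\<^bsub>G\<^esub> \<longleftrightarrow> x = y"
proof -
  interpret abelian_group G by fact
  have "x = (x \<ominus>\<^bsub>G\<^esub> y) \<oplus>\<^bsub>G\<^esub> y" using assms by (simp add: a_minus_def a_assoc l_neg)
  then show ?thesis using assms by (metis a_minus_def l_zero r_neg)
qed

context principal_comodule_algebra
begin

section \<open>Flatness applied to the defining sequence\<close>

lemma infinite_test: "infinite (UNIV :: (nat + 'a + 'h) list set)"
  by (rule infinite_UNIV_listI)

lemma A_lepoll: "carrier A \<lesssim> (UNIV :: (nat + 'a + 'h) list set)"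
  unfolding lepoll_def by (rule exI[of _ "\<lambda>a. [Inr (Inl a)]"]) (auto intro: inj_onI)

lemma H_lepoll: "carrier H \<lesssim> (UNIV :: (nat + 'a + 'h) list set)"
  unfolding lepoll_def by (rule exI[of _ "\<lambda>a. [Inr (Inr a)]"]) (auto intro: inj_onI)

lemma Ae_lepoll: "carrier Ae \<lesssim> (UNIV :: (nat + 'a + 'h) list set)"
  by (rule tensor_lepoll[OF infinite_test A_lepoll A_lepoll tAe])

lemma ES_lepoll: "carrier ES \<lesssim> (UNIV :: (nat + 'a + 'h) list set)"
  by (rule lepoll_trans[OF subset_imp_lepoll Ae_lepoll]) (auto simp: ES_Ae)

lemma AR_lepoll: "carrier AR \<lesssim> (UNIV :: (nat + 'a + 'h) list set)"
  by (rule tensor_lepoll[OF infinite_test A_lepoll tensor_lepoll[OF infinite_test A_lepoll H_lepoll tR] tAR])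

text \<open>Exactness is phrased with kernels, so the equalizer of \<open>D1\<close> and
  \<open>D2\<close> is presented as the kernel of a difference.\<close>

definition "Ddiff X = D2 X \<ominus>\<^bsub>AR\<^esub> D1 X"

lemma Ddiff_hom: "add_hom Ae AR Ddiff"
  unfolding Ddiff_def by (rule add_hom_diff[OF AR_group D2_hom D1_hom])

lemmas AR_minus_zero = ag_minus_eq_zero_iff[OF AR_group] and E3_minus_zero = ag_minus_eq_zero_iff[OF E3_group]

lemma ES_D_zero: "X \<in> carrier ES \<longleftrightarrow> X \<in> carrier Ae \<and> Ddiff X = \<zero>\<^bsub>AR\<^esub>"
  unfolding ES_iff Ddiff_def by (metis AR_minus_zero D1_closed D2_closed)

lemma id_right_hom: "(\<lambda>X. X) \<in> right_module_hom B ES br Ae br"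
  by (auto simp: right_module_hom_def ES_Ae)

lemma Ddiff_right_hom: "Ddiff \<in> right_module_hom B Ae br AR (\<lambda>W b. rAR (\<iota> b) W)"
  using add_hom_closed[OF Ddiff_hom] add_hom_add[OF Ddiff_hom]
  by (auto simp: right_module_hom_def Ddiff_def D1_rAe D2_rAe coinv_\<rho> add_hom_minus[OF AR_group AR_group rAR_hom])

lemma tE1B: "is_tensor (carrier B) ES br A lmult E1 p1"
  and tE2B: "is_tensor (carrier B) Ae br A lmult E2 p2"
  and tE3B: "is_tensor (carrier B) AR (\<lambda>W b. rAR (\<iota> b) W) A lmult E3 p3"
  using tE1 tE2 tE3 by simp_all

lemma incl_inj: "inj_on incl (carrier E1)"
  using faithfully_flat_inj[OF faithfully_flat ES_right_module ES_lepoll tE1B Ae_right_module Ae_lepoll tE2B id_right_hom, of incl]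
    incl_hom incl_pure by (simp add: inj_on_def)

text \<open>Flatness applied to the exact sequence
  \<open>ES \<rightarrow> Ae \<rightarrow> AR\<close> with second map \<open>Ddiff\<close>. It
  provides the existence part for \<open>ES_coaction\<close>, as \<open>incl_inj\<close> provides
  uniqueness.\<close>

lemma incl_exact:
  assumes "t \<in> carrier E2" "DD1 t = DD2 t"
  shows "t \<in> incl ` carrier E1"
proof -
  have Gh: "add_hom E2 E3 (\<lambda>t. DD2 t \<ominus>\<^bsub>E3\<^esub> DD1 t)"
    by (rule add_hom_diff[OF E3_group DD2_hom DD1_hom])
  have Gp: "DD2 (p2 X y) \<ominus>\<^bsub>E3\<^esub> DD1 (p2 X y) = p3 (Ddiff X) y" if "X \<in> carrier Ae" "y \<in> carrier A" for X y
    using that by (simp add: DD1_pure DD2_pure Ddiff_def add_hom_minus[OF AR_group E3_group p_hom(3)])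
  have "exact_pair ES (\<lambda>X. X) Ae Ddiff AR"
    unfolding exact_pair_def using ES_D_zero by auto
  then have "exact_pair E1 incl E2 (\<lambda>t. DD2 t \<ominus>\<^bsub>E3\<^esub> DD1 t) E3"
    using faithfully_flat_exact[OF faithfully_flat ES_right_module ES_lepoll tE1B Ae_right_module Ae_lepoll tE2B
        AR_right_module AR_lepoll tE3B id_right_hom Ddiff_right_hom, of incl "\<lambda>t. DD2 t \<ominus>\<^bsub>E3\<^esub> DD1 t"]
      incl_hom incl_pure Gh Gp by simp
  then show ?thesis
    using assms add_hom_closed[OF DD2_hom] by (auto simp: exact_pair_def E3_minus_zero)
qed

text \<open>\<open>\<xi>\<close> is the inverse of \<open>ES \<otimes>\<^bsub>B\<^esub> A \<rightarrow> A \<otimes> A\<close>, \<open>X \<otimes>\<^bsub>B\<^esub> y \<mapsto> X y\<close>;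
  it maps \<open>a \<otimes> y\<close> to \<open>a\<^bsub>(0)\<^esub> \<otimes> a\<^bsub>(1)\<^esub>\<^sup>\<langle>\<^sup>1\<^sup>\<rangle> \<otimes>\<^bsub>B\<^esub> a\<^bsub>(1)\<^esub>\<^sup>\<langle>\<^sup>2\<^sup>\<rangle>y\<close>.\<close>

definition "\<xi> X = inv_into (carrier E1) incl (\<sigma> (D1 X))"

lemma sD1_range: "X \<in> carrier Ae \<Longrightarrow> \<sigma> (D1 X) \<in> incl ` carrier E1"
  by (rule incl_exact) (simp_all add: \<sigma>_closed DD_s_D1)

lemma \<xi>_closed [simp]: "X \<in> carrier Ae \<Longrightarrow> \<xi> X \<in> carrier E1"
  unfolding \<xi>_def by (rule inv_into_into[OF sD1_range])

lemma incl_\<xi>: "X \<in> carrier Ae \<Longrightarrow> incl (\<xi> X) = \<sigma> (D1 X)"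
  unfolding \<xi>_def by (rule f_inv_into_f[OF sD1_range])

lemma \<xi>_eqI: "\<lbrakk>X \<in> carrier Ae; t \<in> carrier E1; incl t = \<sigma> (D1 X)\<rbrakk> \<Longrightarrow> \<xi> X = t"
  using inj_onD[OF incl_inj, of "\<xi> X" t] by (simp add: incl_\<xi>)

lemma \<xi>_hom: "add_hom Ae E1 \<xi>"
  by (rule add_homI, simp, rule \<xi>_eqI)
    (simp_all add: ag_closed Ae_group E1_group add_hom_add[OF incl_hom] incl_\<xi>
      add_hom_add[OF D1_hom] add_hom_add[OF \<sigma>_hom])

text \<open>For \<open>X\<close> in \<open>ES\<close>, \<open>D1 (X y)\<close> is
  \<open>D1 X\<close> times \<open>\<rho> y\<close>, hence \<open>D2 X\<close> times
  \<open>\<rho> y\<close>, and \<open>\<sigma>\<close> maps this to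
  \<open>X \<otimes>\<^sub>B y\<close>.\<close>

lemma sD1_\<mu>_incl: "t \<in> carrier E1 \<Longrightarrow> \<sigma> (D1 (\<mu> (incl t))) = incl t"
  by (rule tensor_ext[OF tE1 E2_group add_hom_comp[OF \<sigma>_hom add_hom_comp[OF D1_hom add_hom_comp[OF \<mu>_hom incl_hom]]] incl_hom])
    (simp_all add: incl_pure \<mu>_pure ES_Ae D1_rAe ES_D \<sigma>_rAR s_D2 r2_pure)

lemma \<xi>_\<mu>: "t \<in> carrier E1 \<Longrightarrow> \<xi> (\<mu> (incl t)) = t"
  by (rule \<xi>_eqI) (simp_all add: sD1_\<mu>_incl \<mu>_closed incl_closed)

lemma \<xi>_rAe_ES: "\<lbrakk>U \<in> carrier ES; y \<in> carrier A\<rbrakk> \<Longrightarrow> \<xi> (rAe y U) = p1 U y"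
  using \<xi>_\<mu>[of "p1 U y"] by (simp add: incl_pure \<mu>_pure ES_Ae E1_closed)

lemma \<mu>_r2: "\<lbrakk>y \<in> carrier A; t \<in> carrier E2\<rbrakk> \<Longrightarrow> \<mu> (r2 y t) = rAe y (\<mu> t)"
  by (rule tensor_ext[OF tE2 Ae_group add_hom_comp[OF \<mu>_hom r2_hom] add_hom_comp[OF rAe_hom \<mu>_hom]])
    (simp_all add: r2_pure \<mu>_pure rAe_mult)

lemma Ae_pure_hom: "y \<in> carrier A \<Longrightarrow> add_hom A Ae (\<lambda>x. Ae_pure x y)" "x \<in> carrier A \<Longrightarrow> add_hom A Ae (Ae_pure x)"
  by (rule add_homI; simp add: Ae_closed Ae_add)+

lemma \<mu>_v: "\<lbrakk>x \<in> carrier A; z \<in> carrier AA\<rbrakk> \<Longrightarrow> \<mu> (v x z) = Ae_pure x (mA z)"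
  by (rule tensor_ext[OF tAA Ae_group add_hom_comp[OF \<mu>_hom v_hom] add_hom_comp[OF Ae_pure_hom(2) mA_hom]])
    (simp_all add: v_pure \<mu>_pure Ae_closed rAe_pure mA_pure)

text \<open>Multiplying the legs of the translation map gives the counit,
  \<open>mA (\<gamma> Z) = \<epsilon>R Z\<close>. With the counit law for \<open>\<rho>\<close> it
  makes \<open>\<mu>\<close> a left inverse of \<open>\<sigma>\<close> after
  \<open>D1\<close>.\<close>

lemma \<mu>_s_\<Theta>: "Z \<in> carrier R \<Longrightarrow> \<mu> (\<sigma> (\<Theta> Z)) = Ae_pure (\<epsilon>R Z) \<one>\<^bsub>A\<^esub>"
proof (rule R_ext[OF Ae_group add_hom_comp[OF \<mu>_hom add_hom_comp[OF \<sigma>_hom \<Theta>_hom]] add_hom_comp[OF Ae_pure_hom(1) \<epsilon>R_hom]])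
  fix a h assume "a \<in> carrier A" "h \<in> carrier H"
  then show "\<mu> (\<sigma> (\<Theta> (\<iota> a \<star> \<eta> h))) = Ae_pure (\<epsilon>R (\<iota> a \<star> \<eta> h)) \<one>\<^bsub>A\<^esub>"
    by (simp add: \<Theta>_pure \<sigma>_pure \<mu>_v mA_\<gamma> \<epsilon>R_\<eta> \<epsilon>R_pure Ae_act scal_def)
qed simp_all

lemma \<mu>_s_D1: "X \<in> carrier Ae \<Longrightarrow> \<mu> (\<sigma> (D1 X)) = X"
  by (rule tensor_ext[OF tAe Ae_group add_hom_comp[OF \<mu>_hom add_hom_comp[OF \<sigma>_hom D1_hom]] add_hom_id])
    (simp_all add: D1_pure \<sigma>_rAR \<sigma>_closed \<mu>_r2 \<mu>_s_\<Theta> \<epsilon>R_\<rho> rAe_pure)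

lemma \<mu>_incl_\<xi>: "X \<in> carrier Ae \<Longrightarrow> \<mu> (incl (\<xi> X)) = X"
  by (simp add: incl_\<xi> \<mu>_s_D1)

text \<open>Rests on \<open>\<mu> (incl (\<xi> X)) = X\<close>: every element of \<open>Ae\<close>
  is a sum of elements \<open>U y\<close>. It extends to \<open>Ae\<close> identities known on
  \<open>ES\<close>, whenever both sides are compatible with right multiplication.\<close>

lemma Ae_ext:
  assumes P: "abelian_group P" and f: "add_hom Ae P f" and g: "add_hom Ae P g"
    and eq: "\<And>U y. \<lbrakk>U \<in> carrier ES; y \<in> carrier A\<rbrakk> \<Longrightarrow> f (rAe y U) = g (rAe y U)" and X: "X \<in> carrier Ae"
  shows "f X = g X"
proof -
  have "f (\<mu> (incl t)) = g (\<mu> (incl t))" if "t \<in> carrier E1" for t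
    by (rule tensor_ext[OF tE1 P add_hom_comp[OF f add_hom_comp[OF \<mu>_hom incl_hom]] add_hom_comp[OF g add_hom_comp[OF \<mu>_hom incl_hom]] _ that])
      (simp add: incl_pure \<mu>_pure ES_Ae eq)
  from this[of "\<xi> X"] show ?thesis using X by (simp add: \<mu>_incl_\<xi>)
qed

lemma \<xi>_rAe: "\<lbrakk>y \<in> carrier A; X \<in> carrier Ae\<rbrakk> \<Longrightarrow> \<xi> (rAe y X) = r1 y (\<xi> X)"
  by (rule Ae_ext[OF E1_group add_hom_comp[OF \<xi>_hom rAe_hom] add_hom_comp[OF r1_hom \<xi>_hom]])
    (simp_all add: rAe_mult ES_Ae \<xi>_rAe_ES r1_pure)

lemma \<xi>_lAe: "\<lbrakk>b \<in> coinv; X \<in> carrier Ae\<rbrakk> \<Longrightarrow> \<xi> (lAe b X) = l1 b (\<xi> X)"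
  by (rule Ae_ext[OF E1_group add_hom_comp[OF \<xi>_hom lAe_hom] add_hom_comp[OF l1_hom \<xi>_hom]])
    (simp_all add: ES_Ae \<xi>_rAe_ES l1_pure ES_lAe flip: rAe_lAe)

lemma \<sigma>_\<Theta>_\<rho>: "a \<in> carrier A \<Longrightarrow> \<sigma> (\<Theta> (\<rho> a)) = tensor_lift E2 (\<lambda>x h. v x (translation h)) (\<rho> a)"
proof -
  assume a: "a \<in> carrier A"
  have sb: "kbal A H E2 (\<lambda>x h. v x (translation h))"
    unfolding \<gamma>_\<eta>
    by (rule balancedI) (simp_all add: v_closed v_add v_smult \<eta>_add \<eta>_smult \<gamma>_smult add_hom_add[OF \<gamma>_hom] add_hom_add[OF v_hom])
  show ?thesis
    by (rule tensor_lift_unique[OF tR E2_group sb add_hom_comp[OF \<sigma>_hom \<Theta>_hom] _ \<rho>_closed[OF a], symmetric])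
      (simp add: \<iota>_\<eta>[symmetric] \<Theta>_pure \<sigma>_pure \<gamma>_\<eta>)
qed

lemma D1_one: "a \<in> carrier A \<Longrightarrow> D1 (Ae_pure a \<one>\<^bsub>A\<^esub>) = \<Theta> (\<rho> a)"
  by (simp add: D1_pure \<rho>_one rAR_one)

text \<open>The formula in the definition is \<open>\<sigma> (D1 (a \<otimes> 1))\<close>; existence
  of the described element is \<open>incl_\<xi>\<close>, uniqueness is injectivity of
  \<open>incl\<close>.\<close>

lemma ES_coaction_eq: "a \<in> carrier A \<Longrightarrow> ES_coaction a = \<xi> (Ae_pure a \<one>\<^bsub>A\<^esub>)"
proof -
  assume a: "a \<in> carrier A"
  have t: "tensor_lift E2 (\<lambda>x h. tensor_lift E2 (\<lambda>p q. p2 (Ae_pure x p) q) (translation h)) (\<rho> a) = \<sigma> (D1 (Ae_pure a \<one>\<^bsub>A\<^esub>))"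
    using \<sigma>_\<Theta>_\<rho>[OF a] by (simp add: D1_one a v_def)
  show ?thesis
    unfolding ES_coaction_def t
  proof (rule the_equality)
    show "\<xi> (Ae_pure a \<one>\<^bsub>A\<^esub>) \<in> carrier E1 \<and> tensor_lift E2 (\<lambda>U y. p2 U y) (\<xi> (Ae_pure a \<one>\<^bsub>A\<^esub>)) = \<sigma> (D1 (Ae_pure a \<one>\<^bsub>A\<^esub>))"
      using incl_\<xi>[of "Ae_pure a \<one>\<^bsub>A\<^esub>"] by (simp add: a Ae_closed incl_def)
    show "Y = \<xi> (Ae_pure a \<one>\<^bsub>A\<^esub>)"
      if "Y \<in> carrier E1 \<and> tensor_lift E2 (\<lambda>U y. p2 U y) Y = \<sigma> (D1 (Ae_pure a \<one>\<^bsub>A\<^esub>))" for Y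
      using that \<xi>_eqI[of "Ae_pure a \<one>\<^bsub>A\<^esub>" Y] by (simp add: a Ae_closed incl_def)
  qed
qed

section \<open>The coproduct\<close>

lemma ES_bimodule: "bimodule B ES br bl"
  unfolding bimodule_def
  by (auto intro!: add_homI simp: ES_right_module ES_Ae ES_lAe ES_rAe ES_add add_hom_add[OF lAe_hom] rAe_lAe ag_closed[OF Ae_group] rAe_closed lAe_closed)

lemma Ae_bimodule: "bimodule B Ae br bl"
  unfolding bimodule_def
  by (auto intro!: add_homI simp: Ae_right_module add_hom_add[OF lAe_hom] rAe_lAe ag_closed[OF Ae_group] rAe_closed lAe_closed)

lemma AR_bimodule: "bimodule B AR (\<lambda>W b. rAR (\<iota> b) W) lAR"
  unfolding bimodule_def by (auto simp: AR_right_module lAR_hom lAR_rAR)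

section \<open>The defining sequence tensored with the bialgebroid from the left\<close>

abbreviation "N1 \<equiv> tensor_group coinv ES br ES bl"
abbreviation "n1 \<equiv> pure_tensor coinv ES br ES bl"
abbreviation "N2 \<equiv> tensor_group coinv ES br Ae bl"
abbreviation "n2 \<equiv> pure_tensor coinv ES br Ae bl"
abbreviation "N3 \<equiv> tensor_group coinv ES br AR lAR"
abbreviation "n3 \<equiv> pure_tensor coinv ES br AR lAR"

lemma lAR_closed [simp]: "\<lbrakk>y \<in> carrier A; W \<in> carrier AR\<rbrakk> \<Longrightarrow> lAR y W \<in> carrier AR"
  by (rule add_hom_closed[OF lAR_hom])

lemma tN1: "is_tensor coinv ES br ES bl N1 n1"
  by (rule is_tensor_tensor_group) (simp_all add: ES_group ES_Ae ES_rAe ES_lAe)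
lemma tN2: "is_tensor coinv ES br Ae bl N2 n2"
  by (rule is_tensor_tensor_group) (simp_all add: ES_group Ae_group ES_Ae ES_rAe lAe_closed)
lemma tN3: "is_tensor coinv ES br AR lAR N3 n3"
  by (rule is_tensor_tensor_group) (simp_all add: ES_group AR_group ES_Ae ES_rAe)

lemmas N2_group = is_tensor_group[OF tN2] and N3_group = is_tensor_group[OF tN3]
lemmas N2_closed = pure_closed[OF tN2] and N3_closed = pure_closed[OF tN3]
lemmas N2_add = pure_add_left[OF tN2, simplified] pure_add_right[OF tN2]
  and N3_add = pure_add_left[OF tN3, simplified] pure_add_right[OF tN3]

lemma N2_act: "\<lbrakk>X \<in> carrier ES; b \<in> coinv; V \<in> carrier Ae\<rbrakk> \<Longrightarrow> n2 (rAe b X) V = n2 X (lAe b V)"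
  using pure_act[OF tN2, of X b V] by (simp add: ES_Ae)
lemma N3_act: "\<lbrakk>X \<in> carrier ES; b \<in> coinv; V \<in> carrier AR\<rbrakk> \<Longrightarrow> n3 (rAe b X) V = n3 X (lAR b V)"
  using pure_act[OF tN3, of X b V] by (simp add: ES_Ae)

lemma balanced_NI:
  assumes "\<And>X y. \<lbrakk>X \<in> carrier ES; y \<in> carrier M\<rbrakk> \<Longrightarrow> f X y \<in> carrier P"
    and "\<And>X X' y. \<lbrakk>X \<in> carrier ES; X' \<in> carrier ES; y \<in> carrier M\<rbrakk> \<Longrightarrow> f (X \<oplus>\<^bsub>Ae\<^esub> X') y = f X y \<oplus>\<^bsub>P\<^esub> f X' y"
    and "\<And>X y y'. \<lbrakk>X \<in> carrier ES; y \<in> carrier M; y' \<in> carrier M\<rbrakk> \<Longrightarrow> f X (y \<oplus>\<^bsub>M\<^esub> y') = f X y \<oplus>\<^bsub>P\<^esub> f X y'"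
    and "\<And>X b y. \<lbrakk>X \<in> carrier ES; b \<in> coinv; y \<in> carrier M\<rbrakk> \<Longrightarrow> f (rAe b X) y = f X (l b y)"
  shows "balanced coinv ES br M l P f"
  by (rule balancedI) (simp_all add: assms ES_Ae)

definition "tensor_incl = tensor_lift N2 (\<lambda>U V. n2 U V)"
lemma tensor_incl_bal: "balanced coinv ES br ES bl N2 (\<lambda>U V. n2 U V)"
  by (rule balanced_NI) (simp_all add: ES_Ae N2_closed N2_add N2_act)
lemmas tensor_incl_hom = tensor_lift_hom[OF tN1 N2_group tensor_incl_bal, folded tensor_incl_def]
  and tensor_incl_pure = tensor_lift_pure[OF tN1 N2_group tensor_incl_bal, folded tensor_incl_def]

definition "tensor_D1 = tensor_lift N3 (\<lambda>U V. n3 U (D1 V))"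
definition "tensor_D2 = tensor_lift N3 (\<lambda>U V. n3 U (D2 V))"
lemma tensor_D1_bal: "balanced coinv ES br Ae bl N3 (\<lambda>U V. n3 U (D1 V))"
  by (rule balanced_NI) (simp_all add: N3_closed N3_add add_hom_add[OF D1_hom] N3_act D1_lAe)
lemma tensor_D2_bal: "balanced coinv ES br Ae bl N3 (\<lambda>U V. n3 U (D2 V))"
  by (rule balanced_NI) (simp_all add: N3_closed N3_add add_hom_add[OF D2_hom] N3_act D2_lAe)
lemmas tensor_D1_hom = tensor_lift_hom[OF tN2 N3_group tensor_D1_bal, folded tensor_D1_def]
  and tensor_D1_pure = tensor_lift_pure[OF tN2 N3_group tensor_D1_bal, folded tensor_D1_def]
  and tensor_D2_hom = tensor_lift_hom[OF tN2 N3_group tensor_D2_bal, folded tensor_D2_def]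
  and tensor_D2_pure = tensor_lift_pure[OF tN2 N3_group tensor_D2_bal, folded tensor_D2_def]

text \<open>The second half of the splitting: after \<open>D2\<close> tensored with \<open>A\<close>
  it is the identity of \<open>E2\<close>, after \<open>D1\<close> tensored with \<open>A\<close> it
  is \<open>incl\<close> after \<open>\<xi>\<close> after \<open>\<mu>\<close>.\<close>

definition "s0 = tensor_lift E2 (\<lambda>W y. r2 y (\<sigma> W))"

lemma r2_add: "\<lbrakk>y \<in> carrier A; y' \<in> carrier A; t \<in> carrier E2\<rbrakk> \<Longrightarrow> r2 (y \<oplus>\<^bsub>A\<^esub> y') t = r2 y t \<oplus>\<^bsub>E2\<^esub> r2 y' t"
  by (rule tensor_ext[OF tE2 E2_group r2_hom add_hom_plus[OF E2_group r2_hom r2_hom]])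
    (simp_all add: r2_pure A.r_distr E2_add)

lemma r2_mult: "\<lbrakk>y \<in> carrier A; y' \<in> carrier A; t \<in> carrier E2\<rbrakk> \<Longrightarrow> r2 y' (r2 y t) = r2 (y \<cdot> y') t"
  by (rule tensor_ext[OF tE2 E2_group add_hom_comp[OF r2_hom r2_hom] r2_hom])
    (simp_all add: r2_pure A.m_assoc)

lemma r2_l2: "\<lbrakk>y \<in> carrier A; b \<in> coinv; t \<in> carrier E2\<rbrakk> \<Longrightarrow> r2 y (l2 b t) = l2 b (r2 y t)"
  by (rule tensor_ext[OF tE2 E2_group add_hom_comp[OF r2_hom l2_hom] add_hom_comp[OF l2_hom r2_hom]])
    (simp_all add: r2_pure l2_pure lAe_closed)

lemma v_l2: "\<lbrakk>b \<in> coinv; x \<in> carrier A; z \<in> carrier AA\<rbrakk> \<Longrightarrow> v (b \<cdot> x) z = l2 b (v x z)"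
  by (rule tensor_ext[OF tAA E2_group v_hom add_hom_comp[OF l2_hom v_hom]])
    (simp_all add: v_pure l2_pure Ae_closed lAe_pure)

lemma \<sigma>_lAR: "\<lbrakk>b \<in> coinv; W \<in> carrier AR\<rbrakk> \<Longrightarrow> \<sigma> (lAR b W) = l2 b (\<sigma> W)"
  by (rule tensor_ext[OF tAR E2_group add_hom_comp[OF \<sigma>_hom lAR_hom] add_hom_comp[OF l2_hom \<sigma>_hom]])
    (simp_all add: lAR_pure \<sigma>_pure v_l2)

lemma s0_bal: "balanced coinv AR (\<lambda>W b. rAR (\<iota> b) W) A lmult E2 (\<lambda>W y. r2 y (\<sigma> W))"
proof (rule balancedI)
  show "r2 y (\<sigma> (rAR (\<iota> b) W)) = r2 (b \<cdot> y) (\<sigma> W)"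
    if "W \<in> carrier AR" "b \<in> coinv" "y \<in> carrier A" for W b y
    using that \<sigma>_rAR[of b W] by (simp add: coinv_\<rho> r2_mult \<sigma>_closed)
qed (simp_all add: r2_closed \<sigma>_closed add_hom_add[OF r2_hom] add_hom_add[OF \<sigma>_hom] r2_add)
lemmas s0_hom = tensor_lift_hom[OF tE3 E2_group s0_bal, folded s0_def]
  and s0_pure = tensor_lift_pure[OF tE3 E2_group s0_bal, folded s0_def]

text \<open>Descent with \<open>W = ES\<close> and \<open>C = A\<close>: the retraction is
  \<open>\<xi>\<close> after \<open>\<mu>\<close> and the complementary map is \<open>s0\<close>,
  both left \<open>B\<close>-linear.\<close>

lemma coproduct_descent:
  shows "inj_on tensor_incl (carrier N1)" and "exact_pair N1 tensor_incl N2 (\<lambda>t. tensor_D2 t \<ominus>\<^bsub>N3\<^esub> tensor_D1 t) N3"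
proof -
  have 1: "\<xi> (\<mu> (p2 (bl b X) c)) = tensor_lift E1 (\<lambda>y c. p1 (bl b y) c) (\<xi> (\<mu> (p2 X c)))"
    if "b \<in> carrier B" "X \<in> carrier Ae" "c \<in> carrier A" for b X c
    using that by (simp add: \<mu>_pure lAe_closed rAe_closed rAe_lAe \<xi>_lAe l1_def)
  have 2: "s0 (p3 (lAR b W) c) = tensor_lift E2 (\<lambda>y c. p2 (bl b y) c) (s0 (p3 W c))"
    if "b \<in> carrier B" "W \<in> carrier AR" "c \<in> carrier A" for b W c
    using that by (simp add: s0_pure \<sigma>_lAR r2_l2 \<sigma>_closed l2_def[symmetric])
  \<comment> \<open>The splitting identity: \<open>s0\<close> contributes \<open>p2 X c\<close>
    minus \<open>r2 c (\<sigma> (D1 X))\<close>, and the subtracted term is exactly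
    \<open>incl (\<xi> (\<mu> (p2 X c)))\<close>.\<close>
  have 3: "tensor_lift E2 (\<lambda>x c. p2 x c) (\<xi> (\<mu> (p2 X c))) \<oplus>\<^bsub>E2\<^esub> s0 (p3 (Ddiff X) c) = p2 X c"
    if X: "X \<in> carrier Ae" and c: "c \<in> carrier A" for X c
  proof -
    interpret E2: abelian_group E2 by (rule E2_group)
    have "s0 (p3 (Ddiff X) c) = r2 c (\<sigma> (Ddiff X))" using X c by (simp add: s0_pure add_hom_closed[OF Ddiff_hom])
    also have "\<dots> = r2 c (\<sigma> (D2 X)) \<ominus>\<^bsub>E2\<^esub> r2 c (\<sigma> (D1 X))"
      unfolding Ddiff_def using X c
      by (simp add: add_hom_minus[OF AR_group E2_group \<sigma>_hom] add_hom_minus[OF E2_group E2_group r2_hom] \<sigma>_closed)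
    also have "r2 c (\<sigma> (D2 X)) = p2 X c" using X c by (simp add: s_D2 r2_pure)
    finally have "s0 (p3 (Ddiff X) c) = p2 X c \<ominus>\<^bsub>E2\<^esub> r2 c (\<sigma> (D1 X))" .
    moreover have "incl (\<xi> (\<mu> (p2 X c))) = r2 c (\<sigma> (D1 X))"
      using X c by (simp add: \<mu>_pure incl_\<xi> rAe_closed D1_rAe \<sigma>_rAR)
    ultimately show ?thesis
      using X c by (simp add: incl_def[symmetric] E2_closed r2_closed \<sigma>_closed a_minus_def E2.a_ac E2.r_neg1 E2.r_neg2 E2.r_neg)
  qed
  have gh: "add_hom N2 N3 (\<lambda>t. tensor_D2 t \<ominus>\<^bsub>N3\<^esub> tensor_D1 t)"
    by (rule add_hom_diff[OF N3_group tensor_D2_hom tensor_D1_hom])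
  have gp: "tensor_D2 (n2 U V) \<ominus>\<^bsub>N3\<^esub> tensor_D1 (n2 U V) = n3 U (Ddiff V)" if "U \<in> carrier ES" "V \<in> carrier Ae" for U V
  proof -
    have "add_hom AR N3 (n3 U)" using that by (intro add_homI) (simp_all add: N3_closed N3_add)
    then show ?thesis
      using that by (simp add: tensor_D1_pure tensor_D2_pure Ddiff_def add_hom_minus[OF AR_group N3_group])
  qed
  have 4: "Ddiff (bl b X) = lAR b (Ddiff X)" if "b \<in> carrier B" "X \<in> carrier Ae" for b X
    using that by (simp add: Ddiff_def D1_lAe D2_lAe add_hom_minus[OF AR_group AR_group lAR_hom])
  have 5: "\<xi> (\<mu> (p2 X c)) = p1 X c" if "X \<in> carrier ES" "c \<in> carrier A" for X c
    using that by (simp add: \<mu>_pure ES_Ae \<xi>_rAe_ES)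
  have tB: "is_tensor (carrier B) ES br ES bl N1 n1" "is_tensor (carrier B) ES br Ae bl N2 n2"
    "is_tensor (carrier B) ES br AR lAR N3 n3"
    using tN1 tN2 tN3 by simp_all
  note Ddiff = faithfully_flat_descent[where f = "\<lambda>X. X" and g = Ddiff and \<sigma> = "\<lambda>t. \<xi> (\<mu> t)" and \<tau> = s0
      and F = tensor_incl and G = "\<lambda>t. tensor_D2 t \<ominus>\<^bsub>N3\<^esub> tensor_D1 t", OF faithfully_flat infinite_test ES_right_module ES_lepoll
      ES_bimodule ES_lepoll tE1B Ae_bimodule Ae_lepoll tE2B AR_bimodule AR_lepoll tE3B id_right_hom refl Ddiff_right_hom _ _
      add_hom_comp[OF \<xi>_hom \<mu>_hom] _ s0_hom _ _ _ tB tensor_incl_hom _ gh]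
  show "inj_on tensor_incl (carrier N1)" "exact_pair N1 tensor_incl N2 (\<lambda>t. tensor_D2 t \<ominus>\<^bsub>N3\<^esub> tensor_D1 t) N3"
    by (rule Ddiff; use 1 2 3 4 5 gp tensor_incl_pure ES_D_zero in \<open>simp del: br_eq bl_eq\<close>)+
qed

text \<open>Appends a last factor to an element of \<open>ES \<otimes>\<^sub>B A\<close>. At
  \<open>\<xi> (a \<otimes> 1)\<close> this produces the coproduct formula for
  \<open>a \<otimes> c\<close>.\<close>

definition "\<theta> c = tensor_lift N2 (\<lambda>U y. n2 U (Ae_pure y c))"
definition "\<theta>R Z = tensor_lift N3 (\<lambda>U y. n3 U (pAR y Z))"

lemma \<theta>_bal: "c \<in> carrier A \<Longrightarrow> balanced coinv ES br A lmult N2 (\<lambda>U y. n2 U (Ae_pure y c))"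
  by (rule balanced_E1I) (simp_all add: N2_closed N2_add Ae_closed Ae_add N2_act lAe_pure)
lemma \<theta>R_bal: "Z \<in> carrier R \<Longrightarrow> balanced coinv ES br A lmult N3 (\<lambda>U y. n3 U (pAR y Z))"
  by (rule balanced_E1I) (simp_all add: N3_closed N3_add AR_closed AR_add N3_act lAR_pure)

lemmas \<theta>_hom = tensor_lift_hom[OF tE1 N2_group \<theta>_bal, folded \<theta>_def]
  and \<theta>_pure = tensor_lift_pure[OF tE1 N2_group \<theta>_bal, folded \<theta>_def]
  and \<theta>R_hom = tensor_lift_hom[OF tE1 N3_group \<theta>R_bal, folded \<theta>R_def]
  and \<theta>R_pure = tensor_lift_pure[OF tE1 N3_group \<theta>R_bal, folded \<theta>R_def]
lemmas \<theta>_closed = add_hom_closed[OF \<theta>_hom] and \<theta>R_closed = add_hom_closed[OF \<theta>R_hom]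

lemma \<theta>_add: "\<lbrakk>c \<in> carrier A; c' \<in> carrier A; t \<in> carrier E1\<rbrakk> \<Longrightarrow> \<theta> (c \<oplus>\<^bsub>A\<^esub> c') t = \<theta> c t \<oplus>\<^bsub>N2\<^esub> \<theta> c' t"
  by (rule tensor_ext[OF tE1 N2_group \<theta>_hom add_hom_plus[OF N2_group \<theta>_hom \<theta>_hom]])
    (simp_all add: \<theta>_pure Ae_add Ae_closed N2_add)

lemma \<theta>R_add: "\<lbrakk>Z \<in> carrier R; Z' \<in> carrier R; t \<in> carrier E1\<rbrakk> \<Longrightarrow> \<theta>R (Z \<oplus>\<^bsub>R\<^esub> Z') t = \<theta>R Z t \<oplus>\<^bsub>N3\<^esub> \<theta>R Z' t"
  by (rule tensor_ext[OF tE1 N3_group \<theta>R_hom add_hom_plus[OF N3_group \<theta>R_hom \<theta>R_hom]])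
    (simp_all add: \<theta>R_pure AR_add AR_closed N3_add)

lemma \<theta>_r1: "\<lbrakk>k \<in> carrier K; c \<in> carrier A; t \<in> carrier E1\<rbrakk> \<Longrightarrow> \<theta> c (r1 (scal k) t) = \<theta> (k \<odot>\<^bsub>A\<^esub> c) t"
  by (rule tensor_ext[OF tE1 N2_group add_hom_comp[OF \<theta>_hom r1_hom] \<theta>_hom])
    (simp_all add: \<theta>_pure r1_pure scal_coinv Ae_act flip: scal_right)

lemma \<theta>R_r1: "\<lbrakk>k \<in> carrier K; Z \<in> carrier R; t \<in> carrier E1\<rbrakk> \<Longrightarrow> \<theta>R Z (r1 (scal k) t) = \<theta>R (k \<odot>\<^bsub>R\<^esub> Z) t"
  by (rule tensor_ext[OF tE1 N3_group add_hom_comp[OF \<theta>R_hom r1_hom] \<theta>R_hom])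
    (simp_all add: \<theta>R_pure r1_pure scal_coinv AR_act flip: scal_right)

lemma \<xi>_smult: "\<lbrakk>k \<in> carrier K; a \<in> carrier A; c \<in> carrier A\<rbrakk> \<Longrightarrow> \<xi> (Ae_pure (k \<odot>\<^bsub>A\<^esub> a) c) = r1 (scal k) (\<xi> (Ae_pure a c))"
  using \<xi>_rAe[of "scal k" "Ae_pure a c"] by (simp add: scal_coinv Ae_closed rAe_pure Ae_act flip: scal_right)

text \<open>The coproduct on all of \<open>Ae\<close>, with left legs already in \<open>ES\<close>
  and right legs still in \<open>A \<otimes> A\<close>. Its counterpart \<open>coact_AR\<close>
  coacts on the first factor of \<open>AR\<close>, so that the two can be compared along
  \<open>D1\<close> and \<open>D2\<close>.\<close>

definition "cop = tensor_lift N2 (\<lambda>a a'. \<theta> a' (\<xi> (Ae_pure a \<one>\<^bsub>A\<^esub>)))"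
definition "coact_AR = tensor_lift N3 (\<lambda>x Z. \<theta>R Z (\<xi> (Ae_pure x \<one>\<^bsub>A\<^esub>)))"

lemma cop_bal: "kbal A A N2 (\<lambda>a a'. \<theta> a' (\<xi> (Ae_pure a \<one>\<^bsub>A\<^esub>)))"
  by (rule balancedI)
    (simp_all add: \<theta>_closed \<theta>_add Ae_closed Ae_add add_hom_add[OF \<xi>_hom] add_hom_add[OF \<theta>_hom] \<xi>_smult \<theta>_r1)
lemma coact_AR_bal: "kbal A R N3 (\<lambda>x Z. \<theta>R Z (\<xi> (Ae_pure x \<one>\<^bsub>A\<^esub>)))"
  by (rule balancedI)
    (simp_all add: \<theta>R_closed \<theta>R_add Ae_closed Ae_add add_hom_add[OF \<xi>_hom] add_hom_add[OF \<theta>R_hom] \<xi>_smult \<theta>R_r1)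
lemmas cop_hom = tensor_lift_hom[OF tAe N2_group cop_bal, folded cop_def]
  and cop_pure = tensor_lift_pure[OF tAe N2_group cop_bal, folded cop_def]
  and coact_AR_hom = tensor_lift_hom[OF tAR N3_group coact_AR_bal, folded coact_AR_def]
  and coact_AR_pure = tensor_lift_pure[OF tAR N3_group coact_AR_bal, folded coact_AR_def]

definition "rN3 Z = tensor_lift N3 (\<lambda>U W. n3 U (rAR Z W))"
lemma rN3_bal: "Z \<in> carrier R \<Longrightarrow> balanced coinv ES br AR lAR N3 (\<lambda>U W. n3 U (rAR Z W))"
  by (rule balanced_NI) (simp_all add: N3_closed N3_add add_hom_add[OF rAR_hom] N3_act lAR_rAR)
lemmas rN3_hom = tensor_lift_hom[OF tN3 N3_group rN3_bal, folded rN3_def]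
  and rN3_pure = tensor_lift_pure[OF tN3 N3_group rN3_bal, folded rN3_def]

lemma coact_AR_rAR: "\<lbrakk>Z \<in> carrier R; W \<in> carrier AR\<rbrakk> \<Longrightarrow> coact_AR (rAR Z W) = rN3 Z (coact_AR W)"
proof (rule tensor_ext[OF tAR N3_group add_hom_comp[OF coact_AR_hom rAR_hom] add_hom_comp[OF rN3_hom coact_AR_hom]])
  fix x Y assume Z: "Z \<in> carrier R" and x: "x \<in> carrier A" and Y: "Y \<in> carrier R"
  have "\<theta>R (Y \<star> Z) t = rN3 Z (\<theta>R Y t)" if t: "t \<in> carrier E1" for t
    by (rule tensor_ext[OF tE1 N3_group \<theta>R_hom add_hom_comp[OF rN3_hom \<theta>R_hom] _ t])
      (simp_all add: Z Y \<theta>R_pure rN3_pure AR_closed rAR_pure)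
  then show "coact_AR (rAR Z (pAR x Y)) = rN3 Z (coact_AR (pAR x Y))"
    using Z x Y by (simp add: rAR_pure coact_AR_pure Ae_closed)
qed

text \<open>Right \<open>H\<close>-colinearity of \<open>ES_coaction\<close>, as an identity in \<open>ES \<otimes>\<^bsub>B\<^esub> (A \<otimes> (A \<otimes> H))\<close>.\<close>

definition "coll = tensor_lift N3 (\<lambda>U y. n3 U (\<Theta> (\<rho> y)))"
lemma coll_bal: "balanced coinv ES br A lmult N3 (\<lambda>U y. n3 U (\<Theta> (\<rho> y)))"
  by (rule balanced_E1I)
    (simp_all add: N3_closed N3_add \<rho>_add add_hom_add[OF \<Theta>_hom] N3_act \<rho>_mult coinv_\<rho> \<Theta>_\<iota>_mult)
lemmas coll_hom = tensor_lift_hom[OF tE1 N3_group coll_bal, folded coll_def]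
  and coll_pure = tensor_lift_pure[OF tE1 N3_group coll_bal, folded coll_def]

lemma \<xi>_colinear:
  assumes a: "a \<in> carrier A"
  shows "coll (\<xi> (Ae_pure a \<one>\<^bsub>A\<^esub>)) = coact_AR (\<Theta> (\<rho> a))"
proof -
  have ib: "kbal A H N3 (\<lambda>c h. \<theta>R (\<eta> h) (\<xi> (Ae_pure x c)))"
    if x: "x \<in> carrier A" for x
    by (rule balancedI)
      (simp_all add: x \<theta>R_closed \<theta>R_add \<eta>_add Ae_closed Ae_add add_hom_add[OF \<xi>_hom] add_hom_add[OF \<theta>R_hom]
        \<eta>_smult \<theta>R_r1[symmetric] \<xi>_smult[symmetric] Ae_act)
  define I where "I x = tensor_lift N3 (\<lambda>c h. \<theta>R (\<eta> h) (\<xi> (Ae_pure x c)))" for x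
  note Ih = tensor_lift_hom[OF tR N3_group ib, folded I_def]
  have Ip: "I x (\<iota> c \<star> \<eta> h) = \<theta>R (\<eta> h) (\<xi> (Ae_pure x c))"
    if "x \<in> carrier A" "c \<in> carrier A" "h \<in> carrier H" for x c h
    using tensor_lift_pure[OF tR N3_group ib, folded I_def] that by (simp add: \<iota>_\<eta>)
  have Ib: "kbal A R N3 I"
  proof (rule balancedI)
    fix x x' Z assume x: "x \<in> carrier A" "x' \<in> carrier A" and Z: "Z \<in> carrier R"
    show "I (x \<oplus>\<^bsub>A\<^esub> x') Z = I x Z \<oplus>\<^bsub>N3\<^esub> I x' Z"
      by (rule R_ext[OF N3_group Ih[OF A.a_closed[OF x]] add_hom_plus[OF N3_group Ih[OF x(1)] Ih[OF x(2)]] _ Z])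
        (simp add: Ip x Ae_closed Ae_add add_hom_add[OF \<xi>_hom] add_hom_add[OF \<theta>R_hom])
  next
    fix x k Z assume x: "x \<in> carrier A" and k: "k \<in> carrier K" and Z: "Z \<in> carrier R"
    have kh: "add_hom R R (\<lambda>Z. k \<odot>\<^bsub>R\<^esub> Z)" using k by (intro add_homI) (auto simp: RK.smult_r_distr)
    have m: "k \<odot>\<^bsub>R\<^esub> (\<iota> c \<star> \<eta> h) = \<iota> (k \<odot>\<^bsub>A\<^esub> c) \<star> \<eta> h" if "c \<in> carrier A" "h \<in> carrier H" for c h
      using that k by (simp add: \<iota>_smult R_smult)
    show "I (k \<odot>\<^bsub>A\<^esub> x) Z = I x (k \<odot>\<^bsub>R\<^esub> Z)"
      by (rule R_ext[OF N3_group Ih[OF AK.smult_closed[OF k x]] add_hom_comp[OF Ih[OF x] kh] _ Z])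
        (simp add: Ip x k m Ae_act)
  qed (simp_all add: add_hom_closed[OF Ih] add_hom_add[OF Ih])
  \<comment> \<open>\<open>\<Xi>\<close> applies \<open>\<xi>\<close> to the first two factors of
    \<open>A \<otimes> (A \<otimes> H)\<close> and keeps the \<open>H\<close>-leg aside. Its value
    at \<open>D1 (a \<otimes> 1) = \<Theta> (\<rho> a)\<close> turns out to be both sides of the
    claim.\<close>
  define \<Xi> where "\<Xi> = tensor_lift N3 I"
  note \<Xi>h = tensor_lift_hom[OF tAR N3_group Ib, folded \<Xi>_def] and \<Xi>p = tensor_lift_pure[OF tAR N3_group Ib, folded \<Xi>_def]
  have 1: "\<Xi> (rAR (\<iota> c \<star> \<eta> h) (D2 U)) = \<theta>R (\<eta> h) (\<xi> (rAe c U))"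
    if c: "c \<in> carrier A" and h: "h \<in> carrier H" and U: "U \<in> carrier Ae" for c h U
  proof (rule tensor_ext[OF tAe N3_group add_hom_comp[OF \<Xi>h add_hom_comp[OF rAR_hom D2_hom]] add_hom_comp[OF \<theta>R_hom add_hom_comp[OF \<xi>_hom rAe_hom]] _ U])
    fix d d' assume d: "d \<in> carrier A" "d' \<in> carrier A"
    show "\<Xi> (rAR (\<iota> c \<star> \<eta> h) (D2 (Ae_pure d d'))) = \<theta>R (\<eta> h) (\<xi> (rAe c (Ae_pure d d')))"
      using c h d by (simp add: D2_pure rAR_pure \<Xi>p Ip rAe_pure R.m_assoc[symmetric] flip: \<iota>_mult)
  qed (simp_all add: c h)
  have 2: "\<Xi> (rAR Z (D2 U)) = n3 U (\<Theta> Z)" if U: "U \<in> carrier ES" and Z: "Z \<in> carrier R" for U Z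
  proof (rule R_ext[OF N3_group _ _ _ Z])
    show "add_hom R N3 (\<lambda>Z. \<Xi> (rAR Z (D2 U)))"
      using U by (intro add_hom_comp[OF \<Xi>h] add_homI) (simp_all add: ES_Ae rAR_add)
    show "add_hom R N3 (\<lambda>Z. n3 U (\<Theta> Z))"
      using U by (intro add_homI) (simp_all add: N3_closed N3_add add_hom_add[OF \<Theta>_hom])
    fix c h assume "c \<in> carrier A" "h \<in> carrier H"
    then show "\<Xi> (rAR (\<iota> c \<star> \<eta> h) (D2 U)) = n3 U (\<Theta> (\<iota> c \<star> \<eta> h))"
      using U by (simp add: 1 ES_Ae \<xi>_rAe_ES \<theta>R_pure \<Theta>_pure)
  qed
  \<comment> \<open>On \<open>U \<otimes>\<^sub>B y\<close> with \<open>U\<close> in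
    \<open>ES\<close>, \<open>D1 (U y)\<close> is \<open>D2 U\<close> times \<open>\<rho> y\<close>,
    where step \<open>2\<close> evaluates \<open>\<Xi>\<close>.\<close>
  have 3: "coll t = \<Xi> (D1 (\<mu> (incl t)))" if t: "t \<in> carrier E1" for t
    by (rule tensor_ext[OF tE1 N3_group coll_hom add_hom_comp[OF \<Xi>h add_hom_comp[OF D1_hom add_hom_comp[OF \<mu>_hom incl_hom]]] _ t])
      (simp add: coll_pure incl_pure \<mu>_pure ES_Ae D1_rAe ES_D 2)
  have "\<Xi> (\<Theta> Z) = coact_AR (\<Theta> Z)" if Z: "Z \<in> carrier R" for Z
  proof (rule R_ext[OF N3_group add_hom_comp[OF \<Xi>h \<Theta>_hom] add_hom_comp[OF coact_AR_hom \<Theta>_hom] _ Z])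
    fix x h assume x: "x \<in> carrier A" and h: "h \<in> carrier H"
    show "\<Xi> (\<Theta> (\<iota> x \<star> \<eta> h)) = coact_AR (\<Theta> (\<iota> x \<star> \<eta> h))"
      using x h Ip[of x "\<one>\<^bsub>A\<^esub>" h] by (simp add: \<Theta>_pure \<Xi>p coact_AR_pure \<iota>_one)
  qed
  then show ?thesis
    using a by (simp add: 3 Ae_closed \<mu>_incl_\<xi> D1_one)
qed

text \<open>\<open>tensor_D2 (cop X)\<close> is \<open>coact_AR (D2 X)\<close> by the formulas
  alone, \<open>tensor_D1 (cop X)\<close> is \<open>coact_AR (D1 X)\<close> by colinearity of
  \<open>\<xi>\<close>. The equation \<open>D1 X = D2 X\<close> finishes.\<close>

lemma cop_equalized:
  assumes X: "X \<in> carrier ES"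
  shows "tensor_D1 (cop X) = tensor_D2 (cop X)"
proof -
  note X' = ES_Ae[OF X]
  have g2: "tensor_D2 (\<theta> c t) = \<theta>R (\<iota> c) t" if c: "c \<in> carrier A" and t: "t \<in> carrier E1" for c t
    by (rule tensor_ext[OF tE1 N3_group add_hom_comp[OF tensor_D2_hom \<theta>_hom] \<theta>R_hom _ t])
      (simp_all add: c \<theta>_pure tensor_D2_pure Ae_closed D2_pure \<theta>R_pure)
  have g1: "tensor_D1 (\<theta> c t) = rN3 (\<rho> c) (coll t)" if c: "c \<in> carrier A" and t: "t \<in> carrier E1" for c t
    by (rule tensor_ext[OF tE1 N3_group add_hom_comp[OF tensor_D1_hom \<theta>_hom] add_hom_comp[OF rN3_hom coll_hom] _ t])
      (simp_all add: c \<theta>_pure tensor_D1_pure Ae_closed D1_pure coll_pure rN3_pure)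
  have "tensor_D2 (cop X) = coact_AR (D2 X)"
    by (rule tensor_ext[OF tAe N3_group add_hom_comp[OF tensor_D2_hom cop_hom] add_hom_comp[OF coact_AR_hom D2_hom] _ X'])
      (simp add: cop_pure g2 Ae_closed D2_pure coact_AR_pure)
  moreover have "tensor_D1 (cop X) = coact_AR (D1 X)"
    by (rule tensor_ext[OF tAe N3_group add_hom_comp[OF tensor_D1_hom cop_hom] add_hom_comp[OF coact_AR_hom D1_hom] _ X'])
      (simp add: cop_pure g1 Ae_closed D1_pure coact_AR_rAR \<xi>_colinear)
  ultimately show ?thesis by (simp add: ES_D[OF X])
qed

lemma cop_range:
  assumes X: "X \<in> carrier ES"
  shows "cop X \<in> tensor_incl ` carrier N1"
proof -
  have c: "cop X \<in> carrier N2" by (rule add_hom_closed[OF cop_hom ES_Ae[OF X]])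
  then have "tensor_D2 (cop X) \<ominus>\<^bsub>N3\<^esub> tensor_D1 (cop X) = \<zero>\<^bsub>N3\<^esub>"
    using ag_minus_eq_zero_iff[OF N3_group] add_hom_closed[OF tensor_D2_hom c] by (simp add: cop_equalized[OF X])
  then show ?thesis using coproduct_descent(2) c by (auto simp: exact_pair_def)
qed

section \<open>The coproduct as characterized in
  \<open>(A \<otimes> A) \<otimes>\<^sub>B (A \<otimes> A)\<close>\<close>

abbreviation "M2 \<equiv> tensor_group coinv Ae br Ae bl"
abbreviation "m2 \<equiv> pure_tensor coinv Ae br Ae bl"

lemma tM2: "is_tensor coinv Ae br Ae bl M2 m2"
  by (rule is_tensor_tensor_group) (simp_all add: Ae_group rAe_closed lAe_closed)
lemmas M2_group = is_tensor_group[OF tM2] and M2_closed = pure_closed[OF tM2]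
  and M2_add = pure_add_left[OF tM2] pure_add_right[OF tM2]
lemma M2_act: "\<lbrakk>X \<in> carrier Ae; b \<in> coinv; V \<in> carrier Ae\<rbrakk> \<Longrightarrow> m2 (rAe b X) V = m2 X (lAe b V)"
  using pure_act[OF tM2, of X b V] by simp

lemma balanced_M2I:
  assumes "\<And>X y. \<lbrakk>X \<in> carrier Ae; y \<in> carrier Ae\<rbrakk> \<Longrightarrow> f X y \<in> carrier P"
    and "\<And>X X' y. \<lbrakk>X \<in> carrier Ae; X' \<in> carrier Ae; y \<in> carrier Ae\<rbrakk> \<Longrightarrow> f (X \<oplus>\<^bsub>Ae\<^esub> X') y = f X y \<oplus>\<^bsub>P\<^esub> f X' y"
    and "\<And>X y y'. \<lbrakk>X \<in> carrier Ae; y \<in> carrier Ae; y' \<in> carrier Ae\<rbrakk> \<Longrightarrow> f X (y \<oplus>\<^bsub>Ae\<^esub> y') = f X y \<oplus>\<^bsub>P\<^esub> f X y'"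
    and "\<And>X b y. \<lbrakk>X \<in> carrier Ae; b \<in> coinv; y \<in> carrier Ae\<rbrakk> \<Longrightarrow> f (rAe b X) y = f X (lAe b y)"
  shows "balanced coinv Ae br Ae bl P f"
  by (rule balancedI) (simp_all add: assms)

definition "extend_left = tensor_lift M2 (\<lambda>U V. m2 U V)"
lemma extend_left_bal: "balanced coinv ES br Ae bl M2 (\<lambda>U V. m2 U V)"
  by (rule balanced_NI) (simp_all add: ES_Ae M2_closed M2_add M2_act)
lemmas extend_left_hom = tensor_lift_hom[OF tN2 M2_group extend_left_bal, folded extend_left_def]
  and extend_left_pure = tensor_lift_pure[OF tN2 M2_group extend_left_bal, folded extend_left_def]

definition "\<kappa> = tensor_lift M2 (\<lambda>U V. m2 U V)"
lemma \<kappa>_bal: "balanced coinv ES br ES bl M2 (\<lambda>U V. m2 U V)"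
  by (rule balanced_NI) (simp_all add: ES_Ae M2_closed M2_add M2_act)
lemmas \<kappa>_hom = tensor_lift_hom[OF tN1 M2_group \<kappa>_bal, folded \<kappa>_def]
  and \<kappa>_pure = tensor_lift_pure[OF tN1 M2_group \<kappa>_bal, folded \<kappa>_def]

text \<open>Splits the comparison map in the definition of \<open>ES_coproduct\<close> into one
  inclusion per tensor factor, so that injectivity is proved for each separately.\<close>

lemma \<kappa>_factor: "Y \<in> carrier N1 \<Longrightarrow> \<kappa> Y = extend_left (tensor_incl Y)"
  by (rule tensor_ext[OF tN1 M2_group \<kappa>_hom add_hom_comp[OF extend_left_hom tensor_incl_hom]])
    (simp_all add: \<kappa>_pure tensor_incl_pure extend_left_pure ES_Ae)

text \<open>\<open>(a \<otimes> a') \<otimes>\<^bsub>B\<^esub> (c \<otimes> c') \<mapsto> \<xi>(a \<otimes> a'c) \<otimes> c'\<close> is a retraction of \<open>extend_left\<close>.\<close>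

lemma extend_left_inj: "inj_on extend_left (carrier N2)"
proof -
  have ib: "kbal A A N2 (\<lambda>c c'. \<theta> c' (\<xi> (rAe c U)))"
    if U: "U \<in> carrier Ae" for U
  proof (rule balancedI)
    fix c k c' assume c: "c \<in> carrier A" and k: "k \<in> carrier K" and c': "c' \<in> carrier A"
    have "rAe (k \<odot>\<^bsub>A\<^esub> c) U = rAe (scal k) (rAe c U)"
      using U c k by (simp add: rAe_mult scal_coinv scal_right)
    then show "\<theta> c' (\<xi> (rAe (k \<odot>\<^bsub>A\<^esub> c) U)) = \<theta> (k \<odot>\<^bsub>A\<^esub> c') (\<xi> (rAe c U))"
      using U c k c' by (simp add: \<xi>_rAe[of "scal k"] rAe_closed scal_coinv \<theta>_r1)
  qed (simp_all add: U \<theta>_closed \<theta>_add rAe_closed rAe_add add_hom_add[OF \<xi>_hom] add_hom_add[OF \<theta>_hom])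
  define I where "I U = tensor_lift N2 (\<lambda>c c'. \<theta> c' (\<xi> (rAe c U)))" for U
  note Ih = tensor_lift_hom[OF tAe N2_group ib, folded I_def] and Ip = tensor_lift_pure[OF tAe N2_group ib, folded I_def]
  have Ib: "balanced coinv Ae br Ae bl N2 I"
  proof (rule balanced_M2I)
    fix U U' V assume U: "U \<in> carrier Ae" "U' \<in> carrier Ae" and V: "V \<in> carrier Ae"
    show "I (U \<oplus>\<^bsub>Ae\<^esub> U') V = I U V \<oplus>\<^bsub>N2\<^esub> I U' V"
      by (rule tensor_ext[OF tAe N2_group Ih[OF ag_closed[OF Ae_group U]] add_hom_plus[OF N2_group Ih[OF U(1)] Ih[OF U(2)]] _ V])
        (simp add: Ip U ag_closed[OF Ae_group] rAe_closed add_hom_add[OF rAe_hom] add_hom_add[OF \<xi>_hom] add_hom_add[OF \<theta>_hom])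
  next
    fix U b V assume U: "U \<in> carrier Ae" and b: "b \<in> coinv" and V: "V \<in> carrier Ae"
    show "I (rAe b U) V = I U (lAe b V)"
      by (rule tensor_ext[OF tAe N2_group Ih[OF rAe_closed[OF coinv_closed[OF b] U]] add_hom_comp[OF Ih[OF U] lAe_hom[OF coinv_closed[OF b]]] _ V])
        (simp add: Ip U b rAe_closed lAe_pure rAe_mult)
  qed (simp_all add: add_hom_closed[OF Ih] add_hom_add[OF Ih])
  define J' where "J' = tensor_lift N2 I"
  note J'h = tensor_lift_hom[OF tM2 N2_group Ib, folded J'_def] and J'p = tensor_lift_pure[OF tM2 N2_group Ib, folded J'_def]
  have "J' (extend_left t) = t" if t: "t \<in> carrier N2" for t
  proof (rule tensor_ext[OF tN2 N2_group add_hom_comp[OF J'h extend_left_hom] add_hom_id _ t])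
    fix U V assume U: "U \<in> carrier ES" and V: "V \<in> carrier Ae"
    have nh: "add_hom Ae N2 (n2 U)" using U by (intro add_homI) (simp_all add: N2_closed N2_add)
    \<comment> \<open>For \<open>U\<close> in \<open>ES\<close>, \<open>\<xi> (U c)\<close> is
      \<open>U \<otimes>\<^sub>B c\<close>, so appending \<open>c'\<close> returns
      \<open>U \<otimes>\<^sub>B (c \<otimes> c')\<close>.\<close>
    have "I U V = n2 U V"
      by (rule tensor_ext[OF tAe N2_group Ih[OF ES_Ae[OF U]] nh _ V])
        (simp add: Ip ES_Ae U \<xi>_rAe_ES \<theta>_pure)
    then show "J' (extend_left (n2 U V)) = n2 U V" using U V by (simp add: extend_left_pure J'p ES_Ae)
  qed
  then show ?thesis by (rule inj_on_inverseI)
qed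

definition "coproduct_formula = tensor_lift M2 (\<lambda>a a'. tensor_lift M2 (\<lambda>x h. tensor_lift M2 (\<lambda>p q.
   m2 (Ae_pure x p) (Ae_pure q a')) (translation h)) (\<rho> a))"

text \<open>For fixed \<open>a\<close> and \<open>a'\<close> the nested inner lifts are identified
  with \<open>extend_left\<close> after \<open>cop\<close> on \<open>a \<otimes> a'\<close>;
  balancedness of the whole formula is then inherited from \<open>cop\<close>.\<close>

lemma coproduct_formula_eq:
  assumes X: "X \<in> carrier Ae"
  shows "kbal A A M2 (\<lambda>a a'. tensor_lift M2 (\<lambda>x h. tensor_lift M2 (\<lambda>p q.
   m2 (Ae_pure x p) (Ae_pure q a')) (translation h)) (\<rho> a))" and "extend_left (cop X) = coproduct_formula X"
proof -
  have tb: "balanced coinv Ae br A lmult M2 (\<lambda>U y. m2 U (Ae_pure y c))" if "c \<in> carrier A" for c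
    using that by (intro balanced_E2I) (simp_all add: M2_closed M2_add Ae_closed Ae_add M2_act lAe_pure)
  define \<theta>' where "\<theta>' c = tensor_lift M2 (\<lambda>U y. m2 U (Ae_pure y c))" for c
  note th = tensor_lift_hom[OF tE2 M2_group tb, folded \<theta>'_def] and tp = tensor_lift_pure[OF tE2 M2_group tb, folded \<theta>'_def]
  have J\<theta>: "extend_left (\<theta> c t) = \<theta>' c (incl t)" if c: "c \<in> carrier A" and t: "t \<in> carrier E1" for c t
    by (rule tensor_ext[OF tE1 M2_group add_hom_comp[OF extend_left_hom \<theta>_hom] add_hom_comp[OF th incl_hom] _ t])
      (simp_all add: c \<theta>_pure extend_left_pure Ae_closed incl_pure tp ES_Ae)
  have sb: "kbal A H E2 (\<lambda>x h. v x (translation h))"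
    unfolding \<gamma>_\<eta>
    by (rule balancedI) (simp_all add: v_closed v_add v_smult \<eta>_add \<eta>_smult \<gamma>_smult add_hom_add[OF \<gamma>_hom] add_hom_add[OF v_hom])
  have eq: "extend_left (\<theta> a' (\<xi> (Ae_pure a \<one>\<^bsub>A\<^esub>))) = tensor_lift M2 (\<lambda>x h. tensor_lift M2 (\<lambda>p q.
      m2 (Ae_pure x p) (Ae_pure q a')) (translation h)) (\<rho> a)" if a: "a \<in> carrier A" and a': "a' \<in> carrier A" for a a'
  proof -
    have "extend_left (\<theta> a' (\<xi> (Ae_pure a \<one>\<^bsub>A\<^esub>))) = \<theta>' a' (\<sigma> (\<Theta> (\<rho> a)))"
      using a a' by (simp add: J\<theta> Ae_closed incl_\<xi> D1_one)
    also have "\<dots> = tensor_lift M2 (\<lambda>x h. \<theta>' a' (v x (translation h))) (\<rho> a)"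
      unfolding \<sigma>_\<Theta>_\<rho>[OF a] by (rule tensor_lift_comp[OF tR E2_group M2_group sb th[OF a'] \<rho>_closed[OF a]])
    also have "\<dots> = tensor_lift M2 (\<lambda>x h. tensor_lift M2 (\<lambda>p q. m2 (Ae_pure x p) (Ae_pure q a')) (translation h)) (\<rho> a)"
    proof (rule tensor_lift_cong[OF tR M2_group balanced_comp[OF sb th[OF a']] _ \<rho>_closed[OF a]])
      fix x h assume x: "x \<in> carrier A" and h: "h \<in> carrier H"
      have "\<theta>' a' (v x (translation h)) = tensor_lift M2 (\<lambda>p q. \<theta>' a' (p2 (Ae_pure x p) q)) (translation h)"
        unfolding v_def by (rule tensor_lift_comp[OF tAA E2_group M2_group v_bal[OF x] th[OF a']]) (simp add: \<gamma>_\<eta> h)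
      also have "\<dots> = tensor_lift M2 (\<lambda>p q. m2 (Ae_pure x p) (Ae_pure q a')) (translation h)"
        by (rule tensor_lift_cong[OF tAA M2_group balanced_comp[OF v_bal[OF x] th[OF a']]])
          (simp_all add: tp Ae_closed x a' \<gamma>_\<eta> h)
      finally show "\<theta>' a' (v x (translation h)) = tensor_lift M2 (\<lambda>p q. m2 (Ae_pure x p) (Ae_pure q a')) (translation h)" .
    qed
    finally show ?thesis .
  qed
  show b: "kbal A A M2 (\<lambda>a a'. tensor_lift M2 (\<lambda>x h. tensor_lift M2 (\<lambda>p q.
      m2 (Ae_pure x p) (Ae_pure q a')) (translation h)) (\<rho> a))"
    by (rule balanced_cong[OF tAe balanced_comp[OF cop_bal extend_left_hom] eq])
  show "extend_left (cop X) = coproduct_formula X"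
    unfolding coproduct_formula_def
    by (rule tensor_lift_unique[OF tAe M2_group b add_hom_comp[OF extend_left_hom cop_hom] _ X, symmetric]) (simp add: cop_pure eq)
qed

text \<open>Existence is \<open>cop_range\<close>; uniqueness combines injectivity of
  \<open>extend_left\<close> with that of \<open>tensor_incl\<close>.\<close>

lemma ES_coproduct_props:
  assumes X: "X \<in> carrier ES"
  shows "ES_coproduct X \<in> carrier N1" and "\<kappa> (ES_coproduct X) = coproduct_formula X"
proof -
  obtain Y where Y: "Y \<in> carrier N1" "cop X = tensor_incl Y" using cop_range[OF X] by auto
  have "\<exists>!Y. Y \<in> carrier N1 \<and> tensor_lift M2 (\<lambda>U V. m2 U V) Y = coproduct_formula X"
    unfolding \<kappa>_def[symmetric]
  proof (rule ex1I[of _ Y])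
    show "Y \<in> carrier N1 \<and> \<kappa> Y = coproduct_formula X"
      using Y coproduct_formula_eq(2)[OF ES_Ae[OF X]] by (simp add: \<kappa>_factor)
    fix Y' assume "Y' \<in> carrier N1 \<and> \<kappa> Y' = coproduct_formula X"
    then have Y': "Y' \<in> carrier N1" "extend_left (tensor_incl Y') = extend_left (tensor_incl Y)"
      using Y coproduct_formula_eq(2)[OF ES_Ae[OF X]] \<kappa>_factor[of Y'] by simp_all
    then have "tensor_incl Y' = tensor_incl Y" using extend_left_inj Y add_hom_closed[OF tensor_incl_hom] by (meson inj_onD)
    then show "Y' = Y" using coproduct_descent(1) Y Y' by (meson inj_onD)
  qed
  from theI'[OF this] show "ES_coproduct X \<in> carrier N1" and "\<kappa> (ES_coproduct X) = coproduct_formula X"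
    unfolding ES_coproduct_def coproduct_formula_def \<kappa>_def by simp_all
qed

end

section \<open>Colinear maps and the convolution monoid\<close>

text \<open>Used for \<open>ES\<close> inside \<open>Ae\<close> and \<open>B\<close> inside
  \<open>A\<close>, where lifting into the subgroup or into the ambient group must give the same
  element. Here \<open>coact_AR\<close> is a mere variable for the ambient group.\<close>

lemma tensor_lift_subgroup:
  assumes T: "is_tensor R M ract N lact T p" and P: "abelian_group P" and coact_AR: "abelian_group coact_AR"
    and f: "balanced R M ract N lact P f" and i: "add_hom P coact_AR (\<lambda>x. x)" and X: "X \<in> carrier T"
  shows "tensor_lift P f X = tensor_lift coact_AR f X"
  using tensor_lift_comp[OF T P coact_AR f i X] .

context principal_comodule_algebra
begin

lemma linear_mapsI:
  assumes "\<And>x. x \<in> carrier M \<Longrightarrow> f x \<in> carrier N"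
    and "\<And>x y. \<lbrakk>x \<in> carrier M; y \<in> carrier M\<rbrakk> \<Longrightarrow> f (x \<oplus>\<^bsub>M\<^esub> y) = f x \<oplus>\<^bsub>N\<^esub> f y"
    and "\<And>k x. \<lbrakk>k \<in> carrier K; x \<in> carrier M\<rbrakk> \<Longrightarrow> f (k \<odot>\<^bsub>M\<^esub> x) = k \<odot>\<^bsub>N\<^esub> f x"
  shows "f \<in> linear_maps K M N"
  using assms by (auto simp: linear_maps_def)

lemma B_group: "abelian_group B"
  using B_ring by (rule ring.is_abelian_group)

lemma B_incl: "add_hom B A (\<lambda>x. x)" and ES_incl: "add_hom ES Ae (\<lambda>x. x)"
  by (auto intro!: add_homI simp: ES_Ae)

section \<open>Linear endomorphisms of \<open>A\<close> and the maps they induce on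
  \<open>A \<otimes> A\<close> and \<open>A \<otimes> H\<close>\<close>

context
  fixes f assumes f: "f \<in> linear_maps K A A"
begin

lemma lin_closed: "a \<in> carrier A \<Longrightarrow> f a \<in> carrier A"
  and lin_add: "\<lbrakk>a \<in> carrier A; a' \<in> carrier A\<rbrakk> \<Longrightarrow> f (a \<oplus>\<^bsub>A\<^esub> a') = f a \<oplus>\<^bsub>A\<^esub> f a'"
  and lin_smult: "\<lbrakk>k \<in> carrier K; a \<in> carrier A\<rbrakk> \<Longrightarrow> f (k \<odot>\<^bsub>A\<^esub> a) = k \<odot>\<^bsub>A\<^esub> f a"
  using f by (auto simp: linear_maps_def)

lemma map_R_bal: "kbal A H R (\<lambda>x h. pR (f x) h)"
  by (rule balancedI) (simp_all add: lin_closed pR_closed pR_add lin_add lin_smult pR_act)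

lemma \<Phi>_bal: "kbal A A A (\<lambda>a a'. f a \<cdot> a')"
  by (rule balancedI) (simp_all add: A.l_distr A.r_distr lin_closed lin_add lin_smult A_smult)

lemma map_Ae_bal: "kbal A A Ae (\<lambda>a a'. Ae_pure (f a) a')"
  by (rule balancedI) (simp_all add: lin_closed Ae_closed Ae_add lin_add lin_smult Ae_act)

end

text \<open>\<open>map_R\<close> and, below, \<open>map_Ae\<close> are the two versions of
  \<open>f \<otimes> id\<close>; \<open>\<Phi>\<close> is the formula of \<open>twist_of_aut\<close>
  before restriction to \<open>ES\<close>.\<close>

definition "map_R f = tensor_lift R (\<lambda>x h. pR (f x) h)"
definition "\<Phi> f = tensor_lift A (\<lambda>a a'. f a \<cdot> a')"
definition "map_Ae f = tensor_lift Ae (\<lambda>a a'. Ae_pure (f a) a')"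

lemmas map_R_hom = tensor_lift_hom[OF tR R_group map_R_bal, folded map_R_def]
  and \<Phi>_hom = tensor_lift_hom[OF tAe A_group \<Phi>_bal, folded \<Phi>_def]
  and \<Phi>_pure = tensor_lift_pure[OF tAe A_group \<Phi>_bal, folded \<Phi>_def]
  and map_Ae_hom = tensor_lift_hom[OF tAe Ae_group map_Ae_bal, folded map_Ae_def]
  and map_Ae_pure = tensor_lift_pure[OF tAe Ae_group map_Ae_bal, folded map_Ae_def]
lemmas \<Phi>_closed = add_hom_closed[OF \<Phi>_hom] and map_R_closed = add_hom_closed[OF map_R_hom] and map_Ae_closed = add_hom_closed[OF map_Ae_hom]

lemma map_R_pure: "\<lbrakk>f \<in> linear_maps K A A; a \<in> carrier A; h \<in> carrier H\<rbrakk> \<Longrightarrow> map_R f (\<iota> a \<star> \<eta> h) = \<iota> (f a) \<star> \<eta> h"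
  using tensor_lift_pure[OF tR R_group map_R_bal, folded map_R_def] by (simp add: \<iota>_\<eta> lin_closed[of f])

lemma A_mult_hom: "y \<in> carrier A \<Longrightarrow> add_hom A A (\<lambda>x. x \<cdot> y)" "y \<in> carrier A \<Longrightarrow> add_hom A A (\<lambda>x. y \<cdot> x)"
  by (auto intro!: add_homI simp: A.l_distr A.r_distr)

lemma \<Phi>_rAe: "\<lbrakk>f \<in> linear_maps K A A; y \<in> carrier A; X \<in> carrier Ae\<rbrakk> \<Longrightarrow> \<Phi> f (rAe y X) = \<Phi> f X \<cdot> y"
  by (rule tensor_ext[OF tAe A_group add_hom_comp[OF \<Phi>_hom rAe_hom] add_hom_comp[OF A_mult_hom(1) \<Phi>_hom]])
    (simp_all add: rAe_pure \<Phi>_pure A.m_assoc lin_closed[of f])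

lemma \<Phi>_smult: "\<lbrakk>f \<in> linear_maps K A A; k \<in> carrier K; X \<in> carrier Ae\<rbrakk> \<Longrightarrow> \<Phi> f (k \<odot>\<^bsub>Ae\<^esub> X) = k \<odot>\<^bsub>A\<^esub> \<Phi> f X"
  unfolding \<Phi>_def
  by (rule tensor_lift_smult[OF tAe AK.module_axioms \<Phi>_bal Ae_module Ae_smult AK.module_axioms])
    (simp_all add: lin_smult lin_closed[of f] A_smult)

text \<open>In Sweedler notation \<open>\<Phi>2 f (a \<otimes> a') = f(a\<^bsub>(0)\<^esub>) a'\<^bsub>(0)\<^esub> \<otimes> a\<^bsub>(1)\<^esub> a'\<^bsub>(1)\<^esub>\<close>.\<close>

definition "\<Phi>2 f = tensor_lift R (\<lambda>a a'. map_R f (\<rho> a) \<star> \<rho> a')"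

lemma map_R_smult: "\<lbrakk>f \<in> linear_maps K A A; k \<in> carrier K; Z \<in> carrier R\<rbrakk> \<Longrightarrow> map_R f (k \<odot>\<^bsub>R\<^esub> Z) = k \<odot>\<^bsub>R\<^esub> map_R f Z"
  unfolding map_R_def
  by (rule tensor_lift_smult[OF tR RK.module_axioms map_R_bal RK.module_axioms pR_smult AK.module_axioms])
    (simp_all add: lin_smult lin_closed[of f] pR_smult)

lemma \<Phi>2_bal: "f \<in> linear_maps K A A \<Longrightarrow>
    kbal A A R (\<lambda>a a'. map_R f (\<rho> a) \<star> \<rho> a')"
  by (rule balancedI)
    (simp_all add: map_R_closed \<rho>_add \<rho>_smult add_hom_add[OF map_R_hom] R.l_distr R.r_distr map_R_smult R_smult)
lemmas \<Phi>2_hom = tensor_lift_hom[OF tAe R_group \<Phi>2_bal, folded \<Phi>2_def]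
  and \<Phi>2_pure = tensor_lift_pure[OF tAe R_group \<Phi>2_bal, folded \<Phi>2_def]

lemma \<Phi>2_rAe: "\<lbrakk>f \<in> linear_maps K A A; y \<in> carrier A; X \<in> carrier Ae\<rbrakk> \<Longrightarrow> \<Phi>2 f (rAe y X) = \<Phi>2 f X \<star> \<rho> y"
  by (rule tensor_ext[OF tAe R_group add_hom_comp[OF \<Phi>2_hom rAe_hom] add_hom_comp[OF R_mult_hom(1) \<Phi>2_hom]])
    (simp_all add: rAe_pure \<Phi>2_pure map_R_closed \<rho>_mult R.m_assoc)

text \<open>The map \<open>x \<otimes> Z \<mapsto> \<iota> (f x) \<star> Z\<close> sends
  \<open>D1 X\<close> to the left side and \<open>D2 X\<close> to the right side.\<close>

lemma \<Phi>2_ES: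
  assumes f: "f \<in> linear_maps K A A" and X: "X \<in> carrier ES"
  shows "\<Phi>2 f X = \<iota> (\<Phi> f X)"
proof -
  have b: "kbal A R R (\<lambda>x Z. \<iota> (f x) \<star> Z)"
    by (rule balancedI) (simp_all add: lin_closed[OF f] lin_add[OF f] lin_smult[OF f] \<iota>_add \<iota>_smult R.l_distr R.r_distr R_smult)
  define P where "P = tensor_lift R (\<lambda>x Z. \<iota> (f x) \<star> Z)"
  note Ph = tensor_lift_hom[OF tAR R_group b, folded P_def] and Pp = tensor_lift_pure[OF tAR R_group b, folded P_def]
  note X' = ES_Ae[OF X]
  have Pr: "P (rAR Z W) = P W \<star> Z" if Z: "Z \<in> carrier R" and W: "W \<in> carrier AR" for Z W
    by (rule tensor_ext[OF tAR R_group add_hom_comp[OF Ph rAR_hom[OF Z]] add_hom_comp[OF R_mult_hom(1)[OF Z] Ph] _ W])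
      (simp add: Z rAR_pure Pp lin_closed[OF f] R.m_assoc)
  have P\<Theta>: "P (\<Theta> Z) = map_R f Z" if Z: "Z \<in> carrier R" for Z
    by (rule R_ext[OF R_group add_hom_comp[OF Ph \<Theta>_hom] map_R_hom[OF f] _ Z]) (simp add: \<Theta>_pure Pp map_R_pure f)
  have "\<Phi>2 f X = P (D1 X)"
    by (rule tensor_ext[OF tAe R_group \<Phi>2_hom[OF f] add_hom_comp[OF Ph D1_hom] _ X'])
      (simp add: \<Phi>2_pure f D1_pure Pr P\<Theta>)
  also have "\<dots> = P (D2 X)" by (simp add: ES_D[OF X])
  also have "\<dots> = \<iota> (\<Phi> f X)"
    by (rule tensor_ext[OF tAe R_group add_hom_comp[OF Ph D2_hom] add_hom_comp[OF \<iota>_hom \<Phi>_hom[OF f]] _ X'])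
      (simp add: D2_pure Pp \<Phi>_pure f lin_closed[OF f] \<iota>_mult)
  finally show ?thesis .
qed

definition "col_maps = {f \<in> extensional (carrier A). f \<in> linear_maps K A A \<and> (\<forall>a\<in>carrier A. \<rho> (f a) = map_R f (\<rho> a))}"

lemma col_mapsD: "f \<in> col_maps \<Longrightarrow> f \<in> linear_maps K A A" "\<lbrakk>f \<in> col_maps; a \<in> carrier A\<rbrakk> \<Longrightarrow> \<rho> (f a) = map_R f (\<rho> a)"
  "f \<in> col_maps \<Longrightarrow> f \<in> extensional (carrier A)"
  by (auto simp: col_maps_def)

text \<open>For colinear \<open>f\<close>, \<open>\<rho> (\<Phi> f X)\<close> is
  \<open>\<Phi>2 f X\<close> on all of \<open>Ae\<close>, since \<open>\<rho>\<close> is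
  multiplicative; on \<open>ES\<close> the latter is \<open>\<iota> (\<Phi> f X)\<close>.\<close>

lemma \<Phi>_coinv: "\<lbrakk>f \<in> col_maps; X \<in> carrier ES\<rbrakk> \<Longrightarrow> \<Phi> f X \<in> coinv"
proof -
  assume f: "f \<in> col_maps" and X: "X \<in> carrier ES"
  note l = col_mapsD(1)[OF f]
  have "\<rho> (\<Phi> f X) = \<Phi>2 f X"
    by (rule tensor_ext[OF tAe R_group add_hom_comp[OF \<rho>_hom \<Phi>_hom[OF l]] \<Phi>2_hom[OF l] _ ES_Ae[OF X]])
      (simp add: \<Phi>_pure \<Phi>2_pure l lin_closed[OF l] \<rho>_mult col_mapsD(2)[OF f])
  then show "\<Phi> f X \<in> coinv" using \<Phi>2_ES[OF l X] \<Phi>_closed[OF l ES_Ae[OF X]] by (simp add: coinv_iff)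
qed

lemma twist_of_aut_eq: "twist_of_aut f = restrict (\<Phi> f) (carrier ES)"
  by (simp add: twist_of_aut_def \<Phi>_def)

lemma twist_of_aut_apply: "X \<in> carrier ES \<Longrightarrow> twist_of_aut f X = \<Phi> f X"
  by (simp add: twist_of_aut_eq)

lemma convolution_carrier: "\<phi> \<in> carrier convolution \<longleftrightarrow> \<phi> \<in> extensional (carrier ES) \<and> \<phi> \<in> linear_maps K ES B \<and>
    (\<forall>b\<in>coinv. \<forall>X\<in>carrier ES. \<phi> (rAe b X) = \<phi> X \<cdot> b)"
  by (simp add: convolution_def target_mult ES_Ae)

lemma twist_of_aut_closed:
  assumes f: "f \<in> col_maps"
  shows "twist_of_aut f \<in> carrier convolution"
proof -
  note l = col_mapsD(1)[OF f]
  note t = twist_of_aut_apply ES_Ae ES_add ES_smult ES_rAe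
  have "twist_of_aut f \<in> linear_maps K ES B"
    by (rule linear_mapsI)
      (simp_all add: t \<Phi>_coinv[OF f] add_hom_add[OF \<Phi>_hom[OF l]] \<Phi>_smult[OF l])
  moreover have "twist_of_aut f \<in> extensional (carrier ES)" by (simp add: twist_of_aut_eq)
  ultimately show ?thesis by (simp add: convolution_carrier t \<Phi>_rAe l)
qed

lemma convolution_balanced: "\<phi> \<in> carrier convolution \<Longrightarrow> balanced coinv ES br A lmult A (\<lambda>U y. \<phi> U \<cdot> y)"
proof (rule balanced_E1I)
  assume \<phi>: "\<phi> \<in> carrier convolution"
  have c: "\<phi> U \<in> coinv" if "U \<in> carrier ES" for U using that \<phi> by (auto simp: convolution_carrier linear_maps_def)
  show "\<phi> X \<cdot> y \<in> carrier A" if "X \<in> carrier ES" "y \<in> carrier A" for X y using c that by simp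
  show "\<phi> (X \<oplus>\<^bsub>Ae\<^esub> X') \<cdot> y = \<phi> X \<cdot> y \<oplus>\<^bsub>A\<^esub> \<phi> X' \<cdot> y"
    if "X \<in> carrier ES" "X' \<in> carrier ES" "y \<in> carrier A" for X X' y
    using that c \<phi> by (simp add: convolution_carrier linear_maps_def A.l_distr)
  show "\<phi> X \<cdot> (y \<oplus>\<^bsub>A\<^esub> y') = \<phi> X \<cdot> y \<oplus>\<^bsub>A\<^esub> \<phi> X \<cdot> y'"
    if "X \<in> carrier ES" "y \<in> carrier A" "y' \<in> carrier A" for X y y'
    using that c by (simp add: A.r_distr)
  show "\<phi> (rAe b X) \<cdot> y = \<phi> X \<cdot> (b \<cdot> y)"
    if "X \<in> carrier ES" "b \<in> coinv" "y \<in> carrier A" for X b y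
    using that c \<phi> by (simp add: convolution_carrier A.m_assoc)
qed

text \<open>The right \<open>A\<close>-linear extension of a right \<open>B\<close>-linear map to
  \<open>ES \<otimes>\<^sub>B A\<close>. Through \<open>\<xi>\<close> it becomes a map on
  \<open>A \<otimes> A\<close>, whose value at \<open>a \<otimes> 1\<close> is
  \<open>aut_of_twist \<phi> a\<close>.\<close>

definition "\<Phi>h \<phi> = tensor_lift A (\<lambda>U y. \<phi> U \<cdot> y)"
lemmas \<Phi>h_hom = tensor_lift_hom[OF tE1 A_group convolution_balanced, folded \<Phi>h_def]
  and \<Phi>h_pure = tensor_lift_pure[OF tE1 A_group convolution_balanced, folded \<Phi>h_def]
lemmas \<Phi>h_closed = add_hom_closed[OF \<Phi>h_hom]

lemma aut_of_twist_eq: "aut_of_twist \<phi> = (\<lambda>a\<in>carrier A. \<Phi>h \<phi> (\<xi> (Ae_pure a \<one>\<^bsub>A\<^esub>)))"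
  unfolding aut_of_twist_def \<Phi>h_def by (rule restrict_ext) (simp add: ES_coaction_eq)

lemma aut_of_twist_apply: "a \<in> carrier A \<Longrightarrow> aut_of_twist \<phi> a = \<Phi>h \<phi> (\<xi> (Ae_pure a \<one>\<^bsub>A\<^esub>))"
  by (simp add: aut_of_twist_eq)

section \<open>From the convolution monoid to colinear maps and back\<close>

context
  fixes \<phi> assumes \<phi>: "\<phi> \<in> carrier convolution"
begin

lemma \<phi>_coinv: "U \<in> carrier ES \<Longrightarrow> \<phi> U \<in> coinv"
  and \<phi>_smult: "\<lbrakk>k \<in> carrier K; U \<in> carrier ES\<rbrakk> \<Longrightarrow> \<phi> (k \<odot>\<^bsub>Ae\<^esub> U) = k \<odot>\<^bsub>A\<^esub> \<phi> U"
  using \<phi> by (auto simp: convolution_carrier linear_maps_def)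

lemma \<Phi>h_r1: "\<lbrakk>y \<in> carrier A; t \<in> carrier E1\<rbrakk> \<Longrightarrow> \<Phi>h \<phi> (r1 y t) = \<Phi>h \<phi> t \<cdot> y"
  by (rule tensor_ext[OF tE1 A_group add_hom_comp[OF \<Phi>h_hom r1_hom] add_hom_comp[OF A_mult_hom(1) \<Phi>h_hom]])
    (simp_all add: \<phi> r1_pure \<Phi>h_pure A.m_assoc \<phi>_coinv)

lemma \<Phi>h_l1: "\<lbrakk>k \<in> carrier K; t \<in> carrier E1\<rbrakk> \<Longrightarrow> \<Phi>h \<phi> (l1 (scal k) t) = k \<odot>\<^bsub>A\<^esub> \<Phi>h \<phi> t"
  by (rule tensor_ext[OF tE1 A_group add_hom_comp[OF \<Phi>h_hom l1_hom] add_hom_comp[of A A "\<lambda>x. k \<odot>\<^bsub>A\<^esub> x", OF _ \<Phi>h_hom]])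
    (simp_all add: \<phi> l1_pure \<Phi>h_pure \<phi>_coinv scal_coinv ES_Ae ES_lAe ES_smult \<phi>_smult A_smult add_homI AK.smult_r_distr flip: scal_lAe)

lemma aut_of_twist_linear: "aut_of_twist \<phi> \<in> linear_maps K A A"
proof -
  have "\<xi> (Ae_pure (k \<odot>\<^bsub>A\<^esub> a) \<one>\<^bsub>A\<^esub>) = l1 (scal k) (\<xi> (Ae_pure a \<one>\<^bsub>A\<^esub>))" if "k \<in> carrier K" "a \<in> carrier A" for k a
    using that \<xi>_lAe[of "scal k" "Ae_pure a \<one>\<^bsub>A\<^esub>"] by (simp add: scal_coinv Ae_closed lAe_pure flip: scal_left)
  then show ?thesis
    by (intro linear_mapsI)
      (simp_all add: aut_of_twist_apply Ae_closed Ae_add \<Phi>h_closed[OF \<phi>] add_hom_add[OF \<xi>_hom]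
        add_hom_add[OF \<Phi>h_hom[OF \<phi>]] \<Phi>h_l1)
qed

text \<open>Both sides are compatible with right multiplication, and at \<open>a \<otimes> 1\<close>
  the claim is the definition of \<open>aut_of_twist\<close>.\<close>

lemma \<Phi>_aut_of_twist: "X \<in> carrier Ae \<Longrightarrow> \<Phi> (aut_of_twist \<phi>) X = \<Phi>h \<phi> (\<xi> X)"
proof (rule tensor_ext[OF tAe A_group \<Phi>_hom[OF aut_of_twist_linear] add_hom_comp[OF \<Phi>h_hom[OF \<phi>] \<xi>_hom]])
  fix a a' assume a: "a \<in> carrier A" "a' \<in> carrier A"
  then show "\<Phi> (aut_of_twist \<phi>) (Ae_pure a a') = \<Phi>h \<phi> (\<xi> (Ae_pure a a'))"
    using \<xi>_rAe[of a' "Ae_pure a \<one>\<^bsub>A\<^esub>"]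
    by (simp add: \<Phi>_pure[OF aut_of_twist_linear] aut_of_twist_apply \<Phi>h_r1 Ae_closed rAe_pure)
qed

lemma \<Phi>_aut_of_twist_ES: "X \<in> carrier ES \<Longrightarrow> \<Phi> (aut_of_twist \<phi>) X = \<phi> X"
  using \<xi>_rAe_ES[of X "\<one>\<^bsub>A\<^esub>"] by (simp add: \<Phi>_aut_of_twist ES_Ae rAe_one \<Phi>h_pure[OF \<phi>] \<phi>_coinv)

text \<open>Colinearity is the case \<open>a \<otimes> 1\<close> of
  \<open>\<rho> (\<Phi> f X) = \<Phi>2 f X\<close>. By \<open>Ae_ext\<close> this need only be
  checked on \<open>U y\<close> with \<open>U\<close> in \<open>ES\<close>, where
  \<open>\<Phi> f U = \<phi> U\<close> is coinvariant.\<close>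

lemma aut_of_twist_col: "aut_of_twist \<phi> \<in> col_maps"
proof -
  let ?f = "aut_of_twist \<phi>"
  note l = aut_of_twist_linear
  have e: "\<rho> (\<Phi> ?f X) = \<Phi>2 ?f X" if X: "X \<in> carrier Ae" for X
    by (rule Ae_ext[OF R_group add_hom_comp[OF \<rho>_hom \<Phi>_hom[OF l]] \<Phi>2_hom[OF l] _ X])
      (simp add: \<Phi>_rAe l ES_Ae \<Phi>2_rAe \<Phi>2_ES \<Phi>_aut_of_twist_ES \<phi>_coinv \<rho>_mult coinv_\<rho>)
  have "\<rho> (?f a) = map_R ?f (\<rho> a)" if "a \<in> carrier A" for a
    using that e[OF Ae_closed[OF that A.one_closed]]
    by (simp add: \<Phi>_pure[OF l] \<Phi>2_pure[OF l] \<rho>_one map_R_closed[OF l] lin_closed[OF l])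
  moreover have "?f \<in> extensional (carrier A)" by (simp add: aut_of_twist_eq)
  ultimately show ?thesis using l by (simp add: col_maps_def)
qed

lemma twist_of_aut_of_twist: "twist_of_aut (aut_of_twist \<phi>) = \<phi>"
  using \<phi> by (intro extensionalityI[of _ "carrier ES"])
    (auto simp: twist_of_aut_eq \<Phi>_aut_of_twist_ES convolution_carrier)

end

text \<open>On \<open>ES \<otimes>\<^sub>B A\<close>, \<open>\<Phi>h\<close> of the restricted map
  is \<open>\<Phi> f\<close> after multiplication. The element \<open>\<xi> (a \<otimes> 1)\<close>
  multiplies to \<open>a \<otimes> 1\<close>, where \<open>\<Phi> f\<close> gives
  \<open>f a\<close>.\<close>

lemma aut_of_twist_of_aut:
  assumes f: "f \<in> col_maps"
  shows "aut_of_twist (twist_of_aut f) = f"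
proof (rule extensionalityI[of _ "carrier A"])
  note l = col_mapsD(1)[OF f] and c = twist_of_aut_closed[OF f]
  have "\<Phi>h (twist_of_aut f) t = \<Phi> f (\<mu> (incl t))" if "t \<in> carrier E1" for t
    by (rule tensor_ext[OF tE1 A_group \<Phi>h_hom[OF c] add_hom_comp[OF \<Phi>_hom[OF l] add_hom_comp[OF \<mu>_hom incl_hom]] _ that])
      (simp add: \<Phi>h_pure[OF c] incl_pure \<mu>_pure ES_Ae \<Phi>_rAe l twist_of_aut_apply)
  then show "aut_of_twist (twist_of_aut f) a = f a" if "a \<in> carrier A" for a
    using that by (simp add: aut_of_twist_apply Ae_closed \<mu>_incl_\<xi> \<Phi>_pure l lin_closed[OF l])
qed (use col_mapsD(3)[OF f] in \<open>auto simp: aut_of_twist_eq\<close>)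

subsection \<open>Multiplicativity\<close>

lemma lAe_add: "\<lbrakk>x \<in> carrier A; x' \<in> carrier A; V \<in> carrier Ae\<rbrakk> \<Longrightarrow> lAe (x \<oplus>\<^bsub>A\<^esub> x') V = lAe x V \<oplus>\<^bsub>Ae\<^esub> lAe x' V"
  by (rule tensor_ext[OF tAe Ae_group lAe_hom add_hom_plus[OF Ae_group lAe_hom lAe_hom]])
    (simp_all add: lAe_pure A.l_distr Ae_add)

lemma lAe_mult: "\<lbrakk>x \<in> carrier A; x' \<in> carrier A; V \<in> carrier Ae\<rbrakk> \<Longrightarrow> lAe (x \<cdot> x') V = lAe x (lAe x' V)"
  by (rule tensor_ext[OF tAe Ae_group lAe_hom add_hom_comp[OF lAe_hom lAe_hom]])
    (simp_all add: lAe_pure A.m_assoc)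

text \<open>Evaluates a sum over the coproduct without a representative in
  \<open>ES \<otimes>\<^sub>B ES\<close>: if \<open>g\<close> comes from an additive
  \<open>w\<close> on \<open>M2\<close>, then \<open>w\<close> can be applied to the explicit
  formula instead.\<close>

lemma lift_coproduct:
  assumes P: "abelian_group P" and w: "add_hom M2 P w"
    and g: "\<And>U V. \<lbrakk>U \<in> carrier ES; V \<in> carrier ES\<rbrakk> \<Longrightarrow> w (m2 U V) = g U V" and X: "X \<in> carrier ES"
  shows "balanced coinv ES br ES bl P g" and "tensor_lift P g (ES_coproduct X) = w (extend_left (cop X))"
proof -
  have b: "balanced coinv ES br ES bl P (\<lambda>U V. w (m2 U V))" by (rule balanced_comp[OF \<kappa>_bal w])
  show "balanced coinv ES br ES bl P g" by (rule balanced_cong[OF tN1 b g])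
  have "tensor_lift P g (ES_coproduct X) = tensor_lift P (\<lambda>U V. w (m2 U V)) (ES_coproduct X)"
    by (rule tensor_lift_cong[OF tN1 P b g ES_coproduct_props(1)[OF X], symmetric])
  also have "\<dots> = w (\<kappa> (ES_coproduct X))"
    unfolding \<kappa>_def by (rule tensor_lift_comp[OF tN1 M2_group P \<kappa>_bal w ES_coproduct_props(1)[OF X], symmetric])
  finally show "tensor_lift P g (ES_coproduct X) = w (extend_left (cop X))"
    using ES_coproduct_props(2)[OF X] coproduct_formula_eq(2)[OF ES_Ae[OF X]] by simp
qed

lemma coproduct_act:
  assumes f: "f \<in> col_maps" and X: "X \<in> carrier ES"
  obtains w where "add_hom M2 Ae w" "\<And>U V. \<lbrakk>U \<in> carrier Ae; V \<in> carrier Ae\<rbrakk> \<Longrightarrow> w (m2 U V) = lAe (\<Phi> f U) V"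
    "w (extend_left (cop X)) = map_Ae f X"
proof -
  note l = col_mapsD(1)[OF f]
  have b: "balanced coinv Ae br Ae bl Ae (\<lambda>U V. lAe (\<Phi> f U) V)"
    by (rule balanced_M2I)
      (simp_all add: lAe_closed \<Phi>_closed l lAe_add add_hom_add[OF lAe_hom] add_hom_add[OF \<Phi>_hom] \<Phi>_rAe lAe_mult)
  define w where "w = tensor_lift Ae (\<lambda>U V. lAe (\<Phi> f U) V)"
  note wh = tensor_lift_hom[OF tM2 Ae_group b, folded w_def] and wp = tensor_lift_pure[OF tM2 Ae_group b, folded w_def]
  \<comment> \<open>All legs before the last factor are multiplied out. For
    \<open>t = \<xi> (a \<otimes> 1)\<close> they multiply to \<open>a \<otimes> 1\<close> again,
    which leaves \<open>f a \<otimes> c\<close>.\<close>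
  have 1: "w (extend_left (\<theta> c t)) = Ae_pure (\<Phi> f (\<mu> (incl t))) c" if c: "c \<in> carrier A" and t: "t \<in> carrier E1" for c t
    by (rule tensor_ext[OF tE1 Ae_group add_hom_comp[OF wh add_hom_comp[OF extend_left_hom \<theta>_hom[OF c]]]
          add_hom_comp[OF Ae_pure_hom(1)[OF c] add_hom_comp[OF \<Phi>_hom[OF l] add_hom_comp[OF \<mu>_hom incl_hom]]] _ t])
      (simp add: c \<theta>_pure extend_left_pure Ae_closed wp ES_Ae lAe_pure \<Phi>_closed[OF l] l incl_pure \<mu>_pure \<Phi>_rAe)
  have "w (extend_left (cop X)) = map_Ae f X"
    by (rule tensor_ext[OF tAe Ae_group add_hom_comp[OF wh add_hom_comp[OF extend_left_hom cop_hom]] map_Ae_hom[OF l] _ ES_Ae[OF X]])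
      (simp add: cop_pure 1 Ae_closed \<mu>_incl_\<xi> \<Phi>_pure l map_Ae_pure lin_closed[OF l])
  with wh wp that show thesis by blast
qed

lemma conv_act_twist_of_aut:
  assumes f: "f \<in> col_maps" and X: "X \<in> carrier ES"
  shows "conv_act X (twist_of_aut f) = map_Ae f X"
proof -
  obtain w where w: "add_hom M2 Ae w" "\<And>U V. \<lbrakk>U \<in> carrier Ae; V \<in> carrier Ae\<rbrakk> \<Longrightarrow> w (m2 U V) = lAe (\<Phi> f U) V"
    "w (extend_left (cop X)) = map_Ae f X" using coproduct_act[OF f X] by blast
  let ?g = "\<lambda>U V. source (twist_of_aut f U) \<otimes>\<^bsub>ES\<^esub> V"
  have g: "w (m2 U V) = ?g U V" if "U \<in> carrier ES" "V \<in> carrier ES" for U V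
    using that \<Phi>_coinv[OF f that(1)] by (simp add: w(2) ES_Ae twist_of_aut_apply source_mult)
  note L = lift_coproduct[OF Ae_group w(1) g X]
  \<comment> \<open>The values lie in \<open>ES\<close> because \<open>\<Phi> f U\<close> is
    coinvariant, so balancedness in \<open>Ae\<close> is balancedness in \<open>ES\<close>.\<close>
  have "balanced coinv ES br ES bl ES ?g"
    using L(1) by (simp add: balanced_def add_hom_def Pi_def)
      (simp add: twist_of_aut_apply source_mult \<Phi>_coinv[OF f] ES_Ae ES_lAe)
  from tensor_lift_subgroup[OF tN1 ES_group Ae_group this ES_incl ES_coproduct_props(1)[OF X]]
  show ?thesis using L(2) by (simp add: conv_act_def w(3))
qed

lemma compose_linear:
  assumes lf: "f \<in> linear_maps K A A" and lg: "g \<in> linear_maps K A A"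
  shows "compose (carrier A) g f \<in> linear_maps K A A"
  by (rule linear_mapsI)
    (simp_all add: compose_eq lin_closed[OF lf] lin_closed[OF lg] lin_add[OF lf] lin_add[OF lg]
      lin_smult[OF lf] lin_smult[OF lg])

text \<open>The first map acts as \<open>f \<otimes> id\<close> on \<open>X\<close>, and
  \<open>\<Phi> g\<close> is then evaluated on the result, so \<open>g\<close> is applied after
  \<open>f\<close>. This is why the automorphism group carries the reversed composition.\<close>

lemma convolution_mult_twist_of_aut:
  assumes f: "f \<in> col_maps" and g: "g \<in> col_maps"
  shows "twist_of_aut f \<otimes>\<^bsub>convolution\<^esub> twist_of_aut g = twist_of_aut (compose (carrier A) g f)"
proof -
  note lf = col_mapsD(1)[OF f] and lg = col_mapsD(1)[OF g]
  have lc: "compose (carrier A) g f \<in> linear_maps K A A"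
    by (rule compose_linear[OF lf lg])
  have "tensor_lift B (\<lambda>U V. twist_of_aut g (source (twist_of_aut f U) \<otimes>\<^bsub>ES\<^esub> V)) (ES_coproduct X) = \<Phi> (compose (carrier A) g f) X"
    if X: "X \<in> carrier ES" for X
  proof -
    obtain w where w: "add_hom M2 Ae w" "\<And>U V. \<lbrakk>U \<in> carrier Ae; V \<in> carrier Ae\<rbrakk> \<Longrightarrow> w (m2 U V) = lAe (\<Phi> f U) V"
      "w (extend_left (cop X)) = map_Ae f X" using coproduct_act[OF f X] by blast
    let ?g = "\<lambda>U V. twist_of_aut g (source (twist_of_aut f U) \<otimes>\<^bsub>ES\<^esub> V)"
    have e: "?g U V = \<Phi> g (lAe (\<Phi> f U) V)" "?g U V \<in> coinv" if "U \<in> carrier ES" "V \<in> carrier ES" for U V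
      using that \<Phi>_coinv[OF f that(1)] by (simp_all add: ES_Ae twist_of_aut_apply source_mult ES_lAe \<Phi>_coinv[OF g])
    then have "\<Phi> g (w (m2 U V)) = ?g U V" if "U \<in> carrier ES" "V \<in> carrier ES" for U V
      using that by (simp add: w(2) ES_Ae)
    note L = lift_coproduct[OF A_group add_hom_comp[OF \<Phi>_hom[OF lg] w(1)] this X]
    have "balanced coinv ES br ES bl B ?g"
      using L(1) e(2) by (simp add: balanced_def add_hom_def Pi_def)
    from tensor_lift_subgroup[OF tN1 B_group A_group this B_incl ES_coproduct_props(1)[OF X]]
    have "tensor_lift B ?g (ES_coproduct X) = \<Phi> g (map_Ae f X)" using L(2) by (simp add: w(3))
    also have "\<dots> = \<Phi> (compose (carrier A) g f) X"
      by (rule tensor_ext[OF tAe A_group add_hom_comp[OF \<Phi>_hom[OF lg] map_Ae_hom[OF lf]] \<Phi>_hom[OF lc] _ ES_Ae[OF X]])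
        (simp add: map_Ae_pure lf lg lc \<Phi>_pure lin_closed[OF lf] compose_eq)
    finally show ?thesis .
  qed
  then show ?thesis
    by (simp add: convolution_def twist_of_aut_eq[of "compose (carrier A) g f"]) (rule restrict_ext, simp)
qed

lemma id_col: "(\<lambda>a\<in>carrier A. a) \<in> col_maps"
proof -
  define i where "i = (\<lambda>a\<in>carrier A. a)"
  have i: "i a = a" if "a \<in> carrier A" for a using that by (simp add: i_def)
  have l: "i \<in> linear_maps K A A" by (rule linear_mapsI) (simp_all add: i)
  have "map_R i Z = Z" if "Z \<in> carrier R" for Z
    by (rule R_ext[OF R_group map_R_hom[OF l] add_hom_id _ that]) (simp add: map_R_pure[OF l] i)
  moreover have "i \<in> extensional (carrier A)" by (simp add: i_def)
  ultimately have "i \<in> col_maps" using l by (simp add: col_maps_def i)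
  then show ?thesis by (simp add: i_def)
qed

lemma twist_of_aut_id: "twist_of_aut (\<lambda>a\<in>carrier A. a) = \<one>\<^bsub>convolution\<^esub>"
proof -
  note l = col_mapsD(1)[OF id_col]
  have "\<Phi> (\<lambda>a\<in>carrier A. a) X = tensor_lift A (\<lambda>a a'. a \<cdot> a') X" if "X \<in> carrier Ae" for X
    unfolding \<Phi>_def by (rule tensor_lift_cong[OF tAe A_group \<Phi>_bal[OF l] _ that]) simp
  then show ?thesis
    by (simp add: convolution_def ES_counit_def twist_of_aut_eq) (rule restrict_ext, simp add: ES_Ae)
qed

lemma compose_col: "\<lbrakk>f \<in> col_maps; g \<in> col_maps\<rbrakk> \<Longrightarrow> compose (carrier A) g f \<in> col_maps"
proof -
  assume f: "f \<in> col_maps" and g: "g \<in> col_maps"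
  note lf = col_mapsD(1)[OF f] and lg = col_mapsD(1)[OF g]
  have lc: "compose (carrier A) g f \<in> linear_maps K A A"
    by (rule compose_linear[OF lf lg])
  have "map_R (compose (carrier A) g f) Z = map_R g (map_R f Z)" if "Z \<in> carrier R" for Z
    by (rule R_ext[OF R_group map_R_hom[OF lc] add_hom_comp[OF map_R_hom[OF lg] map_R_hom[OF lf]] _ that])
      (simp add: map_R_pure[OF lc] map_R_pure[OF lf] map_R_pure[OF lg] lin_closed[OF lf] compose_eq)
  then show ?thesis
    using lc by (simp add: col_maps_def compose_eq col_mapsD(2)[OF f] col_mapsD(2)[OF g] lin_closed[OF lf])
qed

text \<open>With \<open>g\<close> the inverse, \<open>map_R g\<close> undoes \<open>map_R f\<close>;
  applying it to \<open>\<rho> (f (g a)) = map_R f (\<rho> (g a))\<close> yields colinearity of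
  \<open>g\<close>.\<close>

lemma inv_col:
  assumes f: "f \<in> col_maps" and bij: "bij_betw f (carrier A) (carrier A)"
  shows "restrict (inv_into (carrier A) f) (carrier A) \<in> col_maps" (is "?g \<in> _")
proof -
  note lf = col_mapsD(1)[OF f]
  have gc: "?g a \<in> carrier A" and fg: "f (?g a) = a" if "a \<in> carrier A" for a
    using that bij_betw_imp_surj_on[OF bij] by (simp_all add: inv_into_into f_inv_into_f)
  have gI: "?g a = x" if "x \<in> carrier A" "f x = a" for a x
    using inv_into_f_f[OF bij_betw_imp_inj_on[OF bij] that(1)] that lin_closed[OF lf that(1)] by simp
  have lg: "?g \<in> linear_maps K A A"
    by (rule linear_mapsI)
      (use gc in \<open>simp_all add: gI lin_add[OF lf] lin_smult[OF lf] fg del: restrict_apply\<close>)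
  have inv: "map_R ?g (map_R f Z) = Z" if "Z \<in> carrier R" for Z
    by (rule R_ext[OF R_group add_hom_comp[OF map_R_hom[OF lg] map_R_hom[OF lf]] add_hom_id _ that])
      (simp add: map_R_pure[OF lf] map_R_pure[OF lg] lin_closed[OF lf] gI del: restrict_apply)
  have "\<rho> (?g a) = map_R ?g (\<rho> a)" if a: "a \<in> carrier A" for a
    using inv[of "\<rho> (?g a)"] col_mapsD(2)[OF f gc[OF a]] by (simp add: gc[OF a] fg[OF a] del: restrict_apply)
  then show ?thesis using lg by (simp add: col_maps_def)
qed

text \<open>A convolution inverse is \<open>twist_of_aut\<close> of some colinear map, and
  injectivity of \<open>twist_of_aut\<close> turns the two product identities into composition
  identities. The converse rests on \<open>inv_col\<close>.\<close>

lemma twist_of_aut_Units: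
  assumes f: "f \<in> col_maps"
  shows "twist_of_aut f \<in> Units convolution \<longleftrightarrow> bij_betw f (carrier A) (carrier A)"
proof
  note lf = col_mapsD(1)[OF f]
  have inj: "g = h" if "g \<in> col_maps" "h \<in> col_maps" "twist_of_aut g = twist_of_aut h" for g h
    using that aut_of_twist_of_aut by metis
  assume "twist_of_aut f \<in> Units convolution"
  then obtain \<psi> where \<psi>: "\<psi> \<in> carrier convolution" "\<psi> \<otimes>\<^bsub>convolution\<^esub> twist_of_aut f = \<one>\<^bsub>convolution\<^esub>"
    "twist_of_aut f \<otimes>\<^bsub>convolution\<^esub> \<psi> = \<one>\<^bsub>convolution\<^esub>" by (auto simp: Units_def)
  define g where "g = aut_of_twist \<psi>"
  have g: "g \<in> col_maps" "\<psi> = twist_of_aut g" unfolding g_def using \<psi>(1) by (simp_all add: aut_of_twist_col twist_of_aut_of_twist)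
  have "compose (carrier A) f g = (\<lambda>a\<in>carrier A. a)" "compose (carrier A) g f = (\<lambda>a\<in>carrier A. a)"
    using \<psi>(2,3) f g by (auto intro!: inj compose_col id_col simp: convolution_mult_twist_of_aut twist_of_aut_id)
  then have "f (g a) = a" "g (f a) = a" if "a \<in> carrier A" for a
    using that by (metis compose_eq restrict_apply')+
  then show "bij_betw f (carrier A) (carrier A)"
    using lin_closed[OF lf] lin_closed[OF col_mapsD(1)[OF g(1)]] by (intro bij_betwI[of _ _ _ g]) auto
next
  assume bij: "bij_betw f (carrier A) (carrier A)"
  let ?g = "restrict (inv_into (carrier A) f) (carrier A)"
  note g = inv_col[OF f bij]
  note lf = col_mapsD(1)[OF f]
  have "compose (carrier A) f ?g = (\<lambda>a\<in>carrier A. a)" "compose (carrier A) ?g f = (\<lambda>a\<in>carrier A. a)"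
    using bij_betw_imp_surj_on[OF bij] bij_betw_imp_inj_on[OF bij] lin_closed[OF lf]
    by (auto simp: compose_def f_inv_into_f inv_into_f_f intro!: restrict_ext)
  then show "twist_of_aut f \<in> Units convolution"
    unfolding Units_def
    using f g convolution_mult_twist_of_aut[OF f g] convolution_mult_twist_of_aut[OF g f]
    by (auto simp: twist_of_aut_closed twist_of_aut_id intro!: bexI[of _ "twist_of_aut ?g"])
qed

text \<open>For the harder direction, apply the multiplication
  \<open>a \<otimes> a' \<mapsto> a a'\<close> to the hypothesis, which gives an identity in
  \<open>A\<close>. Each argument is then released from \<open>ES\<close> in turn by
  \<open>Ae_ext\<close> and specialized to \<open>a \<otimes> 1\<close> and
  \<open>c \<otimes> 1\<close>.\<close>

lemma twist_of_aut_mult_iff: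
  assumes f: "f \<in> col_maps"
  shows "(\<forall>X\<in>carrier ES. \<forall>Y\<in>carrier ES. map_Ae f X \<otimes>\<^bsub>Ae\<^esub> map_Ae f Y = map_Ae f (X \<otimes>\<^bsub>Ae\<^esub> Y))
    \<longleftrightarrow> (\<forall>a\<in>carrier A. \<forall>c\<in>carrier A. f (a \<cdot> c) = f a \<cdot> f c)"
proof
  note l = col_mapsD(1)[OF f]
  note ac = Ae_closed lin_closed[OF l] map_Ae_pure[OF l] Ae_mult_pure
  interpret Ae: ring Ae by (rule Ae_ring)
  note map_Ae_closed_f = map_Ae_closed[OF l]
  {
    assume m: "\<forall>a\<in>carrier A. \<forall>c\<in>carrier A. f (a \<cdot> c) = f a \<cdot> f c"
    have "map_Ae f X \<otimes>\<^bsub>Ae\<^esub> map_Ae f Y = map_Ae f (X \<otimes>\<^bsub>Ae\<^esub> Y)" if X: "X \<in> carrier Ae" and Y: "Y \<in> carrier Ae" for X Y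
    proof (rule tensor_ext[OF tAe Ae_group add_hom_comp[OF Ae_mult_hom(1)[OF map_Ae_closed_f[OF Y]] map_Ae_hom[OF l]] add_hom_comp[OF map_Ae_hom[OF l] Ae_mult_hom(1)[OF Y]] _ X])
      fix a a' assume a: "a \<in> carrier A" "a' \<in> carrier A"
      then have aa: "Ae_pure a a' \<in> carrier Ae" by (simp add: ac)
      show "map_Ae f (Ae_pure a a') \<otimes>\<^bsub>Ae\<^esub> map_Ae f Y = map_Ae f (Ae_pure a a' \<otimes>\<^bsub>Ae\<^esub> Y)"
        by (rule tensor_ext[OF tAe Ae_group add_hom_comp[OF Ae_mult_hom(2)[OF map_Ae_closed_f[OF aa]] map_Ae_hom[OF l]] add_hom_comp[OF map_Ae_hom[OF l] Ae_mult_hom(2)[OF aa]] _ Y])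
          (simp add: a ac m)
    qed
    then show "\<forall>X\<in>carrier ES. \<forall>Y\<in>carrier ES. map_Ae f X \<otimes>\<^bsub>Ae\<^esub> map_Ae f Y = map_Ae f (X \<otimes>\<^bsub>Ae\<^esub> Y)" by (simp add: ES_Ae)
  }
  assume m: "\<forall>X\<in>carrier ES. \<forall>Y\<in>carrier ES. map_Ae f X \<otimes>\<^bsub>Ae\<^esub> map_Ae f Y = map_Ae f (X \<otimes>\<^bsub>Ae\<^esub> Y)"
  have il: "(\<lambda>a. a) \<in> linear_maps K A A" by (rule linear_mapsI) simp_all
  let ?\<Phi> = "\<Phi> (\<lambda>a. a)"
  have \<Phi>fe: "?\<Phi> (map_Ae f X) = \<Phi> f X" if X: "X \<in> carrier Ae" for X
    by (rule tensor_ext[OF tAe A_group add_hom_comp[OF \<Phi>_hom[OF il] map_Ae_hom[OF l]] \<Phi>_hom[OF l] _ X])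
      (simp add: ac \<Phi>_pure[OF il] \<Phi>_pure[OF l])
  have 1: "f a \<cdot> \<Phi> f Y = \<Phi> f (lAe a Y)" if a: "a \<in> carrier A" and Y: "Y \<in> carrier ES" for a Y
  proof -
    note Y' = ES_Ae[OF Y] and YA = \<Phi>_closed[OF l ES_Ae[OF Y]]
    have lb: "kbal A A A (\<lambda>a a'. f a \<cdot> \<Phi> f Y \<cdot> a')"
      by (rule balancedI)
        (simp_all add: YA lin_closed[OF l] lin_add[OF l] lin_smult[OF l] A.l_distr A.r_distr A_smult)
    \<comment> \<open>The left side of the multiplied identity as a function of the first argument.
      Both it and \<open>\<Phi> f (X Y)\<close> are compatible with right multiplication on
      \<open>X\<close>, so agreement on \<open>ES\<close> suffices.\<close>
    define L where "L = tensor_lift A (\<lambda>a a'. f a \<cdot> \<Phi> f Y \<cdot> a')"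
    note Lh = tensor_lift_hom[OF tAe A_group lb, folded L_def] and Lp = tensor_lift_pure[OF tAe A_group lb, folded L_def]
    have Lr: "L (rAe y X) = L X \<cdot> y" if y: "y \<in> carrier A" and X: "X \<in> carrier Ae" for y X
      by (rule tensor_ext[OF tAe A_group add_hom_comp[OF Lh rAe_hom[OF y]] add_hom_comp[OF A_mult_hom(1)[OF y] Lh] _ X])
        (simp add: y rAe_pure Lp lin_closed[OF l] YA A.m_assoc)
    have rm: "rAe y X \<otimes>\<^bsub>Ae\<^esub> V = rAe y (X \<otimes>\<^bsub>Ae\<^esub> V)" if "y \<in> carrier A" "X \<in> carrier Ae" "V \<in> carrier Ae" for y X V
      using that Ae.m_assoc[of "target y" X V] by (simp add: target_mult[symmetric] target_def Ae_closed)
    have L1: "?\<Phi> (map_Ae f X \<otimes>\<^bsub>Ae\<^esub> map_Ae f Y) = L X" if X: "X \<in> carrier Ae" for X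
    proof (rule tensor_ext[OF tAe A_group add_hom_comp[OF \<Phi>_hom[OF il] add_hom_comp[OF Ae_mult_hom(1)[OF map_Ae_closed_f[OF Y']] map_Ae_hom[OF l]]] Lh _ X])
      fix a a' assume a: "a \<in> carrier A" "a' \<in> carrier A"
      then have faa: "Ae_pure (f a) a' \<in> carrier Ae" by (simp add: ac)
      have "?\<Phi> (Ae_pure (f a) a' \<otimes>\<^bsub>Ae\<^esub> map_Ae f V) = f a \<cdot> \<Phi> f V \<cdot> a'" if V: "V \<in> carrier Ae" for V
        by (rule tensor_ext[OF tAe A_group add_hom_comp[OF \<Phi>_hom[OF il] add_hom_comp[OF Ae_mult_hom(2)[OF faa] map_Ae_hom[OF l]]]
              add_hom_comp[OF A_mult_hom(1)[OF a(2)] add_hom_comp[OF A_mult_hom(2)[OF lin_closed[OF l a(1)]] \<Phi>_hom[OF l]]] _ V])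
          (simp add: a ac \<Phi>_pure[OF il] \<Phi>_pure[OF l] A.m_assoc)
      then show "?\<Phi> (map_Ae f (Ae_pure a a') \<otimes>\<^bsub>Ae\<^esub> map_Ae f Y) = L (Ae_pure a a')"
        using a Y' by (simp add: ac Lp)
    qed
    have L2: "L X = \<Phi> f (X \<otimes>\<^bsub>Ae\<^esub> Y)" if X: "X \<in> carrier Ae" for X
    proof (rule Ae_ext[OF A_group Lh add_hom_comp[OF \<Phi>_hom[OF l] Ae_mult_hom(1)[OF Y']] _ X])
      fix U y assume U: "U \<in> carrier ES" and y: "y \<in> carrier A"
      have "L U = ?\<Phi> (map_Ae f (U \<otimes>\<^bsub>Ae\<^esub> Y))" using L1[OF ES_Ae[OF U]] m U Y by simp
      also have "\<dots> = \<Phi> f (U \<otimes>\<^bsub>Ae\<^esub> Y)" using U Y' by (simp add: \<Phi>fe ES_Ae)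
      finally show "L (rAe y U) = \<Phi> f (rAe y U \<otimes>\<^bsub>Ae\<^esub> Y)"
        using U y Y' by (simp add: Lr ES_Ae rm \<Phi>_rAe l)
    qed
    have "Ae_pure a \<one>\<^bsub>A\<^esub> \<otimes>\<^bsub>Ae\<^esub> Y = lAe a Y" using a Y' source_mult[of a Y] by (simp add: source_def)
    then show ?thesis using L2[of "Ae_pure a \<one>\<^bsub>A\<^esub>"] a YA by (simp add: Ae_closed Lp lin_closed[OF l])
  qed
  \<comment> \<open>Now the second argument is released from \<open>ES\<close>, again by
    compatibility with right multiplication.\<close>
  have 2: "f a \<cdot> \<Phi> f Y = \<Phi> f (lAe a Y)" if a: "a \<in> carrier A" and Y: "Y \<in> carrier Ae" for a Y
  proof (rule Ae_ext[OF A_group add_hom_comp[OF A_mult_hom(2)[OF lin_closed[OF l a]] \<Phi>_hom[OF l]] add_hom_comp[OF \<Phi>_hom[OF l] lAe_hom[OF a]] _ Y])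
    fix U y assume "U \<in> carrier ES" "y \<in> carrier A"
    then show "f a \<cdot> \<Phi> f (rAe y U) = \<Phi> f (lAe a (rAe y U))"
      using a by (simp add: \<Phi>_rAe l ES_Ae lAe_closed 1 A.m_assoc[symmetric] lin_closed[OF l] \<Phi>_closed[OF l] flip: rAe_lAe)
  qed
  show "\<forall>a\<in>carrier A. \<forall>c\<in>carrier A. f (a \<cdot> c) = f a \<cdot> f c"
  proof (intro ballI)
    fix a c assume "a \<in> carrier A" "c \<in> carrier A"
    then show "f (a \<cdot> c) = f a \<cdot> f c"
      using 2[of a "Ae_pure c \<one>\<^bsub>A\<^esub>"] by (simp add: Ae_closed \<Phi>_pure[OF l] lAe_pure lin_closed[OF l])
  qed
qed

section \<open>The two groups and the isomorphisms between them\<close>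

lemma auts_carrier: "f \<in> carrier comodule_algebra_auts \<longleftrightarrow> f \<in> col_maps \<and> bij_betw f (carrier A) (carrier A) \<and> f \<in> ring_hom A A"
  by (auto simp: comodule_algebra_auts_def col_maps_def algebra_homs_def map_R_def)

lemma auts_simps [simp]: "mult comodule_algebra_auts = (\<lambda>f g. compose (carrier A) g f)"
  "one comodule_algebra_auts = (\<lambda>a\<in>carrier A. a)"
  by (simp_all add: comodule_algebra_auts_def)

lemma twist_of_aut_twists:
  assumes f: "f \<in> col_maps"
  shows "twist_of_aut f \<in> carrier twists \<longleftrightarrow> f \<in> carrier comodule_algebra_auts"
proof -
  note l = col_mapsD(1)[OF f]
  have il: "(\<lambda>a. a) \<in> linear_maps K A A" by (rule linear_mapsI) simp_all
  have one: "map_Ae f \<one>\<^bsub>Ae\<^esub> = \<one>\<^bsub>Ae\<^esub> \<longleftrightarrow> f \<one>\<^bsub>A\<^esub> = \<one>\<^bsub>A\<^esub>"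
  proof
    assume "map_Ae f \<one>\<^bsub>Ae\<^esub> = \<one>\<^bsub>Ae\<^esub>"
    \<comment> \<open>The multiplication \<open>a \<otimes> a' \<mapsto> a a'\<close> recovers
      \<open>f 1\<close> from \<open>f 1 \<otimes> 1\<close>.\<close>
    then have "\<Phi> (\<lambda>a. a) (Ae_pure (f \<one>\<^bsub>A\<^esub>) \<one>\<^bsub>A\<^esub>) = \<Phi> (\<lambda>a. a) (Ae_pure \<one>\<^bsub>A\<^esub> \<one>\<^bsub>A\<^esub>)"
      by (simp add: Ae_one map_Ae_pure[OF l])
    then show "f \<one>\<^bsub>A\<^esub> = \<one>\<^bsub>A\<^esub>" by (simp add: \<Phi>_pure[OF il] lin_closed[OF l])
  qed (simp add: Ae_one map_Ae_pure[OF l])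
  have "twist_of_aut f \<in> carrier twists \<longleftrightarrow> bij_betw f (carrier A) (carrier A) \<and> f \<one>\<^bsub>A\<^esub> = \<one>\<^bsub>A\<^esub> \<and>
     (\<forall>a\<in>carrier A. \<forall>c\<in>carrier A. f (a \<cdot> c) = f a \<cdot> f c)"
    by (simp add: twists_def twist_of_aut_Units[OF f] conv_act_twist_of_aut[OF f] ES_one ES_mult one twist_of_aut_mult_iff[OF f])
  also have "\<dots> \<longleftrightarrow> f \<in> carrier comodule_algebra_auts"
    using f by (auto simp: auts_carrier ring_hom_def lin_closed[OF l] lin_add[OF l])
  finally show ?thesis .
qed

lemma auts_group: "group comodule_algebra_auts"
proof (rule groupI)
  fix f g assume f: "f \<in> carrier comodule_algebra_auts" and g: "g \<in> carrier comodule_algebra_auts"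
  then show "f \<otimes>\<^bsub>comodule_algebra_auts\<^esub> g \<in> carrier comodule_algebra_auts"
    by (auto simp: auts_carrier compose_col ring_hom_def compose_eq Pi_def intro!: bij_betw_compose)
next
  show "\<one>\<^bsub>comodule_algebra_auts\<^esub> \<in> carrier comodule_algebra_auts"
    by (auto simp: auts_carrier id_col ring_hom_def bij_betw_def inj_on_def)
next
  fix f g h assume "f \<in> carrier comodule_algebra_auts" "g \<in> carrier comodule_algebra_auts" "h \<in> carrier comodule_algebra_auts"
  then show "f \<otimes>\<^bsub>comodule_algebra_auts\<^esub> g \<otimes>\<^bsub>comodule_algebra_auts\<^esub> h
      = f \<otimes>\<^bsub>comodule_algebra_auts\<^esub> (g \<otimes>\<^bsub>comodule_algebra_auts\<^esub> h)"
    by (auto simp: auts_carrier ring_hom_def compose_def intro!: restrict_ext)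
next
  fix f assume "f \<in> carrier comodule_algebra_auts"
  then show "\<one>\<^bsub>comodule_algebra_auts\<^esub> \<otimes>\<^bsub>comodule_algebra_auts\<^esub> f = f"
    by (intro extensionalityI[of _ "carrier A"]) (auto simp: auts_carrier col_maps_def compose_def)
next
  fix f assume f: "f \<in> carrier comodule_algebra_auts"
  let ?g = "restrict (inv_into (carrier A) f) (carrier A)"
  have c: "f \<in> col_maps" and bij: "bij_betw f (carrier A) (carrier A)" and r: "f \<in> ring_hom A A"
    using f by (auto simp: auts_carrier)
  have gc: "?g a \<in> carrier A" and fg: "f (?g a) = a" if "a \<in> carrier A" for a
    using that bij_betw_imp_surj_on[OF bij] by (simp_all add: inv_into_into f_inv_into_f)
  have gI: "?g a = x" if "x \<in> carrier A" "f x = a" for a x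
    using inv_into_f_f[OF bij_betw_imp_inj_on[OF bij] that(1)] that ring_hom_closed[OF r that(1)] by simp
  have "?g \<in> ring_hom A A"
    by (rule ring_hom_memI)
      (auto intro!: gI gc simp: gc fg ring_hom_mult[OF r] ring_hom_add[OF r] ring_hom_one[OF r] simp del: restrict_apply)
  moreover have "bij_betw ?g (carrier A) (carrier A)"
    using bij_betw_inv_into[OF bij] by (simp cong: bij_betw_cong)
  ultimately have g: "?g \<in> carrier comodule_algebra_auts" by (simp add: auts_carrier inv_col[OF c bij])
  have "compose (carrier A) f ?g = (\<lambda>a\<in>carrier A. a)"
    by (auto simp: compose_def fg simp del: restrict_apply intro!: restrict_ext)
  then show "\<exists>g\<in>carrier comodule_algebra_auts. g \<otimes>\<^bsub>comodule_algebra_auts\<^esub> f = \<one>\<^bsub>comodule_algebra_auts\<^esub>"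
    using g by auto
qed

lemma twists_convolution: "\<phi> \<in> carrier twists \<Longrightarrow> \<phi> \<in> carrier convolution"
  by (auto simp: twists_def Units_def)

lemma twists_simps: "mult twists = mult convolution" "one twists = one convolution"
  by (simp_all add: twists_def)

lemma aut_of_twist_auts: "\<phi> \<in> carrier twists \<Longrightarrow> aut_of_twist \<phi> \<in> carrier comodule_algebra_auts"
  using twist_of_aut_twists[of "aut_of_twist \<phi>"]
  by (simp add: twists_convolution aut_of_twist_col twist_of_aut_of_twist)

lemma twist_of_aut_iso: "twist_of_aut \<in> iso comodule_algebra_auts twists"
proof -
  have c: "f \<in> col_maps" if "f \<in> carrier comodule_algebra_auts" for f using that by (simp add: auts_carrier)
  have "bij_betw twist_of_aut (carrier comodule_algebra_auts) (carrier twists)"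
    by (rule bij_betwI[of _ _ _ aut_of_twist])
      (auto simp: c twist_of_aut_twists aut_of_twist_auts aut_of_twist_of_aut twist_of_aut_of_twist twists_convolution)
  moreover have "twist_of_aut \<in> hom comodule_algebra_auts twists"
    by (rule homI) (simp_all add: c twist_of_aut_twists convolution_mult_twist_of_aut twists_simps)
  ultimately show ?thesis by (simp add: iso_def)
qed

text \<open>The group laws are carried over along the isomorphism instead of being verified for
  convolution; the rewriting matches the image of the unit with the unit of
  \<open>twists\<close>.\<close>

lemma twists_group: "group twists"
  using group.iso_imp_img_group[OF auts_group twist_of_aut_iso]
  by (simp add: twist_of_aut_id twists_simps flip: twists_simps(2))

lemma aut_of_twist_iso: "aut_of_twist \<in> iso twists comodule_algebra_auts"
proof -
  have bij: "bij_betw aut_of_twist (carrier twists) (carrier comodule_algebra_auts)"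
    by (rule bij_betwI[of _ _ _ twist_of_aut])
      (auto simp: auts_carrier[THEN iffD1] twist_of_aut_twists aut_of_twist_auts aut_of_twist_of_aut twist_of_aut_of_twist twists_convolution)
  have "aut_of_twist \<in> hom twists comodule_algebra_auts"
  proof (rule homI)
    fix \<phi> \<psi> assume \<phi>: "\<phi> \<in> carrier twists" and \<psi>: "\<psi> \<in> carrier twists"
    let ?f = "aut_of_twist \<phi>" and ?g = "aut_of_twist \<psi>"
    have fg: "?f \<in> col_maps" "?g \<in> col_maps" using \<phi> \<psi> by (simp_all add: aut_of_twist_col twists_convolution)
    have "\<phi> \<otimes>\<^bsub>twists\<^esub> \<psi> = twist_of_aut (compose (carrier A) ?g ?f)"
      using convolution_mult_twist_of_aut[OF fg] \<phi> \<psi> by (simp add: twists_simps twist_of_aut_of_twist twists_convolution)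
    then show "aut_of_twist (\<phi> \<otimes>\<^bsub>twists\<^esub> \<psi>) = ?f \<otimes>\<^bsub>comodule_algebra_auts\<^esub> ?g"
      by (simp add: aut_of_twist_of_aut compose_col fg)
  qed (rule aut_of_twist_auts)
  with bij show ?thesis by (simp add: iso_def)
qed

end

theorem proposition3p5:
  fixes K :: "'k ring" and H :: "('k, 'h) module"
    and \<Delta> :: "'h \<Rightarrow> ('h, 'h) tensor" and \<epsilon> :: "'h \<Rightarrow> 'k" and S :: "'h \<Rightarrow> 'h"
    and A :: "('k, 'a) module" and \<rho> :: "'a \<Rightarrow> ('a, 'h) tensor"
  assumes "principal_comodule_algebra K H \<Delta> \<epsilon> S A \<rho>"
  shows "group (coaction_data.comodule_algebra_auts K H A \<rho>)
    \<and> group (coaction_data.twists K H A \<rho>)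
    \<and> coaction_data.twist_of_aut K H A \<rho>
        \<in> iso (coaction_data.comodule_algebra_auts K H A \<rho>) (coaction_data.twists K H A \<rho>)
    \<and> coaction_data.aut_of_twist K H A \<rho>
        \<in> iso (coaction_data.twists K H A \<rho>) (coaction_data.comodule_algebra_auts K H A \<rho>)
    \<and> (\<forall>F\<in>carrier (coaction_data.comodule_algebra_auts K H A \<rho>).
        coaction_data.aut_of_twist K H A \<rho> (coaction_data.twist_of_aut K H A \<rho> F) = F)
    \<and> (\<forall>\<phi>\<in>carrier (coaction_data.twists K H A \<rho>).
        coaction_data.twist_of_aut K H A \<rho> (coaction_data.aut_of_twist K H A \<rho> \<phi>) = \<phi>)"
proof -
  interpret principal_comodule_algebra K H \<Delta> \<epsilon> S A \<rho> by fact
  show ?thesis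
    using auts_group twists_group twist_of_aut_iso aut_of_twist_iso
    by (simp add: auts_carrier aut_of_twist_of_aut twist_of_aut_of_twist twists_convolution)
qed

end
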